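(* Let $\psi$ be a predicate of $n$ algebraic polytopes of the same combinatorial type, and suppose that ridges projectively inherit $\psi$. Then $\psi$ holds for some realizations of every combinatorial type of polytope if and only if it holds for some realizations of every algebraic projective type. Moreover, there can be a gap of at most $2$ between the lowest dimension of a combinatorial type where $\psi$ always fails and the lowest dimension of an algebraic projective type where $\psi$ always fails. Precisely, for every $d$, $$\begin{array}{l} \text{(for all finite families } p_1,\dots,p_m\in\mathbb{R}_{\rm alg}^{d+2}\text{ there exist } P_1,\dots,P_n\in[\operatorname{conv}\{p_1,\dots,p_m\}]_{\rm comb}\text{ with }\psi(P_1,\dots,P_n))\\ \Rightarrow \text{(for all finite families } p_1,\dots,p_m\in\mathbb{R}_{\rm alg}^{d}\text{ there exist } P_1,\dots,P_n\in[\operatorname{conv}\{p_1,\dots,p_m\}]_{\rm proj}\text{ with }\psi(P_1,\dots,P_n))\\ \Rightarrow \text{(for all finite families } p_1,\dots,p_m\in\mathbb{R}_{\rm alg}^{d}\text{ there exist } P_1,\dots,P_n\in[\operatorname{conv}\{p_1,\dots,p_m\}]_{\rm comb}\text{ with }\psi(P_1,\dots,P_n)). \end{array}$$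
   Context: $\mathbb{R}_{\rm alg}$ is the field of real algebraic numbers; a polytope is algebraic if its vertices have coordinates in $\mathbb{R}_{\rm alg}$. Faces of polytopes are indexed by a poset (least element $\bot$, greatest $\top$): a combinatorial polytope $\mathcal{P}$ is a bounded poset isomorphic to the face lattice of a polytope, a realization of $\mathcal{P}$ is a polytope $P$ with an isomorphism from $\mathcal{P}$ to its face lattice, and $\operatorname{face}(P,f)$ is the face with index $f$. Polytopes are combinatorially equivalent (same combinatorial type) if their faces are indexed by the same poset. They are projectively equivalent (same projective type) if moreover there is an invertible projective transformation (projectivity) $\pi$, finite on $P$, with $\pi(\operatorname{face}(P,f))=\operatorname{face}(Q,f)$ for every index $f$. $[P]_{\rm comb}$ and $[P]_{\rm proj}$ denote the classes of (algebraic) polytopes combinatorially, respectively projectively, equivalent to $P$. An algebraic projective type is the projective type of an algebraic polytope; "$\psi$ holds for some realizations of a type" means there are $n$ algebraic polytopes $P_1,\dots,P_n$ of that type with $\psi(P_1,\dots,P_n)$ true, and "$\psi$ always fails" for a type means there are none. A face $f\in\mathcal{P}$ projectively inherits $\psi$ if, whenever $P_1,\dots,P_n$ are realizations of $\mathcal{P}$ with $\psi(P_1,\dots,P_n)$ true, there are projectivities $\pi_1,\dots,\pi_n$ such that $\psi(\pi_1(\operatorname{face}(P_1,f)),\dots,\pi_n(\operatorname{face}(P_n,f)))$ is true. A ridge is a face of codimension $2$; "ridges projectively inherit $\psi$" means that every ridge of every combinatorial polytope does. *)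

theory Defs
  imports "HOL-Analysis.Analysis" "HOL-Analysis.Finite_Function_Topology"
    "HOL-Computational_Algebra.Polynomial"
begin

text \<open>
  The dimension of the ambient space varies inside the statements below, and one predicate is
  applied to polytopes of different dimensions. All polytopes therefore live in the real vector
  space of finitely supported real sequences, and \<open>\<real>\<^sup>d\<close> is the subspace of the
  sequences that vanish from position \<open>d\<close> on.
\<close>

type_synonym pt = "nat \<Rightarrow>\<^sub>0 real"

definition Rpow :: "nat \<Rightarrow> pt set" where
  "Rpow d = {x. \<forall>i\<ge>d. poly_mapping.lookup x i = 0}"

definition algebraic_pt :: "pt \<Rightarrow> bool" where
  "algebraic_pt x \<longleftrightarrow> (\<forall>i. algebraic (poly_mapping.lookup x i))"

definition Ralg_pow :: "nat \<Rightarrow> pt set" where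
  "Ralg_pow d = {x \<in> Rpow d. algebraic_pt x}"

text \<open>
  The library's \<^const>\<open>aff_dim\<close> is restricted to Euclidean spaces, which excludes
  \<^typ>\<open>pt\<close>; the lemma shows that the two agree where both are available.
\<close>

definition pdim :: "'a::real_vector set \<Rightarrow> int" where
  "pdim S = (if S = {} then -1 else int (dim {x - y | x y. x \<in> S \<and> y \<in> S}))"

lemma pdim_eq_aff_dim: "pdim (S :: 'a::euclidean_space set) = aff_dim S"
proof (cases "S = {}")
  case True
  then show ?thesis by (simp add: pdim_def)
next
  case False
  then obtain a where a: "a \<in> S" by blast
  let ?D = "{x - y | x y. x \<in> S \<and> y \<in> S}" and ?T = "(+) (- a) ` S"
  have "?D \<subseteq> span ?T"
  proof
    fix z assume "z \<in> ?D"
    then obtain x y where z: "z = x - y" "x \<in> S" "y \<in> S" by blast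
    have "(- a + x) - (- a + y) \<in> span ?T"
      by (rule span_diff; rule span_base; rule imageI; fact)
    then show "z \<in> span ?T" using z(1) by simp
  qed
  moreover have "?T \<subseteq> span ?D"
    using a by (auto intro!: span_base)
  ultimately have "span ?D = span ?T" by (simp only: span_eq)
  then have "dim ?D = dim ?T" using dim_span[of ?D] dim_span[of ?T] by simp
  moreover have "aff_dim S = int (dim ?T)"
    using a by (intro aff_dim_eq_dim) (simp add: hull_inc)
  ultimately show ?thesis using False by (simp add: pdim_def)
qed

definition algebraic_polytope :: "pt set \<Rightarrow> bool" where
  "algebraic_polytope P \<longleftrightarrow> polytope P \<and> (\<forall>v. v extreme_point_of P \<longrightarrow> algebraic_pt v)"

text \<open>
  A polytope whose faces are indexed by a poset is represented by the partial function that sends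
  each index to the corresponding face. The polytope is the union of all its faces, and the
  index poset is the domain of the function with the order pulled back from inclusion, so both are
  determined by the partial function. Indices are natural numbers, which is enough for every
  finite poset. A poset is given by its (reflexive) order relation, with carrier
  \<^term>\<open>Field r\<close>. The empty polytope is included, and the empty face is always a face.
\<close>

type_synonym indexed = "nat \<Rightarrow> pt set option"

definition realization :: "nat rel \<Rightarrow> indexed \<Rightarrow> bool" where
  "realization r F \<longleftrightarrow> (\<exists>P. polytope P \<and> dom F = Field r \<and>
     bij_betw (\<lambda>f. the (F f)) (Field r) {A. A face_of P} \<and>
     (\<forall>f\<in>Field r. \<forall>g\<in>Field r. (f, g) \<in> r \<longleftrightarrow> the (F f) \<subseteq> the (F g)))"

definition combinatorial_polytope :: "nat rel \<Rightarrow> bool" where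
  "combinatorial_polytope r \<longleftrightarrow> (\<exists>F. realization r F)"

definition body :: "indexed \<Rightarrow> pt set" where
  "body F = \<Union> (ran F)"

definition index_order :: "indexed \<Rightarrow> nat rel" where
  "index_order F = {(f, g). f \<in> dom F \<and> g \<in> dom F \<and> the (F f) \<subseteq> the (F g)}"

definition indexed_polytope :: "indexed \<Rightarrow> bool" where
  "indexed_polytope F \<longleftrightarrow> (\<exists>r. realization r F)"

lemma realization_index_order:
  assumes "realization r F"
  shows "index_order F = r"
proof -
  have "dom F = Field r"
    and "\<forall>f\<in>Field r. \<forall>g\<in>Field r. (f, g) \<in> r \<longleftrightarrow> the (F f) \<subseteq> the (F g)"
    using assms by (auto simp: realization_def)
  then show ?thesis
    by (auto simp: index_order_def intro: FieldI1 FieldI2)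
qed

lemma realization_body:
  assumes "realization r F"
  shows "polytope (body F)" "ran F = {A. A face_of body F}"
proof -
  obtain P where P: "polytope P" "dom F = Field r"
    "bij_betw (\<lambda>f. the (F f)) (Field r) {A. A face_of P}"
    using assms unfolding realization_def by blast
  have "ran F = (\<lambda>f. the (F f)) ` dom F"
  proof
    show "ran F \<subseteq> (\<lambda>f. the (F f)) ` dom F"
    proof
      fix A assume "A \<in> ran F"
      then obtain f where "F f = Some A" by (auto simp: ran_def)
      then show "A \<in> (\<lambda>f. the (F f)) ` dom F" by (intro image_eqI[of _ _ f]) auto
    qed
    show "(\<lambda>f. the (F f)) ` dom F \<subseteq> ran F" by (auto intro: ranI)
  qed
  then have ran: "ran F = {A. A face_of P}"
    using P by (simp add: bij_betw_def)
  moreover have "P face_of P"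
    using P(1) by (intro face_of_refl polytope_imp_convex)
  ultimately have "body F = P"
    unfolding body_def using face_of_imp_subset by fastforce
  then show "polytope (body F)" "ran F = {A. A face_of body F}"
    using P ran by auto
qed

lemma combinatorial_polytope_bounded_poset:
  assumes "combinatorial_polytope r"
  shows "Partial_order r"
    and "\<exists>b\<in>Field r. \<forall>f\<in>Field r. (b, f) \<in> r"
    and "\<exists>t\<in>Field r. \<forall>f\<in>Field r. (f, t) \<in> r"
proof -
  obtain F :: indexed and P where P: "polytope P"
    and bij: "bij_betw (\<lambda>f. the (F f)) (Field r) {A. A face_of P}"
    and ord': "\<forall>f\<in>Field r. \<forall>g\<in>Field r. (f, g) \<in> r \<longleftrightarrow> the (F f) \<subseteq> the (F g)"
    using assms unfolding combinatorial_polytope_def realization_def by blast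
  note ord = ord'[rule_format]
  have fld: "f \<in> Field r" "g \<in> Field r" if "(f, g) \<in> r" for f g
    using that by (auto intro: FieldI1 FieldI2)
  have "refl_on (Field r) r"
    by (rule refl_onI) (simp add: ord)
  moreover have "trans r"
  proof (rule transI)
    fix x y z assume a: "(x, y) \<in> r" "(y, z) \<in> r"
    then have m: "x \<in> Field r" "y \<in> Field r" "z \<in> Field r"
      using fld by blast+
    then have "the (F x) \<subseteq> the (F z)"
      using a ord[of x y] ord[of y z] by simp
    then show "(x, z) \<in> r"
      using m ord by simp
  qed
  moreover have "antisym r"
  proof (rule antisymI)
    fix x y assume a: "(x, y) \<in> r" "(y, x) \<in> r"
    then have m: "x \<in> Field r" "y \<in> Field r"
      using fld by blast+
    then have "the (F x) = the (F y)"
      using a ord[of x y] ord[of y x] by simp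
    then show "x = y"
      using m bij_betw_imp_inj_on[OF bij] by (simp add: inj_on_def)
  qed
  ultimately show "Partial_order r"
    using fld by (auto simp: partial_order_on_def preorder_on_def)
  have ex_index: "\<exists>f\<in>Field r. the (F f) = A" if "A face_of P" for A
  proof -
    have "A \<in> (\<lambda>f. the (F f)) ` Field r"
      unfolding bij_betw_imp_surj_on[OF bij] using that by simp
    then show ?thesis by (elim imageE) (rule bexI, rule sym)
  qed
  have top: "{} face_of P" "P face_of P"
    using P by (simp_all add: face_of_refl polytope_imp_convex)
  obtain b where b: "b \<in> Field r" "the (F b) = {}"
    using ex_index[OF top(1)] by blast
  then show "\<exists>b\<in>Field r. \<forall>f\<in>Field r. (b, f) \<in> r"
    by (intro bexI[OF _ b(1)] ballI) (simp add: ord[OF b(1)] b(2))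
  obtain t where t: "t \<in> Field r" "the (F t) = P"
    using ex_index[OF top(2)] by blast
  have sub: "the (F f) \<subseteq> P" if "f \<in> Field r" for f
    using bij_betwE[OF bij] that by (intro face_of_imp_subset) simp
  then show "\<exists>t\<in>Field r. \<forall>f\<in>Field r. (f, t) \<in> r"
    by (intro bexI[OF _ t(1)] ballI) (simp add: ord t sub)
qed

text \<open>The face with index \<open>f\<close>, itself indexed by the interval from the least element to \<open>f\<close>.\<close>

definition face :: "indexed \<Rightarrow> nat \<Rightarrow> indexed" where
  "face F f = F |` {g. (g, f) \<in> index_order F}"

definition algebraic_indexed :: "indexed \<Rightarrow> bool" where
  "algebraic_indexed F \<longleftrightarrow> indexed_polytope F \<and> algebraic_polytope (body F)"

definition ridge :: "nat rel \<Rightarrow> nat \<Rightarrow> bool" where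
  "ridge r f \<longleftrightarrow> f \<in> Field r \<and> (\<exists>F. realization r F \<and> pdim (the (F f)) = pdim (body F) - 2)"

definition comb_dim :: "nat rel \<Rightarrow> int \<Rightarrow> bool" where
  "comb_dim r k \<longleftrightarrow> (\<exists>F. realization r F \<and> pdim (body F) = k)"

text \<open>
  A projectivity of \<open>N\<close>-dimensional real projective space is given by an invertible linear map
  of \<open>\<real>\<^sup>N \<times> \<real>\<close> in homogeneous coordinates, where the finite point \<open>x\<close> is represented by
  \<open>(x, 1)\<close>. The values of the map outside \<open>\<real>\<^sup>N \<times> \<real>\<close> are irrelevant.
\<close>

definition projectivity :: "nat \<Rightarrow> (pt \<times> real \<Rightarrow> pt \<times> real) \<Rightarrow> bool" where
  "projectivity N M \<longleftrightarrow> linear M \<and> bij_betw M (Rpow N \<times> UNIV) (Rpow N \<times> UNIV)"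

definition proj_apply :: "(pt \<times> real \<Rightarrow> pt \<times> real) \<Rightarrow> pt \<Rightarrow> pt" where
  "proj_apply M x = fst (M (x, 1)) /\<^sub>R snd (M (x, 1))"

definition finite_on :: "(pt \<times> real \<Rightarrow> pt \<times> real) \<Rightarrow> pt set \<Rightarrow> bool" where
  "finite_on M S \<longleftrightarrow> (\<forall>x\<in>S. snd (M (x, 1)) \<noteq> 0)"

definition projectivity_on :: "(pt \<times> real \<Rightarrow> pt \<times> real) \<Rightarrow> pt set \<Rightarrow> bool" where
  "projectivity_on M S \<longleftrightarrow> (\<exists>N. S \<subseteq> Rpow N \<and> projectivity N M \<and> finite_on M S)"

definition proj_image :: "(pt \<times> real \<Rightarrow> pt \<times> real) \<Rightarrow> indexed \<Rightarrow> indexed" where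
  "proj_image M F = (\<lambda>f. map_option ((`) (proj_apply M)) (F f))"

definition comb_equivalent :: "indexed \<Rightarrow> indexed \<Rightarrow> bool" where
  "comb_equivalent F G \<longleftrightarrow> index_order F = index_order G"

definition proj_equivalent :: "indexed \<Rightarrow> indexed \<Rightarrow> bool" where
  "proj_equivalent F G \<longleftrightarrow> comb_equivalent F G \<and>
     (\<exists>M. projectivity_on M (body F) \<and> proj_image M F = G)"

definition comb_class :: "indexed \<Rightarrow> indexed set" where
  "comb_class F = {G. algebraic_indexed G \<and> comb_equivalent F G}"

definition proj_class :: "indexed \<Rightarrow> indexed set" where
  "proj_class F = {G. algebraic_indexed G \<and> proj_equivalent F G}"

definition algebraic_realizations :: "nat rel \<Rightarrow> indexed set" where
  "algebraic_realizations r = {G. algebraic_indexed G \<and> realization r G}"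

text \<open>
  A predicate of \<open>n\<close> algebraic polytopes of the same combinatorial type is a predicate on lists
  of indexed polytopes, which is only ever consulted on lists of length \<open>n\<close> of algebraic
  polytopes with the same index poset.
\<close>

definition holds_for_some :: "nat \<Rightarrow> (indexed list \<Rightarrow> bool) \<Rightarrow> indexed set \<Rightarrow> bool" where
  "holds_for_some n \<psi> C \<longleftrightarrow> (\<exists>Ps. length Ps = n \<and> set Ps \<subseteq> C \<and> \<psi> Ps)"

definition projectively_inherits ::
    "nat \<Rightarrow> (indexed list \<Rightarrow> bool) \<Rightarrow> nat rel \<Rightarrow> nat \<Rightarrow> bool" where
  "projectively_inherits n \<psi> r f \<longleftrightarrow>
     (\<forall>Ps. length Ps = n \<and> set Ps \<subseteq> algebraic_realizations r \<and> \<psi> Ps \<longrightarrow>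
       (\<exists>Ms. length Ms = n \<and>
         (\<forall>i<n. projectivity_on (Ms ! i) (body (face (Ps ! i) f)) \<and>
                algebraic_indexed (proj_image (Ms ! i) (face (Ps ! i) f))) \<and>
         \<psi> (map (\<lambda>i. proj_image (Ms ! i) (face (Ps ! i) f)) [0..<n])))"

definition ridges_projectively_inherit :: "nat \<Rightarrow> (indexed list \<Rightarrow> bool) \<Rightarrow> bool" where
  "ridges_projectively_inherit n \<psi> \<longleftrightarrow>
     (\<forall>r f. combinatorial_polytope r \<and> ridge r f \<longrightarrow> projectively_inherits n \<psi> r f)"

definition comb_fail_dims :: "nat \<Rightarrow> (indexed list \<Rightarrow> bool) \<Rightarrow> int set" where
  "comb_fail_dims n \<psi> = {k. \<exists>r. combinatorial_polytope r \<and> comb_dim r k \<and>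
     \<not> holds_for_some n \<psi> (algebraic_realizations r)}"

definition proj_fail_dims :: "nat \<Rightarrow> (indexed list \<Rightarrow> bool) \<Rightarrow> int set" where
  "proj_fail_dims n \<psi> = {k. \<exists>F. algebraic_indexed F \<and> pdim (body F) = k \<and>
     \<not> holds_for_some n \<psi> (proj_class F)}"

definition lowest :: "int set \<Rightarrow> int \<Rightarrow> bool" where
  "lowest K k \<longleftrightarrow> k \<in> K \<and> (\<forall>j\<in>K. k \<le> j)"

text \<open>
  The faces of the convex hull may be indexed in any way; the quantification over all \<open>F\<close> with
  body \<^term>\<open>convex hull (set ps)\<close> covers every indexing.
\<close>

definition all_hulls_comb :: "nat \<Rightarrow> (indexed list \<Rightarrow> bool) \<Rightarrow> nat \<Rightarrow> bool" where
  "all_hulls_comb n \<psi> d \<longleftrightarrow> (\<forall>ps F. set ps \<subseteq> Ralg_pow d \<and> indexed_polytope F \<and>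
     body F = convex hull (set ps) \<longrightarrow> holds_for_some n \<psi> (comb_class F))"

definition all_hulls_proj :: "nat \<Rightarrow> (indexed list \<Rightarrow> bool) \<Rightarrow> nat \<Rightarrow> bool" where
  "all_hulls_proj n \<psi> d \<longleftrightarrow> (\<forall>ps F. set ps \<subseteq> Ralg_pow d \<and> indexed_polytope F \<and>
     body F = convex hull (set ps) \<longrightarrow> holds_for_some n \<psi> (proj_class F))"

end

(* Every algebraic polytope E is shown to be, up to projectivity, a ridge of a polytope S of
   dimension at most two more, whose combinatorial type determines the projective type of that
   ridge in every realization of S.  Realizations of S satisfying psi therefore pass psi by
   inheritance to polytopes projectively equivalent to E.  Rigidity comes from stacking point
   configurations over points of a conic: the face lattice of S then forces incidences and
   parallelisms among the clusters, and these can encode sums and products, hence pin down every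
   algebraic coordinate. *)

theory Submission
 imports Defs
begin

text \<open>Incidences can be read from the lattice because of covers: if one face covers another,
  its vectors have rank one modulo the smaller face, in every realization. Each forced parallelism
  is arranged as such a cover. The conic needs only two dimensions beyond the cluster, however many
  fibres are hung over it; hence a ridge, and a gap of 2. The price: the rays, which tie all fibres
  to one common linear space, must stay strictly negative, so only functionals positive on one
  direction \<open>up d\<close> are usable and only \<open>admissible\<close> clusters can be
  stamped. In the plane this excludes many slopes. Therefore numbers are forced only on the
  nonnegative half-line, with product and sum both drawn from one relation between the slopes of a
  quadrangle, and a polytope must first be brought by a projectivity into an admissible and
  \<open>flat\<close> position. Algebraicity is used twice: order and integer polynomial relations
  isolate exactly the algebraic numbers, and a finite system of polynomial equations and strict
  inequalities with algebraic coefficients that is solvable over the reals has an algebraic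
  solution.\<close>

notation scaleR (infixr "*R" 75)

section \<open>Cones over finitely many vectors: faces as index sets and the linear algebra that
  they determine\<close>

section \<open>Faces of vector configurations\<close>

lemma linear_separate_span:
 fixes x :: "'a::real_vector"
 assumes "x ~: span A"
 obtains g :: "'a => real" where "linear g" "!!a. a : span A ==> g a = 0" "g x = 1"
proof -
 obtain B where B: "B <= A" "independent B" "A <= span B" using maximal_independent_subset[of A] by blast
 have sp: "span B = span A" using B by (metis span_mono span_span subset_antisym)
 have ind: "independent (insert x B)" using B(2) assms sp by (simp add: independent_insert)
 obtain g :: "'a => real" where g: "linear g" "ALL b:insert x B. g b = (if b = x then 1 else 0)"
  using linear_independent_extend[OF ind, of "%b. if b = x then 1 else 0"] by blast
 have "x ~: B" using assms sp span_base by blast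
 hence "g b = 0" if "b : B" for b using g(2) that by auto
 hence "g a = 0" if "a : span B" for a using linear_eq_on_span[OF g(1) linear_zero, of B a] that by auto
 thus ?thesis using g sp that by auto
qed

lemma dim_insert_finite:
 fixes x :: "'a::real_vector"
 assumes "finite A" "x ~: span A"
 shows "dim (insert x A) = Suc (dim A)"
proof -
 obtain B where B: "B <= A" "independent B" "A <= span B" "card B = dim A" using basis_exists[of A] by blast
 have sp: "span B = span A" using B by (metis span_mono span_span subset_antisym)
 have fin: "finite B" using B(1) assms(1) finite_subset by blast
 have "independent (insert x B)" using B(2) assms(2) sp by (simp add: independent_insert)
 moreover have "insert x A <= span (insert x B)" using B(3) by (meson insert_subset span_base insertI1 span_mono subset_insertI subset_trans)
 moreover have "x ~: B" using assms(2) sp span_base by blast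
 ultimately show ?thesis using dim_unique[of "insert x B" "insert x A" "Suc (dim A)"] B fin by auto
qed

text \<open>Induction as in Fourier-Motzkin elimination: a functional that separates for
  \<open>I\<close> but is positive on the new vector \<open>v j\<close> is used to project along
  \<open>v j\<close>, and the alternative for the projected vectors lifts back. The argument is
  purely algebraic, which matters because \<open>pt\<close> is infinite-dimensional.\<close>

lemma farkas:
 fixes v :: "'i => 'a::real_vector"
 assumes "finite I"
 shows "(EX a. (ALL i:I. 0 <= a i) & b = (\<Sum>i\<in>I. a i *R v i)) \<or>
  (EX f::'a=>real. linear f & (ALL i:I. f (v i) <= 0) & f b > 0)" using assms
proof (induction I arbitrary: v b rule: finite_induct)
 case empty
 show ?case
 proof (cases "b = 0")
  case True thus ?thesis by simp
 next
  case False
  hence "b ~: span {}" by simp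
  then obtain g :: "'a => real" where "linear g" "g b = 1" using linear_separate_span by metis
  thus ?thesis by (auto intro!: exI[of _ g])
 qed
next
 case (insert j I)
 consider a where "ALL i:I. 0 <= a i" "b = (\<Sum>i\<in>I. a i *R v i)"
  | f :: "'a => real" where "linear f" "ALL i:I. f (v i) <= 0" "f b > 0" using insert.IH[of b v] by blast
 thus ?case
 proof cases
  case (1 a)
  hence "(ALL i:insert j I. 0 <= (a(j:=0)) i) & b = (\<Sum>i\<in>insert j I. (a(j:=0)) i *R v i)"
   using insert.hyps by (auto intro!: sum.cong)
  thus ?thesis by blast
 next
  case (2 f)
  interpret f: linear f by fact
  show ?thesis
  proof (cases "f (v j) <= 0")
   case True
   thus ?thesis using 2 by blast
  next
   case False
   hence pos: "f (v j) > 0" by simp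
   define P where "P x = x - (f x / f (v j)) *R v j" for x
   have linP: "linear P" unfolding P_def by (rule linearI) (auto simp: f.add f.scaleR algebra_simps add_divide_distrib)
   consider a where "ALL i:I. 0 <= a i" "P b = (\<Sum>i\<in>I. a i *R P (v i))"
    | g :: "'a => real" where "linear g" "ALL i:I. g (P (v i)) <= 0" "g (P b) > 0"
    using insert.IH[of "P b" "%i. P (v i)"] by blast
   thus ?thesis
   proof cases
    case (1 a)
    \<comment> \<open>The coefficient that lifting back puts on \<open>v j\<close>: nonnegative
      because \<open>f\<close> is positive at \<open>b\<close> and nonpositive on the old
      vectors.\<close>
    define c where "c = f b / f (v j) - (\<Sum>i\<in>I. a i * (f (v i) / f (v j)))"
    have "(\<Sum>i\<in>I. a i * (f (v i) / f (v j))) <= 0"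
     using 1(1) 2(2) pos by (intro sum_nonpos mult_nonneg_nonpos divide_nonpos_pos) auto
    moreover have "f b / f (v j) > 0" using 2(3) pos by simp
    ultimately have c: "c >= 0" unfolding c_def by linarith
    have "b = P b + (f b / f (v j)) *R v j" by (simp add: P_def)
    also have "P b = (\<Sum>i\<in>I. a i *R v i) - (\<Sum>i\<in>I. a i * (f (v i) / f (v j))) *R v j"
     unfolding 1(2) by (simp add: P_def scaleR_diff_right sum_subtractf scaleR_left.sum)
    finally have "b = (\<Sum>i\<in>I. a i *R v i) + c *R v j" by (simp add: c_def algebra_simps)
    moreover have "(\<Sum>i\<in>I. (a(j:=c)) i *R v i) = (\<Sum>i\<in>I. a i *R v i)" using insert.hyps by (intro sum.cong) auto
    ultimately have "b = (\<Sum>i\<in>insert j I. (a(j:=c)) i *R v i)" using insert.hyps by simp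
    moreover have "ALL i:insert j I. 0 <= (a(j:=c)) i" using 1(1) c by simp
    ultimately show ?thesis by blast
   next
    case (2 g)
    interpret g: linear g by fact
    have "P (v j) = 0" using pos by (simp add: P_def)
    hence "g (P (v j)) = 0" by (simp add: g.zero)
    thus ?thesis using 2 linear_compose[OF linP 2(1)] by (auto intro!: exI[of _ "g \<circ> P"])
   qed
  qed
 qed
qed

text \<open>Farkas for the vectors lifted to height 1 with target \<open>(0, 1)\<close>: the height
  coordinate makes the coefficients add up to 1.\<close>

lemma gordan:
 fixes v :: "'i => 'a::real_vector"
 assumes "finite I"
 shows "(EX a. (ALL i:I. 0 <= a i) & sum a I = 1 & (\<Sum>i\<in>I. a i *R v i) = 0) \<or>
  (EX f::'a=>real. linear f & (ALL i:I. f (v i) < 0))"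
proof -
 consider a where "ALL i:I. 0 <= a i" "(0, 1) = (\<Sum>i\<in>I. a i *R (v i, 1::real))"
  | f :: "'a \<times> real => real" where "linear f" "ALL i:I. f (v i, 1) <= 0" "f (0, 1) > 0"
  using farkas[OF assms, of "(0::'a, 1::real)" "%i. (v i, 1)"] by blast
 thus ?thesis
 proof cases
  case (1 a)
  hence "(0, 1) = ((\<Sum>i\<in>I. a i *R v i), sum a I)" by (simp add: sum_prod)
  thus ?thesis using 1 by force
 next
  case (2 f)
  interpret linear f by fact
  have "linear (%x. f (x, 0))" by (rule linearI) (simp_all flip: add real_scaleR_def scaleR)
  moreover have "f (v i, 0) < 0" if "i : I" for i
  proof -
   have "f (v i, 1) = f (v i, 0) + f (0, 1)" by (simp flip: add)
   moreover have "f (v i, 1) <= 0" using 2(2) that by blast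
   ultimately show ?thesis using 2(3) by linarith
  qed
  ultimately show ?thesis by blast
 qed
qed

text \<open>The face lattice of the cone generated by the vectors, recorded by indices, so that
  configurations in different spaces can have literally equal face lattices.\<close>

definition cfaces :: "('i => 'a::real_vector) => 'i set => 'i set set" where
 "cfaces v I = {S. S <= I & (EX f::'a=>real. linear f &
   (ALL i:I. f (v i) <= 0 & (f (v i) = 0 \<longleftrightarrow> i : S)))}"

lemma cfacesI:
 assumes "linear f" "S <= I" "!!i. i : S ==> f (v i) = (0::real)" "!!i. i : I - S ==> f (v i) < 0"
 shows "S : cfaces v I"
 unfolding cfaces_def using assms by (auto intro!: exI[of _ f]) (metis DiffI less_eq_real_def, metis DiffI less_irrefl)

lemma cfacesE':
 assumes "S : cfaces v I"
 obtains f :: "'a::real_vector => real" where "linear f" "S <= I" "!!i. i : S ==> f (v i) = 0"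
  "!!i. i : I - S ==> f (v i) < 0" "!!i. i : I ==> f (v i) <= 0"
 using assms unfolding cfaces_def by (auto simp: order_le_less subset_iff)

lemma cfacesE:
 assumes "S : cfaces v I"
 obtains f :: "'a::real_vector => real" where "linear f" "S <= I" "!!i. i : S ==> f (v i) = 0"
  "!!i. i : I - S ==> f (v i) < 0" by (rule cfacesE'[OF assms]) blast

lemma cfaces_subset: "S : cfaces v I ==> S <= I" by (simp add: cfaces_def)

lemma cfaces_top: "I : cfaces v I" by (rule cfacesI[of "%_. 0"]) (auto intro: linear_zero)

lemma cfaces_Int:
 assumes "S : cfaces v I" "T : cfaces v I"
 shows "S \<inter> T : cfaces v I"
proof -
 obtain f :: "_ => real" where f: "linear f" "S <= I" "!!i. i : S ==> f (v i) = 0"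
  "!!i. i : I - S ==> f (v i) < 0" "!!i. i : I ==> f (v i) <= 0" by (rule cfacesE'[OF assms(1)]) blast
 obtain g :: "_ => real" where g: "linear g" "T <= I" "!!i. i : T ==> g (v i) = 0"
  "!!i. i : I - T ==> g (v i) < 0" "!!i. i : I ==> g (v i) <= 0" by (rule cfacesE'[OF assms(2)]) blast
 show ?thesis
 proof (rule cfacesI[of "%x. f x + g x"])
  show "linear (%x. f x + g x)" using f(1) g(1) by (rule linear_compose_add)
  fix i assume i: "i : I - S \<inter> T"
  then consider "i : I - S" "i : I" | "i : I - T" "i : I" by blast
  thus "f (v i) + g (v i) < 0" by cases (use f(4,5)[of i] g(4,5)[of i] in linarith)+
 qed (use f(2,3) g(2,3) in auto)
qed

text \<open>To a functional for \<open>U\<close> inside \<open>T\<close> a large multiple of one for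
  \<open>T\<close> is added; it decides the sign outside \<open>T\<close> and changes nothing on
  \<open>T\<close>.\<close>

lemma cfaces_trans:
 assumes "finite I" "T : cfaces v I" "U : cfaces v T"
 shows "U : cfaces v I"
proof -
 obtain f :: "_ => real" where f: "linear f" "T <= I" "!!i. i : T ==> f (v i) = 0"
  "!!i. i : I - T ==> f (v i) < 0" by (rule cfacesE[OF assms(2)]) blast
 obtain g :: "_ => real" where g: "linear g" "U <= T" "!!i. i : U ==> g (v i) = 0"
  "!!i. i : T - U ==> g (v i) < 0" by (rule cfacesE[OF assms(3)]) blast
 define N where "N = (\<Sum>i\<in>I-T. \<bar>g (v i)\<bar> / - f (v i)) + 1"
 have nn: "0 <= \<bar>g (v i)\<bar> / - f (v i)" if "i : I - T" for i using f(4)[OF that] by (intro divide_nonneg_pos) auto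
 have N: "g (v i) + N * f (v i) < 0" if i: "i : I - T" for i
 proof -
  have neg: "f (v i) < 0" using f(4) i .
  have "\<bar>g (v i)\<bar> / - f (v i) <= (\<Sum>i\<in>I-T. \<bar>g (v i)\<bar> / - f (v i))"
   using assms(1) i nn by (intro member_le_sum) auto
  hence "\<bar>g (v i)\<bar> / - f (v i) < N" by (simp add: N_def)
  hence "\<bar>g (v i)\<bar> < N * - f (v i)" using neg by (simp add: divide_less_eq field_simps split: if_splits)
  thus ?thesis by linarith
 qed
 show ?thesis
 proof (rule cfacesI[of "%x. g x + N * f x"])
  show "linear (%x. g x + N * f x)"
   using f(1) g(1) by (intro linear_compose_add linear_compose_scale_right[of f N, simplified])
  show "g (v i) + N * f (v i) < 0" if "i : I - U" for i using that N[of i] g(4)[of i] f(3)[of i] by (cases "i : T") auto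
 qed (use f(2,3) g(2,3) in auto)
qed

lemma cfaces_restrict:
 assumes "S : cfaces v I" "T <= I"
 shows "S \<inter> T : cfaces v T"
proof -
 obtain f :: "_ => real" where "linear f" "S <= I" "!!i. i : S ==> f (v i) = 0"
  "!!i. i : I - S ==> f (v i) < 0" by (rule cfacesE[OF assms(1)]) blast
 thus ?thesis using assms(2) by (intro cfacesI[of f]) auto
qed

text \<open>A hyperplane supporting \<open>S\<close> is tilted by a functional that vanishes on
  \<open>S\<close> and \<open>j\<close> and is positive at \<open>k\<close>, until it first touches
  another index of \<open>T\<close>. The face reached contains the index touched, but
  \<open>j\<close> keeps its negative value and stays outside.\<close>

lemma cfaces_tilt:
 fixes v :: "'i => 'a::real_vector"
 assumes fin: "finite I" and S: "S : cfaces v I" and T: "T : cfaces v I" and "S \<subset> T"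
  and jk: "j : T - S" "k : T - S" "v k ~: span (insert (v j) (v ` S))"
 shows "EX U:cfaces v I. S \<subset> U & U \<subset> T"
proof -
 obtain f :: "_ => real" where f: "linear f" "S <= I" "!!i. i : S ==> f (v i) = 0"
  "!!i. i : I - S ==> f (v i) < 0" by (rule cfacesE[OF S]) blast
 have TI: "T <= I" using T by (rule cfaces_subset)
 obtain g :: "'a => real" where g: "linear g" "!!a. a : span (insert (v j) (v ` S)) ==> g a = 0" "g (v k) = 1"
  using linear_separate_span[OF jk(3)] by metis
 have g0: "g (v i) = 0" if "i : S \<or> i = j" for i using that by (intro g(2) span_base) auto
 define K where "K = {i:T. g (v i) > 0}"
 have K: "finite K" "k : K" "K <= I - S" using fin TI jk g(3) g0 by (auto simp: K_def intro: finite_subset[OF _ fin])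
 define \<tau> where "\<tau> = Min ((%i. - f (v i) / g (v i)) ` K)"
 have "\<tau> : (%i. - f (v i) / g (v i)) ` K" unfolding \<tau>_def using K by (intro Min_in) auto
 then obtain m where m: "m : K" "\<tau> = - f (v m) / g (v m)" by auto
 have \<tau>le: "\<tau> <= - f (v i) / g (v i)" if "i : K" for i unfolding \<tau>_def using K that by (intro Min_le) auto
 have \<tau>pos: "\<tau> > 0"
 proof -
  have "f (v m) < 0" "g (v m) > 0" using m(1) K(3) f(4)[of m] by (auto simp: K_def)
  thus ?thesis by (simp add: m(2) divide_neg_pos)
 qed
 define \<Phi> where "\<Phi> x = f x + \<tau> * g x" for x
 have lin: "linear \<Phi>" unfolding \<Phi>_def
  using f(1) g(1) by (intro linear_compose_add linear_compose_scale_right[of g \<tau>, simplified])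
 have le: "\<Phi> (v i) <= 0" if "i : T" for i
 proof (cases "i : K")
  case True
  thus ?thesis using \<tau>le[OF True] by (auto simp: \<Phi>_def K_def field_simps)
 next
  case False
  hence "\<tau> * g (v i) <= 0" using that \<tau>pos by (auto simp: K_def intro!: mult_nonneg_nonpos)
  moreover have "f (v i) <= 0" using f(3,4)[of i] that TI by (cases "i : S") auto
  ultimately show ?thesis by (simp add: \<Phi>_def)
 qed
 define U where "U = {i:T. \<Phi> (v i) = 0}"
 have "U : cfaces v T" using lin le by (intro cfacesI[of \<Phi>]) (auto simp: U_def order_less_le)
 hence "U : cfaces v I" using cfaces_trans[OF fin T] by blast
 moreover have "S <= U" using \<open>S \<subset> T\<close> f(3) g0 by (auto simp: U_def \<Phi>_def)
 moreover have "m : U" "m ~: S" using m K by (auto simp: U_def \<Phi>_def K_def)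
 moreover have "j ~: U" using jk(1) g0 f(4)[of j] TI by (auto simp: U_def \<Phi>_def)
 ultimately show ?thesis using jk(1) by (intro bexI[of _ U]) (auto simp: U_def)
qed

text \<open>The way in which the lattice forces incidences: if \<open>v\<close> has rank one on
  \<open>T\<close> modulo \<open>S\<close>, then no face lies strictly between them, and by tilting
  \<open>w\<close> has rank one there too. Every rigidity statement about the stamp goes through
  this lemma.\<close>

lemma cfaces_cover_transfer:
 fixes v :: "'i => 'a::real_vector" and w :: "'i => 'b::real_vector"
 assumes fin: "finite I" and eq: "cfaces v I = cfaces w I" and S: "S : cfaces v I" and T: "T : cfaces v I" and ST: "S <= T"
  and cov: "!!j k. j : T - S ==> k : T - S ==> v k : span (insert (v j) (v ` S))"
  and jk: "j : T - S" "k : T - S"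
 shows "w k : span (insert (w j) (w ` S))"
proof (rule ccontr)
 assume "w k ~: span (insert (w j) (w ` S))"
 then obtain U where U: "U : cfaces w I" "S \<subset> U" "U \<subset> T" using cfaces_tilt[OF fin, of S w T j k] S T ST eq jk by blast
 obtain f :: "_ => real" where f: "linear f" "U <= I" "!!i. i : U ==> f (v i) = 0"
  "!!i. i : I - U ==> f (v i) < 0" using U(1) unfolding eq[symmetric] by (rule cfacesE) blast
 obtain a b where a: "a : U - S" and b: "b : T - U" using U by blast
 have "v b : span (insert (v a) (v ` S))" using cov[of a b] a b U by blast
 moreover have "f x = 0" if "x : insert (v a) (v ` S)" for x using that a U f(3) by auto
 ultimately have "f (v b) = 0" using linear_eq_on_span[OF f(1) linear_zero, of "insert (v a) (v ` S)" "v b"] by auto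
 thus False using f(4)[of b] b cfaces_subset[OF T] by auto
qed

lemma cfaces_not_in_span:
 assumes "S : cfaces v I" "i : I - S"
 shows "v i ~: span (v ` S)"
proof
 assume i: "v i : span (v ` S)"
 obtain f :: "_ => real" where f: "linear f" "S <= I" "!!i. i : S ==> f (v i) = 0"
  "!!i. i : I - S ==> f (v i) < 0" by (rule cfacesE[OF assms(1)]) blast
 have "f (v i) = 0" using linear_eq_on_span[OF f(1) linear_zero, of "v ` S" "v i"] f(3) i by auto
 thus False using f(4)[of i] assms(2) by auto
qed

text \<open>Tilting shows that a cover adds at most one dimension; a vector outside a face is never
  in the span of that face, so it adds exactly one.\<close>

lemma cfaces_dim_cover:
 assumes fin: "finite I" and S: "S : cfaces u I" and T: "T : cfaces u I" "T \<subset> S"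
  and cov: "!!U. U : cfaces u I ==> T \<subset> U ==> ~ U \<subset> S"
 shows "dim (u ` S) = Suc (dim (u ` T))"
proof -
 have finS: "finite S" using cfaces_subset[OF S] fin finite_subset by blast
 obtain j where j: "j : S - T" using T by blast
 have sub: "u ` S <= span (insert (u j) (u ` T))"
 proof safe
  fix k assume k: "k : S"
  show "u k : span (insert (u j) (u ` T))"
  proof (cases "k : T")
   case True thus ?thesis by (auto intro: span_base)
  next
   case False
   thus ?thesis using cfaces_tilt[OF fin T(1) S T(2) j, of k] k cov by blast
  qed
 qed
 have "insert (u j) (u ` T) <= u ` S" using j T by auto
 hence "span (u ` S) = span (insert (u j) (u ` T))" using sub by (simp add: span_mono span_minimal subset_antisym)
 hence "dim (u ` S) = dim (insert (u j) (u ` T))" by (rule span_eq_dim)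
 also have "\<dots> = Suc (dim (u ` T))"
 proof (rule dim_insert_finite)
  show "finite (u ` T)" using T finS finite_subset by blast
  show "u j ~: span (u ` T)" using cfaces_not_in_span[of T u I j] T(1) j cfaces_subset[OF S] by blast
 qed
 finally show ?thesis .
qed

text \<open>Rank is counted along a chain of covers that starts at the empty face with rank 0, and
  covers depend on the lattice alone.\<close>

theorem cfaces_dim_eq:
 fixes v :: "'i => 'a::real_vector" and w :: "'i => 'b::real_vector"
 assumes fin: "finite I" and eq: "cfaces v I = cfaces w I" and bot: "{} : cfaces v I" and "S : cfaces v I"
 shows "dim (v ` S) = dim (w ` S)" using assms(4)
proof (induction "card S" arbitrary: S rule: less_induct)
 case less
 have finS: "finite S" using cfaces_subset[OF less.prems] fin finite_subset by blast
 show ?case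
 proof (cases "S = {}")
  case True
  thus ?thesis by (simp add: real_vector.dim_eq_card_independent[OF independent_empty])
 next
  case False
  let ?A = "{T : cfaces v I. T \<subset> S}"
  have "finite ?A" using finS by (rule_tac finite_subset[of _ "Pow S"]) auto
  moreover have "?A ~= {}" using bot False by auto
  ultimately obtain T where T: "T : ?A" "ALL U:?A. T <= U --> T = U" using finite_has_maximal[of ?A] by blast
  have "dim (v ` T) = dim (w ` T)" using less.hyps[of T] T finS by (auto intro: psubset_card_mono)
  moreover have "dim (v ` S) = Suc (dim (v ` T))" using T by (intro cfaces_dim_cover[OF fin less.prems]) auto
  moreover have "dim (w ` S) = Suc (dim (w ` T))" using T less.prems eq by (intro cfaces_dim_cover[OF fin]) auto
  ultimately show ?thesis by simp
 qed
qed

text \<open>The sum over \<open>S\<close> lies in the relative interior of the cone of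
  \<open>T\<close>. Any functional that is nonpositive on \<open>T\<close> and vanishes on
  \<open>S\<close> must then vanish on \<open>T\<close>, so this single equation with positive
  coefficients certifies that \<open>T\<close> is minimal. It turns a statement about all
  functionals into a polynomial condition.\<close>

lemma cfaces_certificate:
 fixes v :: "'i => 'a::real_vector"
 assumes fin: "finite I" and "S <= I" and T: "T : cfaces v I" "S <= T"
  and least: "!!U. U : cfaces v I ==> S <= U ==> T <= U"
 obtains \<mu> where "!!i. i : T ==> 0 < \<mu> i" "(\<Sum>i\<in>S. v i) = (\<Sum>i\<in>T. \<mu> i *R v i)"
proof -
 have TI: "T <= I" using T by (simp add: cfaces_subset)
 have finT: "finite T" "finite S" using TI fin assms(2) finite_subset by blast+
 have TT: "U : cfaces v T ==> S <= U ==> U = T" for U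
  using least[of U, OF cfaces_trans[OF fin T(1)]] cfaces_subset[of U v T] by auto
 \<comment> \<open>Farkas for \<open>- v j\<close> against the vectors of \<open>T\<close> and the
   negatives of those of \<open>S\<close>: a separating functional would cut out of \<open>T\<close>
   a face that contains \<open>S\<close> but not \<open>j\<close>.\<close>
 have ex: "ALL j:T. EX a b. (ALL i:T. 0 <= a i) & (ALL i:S. 0 <= b i) &
   - v j = (\<Sum>i\<in>T. a i *R v i) - (\<Sum>i\<in>S. b i *R v i)"
 proof
  fix j assume j: "j : T"
  let ?J = "Inl ` T \<union> Inr ` S" and ?w = "case_sum v (%i. - v i)"
  have finJ: "finite ?J" using finT by simp
  have split: "(\<Sum>i\<in>?J. a i *R ?w i) = (\<Sum>i\<in>T. a (Inl i) *R v i) - (\<Sum>i\<in>S. a (Inr i) *R v i)" for a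
  proof -
   have "(\<Sum>i\<in>?J. a i *R ?w i) = (\<Sum>i\<in>Inl ` T. a i *R ?w i) + (\<Sum>i\<in>Inr ` S. a i *R ?w i)"
    using finT by (intro sum.union_disjoint) auto
   thus ?thesis by (simp add: sum.reindex sum_negf)
  qed
  consider a where "ALL i:?J. 0 <= a i" "- v j = (\<Sum>i\<in>?J. a i *R ?w i)"
   | f :: "'a => real" where "linear f" "ALL i:?J. f (?w i) <= 0" "f (- v j) > 0"
   using farkas[OF finJ, of "- v j" ?w] by blast
  thus "EX a b. (ALL i:T. 0 <= a i) & (ALL i:S. 0 <= b i) &
   - v j = (\<Sum>i\<in>T. a i *R v i) - (\<Sum>i\<in>S. b i *R v i)"
  proof cases
   case (1 a)
   thus ?thesis unfolding split by (intro exI[of _ "%i. a (Inl i)"] exI[of _ "%i. a (Inr i)"]) auto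
  next
   case (2 f)
   interpret linear f by fact
   have le: "f (v i) <= 0" if "i : T" for i using 2(2) that by force
   have "f (- v i) <= 0" if "i : S" for i using 2(2) that by force
   hence zero: "f (v i) = 0" if "i : S" for i using le[of i] that T(2) by (force simp: neg)
   have "{i:T. f (v i) = 0} : cfaces v T" using 2(1) le by (intro cfacesI[of f]) (auto simp: order_less_le)
   hence "{i:T. f (v i) = 0} = T" using TT zero T(2) by blast
   hence "f (v j) = 0" using j by blast
   thus ?thesis using 2(3) by (simp add: neg)
  qed
 qed
 obtain a where a': "ALL j:T. EX b. (ALL i:T. 0 <= a j i) & (ALL i:S. 0 <= b i) &
   - v j = (\<Sum>i\<in>T. a j i *R v i) - (\<Sum>i\<in>S. b i *R v i)" using bchoice[OF ex] by (elim exE) (rule that)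
 obtain b where ab': "ALL j:T. (ALL i:T. 0 <= a j i) & (ALL i:S. 0 <= b j i) &
   - v j = (\<Sum>i\<in>T. a j i *R v i) - (\<Sum>i\<in>S. b j i *R v i)" using bchoice[OF a'] by (elim exE) (rule that)
 hence a: "!!j i. j : T ==> i : T ==> 0 <= a j i"
  and b: "!!j i. j : T ==> i : S ==> 0 <= b j i"
  and ab: "!!j. j : T ==> - v j = (\<Sum>i\<in>T. a j i *R v i) - (\<Sum>i\<in>S. b j i *R v i)" by blast+
 define A where "A i = (\<Sum>j\<in>T. a j i)" for i
 define B where "B i = (\<Sum>j\<in>T. b j i)" for i
 have "(\<Sum>j\<in>T. - v j) = (\<Sum>i\<in>T. A i *R v i) - (\<Sum>i\<in>S. B i *R v i)"
 proof -
  have "(\<Sum>j\<in>T. \<Sum>i\<in>T. a j i *R v i) = (\<Sum>i\<in>T. A i *R v i)"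
   by (subst sum.swap) (simp add: A_def scaleR_left.sum)
  moreover have "(\<Sum>j\<in>T. \<Sum>i\<in>S. b j i *R v i) = (\<Sum>i\<in>S. B i *R v i)"
   by (subst sum.swap) (simp add: B_def scaleR_left.sum)
  ultimately show ?thesis using ab by (simp add: sum_subtractf)
 qed
 hence eq: "(\<Sum>i\<in>S. B i *R v i) = (\<Sum>i\<in>T. (A i + 1) *R v i)"
  by (simp add: scaleR_add_left sum.distrib sum_negf algebra_simps)
 \<comment> \<open>Larger than every \<open>B i\<close>, so that adding \<open>N - B i\<close> times
   each vector of \<open>S\<close> to both sides leaves a multiple of the plain sum on the left and
   positive coefficients on the right.\<close>
 define N where "N = (\<Sum>i\<in>S. B i) + 1"
 have Bpos: "0 <= B i" if "i : S" for i using b that by (auto simp: B_def intro: sum_nonneg)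
 have Apos: "0 <= A i" if "i : T" for i using a that by (auto simp: A_def intro: sum_nonneg)
 have BN: "B i < N" if "i : S" for i using member_le_sum[of i S B] Bpos finT that by (auto simp: N_def)
 have Npos: "N > 0" using Bpos by (auto simp: N_def intro!: add_nonneg_pos sum_nonneg)
 define C where "C i = (if i : S then N - B i else 0) + (A i + 1)" for i
 have "N *R (\<Sum>i\<in>S. v i) = (\<Sum>i\<in>S. (N - B i) *R v i) + (\<Sum>i\<in>S. B i *R v i)"
  by (simp add: scaleR_diff_left sum_subtractf scaleR_sum_right)
 also have "(\<Sum>i\<in>S. (N - B i) *R v i) = (\<Sum>i\<in>T. (if i : S then N - B i else 0) *R v i)"
  using T(2) finT by (intro sum.mono_neutral_cong_left) auto
 finally have N: "N *R (\<Sum>i\<in>S. v i) = (\<Sum>i\<in>T. C i *R v i)" unfolding eq C_def by (simp add: scaleR_add_left sum.distrib)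
 have Cpos: "0 < C i" if "i : T" for i using Apos[OF that] BN[of i] by (auto simp: C_def)
 show ?thesis
 proof (rule that)
  show "0 < C i / N" if "i : T" for i using Cpos[OF that] Npos by simp
  have "(\<Sum>i\<in>S. v i) = (1/N) *R (N *R (\<Sum>i\<in>S. v i))" using Npos by simp
  thus "(\<Sum>i\<in>S. v i) = (\<Sum>i\<in>T. (C i / N) *R v i)" unfolding N by (simp add: scaleR_sum_right)
 qed
qed

lemma cfaces_least:
 assumes "finite I" "S <= I"
 obtains T where "T : cfaces v I" "S <= T" "!!U. U : cfaces v I ==> S <= U ==> T <= U"
proof -
 let ?A = "{T : cfaces v I. S <= T}"
 have "finite ?A" using assms(1) by (intro finite_subset[of ?A "Pow I"]) (auto dest: cfaces_subset)
 moreover have "?A ~= {}" using assms cfaces_top by blast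
 ultimately obtain T where T: "T : ?A" "ALL U:?A. U <= T --> T = U" using finite_has_minimal[of ?A] by blast
 show ?thesis
 proof (rule that[of T])
  fix U assume "U : cfaces v I" "S <= U"
  hence "T \<inter> U : ?A" using T(1) cfaces_Int[of T v I U] by simp
  thus "T <= U" using T(2) by auto
 qed (use T in auto)
qed

section \<open>Algebraic numbers as a ring, and approximation of real solutions by algebraic
  ones\<close>

section \<open>Algebraic numbers and specialization\<close>

interpretation rat_span: vector_space "%(q::rat) (x::real). of_rat q * x" by standard (auto simp: algebra_simps of_rat_add of_rat_mult)

text \<open>Rings of finite dimension over the rationals: the powers of an element are dependent, so
  it is algebraic. Closure properties of the algebraic numbers reduce to adjoining elements to such
  rings.\<close>

definition fin_subalgebra :: "real set => bool" where
 "fin_subalgebra R \<longleftrightarrow> (EX W. finite W & R = rat_span.span W) & 1 : R & (ALL a:R. ALL b:R. a * b : R)"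

lemma fin_subalgebra_algebraic:
 assumes "fin_subalgebra R" "x : R"
 shows "algebraic x"
proof (cases "ALL n. inj_on (%i::nat. x ^ i) {..n}")
 case False
 then obtain i j :: nat where "i < j" "x ^ i = x ^ j" unfolding inj_on_def by (metis nat_neq_iff)
 hence "poly (monom 1 j - monom 1 i) x = 0" by (simp add: poly_monom)
 moreover have "coeff (monom 1 j - monom 1 i :: real poly) j = 1" using \<open>i < j\<close> by simp
 hence "monom 1 j - monom 1 i ~= (0 :: real poly)" by (metis coeff_0 zero_neq_one)
 ultimately show ?thesis by (intro algebraicI[of "monom 1 j - monom 1 i"]) auto
next
 case inj: True
 obtain W where W: "finite W" "R = rat_span.span W" using assms by (auto simp: fin_subalgebra_def)
 define n where "n = card W"
 let ?P = "(%i. x ^ i) ` {..n}"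
 have pow: "x ^ i : R" for i using assms by (induction i) (auto simp: fin_subalgebra_def)
 have "card ?P = Suc n" using inj[rule_format, of n] by (simp add: card_image)
 hence "~ rat_span.independent ?P" using rat_span.independent_span_bound[of W ?P] W pow by (auto simp: n_def)
 then obtain u where u: "(\<Sum>v\<in>?P. of_rat (u v) * v) = 0" "EX v:?P. u v ~= 0" using rat_span.dependent_finite[of ?P] by auto
 define p :: "real poly" where "p = (\<Sum>i\<le>n. monom (of_rat (u (x ^ i))) i)"
 have coeff: "coeff p i = (if i <= n then of_rat (u (x ^ i)) else 0)" for i by (simp add: p_def coeff_sum sum.delta')
 have "poly p x = (\<Sum>i\<le>n. of_rat (u (x ^ i)) * x ^ i)" by (simp add: p_def poly_sum poly_monom)
 also have "\<dots> = 0" using u(1) inj[rule_format, of n] by (simp add: sum.reindex)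
 finally have "poly p x = 0" .
 moreover obtain i where "i <= n" "u (x ^ i) ~= 0" using u(2) by auto
 hence "coeff p i ~= 0" by (simp add: coeff)
 hence "p ~= 0" by auto
 ultimately show ?thesis by (intro algebraicI'[of p]) (auto simp: coeff)
qed

text \<open>The products \<open>w * y ^ i\<close> with \<open>i < d\<close> already span a ring,
  since the monic equation rewrites \<open>y ^ d\<close> in lower powers.\<close>

lemma fin_subalgebra_adjoin:
 assumes R: "fin_subalgebra R" and c: "!!i. i < d ==> c i : R" and y: "y ^ d = (\<Sum>i<d. c i * y ^ i)"
 shows "EX R'. fin_subalgebra R' & R <= R' & y : R'"
proof -
 obtain W where W: "finite W" "R = rat_span.span W" and R1: "1 : R"
  and mult: "!!a b. a : R ==> b : R ==> a * b : R" using R by (auto simp: fin_subalgebra_def)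
 have d: "d > 0" using y by (cases d) auto
 define G where "G = (%(w,i). w * y ^ i) ` (W \<times> {..<d})"
 define R' where "R' = rat_span.span G"
 have sumR': "(\<Sum>i\<in>A. f i) : R'" if "!!i. i : A ==> f i : R'" for A and f :: "nat => real"
  using that unfolding R'_def by (rule rat_span.span_sum)
 have low: "r * y ^ i : R'" if "r : R" "i < d" for r i using that(1) unfolding W(2)
 proof (induction rule: rat_span.span_induct_alt)
  case base
  thus ?case by (simp add: R'_def rat_span.span_zero)
 next
  case (step q w r)
  have "w * y ^ i : R'" unfolding R'_def using step(1) that(2) by (intro rat_span.span_base) (auto simp: G_def)
  hence "of_rat q * (w * y ^ i) + r * y ^ i : R'" using step(2) unfolding R'_def by (intro rat_span.span_add rat_span.span_scale)
  thus ?case by (simp add: algebra_simps)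
 qed
 have ind: "P r" if "r : R'" "P 0" "!!q w i r. w : W ==> i < d ==> r : R' ==> P r ==> P (of_rat q * (w * y ^ i) + r)" for P r
 proof -
  have "r : R' & P r" using that(1) unfolding R'_def
  proof (induction rule: rat_span.span_induct_alt)
   case base
   thus ?case using that(2) by (simp add: rat_span.span_zero)
  next
   case (step q g r)
   then obtain w i where "g = w * y ^ i" "w : W" "i < d" by (auto simp: G_def)
   thus ?case using step that(3)[of w i r q] unfolding R'_def by (auto intro: rat_span.span_add rat_span.span_scale rat_span.span_base)
  qed
  thus ?thesis by simp
 qed
 have mulR: "a * r : R'" if "a : R" "r : R'" for a r using that(2)
 proof (rule ind)
  fix q w i r assume "w : W" "i < d" "a * r : R'"
  moreover from \<open>w : W\<close> have "w : R" unfolding W(2) by (rule rat_span.span_base)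
  ultimately have "of_rat q * (a * w * y ^ i) + a * r : R'" using low[of "a * w" i] mult[OF that(1)] unfolding R'_def
   by (intro rat_span.span_add rat_span.span_scale) auto
  thus "a * (of_rat q * (w * y ^ i) + r) : R'" by (simp add: algebra_simps)
 qed (simp add: R'_def rat_span.span_zero)
 have muly: "y * r : R'" if "r : R'" for r using that
 proof (rule ind)
  fix q w i r assume w: "w : W" "i < d" "y * r : R'"
  have wR: "w : R" unfolding W(2) using w(1) by (rule rat_span.span_base)
  have "w * y ^ Suc i : R'"
  proof (cases "Suc i < d")
   case True thus ?thesis using low wR by blast
  next
   case False
   hence "w * y ^ Suc i = (\<Sum>i<d. (w * c i) * y ^ i)" using w(2) y by (simp add: sum_distrib_left less_antisym mult.assoc)
     (metis not_less_eq power_Suc w(2) y less_antisym sum_distrib_left mult.assoc)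
   also have "\<dots> : R'" by (intro sumR' low mult wR c) auto
   finally show ?thesis .
  qed
  hence "of_rat q * (w * y ^ Suc i) + y * r : R'" using w(3) unfolding R'_def by (intro rat_span.span_add rat_span.span_scale) auto
  thus "y * (of_rat q * (w * y ^ i) + r) : R'" by (simp add: algebra_simps)
 qed (simp add: R'_def rat_span.span_zero)
 have mulyn: "y ^ n * r : R'" if "r : R'" for r n using that by (induction n) (auto simp: mult.assoc intro: muly)
 have mul: "a * b : R'" if "a : R'" "b : R'" for a b using that(1)
 proof (rule ind)
  fix q w i r assume w: "w : W" "i < d" "r * b : R'"
  have "w : R" unfolding W(2) using w(1) by (rule rat_span.span_base)
  hence "w * (y ^ i * b) : R'" using mulR mulyn that(2) by blast
  hence "of_rat q * (w * (y ^ i * b)) + r * b : R'" using w(3) unfolding R'_def by (intro rat_span.span_add rat_span.span_scale) auto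
  thus "(of_rat q * (w * y ^ i) + r) * b : R'" by (simp add: algebra_simps)
 qed (simp add: R'_def rat_span.span_zero)
 have sub: "R <= R'" using low[of _ 0] d by auto
 have "fin_subalgebra R'" unfolding fin_subalgebra_def using sub R1 mul W(1) by (auto simp: R'_def G_def intro!: exI[of _ G])
 moreover have "y : R'" using muly[of 1] sub R1 by auto
 ultimately show ?thesis using sub by blast
qed

lemma fin_subalgebra_adjoin_algebraic:
 assumes R: "fin_subalgebra R" and "algebraic a"
 shows "EX R'. fin_subalgebra R' & R <= R' & a : R'"
proof -
 obtain p where p: "!!i. coeff p i : \<rat>" "p ~= 0" "poly p a = 0" using assms(2) unfolding algebraic_altdef by blast
 define d where "d = degree p"
 define c where "c i = - coeff p i / lead_coeff p" for i
 have rat: "q : R" if "q : \<rat>" for q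
 proof -
  obtain r where r: "q = of_rat r * 1" using \<open>q : \<rat>\<close> by (metis Rats_cases mult.right_neutral)
  obtain W where W: "R = rat_span.span W" and "1 : R" using R by (auto simp: fin_subalgebra_def)
  thus ?thesis unfolding r W by (rule_tac rat_span.span_scale) simp
 qed
 have "0 = (\<Sum>i<d. coeff p i * a ^ i) + lead_coeff p * a ^ d" using p(3) unfolding poly_altdef d_def lessThan_Suc_atMost[symmetric] by simp
 hence "a ^ d = (\<Sum>i<d. c i * a ^ i)" using p(2) unfolding c_def by (simp add: field_simps sum_negf flip: sum_divide_distrib)
 moreover have "c i : R" for i unfolding c_def using p(1) by (intro rat Rats_divide) auto
 ultimately show ?thesis using fin_subalgebra_adjoin[OF R, of d c a] by blast
qed

lemma fin_subalgebra_rat: "fin_subalgebra (rat_span.span {1})"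
proof -
 have *: "rat_span.span {1} = range real_of_rat" using rat_span.span_singleton[of 1] by (auto simp: image_def)
 have "1 : rat_span.span {1}" by (rule rat_span.span_base) simp
 moreover have "a * b : rat_span.span {1}" if "a : rat_span.span {1}" "b : rat_span.span {1}" for a b
  using that unfolding * by (auto simp flip: of_rat_mult)
 ultimately show ?thesis unfolding fin_subalgebra_def by blast
qed

lemma fin_subalgebra_adjoin_set:
 assumes "finite A" "!!a. a : A ==> algebraic a"
 shows "EX R. fin_subalgebra R & A <= R" using assms
proof (induction A rule: finite_induct)
 case empty thus ?case using fin_subalgebra_rat by blast
next
 case (insert a A)
 then obtain R where "fin_subalgebra R" "A <= R" by auto
 moreover then obtain R' where "fin_subalgebra R'" "R <= R'" "a : R'" using fin_subalgebra_adjoin_algebraic insert.prems by blast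
 ultimately show ?case by blast
qed

lemma algebraic_add_mult:
 fixes a b :: real
 assumes "algebraic a" "algebraic b"
 shows "algebraic (a + b)" "algebraic (a * b)"
proof -
 obtain R where R: "fin_subalgebra R" "a : R" "b : R" using fin_subalgebra_adjoin_set[of "{a,b}"] assms by auto
 hence "a + b : R" "a * b : R" by (auto simp: fin_subalgebra_def intro: rat_span.span_add)
 thus "algebraic (a + b)" "algebraic (a * b)" using fin_subalgebra_algebraic[OF R(1)] by auto
qed

lemma algebraic_diff: "algebraic (a::real) ==> algebraic b ==> algebraic (a - b)"
 using algebraic_add_mult(1)[of a "- b"] by simp

lemma algebraic_divide: "algebraic (a::real) ==> algebraic b ==> algebraic (a / b)"
 using algebraic_add_mult(2)[of a "inverse b"] by (auto simp: divide_inverse)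

text \<open>Transitivity of algebraicity: the coefficients, made monic, lie in one
  finite-dimensional ring, and the root is adjoined to it.\<close>

lemma algebraic_poly_root:
 fixes y :: real
 assumes c: "!!i. i <= n ==> algebraic (c i)" and "c n ~= 0" and y: "(\<Sum>i\<le>n. c i * y ^ i) = 0"
 shows "algebraic y"
proof -
 define e where "e i = - c i / c n" for i
 have alg: "algebraic (e i)" if "i <= n" for i using c[OF that] c[of n] by (auto simp: e_def intro: algebraic_divide)
 then obtain R where R: "fin_subalgebra R" "e ` {..n} <= R" using fin_subalgebra_adjoin_set[of "e ` {..n}"] by auto
 have "y ^ n = (\<Sum>i<n. e i * y ^ i)" using y \<open>c n ~= 0\<close> unfolding lessThan_Suc_atMost[symmetric] e_def
  by (simp add: field_simps sum_negf flip: sum_divide_distrib)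
 moreover have "e i : R" if "i < n" for i using R(2) that by auto
 ultimately obtain R' where "fin_subalgebra R'" "y : R'" using fin_subalgebra_adjoin[OF R(1), of n e y] by blast
 thus ?thesis by (rule fin_subalgebra_algebraic)
qed

text \<open>Polynomials with algebraic coefficients, kept as functions;
  \<open>polyfun_insert\<close> recovers coefficients in one variable where they are needed.\<close>

inductive_set polyfun :: "'i set => (('i => real) => real) set" for I where
 const: "algebraic a ==> (%_. a) : polyfun I"
| var: "i : I ==> (%x. x i) : polyfun I"
| add: "f : polyfun I ==> g : polyfun I ==> (%x. f x + g x) : polyfun I"
| mult: "f : polyfun I ==> g : polyfun I ==> (%x. f x * g x) : polyfun I"

lemma polyfun_sum: "(!!k. k : A ==> f k : polyfun I) ==> (%x. \<Sum>k\<in>A. f k x) : polyfun I"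
proof (induction A rule: infinite_finite_induct)
 case (insert a A)
 thus ?case using polyfun.add[of "f a" I "%x. \<Sum>k\<in>A. f k x"] by simp
qed (auto intro: polyfun.const)

lemma polyfun_diff: "f : polyfun I ==> g : polyfun I ==> (%x. f x - g x) : polyfun I"
 using polyfun.add[of f I "%x. -1 * g x"] polyfun.mult[of "%_. -1" I g] polyfun.const[of "-1" I] by auto

lemma polyfun_cong: "f : polyfun I ==> (!!i. i : I ==> x i = y i) ==> f x = f y"
 by (induction rule: polyfun.induct) auto

lemma polyfun_tendsto:
 "f : polyfun I ==> (!!i. i : I ==> ((%s. X s i) \<longlongrightarrow> x i) F) ==> ((%s. f (X s)) \<longlongrightarrow> f x) F"
 by (induction rule: polyfun.induct) (auto intro: tendsto_intros)

lemma polyfun_algebraic: "f : polyfun I ==> (!!i. i : I ==> algebraic (x i)) ==> algebraic (f x)"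
 by (induction rule: polyfun.induct) (auto intro: algebraic_add_mult)

lemma polyfun_insert:
 assumes "f : polyfun (insert j I)"
 shows "EX n b. (ALL k. b k : polyfun I) & (ALL k>n. b k = (%_. 0)) & (ALL x. f x = (\<Sum>k\<le>n. b k x * x j ^ k))"
 using assms
proof induction
 case (const a)
 show ?case by (intro exI[of _ 0] exI[of _ "%k _. if k = 0 then a else 0"]) (auto intro: const polyfun.const)
next
 case (var i)
 show ?case
 proof (cases "i = j")
  case True
  show ?thesis by (intro exI[of _ 1] exI[of _ "%k _. if k = 1 then 1 else 0"]) (auto intro: polyfun.const simp: True)
 next
  case False
  hence "i : I" using var by auto
  thus ?thesis by (intro exI[of _ 0] exI[of _ "%k. if k = 0 then (%x. x i) else (%_. 0)"]) (auto intro: polyfun.intros)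
 qed
next
 case (add f g)
 obtain n b where b: "ALL k. b k : polyfun I" "ALL k>n. b k = (%_. 0)" "ALL x. f x = (\<Sum>k\<le>n. b k x * x j ^ k)"
  using add.IH(1) by blast
 obtain m c where c: "ALL k. c k : polyfun I" "ALL k>m. c k = (%_. 0)" "ALL x. g x = (\<Sum>k\<le>m. c k x * x j ^ k)"
  using add.IH(2) by blast
 note bc = b c
 have "f x = (\<Sum>k\<le>max n m. b k x * x j ^ k)" for x using bc by (simp, intro sum.mono_neutral_left) auto
 moreover have "g x = (\<Sum>k\<le>max n m. c k x * x j ^ k)" for x using bc by (simp, intro sum.mono_neutral_left) auto
 ultimately show ?case using bc by (intro exI[of _ "max n m"] exI[of _ "%k x. b k x + c k x"])
   (auto intro: polyfun.add simp: distrib_right sum.distrib)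
next
 case (mult f g)
 obtain n b where b: "ALL k. b k : polyfun I" "ALL k>n. b k = (%_. 0)" "ALL x. f x = (\<Sum>k\<le>n. b k x * x j ^ k)"
  using mult.IH(1) by blast
 obtain m c where c: "ALL k. c k : polyfun I" "ALL k>m. c k = (%_. 0)" "ALL x. g x = (\<Sum>k\<le>m. c k x * x j ^ k)"
  using mult.IH(2) by blast
 note bc = b c
 have "f x * g x = (\<Sum>r\<le>n + m. (\<Sum>k\<le>r. b k x * c (r - k) x) * x j ^ r)" for x
 proof -
  have "f x * g x = (\<Sum>k\<le>n. b k x * x j ^ k) * (\<Sum>k\<le>m. c k x * x j ^ k)" using b(3) c(3) by metis
  also have "\<dots> = (\<Sum>r\<le>n + m. (\<Sum>k\<le>r. b k x * c (r - k) x) * x j ^ r)" by (rule polynomial_product) (use b(2) c(2) in auto)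
  finally show ?thesis .
 qed
 moreover have "(%x. \<Sum>k\<le>r. b k x * c (r - k) x) : polyfun I" for r using bc by (intro polyfun_sum polyfun.mult) auto
 moreover have "(%x. \<Sum>k\<le>r. b k x * c (r - k) x) = (%_. 0)" if "r > n + m" for r
 proof
  fix x
  have "b k x * c (r - k) x = 0" if "k <= r" for k
  proof (cases "k > n")
   case True
   hence "b k = (%_. 0)" using b(2) by blast
   thus ?thesis by simp
  next
   case False
   hence "r - k > m" using \<open>r > n + m\<close> by linarith
   hence "c (r - k) = (%_. 0)" using c(2) by blast
   thus ?thesis by simp
  qed
  thus "(\<Sum>k\<le>r. b k x * c (r - k) x) = 0" by (rule_tac sum.neutral) blast
 qed
 ultimately have "(ALL r. (%x. \<Sum>k\<le>r. b k x * c (r - k) x) : polyfun I) &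
  (ALL r>n + m. (%x. \<Sum>k\<le>r. b k x * c (r - k) x) = (%_. 0)) &
  (ALL x. f x * g x = (\<Sum>r\<le>n + m. (%x. \<Sum>k\<le>r. b k x * c (r - k) x) x * x j ^ r))" by (intro conjI allI impI)
 thus ?case by (rule_tac exI[of _ "n + m"], rule_tac exI[of _ "%r x. \<Sum>k\<le>r. b k x * c (r - k) x"])
qed

text \<open>The two leading terms cancel, so a relation of degree \<open>d + q\<close> becomes one
  of lower degree without dividing by \<open>b d\<close>.\<close>

lemma pseudo_division:
 fixes t :: real
 shows "b d * (\<Sum>k\<le>d + q. c k * t ^ k) - c (d + q) * t ^ q * (\<Sum>k\<le>d. b k * t ^ k) =
  (\<Sum>k<d + q. (b d * c k - (if q <= k then c (d + q) * b (k - q) else 0)) * t ^ k)"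
proof -
 have "(\<Sum>k\<le>d. b k * t ^ (k + q)) = (\<Sum>k\<in>{q..d+q}. b (k - q) * t ^ k)"
  using sum.shift_bounds_cl_nat_ivl[of "%k. b (k - q) * t ^ k" 0 q d] by (simp add: atMost_atLeast0)
 also have "\<dots> = (\<Sum>k\<le>d+q. (if q <= k then b (k - q) else 0) * t ^ k)" by (intro sum.mono_neutral_cong_left) auto
 finally have shift: "(\<Sum>k\<le>d. b k * t ^ (k + q)) = (\<Sum>k\<le>d+q. (if q <= k then b (k - q) else 0) * t ^ k)" .
 have "c (d + q) * t ^ q * (\<Sum>k\<le>d. b k * t ^ k) = c (d + q) * (\<Sum>k\<le>d. b k * t ^ (k + q))"
  by (simp add: sum_distrib_left power_add algebra_simps)
 also have "\<dots> = (\<Sum>k\<le>d+q. (if q <= k then c (d + q) * b (k - q) else 0) * t ^ k)"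
  unfolding shift sum_distrib_left by (intro sum.cong) auto
 finally have "c (d + q) * t ^ q * (\<Sum>k\<le>d. b k * t ^ k) =
   (\<Sum>k\<le>d+q. (if q <= k then c (d + q) * b (k - q) else 0) * t ^ k)" .
 hence "b d * (\<Sum>k\<le>d + q. c k * t ^ k) - c (d + q) * t ^ q * (\<Sum>k\<le>d. b k * t ^ k) =
  (\<Sum>k\<le>d + q. (b d * c k - (if q <= k then c (d + q) * b (k - q) else 0)) * t ^ k)"
  by (simp add: sum_distrib_left algebra_simps flip: sum_subtractf)
 also have "\<dots> = (\<Sum>k<d + q. (b d * c k - (if q <= k then c (d + q) * b (k - q) else 0)) * t ^ k)"
  unfolding lessThan_Suc_atMost[symmetric] by simp
 finally show ?thesis .
qed

lemma sign_change_root: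
 fixes f :: "real => real"
 assumes "a <= b" "f a * f b < 0" "continuous_on {a..b} f"
 shows "EX r. a <= r & r <= b & f r = 0" using assms IVT'[of f a 0 b] IVT2'[of f b 0 a] by (auto simp: mult_less_0_iff)

text \<open>A generic-point argument: each relation holds exactly from some index on, while
  convergence takes care of strict inequalities. Variables are added one at a time. A new variable
  without any relation over the earlier ones is replaced by rationals; otherwise it is replaced by a
  nearby root of its relation of minimal degree, with coefficients specialized.\<close>

theorem algebraic_specialization:
 fixes x :: "'i => real"
 assumes "finite I"
 shows "EX X::nat => 'i => real. (ALL s. ALL i:I. algebraic (X s i)) & (ALL i:I. (%s. X s i) \<longlonglongrightarrow> x i) &
  (ALL f:polyfun I. f x = 0 --> (\<forall>\<^sub>F s in sequentially. f (X s) = 0))" using assms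
proof (induction I rule: finite_induct)
 case empty
 show ?case using polyfun_cong[of _ "{}" x] by (intro exI[of _ "%_. x"]) auto
next
 case (insert j I)
 then obtain X :: "nat => 'i => real" where alg: "!!s i. i : I ==> algebraic (X s i)"
  and lim: "!!i. i : I ==> (%s. X s i) \<longlonglongrightarrow> x i"
  and rel: "!!f. f : polyfun I ==> f x = 0 ==> \<forall>\<^sub>F s in sequentially. f (X s) = 0" by blast
 define y where "y = x j"
 \<comment> \<open>Degree is measured at \<open>x\<close>: a leading coefficient that vanishes there
   counts as zero, because it eventually vanishes along \<open>X\<close> as well.\<close>
 define good where "good c d \<longleftrightarrow> (ALL k. c k : polyfun I) & c d x ~= 0 & (\<Sum>k\<le>d. c k x * y ^ k) = 0"
  for c :: "nat => ('i => real) => real" and d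
 have "EX \<sigma> r. (ALL n. n <= \<sigma> n & \<bar>r n - y\<bar> <= 1 / real (Suc n) & algebraic (r n)) &
  (ALL c e. (ALL k. c k : polyfun I) --> (\<Sum>k<e. c k x * y ^ k) = 0 -->
   (\<forall>\<^sub>F n in sequentially. (\<Sum>k<e. c k (X (\<sigma> n)) * r n ^ k) = 0))"
  (is "EX \<sigma> r. ?near \<sigma> r & ?rel \<sigma> r")
 proof (cases "EX c d. good c d")
  case False
  have "EX r. r : \<rat> & \<bar>r - y\<bar> <= 1 / real (Suc n)" for n
  proof -
   obtain r where "r : \<rat>" "y < r" "r < y + 1 / real (Suc n)" using Rats_dense_in_real[of y "y + 1 / real (Suc n)"] by auto
   thus ?thesis by (intro exI[of _ r]) auto
  qed
  then obtain r where r: "!!n. r n : \<rat>" "!!n. \<bar>r n - y\<bar> <= 1 / real (Suc n)" by metis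
  have "\<forall>\<^sub>F n in sequentially. (\<Sum>k<e. c k (X n) * r n ^ k) = 0"
   if "ALL k. c k : polyfun I" "(\<Sum>k<e. c k x * y ^ k) = 0" for c e using that(2)
  proof (induction e)
   case (Suc e)
   have "c e x = 0" using False that(1) Suc.prems by (auto simp: good_def lessThan_Suc_atMost)
   hence "\<forall>\<^sub>F n in sequentially. c e (X n) = 0" using rel that(1) by blast
   moreover have "\<forall>\<^sub>F n in sequentially. (\<Sum>k<e. c k (X n) * r n ^ k) = 0" using Suc \<open>c e x = 0\<close> by simp
   ultimately show ?case by eventually_elim simp
  qed simp
  thus ?thesis using r by (intro exI[of _ "%n. n"] exI[of _ r]) (auto intro: rat_imp_algebraic)
 next
  case True
  define d where "d = (LEAST d. EX c. good c d)"
  obtain b where b: "good b d" using LeastI_ex[of "%d. EX c. good c d"] True unfolding d_def by blast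
  have least: "~ good c e" if "e < d" for c e using not_less_Least[of e "%d. EX c. good c d"] that unfolding d_def by blast
  have bp: "b k : polyfun I" for k using b by (auto simp: good_def)
  have bd: "b d x ~= 0" "(\<Sum>k\<le>d. b k x * y ^ k) = 0" using b by (auto simp: good_def)
  have d: "d > 0" using bd by (cases d) auto
  define m where "m z t = (\<Sum>k\<le>d. b k z * t ^ k)" for z t
  have deriv: "(m x has_real_derivative (\<Sum>k<d. real (Suc k) * b (Suc k) x * y ^ k)) (at y)"
  proof -
   have "(m x has_real_derivative (\<Sum>k\<le>d. b k x * (real k * y ^ (k - 1)))) (at y)"
    unfolding m_def by (auto intro!: derivative_eq_intros sum.cong simp: algebra_simps)
   also have "(\<Sum>k\<le>d. b k x * (real k * y ^ (k - 1))) = (\<Sum>k<d. real (Suc k) * b (Suc k) x * y ^ k)"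
    using d by (cases d) (simp_all only: sum.atMost_Suc_shift lessThan_Suc_atMost, auto intro!: sum.cong simp: algebra_simps)
   finally show ?thesis .
  qed
  define l where "l = (\<Sum>k<d. real (Suc k) * b (Suc k) x * y ^ k)"
  \<comment> \<open>Minimality of the degree makes \<open>y\<close> a simple root. The polynomial
    then changes sign at \<open>y\<close>, and so the specialized polynomials have real roots close
    to \<open>y\<close>.\<close>
  have l: "l ~= 0"
  proof
   assume "l = 0"
   hence "good (%k z. real (Suc k) * b (Suc k) z) (d - 1)" using d bd bp unfolding good_def l_def
    by (cases d) (auto simp: lessThan_Suc_atMost intro!: polyfun.mult polyfun.const rat_imp_algebraic)
   thus False using least[of "d - 1"] d by auto
  qed
  have my: "m x y = 0" using bd by (simp add: m_def)
  have small: "EX h>0. h < \<epsilon> & m x (y - h) * m x (y + h) < 0" if "\<epsilon> > 0" for \<epsilon>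
  proof (cases "l > 0")
   case True
   obtain d1 where d1: "d1 > 0" "!!h. 0 < h ==> h < d1 ==> m x y < m x (y + h)"
    using DERIV_pos_inc_right[OF deriv] True by (auto simp: l_def)
   obtain d2 where d2: "d2 > 0" "!!h. 0 < h ==> h < d2 ==> m x (y - h) < m x y"
    using DERIV_pos_inc_left[OF deriv] True by (auto simp: l_def)
   show ?thesis using d1 d2 that my by (intro exI[of _ "min \<epsilon> (min d1 d2) / 2"]) (auto simp: mult_less_0_iff)
  next
   case False
   hence neg: "l < 0" using l by simp
   obtain d1 where d1: "d1 > 0" "!!h. 0 < h ==> h < d1 ==> m x (y + h) < m x y"
    using DERIV_neg_dec_right[OF deriv] neg by (auto simp: l_def)
   obtain d2 where d2: "d2 > 0" "!!h. 0 < h ==> h < d2 ==> m x y < m x (y - h)"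
    using DERIV_neg_dec_left[OF deriv] neg by (auto simp: l_def)
   show ?thesis using d1 d2 that my by (intro exI[of _ "min \<epsilon> (min d1 d2) / 2"]) (auto simp: mult_less_0_iff)
  qed
  have ptend: "(%s. f (X s)) \<longlonglongrightarrow> f x" if "f : polyfun I" for f using polyfun_tendsto[OF that, of X x] lim by blast
  have mtend: "(%s. m (X s) t) \<longlonglongrightarrow> m x t" for t unfolding m_def by (intro tendsto_intros ptend bp)
  have bdev: "\<forall>\<^sub>F s in sequentially. b d (X s) ~= 0" using tendsto_imp_eventually_ne[OF ptend[OF bp] bd(1)] .
  have "EX s r. n <= s & \<bar>r - y\<bar> <= 1 / real (Suc n) & b d (X s) ~= 0 & m (X s) r = 0" for n
  proof -
   obtain h where h: "h > 0" "h < 1 / real (Suc n)" "m x (y - h) * m x (y + h) < 0" using small[of "1 / real (Suc n)"] by auto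
   have "(%s. m (X s) (y - h) * m (X s) (y + h)) \<longlonglongrightarrow> m x (y - h) * m x (y + h)" by (intro tendsto_mult mtend)
   hence "\<forall>\<^sub>F s in sequentially. m (X s) (y - h) * m (X s) (y + h) < 0" using h(3) by (rule order_tendstoD(2))
   hence "\<forall>\<^sub>F s in sequentially. m (X s) (y - h) * m (X s) (y + h) < 0 & b d (X s) ~= 0 & n <= s"
    using bdev eventually_ge_at_top[of n] by (intro eventually_conj)
   then obtain s where s: "m (X s) (y - h) * m (X s) (y + h) < 0" "b d (X s) ~= 0" "n <= s"
    using eventually_happens'[OF sequentially_bot] by blast
   have "continuous_on {y-h..y+h} (m (X s))" unfolding m_def by (intro continuous_intros)
   then obtain r where "y - h <= r" "r <= y + h" "m (X s) r = 0" using sign_change_root[of "y - h" "y + h" "m (X s)"] s(1) h(1) by auto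
   thus ?thesis using s h by (intro exI[of _ s] exI[of _ r]) auto
  qed
  then obtain \<sigma> r where \<sigma>: "!!n. n <= \<sigma> n" and r: "!!n. \<bar>r n - y\<bar> <= 1 / real (Suc n)"
   and nz: "!!n. b d (X (\<sigma> n)) ~= 0" and root: "!!n. m (X (\<sigma> n)) (r n) = 0" by metis
  have fl: "filterlim \<sigma> sequentially sequentially" by (rule filterlim_at_top_mono[OF filterlim_ident]) (simp add: \<sigma>)
  have algr: "algebraic (r n)" for n
  proof (rule algebraic_poly_root[of d "%k. b k (X (\<sigma> n))"])
   show "algebraic (b k (X (\<sigma> n)))" for k by (rule polyfun_algebraic[OF bp]) (rule alg)
  qed (use root[of n] nz[of n] in "simp_all add: m_def")
  have "\<forall>\<^sub>F n in sequentially. (\<Sum>k<e. c k (X (\<sigma> n)) * r n ^ k) = 0"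
   if "ALL k. c k : polyfun I" "(\<Sum>k<e. c k x * y ^ k) = 0" for c e using that
  proof (induction e arbitrary: c)
   case (Suc e)
   show ?case
   proof (cases "c e x = 0")
    case True
    hence "\<forall>\<^sub>F n in sequentially. c e (X (\<sigma> n)) = 0" using eventually_compose_filterlim[OF rel fl] Suc.prems(1) by blast
    moreover have "\<forall>\<^sub>F n in sequentially. (\<Sum>k<e. c k (X (\<sigma> n)) * r n ^ k) = 0" using Suc True by simp
    ultimately show ?thesis by eventually_elim simp
   next
    case False
    hence "~ e < d" using least[of e c] Suc.prems by (auto simp: good_def lessThan_Suc_atMost)
    then obtain q where q: "e = d + q" by (metis le_iff_add not_less)
    \<comment> \<open>Remainder of one pseudo-division by the minimal relation. At the chosen root
      it is the original relation times the nonzero number \<open>b d\<close>.\<close>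
    let ?c = "%k z. b d z * c k z - (if q <= k then c e z * b (k - q) z else 0)"
    have pf: "?c k : polyfun I" for k
    proof -
     have "(%z. if q <= k then c e z * b (k - q) z else 0) : polyfun I"
      using Suc.prems(1) bp by (cases "q <= k") (auto intro: polyfun.intros)
     thus ?thesis using Suc.prems(1) bp by (intro polyfun_diff polyfun.mult) auto
    qed
    have id: "(\<Sum>k<e. ?c k z * t ^ k) = b d z * (\<Sum>k<Suc e. c k z * t ^ k) - c e z * t ^ q * m z t" for z t
     using pseudo_division[where b="%k. b k z" and d=d and q=q and c="%k. c k z" and t=t] unfolding q m_def lessThan_Suc_atMost by simp
    have "(\<Sum>k<e. ?c k x * y ^ k) = 0" unfolding id using Suc.prems(2) my by simp
    hence "\<forall>\<^sub>F n in sequentially. (\<Sum>k<e. ?c k (X (\<sigma> n)) * r n ^ k) = 0" using Suc.IH[of ?c] pf by blast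
    thus ?thesis unfolding id by eventually_elim (use root nz in auto)
   qed
  qed simp
  thus ?thesis using \<sigma> r algr by (intro exI[of _ \<sigma>] exI[of _ r]) auto
 qed
 then obtain \<sigma> r where near: "!!n. n <= \<sigma> n" "!!n. \<bar>r n - y\<bar> <= 1 / real (Suc n)" "!!n. algebraic (r n)"
  and rel': "!!c e. (ALL k. c k : polyfun I) ==> (\<Sum>k<e. c k x * y ^ k) = 0 ==>
   \<forall>\<^sub>F n in sequentially. (\<Sum>k<e. c k (X (\<sigma> n)) * r n ^ k) = 0" by blast
 have fl: "filterlim \<sigma> sequentially sequentially" by (rule filterlim_at_top_mono[OF filterlim_ident]) (simp add: near(1))
 have rlim: "r \<longlonglongrightarrow> y"
 proof (rule LIMSEQ_I)
  fix \<epsilon> :: real assume "\<epsilon> > 0"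
  then obtain N where N: "1 / real (Suc N) < \<epsilon>" using nat_approx_posE by metis
  have "norm (r n - y) < \<epsilon>" if "n >= N" for n
  proof -
   have "1 / real (Suc n) <= 1 / real (Suc N)" using that by (simp add: frac_le)
   thus ?thesis using near(2)[of n] N by simp
  qed
  thus "EX N. ALL n>=N. norm (r n - y) < \<epsilon>" by blast
 qed
 define X' where "X' n = (X (\<sigma> n))(j := r n)" for n
 show ?case
 proof (intro exI[of _ X'] conjI ballI allI impI)
  fix s i assume "i : insert j I"
  thus "algebraic (X' s i)" using alg near(3) by (auto simp: X'_def)
 next
  fix i assume i: "i : insert j I"
  show "(%s. X' s i) \<longlonglongrightarrow> x i"
  proof (cases "i = j")
   case True thus ?thesis using rlim by (simp add: X'_def y_def)
  next
   case False
   thus ?thesis using filterlim_compose[OF lim fl, of i] i by (simp add: X'_def)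
  qed
 next
  fix f assume f: "f : polyfun (insert j I)" "f x = 0"
  obtain n c where c: "ALL k. c k : polyfun I" "ALL x. f x = (\<Sum>k\<le>n. c k x * x j ^ k)" using polyfun_insert[OF f(1)] by blast
  have "c k (X' s) = c k (X (\<sigma> s))" for k s using c(1) insert.hyps(2) by (intro polyfun_cong[of "c k" I]) (auto simp: X'_def)
  hence "f (X' s) = (\<Sum>k<Suc n. c k (X (\<sigma> s)) * r s ^ k)" for s using c(2) by (simp add: X'_def lessThan_Suc_atMost)
  moreover have "\<forall>\<^sub>F s in sequentially. (\<Sum>k<Suc n. c k (X (\<sigma> s)) * r s ^ k) = 0"
   using rel'[of c "Suc n"] c f(2) by (simp add: y_def lessThan_Suc_atMost)
  ultimately show "\<forall>\<^sub>F s in sequentially. f (X' s) = 0" by simp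
 qed
qed

definition poly_cond :: "'i set => (('i => real) => bool) => bool" where
 "poly_cond I P \<longleftrightarrow> (EX A B. finite A & A <= polyfun I & finite B & B <= polyfun I &
   (ALL x. P x \<longleftrightarrow> (ALL f:A. f x = 0) & (ALL f:B. 0 < f x)))"

lemma poly_cond_eq: "f : polyfun I ==> g : polyfun I ==> poly_cond I (%x. f x = g x)"
 unfolding poly_cond_def by (rule exI[of _ "{%x. f x - g x}"], rule exI[of _ "{}"]) (auto intro: polyfun_diff)

lemma poly_cond_less: "f : polyfun I ==> g : polyfun I ==> poly_cond I (%x. f x < g x)"
 unfolding poly_cond_def by (rule exI[of _ "{}"], rule exI[of _ "{%x. g x - f x}"]) (auto intro: polyfun_diff)

lemma poly_cond_ball:
 assumes "finite S" "!!s. s : S ==> poly_cond I (P s)"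
 shows "poly_cond I (%x. ALL s:S. P s x)"
proof -
 let ?Q = "%s A B. finite A & A <= polyfun I & finite B & B <= polyfun I &
   (ALL x. P s x \<longleftrightarrow> (ALL f:A. f x = 0) & (ALL f:B. 0 < f x))"
 have "ALL s:S. EX AB. ?Q s (fst AB) (snd AB)" using assms(2) unfolding poly_cond_def by auto
 from bchoice[OF this] obtain F where "ALL s:S. ?Q s (fst (F s)) (snd (F s))" by (elim exE)
 thus ?thesis unfolding poly_cond_def using assms(1)
  by (rule_tac exI[of _ "\<Union>s\<in>S. fst (F s)"], rule_tac exI[of _ "\<Union>s\<in>S. snd (F s)"]) auto
qed

lemma poly_cond_conj:
 assumes "poly_cond I P" "poly_cond I Q"
 shows "poly_cond I (%x. P x & Q x)"
proof -
 have "poly_cond I (%x. if b = (0::nat) then P x else Q x)" for b using assms by (cases "b = 0") simp_all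
 hence "poly_cond I (%x. ALL b:{0::nat, 1}. if b = 0 then P x else Q x)" by (intro poly_cond_ball) auto
 thus ?thesis by simp
qed

text \<open>Equations persist along the specializing sequence by its exactness, strict inequalities
  by its convergence.\<close>

theorem algebraic_solution:
 fixes x :: "'i => real"
 assumes I: "finite I" and P: "poly_cond I P" "P x"
 shows "EX y. (ALL i:I. algebraic (y i)) & P y"
proof -
 obtain A B where AB: "finite A" "A <= polyfun I" "finite B" "B <= polyfun I"
  "!!x. P x \<longleftrightarrow> (ALL f:A. f x = 0) & (ALL f:B. 0 < f x)" using P(1) unfolding poly_cond_def by blast
 obtain X :: "nat => 'i => real" where X: "ALL s. ALL i:I. algebraic (X s i)" "ALL i:I. (%s. X s i) \<longlonglongrightarrow> x i"
  "ALL f:polyfun I. f x = 0 --> (\<forall>\<^sub>F s in sequentially. f (X s) = 0)"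
  using algebraic_specialization[OF I, of x] by blast
 have "\<forall>\<^sub>F s in sequentially. ALL f:A. f (X s) = 0" using AB P(2) X(3) by (intro eventually_ball_finite) auto
 moreover have "\<forall>\<^sub>F s in sequentially. ALL f:B. f (X s) > 0"
 proof (intro eventually_ball_finite ballI AB(3))
  fix f assume f: "f : B"
  hence "(%s. f (X s)) \<longlonglongrightarrow> f x" using AB(4) X(2) by (intro polyfun_tendsto[of f I]) auto
  thus "\<forall>\<^sub>F s in sequentially. 0 < f (X s)" using order_tendstoD(1) AB(5)[of x] P(2) f by blast
 qed
 ultimately have "\<forall>\<^sub>F s in sequentially. P (X s)" by eventually_elim (simp add: AB(5))
 then obtain s where "P (X s)" using eventually_happens'[OF sequentially_bot] by blast
 thus ?thesis using X(1) by blast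
qed

section \<open>Polytopes by homogenized vertices; faces of a hull against faces of a cone\<close>

section \<open>Polytopes and vector configurations\<close>

definition hat :: "('i => 'a) => 'i => 'a \<times> real" where
 "hat w i = (w i, 1)"

text \<open>Points in convex position. They carry indices because the vertices of different
  realizations have to be matched.\<close>

definition vconf :: "('i => 'a::real_vector) => 'i set => bool" where
 "vconf w I \<longleftrightarrow> finite I & (ALL i:I. {i} : cfaces (hat w) I)"

lemma cfaces_hat_empty: "{} : cfaces (hat w) I" by (rule cfacesI[of "%z. - snd z"]) (auto simp: hat_def intro!: linearI)

lemma vconf_inj: "vconf w I ==> inj_on w I"
proof (rule inj_onI)
 fix i j assume v: "vconf w I" and ij: "i : I" "j : I" "w i = w j"
 obtain f :: "_ => real" where f: "linear f" "{i} <= I" "!!k. k : {i} ==> f (hat w k) = 0"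
  "!!k. k : I - {i} ==> f (hat w k) < 0"
  by (rule cfacesE[of "{i}" "hat w" I]) (use v ij in "auto simp: vconf_def")
 have "f (hat w j) = 0" using f(3)[of i] ij by (simp add: hat_def)
 thus "i = j" using f(4)[of j] ij(2) by force
qed

lemma convex_hull_image:
 fixes w :: "'i => 'a::real_vector"
 assumes "finite I"
 shows "convex hull (w ` I) = {\<Sum>i\<in>I. a i *R w i | a. (ALL i:I. 0 <= a i) & sum a I = 1}" (is "_ = ?R")
proof (rule hull_unique)
 show "w ` I <= ?R"
 proof
  fix x assume "x : w ` I"
  then obtain j where j: "j : I" "x = w j" by blast
  have "(\<Sum>i\<in>I. (if i = j then 1 else 0) *R w i) = (\<Sum>i\<in>I. if i = j then w i else 0)" by (intro sum.cong) auto
  thus "x : ?R" using assms j by (intro CollectI exI[of _ "%i. if i = j then 1 else 0"]) auto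
 qed
 show "convex ?R"
 proof (rule convexI)
  fix x y and u v :: real
  assume "x : ?R" "y : ?R" and uv: "0 <= u" "0 <= v" "u + v = 1"
  then obtain a b where ab: "x = (\<Sum>i\<in>I. a i *R w i)" "ALL i:I. 0 <= a i" "sum a I = 1"
   "y = (\<Sum>i\<in>I. b i *R w i)" "ALL i:I. 0 <= b i" "sum b I = 1" by blast
  thus "u *R x + v *R y : ?R" using uv by (intro CollectI exI[of _ "%i. u * a i + v * b i"])
    (auto simp: scaleR_sum_right scaleR_add_left sum.distrib simp flip: sum_distrib_left)
 qed
 fix t assume t: "w ` I <= t" "convex t"
 thus "?R <= t" using assms by (auto intro!: convex_sum)
qed

lemma hat_sum:
 assumes "sum a I = 1"
 shows "(\<Sum>i\<in>I. a i *R hat w i) = (\<Sum>i\<in>I. a i *R w i, 1)" using assms by (simp add: hat_def sum_prod)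

lemma cfaces_face_of:
 assumes "finite I" "S : cfaces (hat w) I"
 shows "convex hull (w ` S) face_of convex hull (w ` I)"
  "i : I ==> w i : convex hull (w ` S) ==> i : S"
proof -
 obtain f :: "_ => real" where f: "linear f" "S <= I" "!!k. k : S ==> f (hat w k) = 0"
  "!!k. k : I - S ==> f (hat w k) < 0" "!!k. k : I ==> f (hat w k) <= 0" by (rule cfacesE'[OF assms(2)]) blast
 interpret linear f by fact
 have finS: "finite S" using f(2) assms(1) finite_subset by blast
 have val: "f (\<Sum>i\<in>J. a i *R w i, 1) = (\<Sum>i\<in>J. a i * f (hat w i))" if "sum a J = 1" for a J
  by (simp add: hat_sum[OF that, symmetric] sum scaleR)
 have on: "f (x, 1) = 0" if x: "x : convex hull (w ` S)" for x using x f(3) val unfolding convex_hull_image[OF finS] by auto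
 have le: "f (x, 1) <= 0" if x: "x : convex hull (w ` I)" for x
 proof -
  obtain a where a: "ALL i:I. 0 <= a i" "sum a I = 1" "x = (\<Sum>i\<in>I. a i *R w i)"
   using x unfolding convex_hull_image[OF assms(1)] by blast
  have "a i * f (hat w i) <= 0" if "i : I" for i using f(5)[OF that] a(1) that by (simp add: mult_nonneg_nonpos)
  thus ?thesis unfolding a(3) val[OF a(2)] by (rule sum_nonpos)
 qed
 have bk: "x : convex hull (w ` S)" if x: "x : convex hull (w ` I)" "f (x, 1) = 0" for x
 proof -
  obtain a where a: "ALL i:I. 0 <= a i" "sum a I = 1" "x = (\<Sum>i\<in>I. a i *R w i)"
   using x unfolding convex_hull_image[OF assms(1)] by blast
  have "a i * f (hat w i) <= 0" if "i : I" for i using f(5)[OF that] a(1) that by (simp add: mult_nonneg_nonpos)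
  moreover have "(\<Sum>i\<in>I. a i * f (hat w i)) = 0" using x(2) unfolding a(3) val[OF a(2)] .
  ultimately have z: "a i * f (hat w i) = 0" if "i : I" for i
   using sum_nonneg_eq_0_iff[of I "%i. - (a i * f (hat w i))"] assms(1) that by (simp add: sum_negf)
  have az: "a i = 0" if "i : I - S" for i using z[of i] f(4)[OF that] that by auto
  have "x = (\<Sum>i\<in>S. a i *R w i)" unfolding a(3) using assms(1) f(2) az by (intro sum.mono_neutral_right) auto
  moreover have "sum a S = 1" using a(2) sum.mono_neutral_right[OF assms(1) f(2), of a] az by simp
  ultimately show ?thesis unfolding convex_hull_image[OF finS] using a(1) f(2) by blast
 qed
 show "convex hull (w ` S) face_of convex hull (w ` I)" unfolding face_of_def
 proof (intro conjI ballI impI)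
  show "convex hull (w ` S) <= convex hull (w ` I)" using f(2) by (intro hull_mono) auto
 next
  fix a b x assume h: "a : convex hull (w ` I)" "b : convex hull (w ` I)"
   "x : convex hull (w ` S)" "x : open_segment a b"
  then obtain u where u: "0 < u" "u < 1" "x = (1 - u) *R a + u *R b" by (auto simp: in_segment)
  have "(x, 1) = (1 - u) *R (a, 1) + u *R (b, 1::real)" by (simp add: u(3))
  hence "f (x, 1) = (1 - u) * f (a, 1) + u * f (b, 1)" by (simp only: add scaleR) simp
  hence "(1 - u) * f (a, 1) + u * f (b, 1) = 0" using on[OF h(3)] by simp
  moreover have "(1 - u) * f (a, 1) <= 0" "u * f (b, 1) <= 0" using le h(1,2) u by (auto simp: mult_nonneg_nonpos)
  ultimately have "(1 - u) * f (a, 1) = 0" "u * f (b, 1) = 0" by linarith+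
  hence "f (a, 1) = 0" "f (b, 1) = 0" using u by auto
  thus "a : convex hull (w ` S)" "b : convex hull (w ` S)" using bk h by auto
 qed simp
 show "i : S" if "i : I" "w i : convex hull (w ` S)" using on[OF that(2)] f(4)[of i] that(1) by (force simp: hat_def)
qed

text \<open>The point is written as a mixture of \<open>w j\<close> with the weighted mean of the
  other points. It then lies inside a segment that ends at \<open>w j\<close>, and a face contains
  the ends of such a segment.\<close>

lemma face_of_support:
 fixes w :: "'i => 'a::real_vector"
 assumes fin: "finite I" and F: "F face_of convex hull (w ` I)"
  and a: "ALL i:I. 0 <= a i" "sum a I = 1" "(\<Sum>i\<in>I. a i *R w i) : F" and j: "j : I" "a j > 0"
 shows "w j : F"
proof -
 define x where "x = (\<Sum>i\<in>I. a i *R w i)"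
 have ex: "x = a j *R w j + (\<Sum>i\<in>I-{j}. a i *R w i)" and es: "1 = a j + sum a (I-{j})"
  using fin j a(2) by (simp_all add: x_def sum.remove)
 have wj: "w j : convex hull (w ` I)" using j by (simp add: hull_inc)
 show ?thesis
 proof (cases "a j = 1")
  case True
  hence "sum a (I - {j}) = 0" using es by simp
  hence "ALL i:I-{j}. a i = 0" using sum_nonneg_eq_0_iff[of "I-{j}" a] fin a(1) by auto
  hence "(\<Sum>i\<in>I-{j}. a i *R w i) = 0" by (intro sum.neutral) auto
  hence "x = w j" using ex True by simp
  thus ?thesis using a(3) by (simp add: x_def)
 next
  case False
  have "0 <= sum a (I - {j})" using a(1) by (intro sum_nonneg) auto
  hence lt: "a j < 1" using es False by simp
  define y where "y = (\<Sum>i\<in>I-{j}. (a i / (1 - a j)) *R w i)"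
  have "(\<Sum>i\<in>I-{j}. a i / (1 - a j)) = 1" using es lt by (simp flip: sum_divide_distrib)
  hence "y : convex hull (w ` (I - {j}))" unfolding y_def convex_hull_image[OF finite_Diff[OF fin]] using a(1) lt by auto
  hence y: "y : convex hull (w ` I)" using hull_mono[of "w ` (I-{j})" "w ` I" convex] by blast
  have "(1 - a j) *R y = (\<Sum>i\<in>I-{j}. a i *R w i)" using lt by (simp add: y_def scaleR_sum_right)
  hence xy: "x = (1 - a j) *R y + a j *R w j" using ex by (simp add: add.commute)
  show ?thesis
  proof (cases "y = w j")
   case True
   hence "x = w j" using xy by (simp flip: scaleR_add_left)
   thus ?thesis using a(3) by (simp add: x_def)
  next
   case False
   hence "x : open_segment y (w j)" using xy lt j by (auto simp: in_segment)
   thus ?thesis using face_ofD[OF F, of x y "w j"] a(3) y wj by (simp add: x_def)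
  qed
 qed
qed

text \<open>\<open>face_of\<close> is intrinsic, whereas \<open>cfaces\<close> asks for a supporting
  functional. The barycentre of \<open>S\<close> lies in \<open>F\<close> and, by the certificate,
  is a combination with positive weights of all points of the least exposed face around
  \<open>S\<close>. These points therefore lie in \<open>F\<close>, and the exposed face is
  \<open>S\<close> itself.\<close>

lemma face_of_cfaces:
 fixes w :: "'i => 'a::real_vector"
 assumes fin: "finite I" and F: "F face_of convex hull (w ` I)"
 shows "{i:I. w i : F} : cfaces (hat w) I" "F = convex hull (w ` {i:I. w i : F})"
proof -
 define S where "S = {i:I. w i : F}"
 have finS: "finite S" "S <= I" using fin by (auto simp: S_def)
 show "F = convex hull (w ` {i:I. w i : F})" unfolding S_def[symmetric]
 proof
  have "convex F" using F by (rule face_of_imp_convex)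
  thus "convex hull (w ` S) <= F" by (intro hull_minimal) (auto simp: S_def)
  show "F <= convex hull (w ` S)"
  proof
   fix x assume x: "x : F"
   then obtain a where a: "ALL i:I. 0 <= a i" "sum a I = 1" "x = (\<Sum>i\<in>I. a i *R w i)"
    using face_of_imp_subset[OF F] unfolding convex_hull_image[OF fin] by blast
   have az: "a i = 0" if "i : I - S" for i
   proof (rule ccontr)
    assume "a i ~= 0"
    hence "a i > 0" using a(1) that by (auto simp: order_less_le)
    thus False using face_of_support[OF fin F a(1,2)] x a(3) that by (auto simp: S_def)
   qed
   have "x = (\<Sum>i\<in>S. a i *R w i)" unfolding a(3) using fin finS az by (intro sum.mono_neutral_right) auto
   moreover have "sum a S = 1" using a(2) sum.mono_neutral_right[OF fin finS(2), of a] az by simp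
   ultimately show "x : convex hull (w ` S)" unfolding convex_hull_image[OF finS(1)] using a(1) finS(2) by blast
  qed
 qed
 show "{i:I. w i : F} : cfaces (hat w) I" unfolding S_def[symmetric]
 proof (cases "S = {}")
  case True
  thus "S : cfaces (hat w) I" using cfaces_hat_empty by simp
 next
  case False
  obtain T where T: "T : cfaces (hat w) I" "S <= T" "!!U. U : cfaces (hat w) I ==> S <= U ==> T <= U"
   by (rule cfaces_least[OF fin finS(2), where v="hat w"]) blast
  obtain \<mu> where \<mu>: "!!i. i : T ==> 0 < \<mu> i" "(\<Sum>i\<in>S. hat w i) = (\<Sum>i\<in>T. \<mu> i *R hat w i)"
   by (rule cfaces_certificate[OF fin finS(2) T(1,2)]) (use T(3) in blast)+
  have TI: "T <= I" using T(1) by (rule cfaces_subset)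
  have sums: "(\<Sum>i\<in>S. w i) = (\<Sum>i\<in>T. \<mu> i *R w i)" "real (card S) = sum \<mu> T"
   using \<mu>(2) by (simp_all add: hat_def sum_prod)
  define n where "n = real (card S)"
  have n: "n > 0" using False finS(1) by (simp add: n_def card_gt_0_iff)
  have "(\<Sum>i\<in>S. (1 / n) *R w i) : convex hull (w ` S)"
   unfolding convex_hull_image[OF finS(1)] using n by (auto simp: n_def intro!: exI[of _ "%_. 1 / n"])
  also have "convex hull (w ` S) <= F" using face_of_imp_convex[OF F] by (intro hull_minimal) (auto simp: S_def)
  also have "(\<Sum>i\<in>S. (1 / n) *R w i) = (1/n) *R (\<Sum>i\<in>S. w i)" by (simp add: scaleR_sum_right)
  also have "\<dots> = (\<Sum>i\<in>T. (\<mu> i / n) *R w i)" unfolding sums(1) by (simp add: scaleR_sum_right)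
  also have "\<dots> = (\<Sum>i\<in>I. (if i : T then \<mu> i / n else 0) *R w i)" using fin TI by (intro sum.mono_neutral_cong_left) auto
  finally have inF: "(\<Sum>i\<in>I. (if i : T then \<mu> i / n else 0) *R w i) : F" .
  have "(\<Sum>i\<in>I. if i : T then \<mu> i / n else 0) = (\<Sum>i\<in>T. \<mu> i / n)" using fin TI by (intro sum.mono_neutral_cong_right) auto
  also have "\<dots> = 1" using sums(2) n by (simp add: n_def flip: sum_divide_distrib)
  finally have one: "(\<Sum>i\<in>I. if i : T then \<mu> i / n else 0) = 1" .
  have nn: "ALL i:I. 0 <= (if i : T then \<mu> i / n else 0)" using \<mu>(1) n by (auto simp: less_imp_le)
  have "T <= S"
  proof
   fix j assume j: "j : T"
   thus "j : S" using face_of_support[OF fin F nn one inF, of j] \<mu>(1)[OF j] n TI by (auto simp: S_def)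
  qed
  thus "S : cfaces (hat w) I" using T by auto
 qed
qed

text \<open>Points that cannot be exposed are discarded one at a time: by Gordan such a point lies
  in the hull of the others.\<close>

lemma convex_hull_extreme_points:
 assumes "finite A"
 shows "EX E<=A. convex hull E = convex hull (A :: 'a::real_vector set) & vconf (%x. x) E" using assms
proof (induction "card A" arbitrary: A rule: less_induct)
 case less
 show ?case
 proof (cases "vconf (%x. x) A")
  case True thus ?thesis by blast
 next
  case False
  then obtain v where v: "v : A" "{v} ~: cfaces (hat (%x. x)) A" using less.prems by (auto simp: vconf_def)
  have fin: "finite (A - {v})" using less.prems by simp
  have "v : convex hull (A - {v})"
  proof (rule ccontr)
   assume nv: "v ~: convex hull (A - {v})"
   consider (rel) a where "ALL i:A-{v}. 0 <= a i" "sum a (A-{v}) = 1" "(\<Sum>i\<in>A-{v}. a i *R (i - v)) = 0"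
    | (sep) f :: "'a => real" where "linear f" "ALL i:A-{v}. f (i - v) < 0"
    using gordan[OF fin, of "%i. i - v"] by blast
   thus False
   proof cases
    case (rel a)
    hence "v = (\<Sum>i\<in>A-{v}. a i *R i)" by (simp add: scaleR_diff_right sum_subtractf flip: scaleR_left.sum)
    hence "v : convex hull ((%x. x) ` (A - {v}))" unfolding convex_hull_image[OF fin] using rel(1,2) by blast
    thus False using nv by simp
   next
    case (sep f)
    interpret linear f by fact
    have "{v} : cfaces (hat (%x. x)) A" by (rule cfacesI[of "%z. f (fst z) - snd z * f v"])
      (use v sep(2) in "auto simp: hat_def diff add scaleR algebra_simps intro!: linearI")
    thus False using v(2) by simp
   qed
  qed
  hence eq: "convex hull (A - {v}) = convex hull A" using hull_redundant[of v convex "A - {v}"] v(1) by (simp add: insert_absorb)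
  have "card (A - {v}) < card A" using v(1) less.prems by (intro card_Diff1_less)
  then obtain E where "E <= A - {v}" "convex hull E = convex hull (A - {v})" "vconf (%x. x) E"
   using less.hyps[of "A - {v}"] fin by blast
  thus ?thesis using eq by (intro exI[of _ E]) auto
 qed
qed

lemma polytope_vconf:
 assumes "polytope P"
 obtains E where "vconf (%x. x) E" "P = convex hull E" using assms convex_hull_extreme_points unfolding polytope_def by metis

lemma vconf_extreme_points:
 assumes "vconf w I"
 shows "x extreme_point_of convex hull (w ` I) \<longleftrightarrow> x : w ` I"
proof -
 have fin: "finite I" using assms by (simp add: vconf_def)
 show ?thesis
 proof
  assume "x extreme_point_of convex hull (w ` I)"
  hence x: "{x} face_of convex hull (w ` I)" by (simp add: face_of_singleton)
  have "{i:I. w i : {x}} ~= {}"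
  proof
   assume "{i:I. w i : {x}} = {}"
   hence "{x} = convex hull (w ` {})" using face_of_cfaces(2)[OF fin x] by simp
   thus False by simp
  qed
  thus "x : w ` I" by auto
 next
  assume "x : w ` I"
  then obtain i where i: "i : I" "x = w i" by blast
  hence "convex hull (w ` {i}) face_of convex hull (w ` I)" using assms by (intro cfaces_face_of(1)[OF fin]) (simp add: vconf_def)
  thus "x extreme_point_of convex hull (w ` I)" using i by (simp add: face_of_singleton)
 qed
qed

lemma vconf_hull_subset_iff:
 assumes "finite I" "S : cfaces (hat w) I" "T : cfaces (hat w) I"
 shows "convex hull (w ` S) <= convex hull (w ` T) \<longleftrightarrow> S <= T"
proof
 assume h: "convex hull (w ` S) <= convex hull (w ` T)"
 show "S <= T"
 proof
  fix i assume i: "i : S"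
  hence "w i : convex hull (w ` S)" by (simp add: hull_inc)
  thus "i : T" using h i cfaces_subset[OF assms(2)] by (intro cfaces_face_of(2)[OF assms(1,3)]) auto
 qed
qed (intro hull_mono image_mono)

text \<open>Differences from a base point, placed at height 0, span one dimension less than the
  homogenized points; the base point at height 1 supplies the missing one.\<close>

lemma pdim_hull:
 fixes w :: "'i => 'a::real_vector"
 assumes "finite I"
 shows "pdim (convex hull (w ` I)) = int (dim (hat w ` I)) - 1"
proof (cases "I = {}")
 case True
 thus ?thesis by (simp add: pdim_def real_vector.dim_eq_card_independent[OF independent_empty])
next
 case False
 then obtain i0 where i0: "i0 : I" by blast
 let ?D = "{x - y |x y. x : convex hull (w ` I) & y : convex hull (w ` I)}"
 let ?T = "(%i. w i - w i0) ` I"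
 have sp: "?D <= span ?T"
 proof
  fix z assume "z : ?D"
  then obtain x y where z: "z = x - y" "x : convex hull (w ` I)" "y : convex hull (w ` I)" by blast
  have *: "x - w i0 : span ?T" if x: "x : convex hull (w ` I)" for x
  proof -
   obtain a where a: "sum a I = 1" "x = (\<Sum>i\<in>I. a i *R w i)" using x unfolding convex_hull_image[OF assms] by blast
   hence "x - w i0 = (\<Sum>i\<in>I. a i *R (w i - w i0))" by (simp add: scaleR_diff_right sum_subtractf flip: scaleR_left.sum)
   thus ?thesis by (simp only:) (intro span_sum span_scale span_base imageI)
  qed
  show "z : span ?T" using span_diff[OF *[OF z(2)] *[OF z(3)]] z(1) by simp
 qed
 moreover have "?T <= ?D" using i0 by (auto intro!: exI hull_inc)
 ultimately have "span ?D = span ?T" using span_mono[of ?T ?D] span_minimal[OF sp] by (auto simp: subspace_span)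
 hence D: "dim ?D = dim ?T" by (rule span_eq_dim)
 obtain B where B: "B <= ?T" "independent B" "?T <= span B" "card B = dim ?T" by (rule basis_exists) blast
 let ?B = "insert (hat w i0) ((%b. (b, 0::real)) ` B)"
 have lin0: "linear (%b::'a. (b, 0::real))" by (rule linearI) auto
 have ind0: "independent ((%b. (b, 0::real)) ` B)" using B(2) by (intro linear_independent_injective_image[OF lin0]) (auto simp: inj_on_def)
 have s0: "span ((%b. (b, 0::real)) ` B) = (%b. (b, 0)) ` span B" by (rule linear_span_image[OF lin0])
 have "hat w i0 ~: span ((%b. (b, 0::real)) ` B)" unfolding s0 by (auto simp: hat_def)
 hence indB: "independent ?B" using ind0 by (rule independent_insertI)
 have finB: "finite B" using B(1) assms finite_subset by blast
 have "card ?B = Suc (card B)"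
 proof -
  have "hat w i0 ~: (%b. (b, 0::real)) ` B" by (auto simp: hat_def)
  moreover have "card ((%b. (b, 0::real)) ` B) = card B" by (intro card_image) (auto simp: inj_on_def)
  ultimately show ?thesis using finB by simp
 qed
 moreover have "span ?B = span (hat w ` I)"
 proof -
  have "?B <= span (hat w ` I)"
  proof -
   have "(w i - w i0, 0) : span (hat w ` I)" if "i : I" for i
    using span_diff[of "hat w i" "hat w ` I" "hat w i0"] that i0 by (simp add: hat_def span_base)
   thus ?thesis using B(1) i0 by (auto intro: span_base)
  qed
  moreover have "hat w ` I <= span ?B"
  proof (rule image_subsetI)
   fix i assume i: "i : I"
   have "(w i - w i0, 0::real) : span ((%b. (b, 0::real)) ` B)" unfolding s0 using B(3) i by auto
   hence "(w i - w i0, 0::real) : span ?B" using span_mono[OF subset_insertI] by blast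
   moreover have "hat w i0 : span ?B" by (simp add: span_base)
   ultimately have "(w i - w i0, 0) + hat w i0 : span ?B" by (rule span_add)
   thus "hat w i : span ?B" by (simp add: hat_def)
  qed
  ultimately show ?thesis using span_eq by blast
 qed
 hence "dim (hat w ` I) = card ?B" using real_vector.dim_eq_card[OF _ indB] by auto
 ultimately have "dim (hat w ` I) = Suc (dim ?T)" using B(4) by simp
 moreover have "convex hull (w ` I) ~= {}" using i0 by auto
 ultimately show ?thesis using D by (simp add: pdim_def)
qed

section \<open>Coordinates, and algebraic realizations of a given face lattice\<close>

section \<open>Coordinates and algebraic realizations\<close>

abbreviation coord :: "pt => nat => real" where
 "coord \<equiv> poly_mapping.lookup"

definition basis_pt :: "nat => pt" where
 "basis_pt k = Poly_Mapping.single k 1"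

lemma coord_scaleR [simp]: "coord (r *R x) k = r * coord x k"
proof -
 have "{i. r * coord x i ~= 0} <= {i. coord x i ~= 0}" by auto
 hence "finite {i. r * coord x i ~= 0}" by (rule finite_subset) simp
 thus ?thesis by (simp add: scaleR_poly_mapping_def)
qed

lemma linear_coord: "linear (%x. coord x k)" by (rule linearI) (simp_all add: lookup_add)

lemma coord_basis_pt [simp]: "coord (basis_pt i) k = (if i = k then 1 else 0)" by (simp add: basis_pt_def lookup_single)

lemma coord_comb: "coord (\<Sum>k<N. c k *R basis_pt k) j = (if j < N then c j else 0)"
 by (simp add: lookup_sum if_distrib[of "(*) _"] cong: if_cong)

lemma Rpow_comb: "(\<Sum>k<N. c k *R basis_pt k) : Rpow N" by (simp add: Rpow_def coord_comb)

lemma Rpow_expansion: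
 assumes "x : Rpow N"
 shows "x = (\<Sum>k<N. coord x k *R basis_pt k)" using assms by (intro poly_mapping_eqI) (simp add: coord_comb Rpow_def not_less)

lemma subspace_Rpow: "subspace (Rpow N)" by (rule subspaceI) (auto simp: Rpow_def lookup_add)

lemma Rpow_mono: "N <= N' ==> Rpow N <= Rpow N'" by (auto simp: Rpow_def)

lemma basis_pt_in_Rpow: "basis_pt k : Rpow N \<longleftrightarrow> k < N" by (auto simp: Rpow_def not_le)

lemma finite_subset_Rpow:
 assumes "finite A"
 shows "EX N. A <= Rpow N" using assms
proof (induction A rule: finite_induct)
 case (insert x A)
 then obtain N where N: "A <= Rpow N" by blast
 have "finite (Poly_Mapping.keys x)" by simp
 then obtain M where M: "ALL k:Poly_Mapping.keys x. k < M" unfolding finite_nat_set_iff_bounded by blast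
 have "coord x i = 0" if "i >= M" for i using M that by (metis in_keys_iff not_le)
 hence "x : Rpow M" by (simp add: Rpow_def)
 hence "insert x A <= Rpow (max N M)" using N Rpow_mono[of N "max N M"] Rpow_mono[of M "max N M"] by auto
 thus ?case by blast
qed auto

lemma convex_hull_Rpow: "A <= Rpow N ==> convex hull A <= Rpow N"
 by (intro hull_minimal subspace_imp_convex subspace_Rpow)

lemma linear_expansion:
 fixes f :: "pt \<times> real => 'b::real_vector"
 assumes "linear f" "x : Rpow N"
 shows "f (x, t) = (\<Sum>k<N. coord x k *R f (basis_pt k, 0)) + t *R f (0, 1)"
proof -
 interpret linear f by fact
 have "(x, t) = (\<Sum>k<N. coord x k *R (basis_pt k, 0)) + t *R (0, 1)" using Rpow_expansion[OF assms(2)] by (simp add: sum_prod)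
 hence "f (x, t) = f ((\<Sum>k<N. coord x k *R (basis_pt k, 0)) + t *R (0, 1))" by (rule arg_cong)
 thus ?thesis by (simp only: add sum scaleR)
qed

text \<open>The unknowns of a realization: coordinates of vertices, coefficients of supporting
  functionals (index \<open>N\<close> is the constant term) and weights of minimality
  certificates.\<close>

datatype 'i unknown = Crd 'i nat | Fun "'i set" nat | Cert "'i set" 'i

text \<open>Supporting functionals only ensure that no face is lost. That no face is gained is
  ensured by the certificates: a functional that exposes \<open>S\<close> in the new configuration
  must vanish on the least old face around \<open>S\<close>, so \<open>S\<close> is that
  face.\<close>

theorem algebraic_vconf:
 fixes w :: "'i => pt"
 assumes w: "vconf w I" "w ` I <= Rpow N"
 obtains w' where "vconf w' I" "cfaces (hat w') I = cfaces (hat w) I" "w' ` I <= Ralg_pow N"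
proof -
 have fin: "finite I" using w by (simp add: vconf_def)
 let ?C = "cfaces (hat w) I"
 have "ALL S:?C. EX f::pt \<times> real => real. linear f & (ALL i:I. f (hat w i) <= 0 & (f (hat w i) = 0 \<longleftrightarrow> i : S))"
  by (auto simp: cfaces_def)
 then obtain f :: "'i set => pt \<times> real => real"
  where f: "!!S. S : ?C ==> linear (f S)"
   "!!S i. S : ?C ==> i : I ==> f S (hat w i) <= 0 & (f S (hat w i) = 0 \<longleftrightarrow> i : S)"
  by (elim bchoice[elim_format] exE) blast
 let ?Q = "%S T \<mu>. T : ?C & S <= T & (ALL i:T. 0 < \<mu> i) & (\<Sum>i\<in>S. hat w i) = (\<Sum>i\<in>T. \<mu> i *R hat w i)"
 have "ALL S:Pow I. EX p. ?Q S (fst p) (snd p)"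
 proof
  fix S assume "S : Pow I"
  hence S: "S <= I" by blast
  obtain T where T: "T : ?C" "S <= T" "!!U. U : ?C ==> S <= U ==> T <= U"
   by (rule cfaces_least[OF fin S, where v="hat w"]) blast
  obtain \<mu> where "!!i. i : T ==> 0 < \<mu> i" "(\<Sum>i\<in>S. hat w i) = (\<Sum>i\<in>T. \<mu> i *R hat w i)"
   by (rule cfaces_certificate[OF fin S T(1,2)]) (use T(3) in blast)+
  thus "EX p. ?Q S (fst p) (snd p)" using T by (intro exI[of _ "(T, \<mu>)"]) auto
 qed
 from bchoice[OF this] obtain p where p: "ALL S:Pow I. ?Q S (fst (p S)) (snd (p S))" by (elim exE)
 define cl where "cl S = fst (p S)" for S
 define \<mu> where "\<mu> S = snd (p S)" for S
 have cl: "cl S : ?C" "S <= cl S" and \<mu>: "!!i. i : cl S ==> 0 < \<mu> S i"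
  and \<mu>sum: "(\<Sum>i\<in>S. w i) = (\<Sum>i\<in>cl S. \<mu> S i *R w i)" "real (card S) = (\<Sum>i\<in>cl S. \<mu> S i)" if "S : Pow I" for S
  using bspec[OF p that] by (simp_all add: cl_def \<mu>_def hat_def sum_prod)
 define U where "U = (%(i, k). Crd i k) ` (I \<times> {..<N}) \<union> (%(S, k). Fun S k) ` (Pow I \<times> {..N}) \<union>
  (%(S, i). Cert S i) ` (Pow I \<times> I)"
 define x where "x z = (case z of Crd i k => coord (w i) k | Fun S k => if k < N then f S (basis_pt k, 0) else f S (0, 1)
  | Cert S i => \<mu> S i)" for z
 define val where "val S i y = (\<Sum>k<N. y (Crd i k) * y (Fun S k)) + y (Fun S N)" for S i and y :: "'i unknown => real"
 let ?P = "%y. (ALL S:?C. (ALL i:S. val S i y = 0) & (ALL i:I - S. val S i y < 0)) &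
  (ALL S:Pow I. (ALL i:cl S. 0 < y (Cert S i)) & real (card S) = (\<Sum>i\<in>cl S. y (Cert S i)) &
   (ALL k:{..<N}. (\<Sum>i\<in>S. y (Crd i k)) = (\<Sum>i\<in>cl S. y (Cert S i) * y (Crd i k))))"
 have subs: "S <= I" if "S : ?C" for S using that by (rule cfaces_subset)
 have finC: "finite ?C" by (rule finite_subset[of _ "Pow I"]) (use fin subs in auto)
 have finS: "finite S" if "S <= I" for S using that fin by (rule finite_subset)
 have clI: "cl S <= I" if "S : Pow I" for S using subs[OF cl(1)[OF that]] .
 have cli: "i : I" if "S <= I" "i : cl S" for S i using that clI by blast
 have SI: "i : I" if "S : ?C" "i : S" for S i using that subs by blast
 have inU: "i : I ==> k < N ==> Crd i k : U" "S <= I ==> k <= N ==> Fun S k : U" "S <= I ==> i : I ==> Cert S i : U" for S i k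
  by (auto simp: U_def)
 have var: "(%y. y (Crd i k)) : polyfun U" if "i : I" "k < N" for i k using that by (intro polyfun.var inU)
 have cert: "(%y. y (Cert S i)) : polyfun U" if "S : Pow I" "i : cl S" for S i
  using that clI[OF that(1)] by (intro polyfun.var inU) auto
 have valU: "val S i : polyfun U" if "S : ?C" "i : I" for S i
  unfolding val_def using that subs by (intro polyfun.add polyfun_sum polyfun.mult var polyfun.var inU) auto
 have const: "(%y. c) : polyfun U" if "algebraic c" for c using that by (rule polyfun.const)
 have PU: "poly_cond U ?P" by (intro poly_cond_conj poly_cond_ball poly_cond_eq poly_cond_less valU var cert const polyfun_sum polyfun.mult finC)
   (use fin finS subs clI SI cli in auto)
 have "val S i x = f S (hat w i)" if "S : ?C" "i : I" for S i using linear_expansion[OF f(1)[OF that(1)], of "w i" N 1] w(2) that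
  by (simp add: val_def x_def hat_def image_subset_iff)
 moreover have "(\<Sum>i\<in>S. coord (w i) k) = (\<Sum>i\<in>cl S. \<mu> S i * coord (w i) k)" if "S : Pow I" for S k
  using arg_cong[OF \<mu>sum(1)[OF that], of "%z. coord z k"] by (simp add: lookup_sum)
 moreover have "f S (hat w i) < 0" if "S : ?C" "i : I" "i ~: S" for S i
  using f(2)[OF that(1,2)] that(3) by (simp add: less_le)
 ultimately have Px: "?P x" using f(2) \<mu> \<mu>sum(2) SI by (auto simp: x_def)
 have finU: "finite U" using fin by (simp add: U_def)
 from algebraic_solution[OF finU PU, OF Px] obtain y where "(ALL u:U. algebraic (y u)) & ?P y" by (elim exE)
 note alg = conjunct1[OF this] and y = conjunct2[OF this]
 define w' where "w' i = (\<Sum>k<N. y (Crd i k) *R basis_pt k)" for i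
 have cw: "coord (w' i) k = (if k < N then y (Crd i k) else 0)" for i k by (simp only: w'_def coord_comb)
 define P where "P S z = (\<Sum>k<N. coord (fst z) k * y (Fun S k)) + snd z * y (Fun S N)" for S z
 have linP: "linear (P S)" for S unfolding P_def by (rule linearI) (simp_all add: lookup_add algebra_simps sum.distrib sum_distrib_left)
 have valP: "P S (hat w' i) = val S i y" for S i by (simp add: P_def hat_def w'_def coord_comb val_def)
 have sub1: "?C <= cfaces (hat w') I"
 proof
  fix S assume "S : ?C"
  thus "S : cfaces (hat w') I" by (intro cfacesI[OF linP[of S]]) (use subs y in "auto simp: valP")
 qed
 have sub2: "cfaces (hat w') I <= ?C"
 proof
  fix S assume S: "S : cfaces (hat w') I"
  obtain g :: "_ => real" where g: "linear g" "S <= I" "!!i. i : S ==> g (hat w' i) = 0"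
   "!!i. i : I - S ==> g (hat w' i) < 0" "!!i. i : I ==> g (hat w' i) <= 0" by (rule cfacesE'[OF S]) blast
  interpret g: linear g by fact
  have S: "S : Pow I" using g(2) by blast
  hence fincl: "finite (cl S)" using clI finS by blast
  have "(ALL i:cl S. 0 < y (Cert S i)) & real (card S) = (\<Sum>i\<in>cl S. y (Cert S i)) &
   (ALL k:{..<N}. (\<Sum>i\<in>S. y (Crd i k)) = (\<Sum>i\<in>cl S. y (Cert S i) * y (Crd i k)))" using bspec[OF conjunct2[OF y] S] .
  note c = conjunct1[OF this] conjunct1[OF conjunct2[OF this]] conjunct2[OF conjunct2[OF this]]
  have "(\<Sum>i\<in>S. hat w' i) = (\<Sum>i\<in>cl S. y (Cert S i) *R hat w' i)"
  proof (rule prod_eqI)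
   show "fst (\<Sum>i\<in>S. hat w' i) = fst (\<Sum>i\<in>cl S. y (Cert S i) *R hat w' i)"
   proof (rule poly_mapping_eqI)
    show "coord (fst (\<Sum>i\<in>S. hat w' i)) k = coord (fst (\<Sum>i\<in>cl S. y (Cert S i) *R hat w' i)) k" for k
     using c(3) by (cases "k < N") (simp_all add: hat_def sum_prod lookup_sum cw)
   qed
   show "snd (\<Sum>i\<in>S. hat w' i) = snd (\<Sum>i\<in>cl S. y (Cert S i) *R hat w' i)" using c(2) by (simp add: hat_def sum_prod)
  qed
  hence "g (\<Sum>i\<in>S. hat w' i) = g (\<Sum>i\<in>cl S. y (Cert S i) *R hat w' i)" by simp
  hence s0: "(\<Sum>i\<in>cl S. y (Cert S i) * g (hat w' i)) = 0" using g(3) by (simp add: g.sum g.scaleR)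
  have nn: "0 <= - (y (Cert S i) * g (hat w' i))" if "i : cl S" for i
   using c(1) g(5)[of i] clI[OF S] that by (auto simp: mult_le_0_iff)
  have "y (Cert S i) * g (hat w' i) = 0" if "i : cl S" for i using sum_nonneg_eq_0_iff[OF fincl nn] s0 that by (simp add: sum_negf)
  hence "cl S <= S" using c(1) g(4) clI[OF S] by force
  thus "S : ?C" using cl[OF S] by (metis subset_antisym)
 qed
 have eq: "cfaces (hat w') I = ?C" using sub1 sub2 by blast
 show ?thesis
 proof (rule that)
  show "cfaces (hat w') I = ?C" by (rule eq)
  show "vconf w' I" using w(1) eq by (simp add: vconf_def)
  have "algebraic_pt (w' i)" if "i : I" for i using alg that by (auto simp: algebraic_pt_def w'_def coord_comb U_def)
  thus "w' ` I <= Ralg_pow N" by (auto simp: Ralg_pow_def w'_def Rpow_comb)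
 qed
qed

section \<open>Comparing realizations with a common labelling of faces\<close>

section \<open>Labelled face lattices\<close>

lemma cfaces_reindex:
 assumes "inj_on b I" "S <= I"
 shows "b ` S : cfaces v (b ` I) \<longleftrightarrow> S : cfaces (%i. v (b i)) I"
proof -
 have "b i : b ` S \<longleftrightarrow> i : S" if "i : I" for i using assms that by (auto simp: inj_on_def)
 thus ?thesis using assms(2) by (auto simp: cfaces_def)
qed

lemma cfaces_face:
 assumes "finite I" "T : cfaces v I"
 shows "cfaces v T = {S : cfaces v I. S <= T}"
proof
 show "cfaces v T <= {S : cfaces v I. S <= T}" using cfaces_trans[OF assms] cfaces_subset by blast
 show "{S : cfaces v I. S <= T} <= cfaces v T"
 proof safe
  fix S assume "S : cfaces v I" "S <= T"
  thus "S : cfaces v T" using cfaces_restrict[of S v I T] cfaces_subset[OF assms(2)] by (simp add: Int_absorb2)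
 qed
qed

lemma vconf_face:
 assumes "vconf w I" "T : cfaces (hat w) I"
 shows "vconf w T"
proof -
 have "finite I" using assms(1) by (simp add: vconf_def)
 thus ?thesis using assms cfaces_face[of I T "hat w"] cfaces_subset[OF assms(2)] finite_subset[of T I] by (auto simp: vconf_def)
qed

text \<open>An indexed polytope given by the positions \<open>w\<close> of its vertices and a fixed
  assignment \<open>L\<close> of vertex sets to labels. Realizations of one poset then differ only
  in \<open>w\<close>.\<close>

definition labelled :: "('i => pt) => (nat => 'i set) => nat set => indexed" where
 "labelled w L D = (%f. if f : D then Some (convex hull (w ` L f)) else None)"

definition labelling :: "('i => pt) => 'i set => (nat => 'i set) => nat set => bool" where
 "labelling w I L D \<longleftrightarrow> vconf w I & bij_betw L D (cfaces (hat w) I)"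

lemma dom_labelled [simp]: "dom (labelled w L D) = D" by (auto simp: labelled_def dom_def split: if_splits)

lemma labelled_the [simp]: "f : D ==> the (labelled w L D f) = convex hull (w ` L f)" by (simp add: labelled_def)

lemma labellingD:
 assumes "labelling w I L D"
 shows "vconf w I" "finite I" "inj_on L D" "!!f. f : D ==> L f : cfaces (hat w) I"
  "!!S. S : cfaces (hat w) I ==> EX f:D. L f = S" "!!f. f : D ==> L f <= I"
proof -
 show "!!S. S : cfaces (hat w) I ==> EX f:D. L f = S"
  using assms unfolding labelling_def bij_betw_def by (metis imageE)
qed (use assms cfaces_subset[of _ "hat w" I] in "auto simp: labelling_def vconf_def bij_betw_def")

lemma labelled_order:
 assumes "labelling w I L D"
 shows "index_order (labelled w L D) = {(f, g). f : D & g : D & L f <= L g}"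
 using vconf_hull_subset_iff[OF labellingD(2,4,4)[OF assms]] by (simp add: index_order_def cong: conj_cong)

lemma labelled_indexed_polytope:
 assumes "labelling w I L D"
 shows "indexed_polytope (labelled w L D)"
proof -
 let ?F = "labelled w L D" and ?P = "convex hull (w ` I)"
 note l = labellingD[OF assms]
 have faces: "A face_of ?P \<longleftrightarrow> A : (%f. the (?F f)) ` D" for A
 proof
  assume "A face_of ?P"
  note * = face_of_cfaces[OF l(2) this]
  then obtain f where "f : D" "L f = {i:I. w i : A}" using l(5) by blast
  thus "A : (%f. the (?F f)) ` D" using *(2) by (intro image_eqI[of _ _ f]) auto
 next
  assume "A : (%f. the (?F f)) ` D"
  thus "A face_of ?P" using cfaces_face_of(1)[OF l(2)] l(4) by auto
 qed
 have fld: "Field (index_order ?F) = D" by (auto simp: Field_def index_order_def)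
 have "inj_on (%f. the (?F f)) D"
 proof (rule inj_onI)
  fix f g assume fg: "f : D" "g : D" "the (?F f) = the (?F g)"
  hence "L f = L g" using vconf_hull_subset_iff[OF l(2) l(4) l(4), of f g] vconf_hull_subset_iff[OF l(2) l(4) l(4), of g f] by simp
  thus "f = g" using l(3) fg by (simp add: inj_on_def)
 qed
 hence "bij_betw (%f. the (?F f)) D {A. A face_of ?P}" using faces unfolding bij_betw_def by blast
 moreover have "polytope ?P" using l(2) by (auto simp: polytope_def)
 ultimately have "realization (index_order ?F) ?F" unfolding realization_def fld by (intro exI[of _ ?P]) (auto simp: index_order_def)
 thus ?thesis by (auto simp: indexed_polytope_def)
qed

lemma labelled_body:
 assumes "labelling w I L D"
 shows "body (labelled w L D) = convex hull (w ` I)"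
proof -
 note l = labellingD[OF assms]
 obtain f where f: "f : D" "L f = I" using l(5)[OF cfaces_top] by blast
 have "convex hull (w ` L g) <= convex hull (w ` I)" if "g : D" for g using l(6)[OF that] by (intro hull_mono image_mono)
 thus ?thesis using f by (auto simp: body_def ran_def labelled_def split: if_splits)
qed

lemma indexed_polytopeE:
 assumes "indexed_polytope F"
 obtains E L where "labelling (%x. x) E L (dom F)" "F = labelled (%x. x) L (dom F)" "body F = convex hull E"
proof -
 obtain r where r: "realization r F" using assms by (auto simp: indexed_polytope_def)
 note b = realization_body[OF r]
 obtain E where E: "vconf (%x. x) E" "body F = convex hull E" using polytope_vconf[OF b(1)] by blast
 hence fin: "finite E" by (simp add: vconf_def)
 obtain P where P: "dom F = Field r" "bij_betw (%f. the (F f)) (Field r) {A. A face_of P}" using r by (auto simp: realization_def)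
 have ran: "(%f. the (F f)) ` dom F = {A. A face_of body F}" unfolding b(2)[symmetric] by (force simp: ran_def dom_def image_iff)
 have inj: "inj_on (%f. the (F f)) (dom F)" using P by (simp add: bij_betw_def)
 define L where "L f = {x:E. x : the (F f)}" for f
 have fc: "the (F f) face_of convex hull ((%x. x) ` E)" if "f : dom F" for f using ran that E(2) by auto
 have Lf: "L f : cfaces (hat (%x. x)) E" "the (F f) = convex hull (L f)" if "f : dom F" for f
  using face_of_cfaces[OF fin fc[OF that]] by (simp_all add: L_def)
 have "inj_on L (dom F)" using inj Lf(2) unfolding inj_on_def by metis
 moreover have "L ` dom F = cfaces (hat (%x. x)) E"
 proof
  show "L ` dom F <= cfaces (hat (%x. x)) E" using Lf(1) by blast
  show "cfaces (hat (%x. x)) E <= L ` dom F"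
  proof
   fix S assume S: "S : cfaces (hat (%x. x)) E"
   have "convex hull S face_of body F" using cfaces_face_of(1)[OF fin S] E(2) by simp
   then obtain f where f: "f : dom F" "the (F f) = convex hull S" using ran by (metis (mono_tags, lifting) imageE mem_Collect_eq)
   have "L f = S"
   proof
    show "L f <= S" using cfaces_face_of(2)[OF fin S] f by (auto simp: L_def)
    show "S <= L f" using cfaces_subset[OF S] f by (auto simp: L_def hull_inc)
   qed
   thus "S : L ` dom F" using f by blast
  qed
 qed
 ultimately have "labelling (%x. x) E L (dom F)" using E by (simp add: labelling_def bij_betw_def)
 moreover have "F = labelled (%x. x) L (dom F)"
 proof
  fix f show "F f = labelled (%x. x) L (dom F) f" using Lf(2)[of f] by (cases "F f") (auto simp: labelled_def domIff)
 qed
 ultimately show ?thesis using E(2) by (rule that)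
qed

text \<open>Singletons are the members directly above the empty set, a property visible in the order
  alone.\<close>

lemma order_atoms:
 assumes L: "bij_betw L D C" and L': "bij_betw L' D C'"
  and ord: "!!f g. f : D ==> g : D ==> L f <= L g \<longleftrightarrow> L' f <= L' g"
  and C: "{} : C" "{} : C'" "!!S e. S : C' ==> e : S ==> {e} : C'" and f: "f : D" "L f = {i}"
 shows "EX e. L' f = {e}"
proof -
 obtain g0 where g0: "g0 : D" "L g0 = {}" using L C(1) by (auto simp: bij_betw_def)
 obtain h0 where h0: "h0 : D" "L' h0 = {}" using L' C(2) by (auto simp: bij_betw_def)
 have "L' f ~= {}"
 proof
  assume "L' f = {}"
  hence "L f <= L g0" using ord[OF f(1) g0(1)] by simp
  thus False using f g0 by simp
 qed
 then obtain e where e: "e : L' f" by blast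
 hence "{e} : C'" using C(3)[of "L' f"] L' f(1) by (auto simp: bij_betw_def)
 then obtain h where h: "h : D" "L' h = {e}" using L' by (auto simp: bij_betw_def)
 have "L h ~= {}"
 proof
  assume "L h = {}"
  hence "L' h <= L' h0" using ord[OF h(1) h0(1)] by simp
  thus False using h h0 by simp
 qed
 moreover have "L h <= L f" using ord[OF h(1) f(1)] h e by simp
 ultimately have "L h = L f" using f(2) by (auto simp: subset_singleton_iff)
 hence "h = f" using L h(1) f(1) by (auto simp: bij_betw_def inj_on_def)
 thus ?thesis using h by blast
qed

text \<open>Vertices are the atoms of the face order, so those of \<open>G\<close> can be renamed by
  \<open>I\<close>. A vertex belongs to a face exactly when its atom lies below it, hence the faces
  correspond as well.\<close>

lemma labelled_same_order:
 assumes F: "labelling w I L D" and G: "indexed_polytope G" and ord: "index_order G = index_order (labelled w L D)"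
 obtains w' where "labelling w' I L D" "G = labelled w' L D" "cfaces (hat w') I = cfaces (hat w) I"
proof -
 obtain E L' where L': "labelling (%x. x) E L' (dom G)" "G = labelled (%x. x) L' (dom G)" using indexed_polytopeE[OF G] by metis
 have "dom G = Field (index_order G)" by (auto simp: Field_def index_order_def)
 also have "\<dots> = D" unfolding ord by (auto simp: Field_def index_order_def)
 finally have dom: "dom G = D" .
 note l = labellingD[OF F] and l' = labellingD[OF L'(1), unfolded dom]
 have o: "L f <= L g \<longleftrightarrow> L' f <= L' g" if "f : D" "g : D" for f g
 proof -
  have "index_order G = {(f, g). f : D & g : D & L' f <= L' g}"
   by (subst L'(2)) (simp only: dom labelled_order[OF L'(1)[unfolded dom]])
  hence "(f, g) : {(f, g). f : D & g : D & L f <= L g} \<longleftrightarrow>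
    (f, g) : {(f, g). f : D & g : D & L' f <= L' g}" using ord labelled_order[OF F] by simp
  thus ?thesis using that by simp
 qed
 have bij: "bij_betw L D (cfaces (hat w) I)" "bij_betw L' D (cfaces (hat (%x. x)) E)" using F L'(1) by (simp_all add: labelling_def dom)
 have sing: "{i} : cfaces (hat w) I" if "i : I" for i using l(1) that by (simp add: vconf_def)
 have sing': "{e} : cfaces (hat (%x. x)) E" if "e : E" for e using l'(1) that by (simp add: vconf_def)
 have sub': "{i} : cfaces (hat w) I" if "S : cfaces (hat w) I" "i : S" for S i using sing that cfaces_subset[of S "hat w" I] by blast
 have sub'': "{e} : cfaces (hat (%x. x)) E" if "S : cfaces (hat (%x. x)) E" "e : S" for S e
  using sing' that cfaces_subset[of S "hat (%x. x)" E] by blast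
 note sub' = sub' sub''
 have "EX e. EX f:D. L f = {i} & L' f = {e}" if iI: "i : I" for i
 proof -
  obtain f where f: "f : D" "L f = {i}" using l(5)[OF sing[OF iI]] by blast
  hence "EX e. L' f = {e}" using sub'(2) by (intro order_atoms[OF bij o]) (simp_all add: cfaces_hat_empty)
  thus ?thesis using f by blast
 qed
 then obtain b where b: "!!i. i : I ==> EX f:D. L f = {i} & L' f = {b i}" by metis
 have mem: "b i : L' g \<longleftrightarrow> i : L g" if "i : I" "g : D" for i g
 proof -
  obtain f where "f : D" "L f = {i}" "L' f = {b i}" using b[OF \<open>i : I\<close>] by blast
  thus ?thesis using o[of f g] \<open>g : D\<close> by simp
 qed
 have surj: "EX i:I. b i = e" if eE: "e : E" for e
 proof -
  obtain f where f: "f : D" "L' f = {e}" using l'(5)[OF sing'[OF eE]] by blast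
  hence "EX i. L f = {i}" using sub'(1) by (intro order_atoms[OF bij(2,1)]) (simp_all add: cfaces_hat_empty o)
  then obtain i where i: "L f = {i}" by blast
  hence "i : I" using l(6)[OF f(1)] by simp
  moreover have "b i : L' f" using mem[OF \<open>i : I\<close> f(1)] i by simp
  ultimately show ?thesis using f by auto
 qed
 have inE: "b i : E" if "i : I" for i using b[OF that] l'(6) by blast
 have inj: "inj_on b I"
 proof (rule inj_onI)
  fix i j assume ij: "i : I" "j : I" "b i = b j"
  obtain f where "f : D" "L f = {i}" "L' f = {b i}" using b[OF ij(1)] by blast
  thus "i = j" using mem[OF ij(2), of f] ij(3) by simp
 qed
 have E: "E = b ` I" using surj inE by blast
 have L'eq: "L' g = b ` L g" if "g : D" for g using mem[OF _ that] l(6)[OF that] l'(6)[OF that] E by blast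
 have cf: "cfaces (hat b) I = cfaces (hat w) I"
 proof (rule set_eqI)
  fix S
  show "S : cfaces (hat b) I \<longleftrightarrow> S : cfaces (hat w) I"
  proof (cases "S <= I")
   case True
   have "S : cfaces (hat b) I \<longleftrightarrow> b ` S : cfaces (hat (%x. x)) E"
    unfolding E cfaces_reindex[OF inj True] by (simp add: hat_def[abs_def])
   also have "\<dots> \<longleftrightarrow> (EX g:D. L' g = b ` S)" using l'(4,5) by metis
   also have "\<dots> \<longleftrightarrow> (EX g:D. L g = S)" using L'eq inj_on_image_eq_iff[OF inj l(6) True] by auto
   also have "\<dots> \<longleftrightarrow> S : cfaces (hat w) I" using l(4,5) by metis
   finally show ?thesis .
  next
   case False
   thus ?thesis using cfaces_subset by blast
  qed
 qed
 show ?thesis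
 proof (rule that)
  show "labelling b I L D" using F cf by (simp add: labelling_def vconf_def)
  show "cfaces (hat b) I = cfaces (hat w) I" by (rule cf)
  show "G = labelled b L D" by (subst L'(2)) (simp add: labelled_def L'eq image_image dom fun_eq_iff)
 qed
qed

lemma labelling_cong:
 assumes "labelling w I L D" "cfaces (hat w') I = cfaces (hat w) I"
 shows "labelling w' I L D" "index_order (labelled w' L D) = index_order (labelled w L D)"
proof -
 show l: "labelling w' I L D" using assms by (simp add: labelling_def vconf_def)
 show "index_order (labelled w' L D) = index_order (labelled w L D)" unfolding labelled_order[OF l] labelled_order[OF assms(1)] ..
qed

lemma face_labelled:
 assumes "labelling w I L D" "f : D"
 shows "face (labelled w L D) f = labelled w L {g:D. L g <= L f}"
  "labelling w (L f) L {g:D. L g <= L f}"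
proof -
 note l = labellingD[OF assms(1)]
 show "face (labelled w L D) f = labelled w L {g:D. L g <= L f}" unfolding face_def labelled_order[OF assms(1)] using assms(2)
  by (intro ext) (simp add: labelled_def restrict_map_def)
 have "bij_betw L {g:D. L g <= L f} (cfaces (hat w) (L f))" unfolding cfaces_face[OF l(2) l(4)[OF assms(2)]] bij_betw_def
  using l(3,4,5) by (auto simp: inj_on_def image_iff) metis
 thus "labelling w (L f) L {g:D. L g <= L f}" using vconf_face[OF l(1) l(4)[OF assms(2)]] by (simp add: labelling_def)
qed

lemma algebraic_labelled:
 assumes "labelling w I L D"
 shows "algebraic_indexed (labelled w L D) \<longleftrightarrow> (ALL i:I. algebraic_pt (w i))"
proof -
 note l = labellingD[OF assms]
 have "polytope (convex hull (w ` I))" using l(2) by (auto simp: polytope_def)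
 thus ?thesis using vconf_extreme_points[OF l(1)] labelled_indexed_polytope[OF assms]
  by (auto simp: algebraic_indexed_def algebraic_polytope_def labelled_body[OF assms])
qed

lemma pdim_labelled:
 assumes "labelling w I L D"
 shows "pdim (body (labelled w L D)) = int (dim (hat w ` I)) - 1"
  "f : D ==> pdim (the (labelled w L D f)) = int (dim (hat w ` L f)) - 1"
proof -
 note l = labellingD[OF assms]
 show "pdim (body (labelled w L D)) = int (dim (hat w ` I)) - 1" using labelled_body[OF assms] pdim_hull[OF l(2)] by simp
 show "pdim (the (labelled w L D f)) = int (dim (hat w ` L f)) - 1" if "f : D"
  using pdim_hull[OF finite_subset[OF l(6)[OF that] l(2)]] that by simp
qed

section \<open>Projectivities as linear maps up to positive factors at the vertices\<close>

section \<open>Projectivities\<close>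

text \<open>Denominators of opposite sign at two vertices would give a zero on the segment between
  them.\<close>

lemma denominator_sign:
 assumes M: "linear M" and fin: "finite_on M (convex hull (w ` I))" and "finite I"
 shows "(ALL i:I. snd (M (hat w i)) > 0) \<or> (ALL i:I. snd (M (hat w i)) < 0)"
proof (rule ccontr)
 assume "~ ?thesis"
 then obtain i j where ij: "i : I" "j : I" "~ snd (M (hat w i)) > 0" "~ snd (M (hat w j)) < 0" by blast
 interpret linear M by fact
 let ?a = "snd (M (hat w i))" and ?b = "snd (M (hat w j))"
 have "w i : convex hull (w ` I)" "w j : convex hull (w ` I)" using ij by (simp_all add: hull_inc)
 hence nz: "?a ~= 0" "?b ~= 0" using fin by (auto simp: finite_on_def hat_def)
 hence lt: "?a < 0" "?b > 0" using ij by auto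
 define t where "t = ?b / (?b - ?a)"
 have t: "0 <= t" "t <= 1" "t * ?a + (1 - t) * ?b = 0" using lt by (auto simp: t_def field_simps)
 have "t *R w i + (1 - t) *R w j : convex hull (w ` I)"
  using convexD[OF convex_convex_hull \<open>w i : _\<close> \<open>w j : _\<close>, of t "1 - t"] t by simp
 moreover have "(t *R w i + (1 - t) *R w j, 1) = t *R hat w i + (1 - t) *R hat w j" by (simp add: hat_def)
 hence "snd (M (t *R w i + (1 - t) *R w j, 1)) = 0" using t(3) by (simp only: add scaleR snd_add snd_scaleR real_scaleR_def)
 ultimately show False using fin by (auto simp: finite_on_def)
qed

text \<open>A projectivity multiplies convex weights by the denominators at the vertices and
  renormalizes; \<open>s\<close> carries the common sign of the denominators.\<close>

lemma proj_hull:
 assumes M: "linear M" and I: "finite I" "J <= I" and pos: "!!i. i : I ==> s * snd (M (hat w i)) > 0"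
 shows "proj_apply M ` (convex hull (w ` J)) = convex hull ((%i. proj_apply M (w i)) ` J)"
  "finite_on M (convex hull (w ` I))"
proof -
 interpret linear M by fact
 let ?\<sigma> = "%i. s * snd (M (hat w i))"
 have finJ: "finite J" using I finite_subset by blast
 have s: "s ~= 0" if "i : I" for i using pos[OF that] by auto
 have posJ: "?\<sigma> i > 0" if "i : J" for i using pos that I by auto
 have Mh: "M (\<Sum>i\<in>K. a i *R w i, 1) = (\<Sum>i\<in>K. a i *R M (hat w i))" if "sum a K = 1" for a K
  by (simp add: hat_sum[OF that, symmetric] sum scaleR)
 have den: "s * snd (M (\<Sum>i\<in>K. a i *R w i, 1)) = (\<Sum>i\<in>K. a i * ?\<sigma> i)" if "sum a K = 1" for a K
  by (simp add: Mh[OF that] snd_sum sum_distrib_left algebra_simps)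
 have denpos: "(\<Sum>i\<in>K. a i * ?\<sigma> i) > 0" if a: "sum a K = 1" "ALL i:K. 0 <= a i" "K <= I" for a K
 proof -
  have finK: "finite K" using I that(3) finite_subset by blast
  obtain i where i: "i : K" "a i ~= 0" using a(1) by (metis sum.neutral zero_neq_one)
  show ?thesis
  proof (rule sum_pos2[OF finK i(1)])
   have "0 < a i" using i a(2) by (auto simp: order_less_le)
   thus "0 < a i * ?\<sigma> i" using i a(3) by (intro mult_pos_pos[OF _ pos]) auto
   show "0 <= a j * ?\<sigma> j" if "j : K" for j using that a by (intro mult_nonneg_nonneg[OF _ less_imp_le[OF pos]]) auto
  qed
 qed
 have fstM: "s *R fst (M (hat w i)) = ?\<sigma> i *R proj_apply M (w i)" if "i : I" for i
 proof -
  have "snd (M (w i, 1)) ~= 0" using pos[OF that] by (auto simp: hat_def)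
  thus ?thesis by (simp add: proj_apply_def hat_def)
 qed
 have app: "proj_apply M (\<Sum>i\<in>J. a i *R w i) =
   (\<Sum>i\<in>J. (a i * ?\<sigma> i / (\<Sum>j\<in>J. a j * ?\<sigma> j)) *R proj_apply M (w i))"
  if a: "sum a J = 1" "ALL i:J. 0 <= a i" for a
 proof -
  let ?x = "\<Sum>i\<in>J. a i *R w i" and ?d = "\<Sum>j\<in>J. a j * ?\<sigma> j"
  have dp: "?d > 0" using denpos[OF a I(2)] .
  have d: "s * snd (M (?x, 1)) = ?d" using den[OF a(1)] .
  hence s0: "s ~= 0" "snd (M (?x, 1)) ~= 0" using dp by auto
  have "proj_apply M ?x = (1 / snd (M (?x, 1))) *R fst (M (?x, 1))" by (simp add: proj_apply_def divide_inverse)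
  also have "1 / snd (M (?x, 1)) = s / ?d" using s0 by (simp flip: d)
  also have "(s / ?d) *R fst (M (?x, 1)) = (1 / ?d) *R (\<Sum>i\<in>J. a i *R (s *R fst (M (hat w i))))"
   by (simp add: Mh[OF a(1)] fst_sum scaleR_sum_right algebra_simps)
  also have "(\<Sum>i\<in>J. a i *R (s *R fst (M (hat w i)))) = (\<Sum>i\<in>J. a i *R (?\<sigma> i *R proj_apply M (w i)))"
   using fstM I(2) by (intro sum.cong arg_cong[of _ _ "scaleR _"]) auto
  also have "(1 / ?d) *R (\<Sum>i\<in>J. a i *R (?\<sigma> i *R proj_apply M (w i))) =
    (\<Sum>i\<in>J. (a i * ?\<sigma> i / ?d) *R proj_apply M (w i))" by (simp add: scaleR_sum_right)
  finally show ?thesis .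
 qed
 show "finite_on M (convex hull (w ` I))" unfolding finite_on_def convex_hull_image[OF I(1)]
 proof safe
  fix a assume a: "ALL i:I. 0 <= a i" "sum a I = 1" "snd (M (\<Sum>i\<in>I. a i *R w i, 1)) = 0"
  thus False using den[OF a(2)] denpos[OF a(2,1)] by simp
 qed
 show "proj_apply M ` (convex hull (w ` J)) = convex hull ((%i. proj_apply M (w i)) ` J)"
 proof
  show "proj_apply M ` (convex hull (w ` J)) <= convex hull ((%i. proj_apply M (w i)) ` J)"
  proof safe
   fix x assume "x : convex hull (w ` J)"
   then obtain a where a: "ALL i:J. 0 <= a i" "sum a J = 1" "x = (\<Sum>i\<in>J. a i *R w i)"
    unfolding convex_hull_image[OF finJ] by blast
   let ?d = "\<Sum>j\<in>J. a j * ?\<sigma> j"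
   have dp: "?d > 0" using denpos[OF a(2,1) I(2)] .
   have "(\<Sum>i\<in>J. a i * ?\<sigma> i / ?d) = 1" using dp by (simp flip: sum_divide_distrib)
   moreover have "0 <= a i * ?\<sigma> i / ?d" if "i : J" for i
    using a(1) that dp by (intro divide_nonneg_pos mult_nonneg_nonneg[OF _ less_imp_le[OF posJ]]) auto
   ultimately show "proj_apply M x : convex hull ((%i. proj_apply M (w i)) ` J)" unfolding a(3) app[OF a(2,1)] convex_hull_image[OF finJ]
    by (intro CollectI exI[of _ "%i. a i * ?\<sigma> i / ?d"]) auto
  qed
  show "convex hull ((%i. proj_apply M (w i)) ` J) <= proj_apply M ` (convex hull (w ` J))"
  proof
   fix y assume "y : convex hull ((%i. proj_apply M (w i)) ` J)"
   then obtain b where b: "ALL i:J. 0 <= b i" "sum b J = 1" "y = (\<Sum>i\<in>J. b i *R proj_apply M (w i))"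
    unfolding convex_hull_image[OF finJ] by blast
   define c where "c i = b i / ?\<sigma> i" for i
   have c0: "0 <= c i" if "i : J" for i using b(1) posJ[OF that] that by (simp add: c_def)
   have c\<sigma>: "c i * ?\<sigma> i = b i" if "i : J" for i using posJ[OF that] by (auto simp: c_def)
   have cs: "sum c J > 0"
   proof -
    obtain i where i: "i : J" "b i ~= 0" using b(2) by (metis sum.neutral zero_neq_one)
    hence "0 < c i" using b(1) posJ[of i] by (auto simp: c_def order_less_le intro!: divide_pos_pos)
    thus ?thesis using c0 by (intro sum_pos2[OF finJ i(1)])
   qed
   define a where "a i = c i / sum c J" for i
   have a: "sum a J = 1" "ALL i:J. 0 <= a i" using cs c0 by (simp_all add: a_def flip: sum_divide_distrib)
   have a\<sigma>: "a i * ?\<sigma> i = b i / sum c J" if "i : J" for i using c\<sigma>[OF that] by (simp add: a_def)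
   have d: "(\<Sum>j\<in>J. a j * ?\<sigma> j) = 1 / sum c J" using a\<sigma> b(2) by (simp flip: sum_divide_distrib)
   have "y = proj_apply M (\<Sum>i\<in>J. a i *R w i)" unfolding app[OF a] d b(3) using a\<sigma> cs by (intro sum.cong) auto
   moreover have "(\<Sum>i\<in>J. a i *R w i) : convex hull (w ` J)" unfolding convex_hull_image[OF finJ] using a by blast
   ultimately show "y : proj_apply M ` (convex hull (w ` J))" by (rule image_eqI)
  qed
 qed
qed

lemma finite_dim_Rpow: "EX T. finite T & span T = Rpow N \<times> (UNIV :: real set)"
proof (intro exI conjI)
 let ?T = "insert (0, 1::real) ((%k. (basis_pt k, 0)) ` {..<N})"
 have sub: "subspace (Rpow N \<times> (UNIV :: real set))" by (intro subspace_Times subspace_Rpow subspace_UNIV)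
 show "span ?T = Rpow N \<times> (UNIV :: real set)"
 proof
  show "span ?T <= Rpow N \<times> UNIV" using subspace_0[OF subspace_Rpow[of N]] by (intro span_minimal sub) (auto simp: basis_pt_in_Rpow)
  show "Rpow N \<times> UNIV <= span ?T"
  proof safe
   fix x and t :: real assume x: "x : Rpow N"
   have "(x, t) = (\<Sum>k<N. coord x k *R (basis_pt k, 0)) + t *R (0, 1)" using Rpow_expansion[OF x] by (simp add: sum_prod)
   also have "\<dots> : span ?T" by (intro span_add span_sum span_scale span_base) auto
   finally show "(x, t) : span ?T" .
  qed
 qed
qed simp

text \<open>A basis of \<open>S\<close> and its image are both extended to bases of the whole space.
  The added vectors are equal in number and can be matched arbitrarily.\<close>

lemma extend_to_projectivity:
 assumes A: "linear A" and S: "subspace S" "S <= Rpow N \<times> UNIV" "A ` S <= Rpow N \<times> UNIV" "inj_on A S"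
 obtains M where "projectivity N M" "!!x. x : S ==> M x = A x"
proof -
 let ?V = "Rpow N \<times> (UNIV :: real set)"
 have subV: "subspace ?V" by (intro subspace_Times subspace_Rpow subspace_UNIV)
 obtain T where T: "finite T" "span T = ?V" using finite_dim_Rpow by blast
 obtain B where B: "B <= S" "independent B" "S <= span B" using basis_exists[of S] by metis
 have spB: "span B = S" using B S(1) by (intro subset_antisym span_minimal) auto
 have indA: "independent (A ` B)" using B(2) S(4) by (intro linear_independent_injective_image[OF A]) (simp_all add: spB)
 obtain B1 where B1: "B <= B1" "B1 <= ?V" "independent B1" "?V <= span B1"
  by (rule maximal_independent_subset_extend[OF subset_trans[OF B(1) S(2)] B(2)])
 obtain B2 where B2: "A ` B <= B2" "B2 <= ?V" "independent B2" "?V <= span B2"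
  by (rule maximal_independent_subset_extend[OF subset_trans[OF image_mono[OF B(1)] S(3)] indA])
 have fin: "finite B1" "finite B2" using independent_span_bound[OF T(1)] B1 B2 T(2) by auto
 have "card B1 = dim ?V" "card B2 = dim ?V" by (rule basis_card_eq_dim; fact)+
 moreover have inj: "inj_on A B" using S(4) B(1) inj_on_subset by blast
 ultimately have "card (B1 - B) = card (B2 - A ` B)"
  using fin B1(1) B2(1) card_image[OF inj] by (simp add: card_Diff_subset finite_subset[of B B1] finite_subset[of "A ` B" B2])
 then obtain g where g: "bij_betw g (B1 - B) (B2 - A ` B)" using fin finite_same_card_bij[of "B1 - B" "B2 - A ` B"] by auto
 define h where "h b = (if b : B then A b else g b)" for b
 have "bij_betw h B1 B2"
 proof -
  have "bij_betw h B (A ` B)" using inj by (auto simp: bij_betw_def h_def inj_on_def)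
  moreover have "bij_betw h (B1 - B) (B2 - A ` B)" using g by (subst bij_betw_cong[where g = g]) (auto simp: h_def)
  ultimately have "bij_betw h (B \<union> (B1 - B)) (A ` B \<union> (B2 - A ` B))" by (rule bij_betw_combine) blast
  thus ?thesis using B1(1) B2(1) by (simp add: Un_absorb1)
 qed
 hence hinj: "inj_on h B1" and hB: "h ` B1 = B2" by (auto simp: bij_betw_def)
 obtain M where M: "linear M" "ALL b:B1. M b = h b" using linear_independent_extend[OF B1(3), of h] by blast
 have MB: "M ` B1 = B2" using M(2) hB by auto
 have "inj_on M (span B1)"
 proof -
  have "inj_on M B1" using hinj M(2) by (simp add: inj_on_def)
  thus ?thesis using linear_inj_on_span_independent_image[OF M(1)] B2(3) MB by simp
 qed
 moreover have V1: "span B1 = ?V" using B1 subV by (intro subset_antisym span_minimal) auto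
 moreover have V2: "span B2 = ?V" using B2 subV by (intro subset_antisym span_minimal) auto
 moreover have "M ` span B1 = span B2" using linear_span_image[OF M(1), of B1] MB by simp
 ultimately have "bij_betw M ?V ?V" by (simp add: bij_betw_def)
 hence "projectivity N M" using M(1) by (simp add: projectivity_def)
 moreover have "M x = A x" if "x : S" for x
 proof -
  have x: "x : span B" using that spB by simp
  show ?thesis
  proof (rule linear_eq_on[OF M(1) A x])
   fix b assume "b : B"
   thus "M b = A b" using M(2) B1(1) by (auto simp: h_def)
  qed
 qed
 ultimately show ?thesis by (rule that)
qed

text \<open>The working criterion for projective equivalence. The factors \<open>\<kappa> i\<close>
  become the denominators at the vertices, and their positivity gives finiteness on the whole
  hull.\<close>

lemma projectivity_from_linear:
 assumes lab: "labelling w I L D" "labelling w' I L D"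
  and A: "linear A" "inj_on A (span (hat w ` I))" and \<kappa>: "!!i. i : I ==> \<kappa> i > 0 & A (hat w i) = \<kappa> i *R hat w' i"
 obtains M where "projectivity_on M (body (labelled w L D))" "proj_image M (labelled w L D) = labelled w' L D"
proof -
 note l = labellingD[OF lab(1)]
 have "finite (w ` I \<union> w' ` I)" using l(2) by simp
 then obtain N where N: "w ` I \<union> w' ` I <= Rpow N" using finite_subset_Rpow by blast
 have subV: "subspace (Rpow N \<times> (UNIV :: real set))" by (intro subspace_Times subspace_Rpow subspace_UNIV)
 have S: "span (hat w ` I) <= Rpow N \<times> UNIV" using N by (intro span_minimal subV) (auto simp: hat_def)
 have "A ` span (hat w ` I) = span (A ` hat w ` I)" by (rule linear_span_image[OF A(1), symmetric])
 also have "\<dots> <= Rpow N \<times> UNIV"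
  using N \<kappa> by (intro span_minimal subV) (auto simp: hat_def image_subset_iff intro!: subspace_scale[OF subspace_Rpow])
 finally have AS: "A ` span (hat w ` I) <= Rpow N \<times> UNIV" .
 obtain M where M: "projectivity N M" "!!x. x : span (hat w ` I) ==> M x = A x"
  using extend_to_projectivity[OF A(1) subspace_span S AS A(2)] by blast
 have Mw: "M (hat w i) = \<kappa> i *R hat w' i" if "i : I" for i using M(2) \<kappa> that by (simp add: span_base)
 have linM: "linear M" using M(1) by (simp add: projectivity_def)
 have pos: "1 * snd (M (hat w i)) > 0" if "i : I" for i using Mw[OF that] \<kappa>[OF that] by (simp add: hat_def)
 have app: "proj_apply M (w i) = w' i" if "i : I" for i using Mw[OF that] \<kappa>[OF that] by (simp add: proj_apply_def hat_def)
 show ?thesis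
 proof (rule that)
  show "projectivity_on M (body (labelled w L D))" unfolding projectivity_on_def labelled_body[OF lab(1)]
   using M(1) N proj_hull(2)[OF linM l(2) _ pos, of I] convex_hull_Rpow by (intro exI[of _ N]) auto
  show "proj_image M (labelled w L D) = labelled w' L D"
  proof
   fix f
   show "proj_image M (labelled w L D) f = labelled w' L D f"
   proof (cases "f : D")
    case True
    hence "proj_apply M ` (convex hull (w ` L f)) = convex hull ((%i. proj_apply M (w i)) ` L f)"
     using l(6) by (intro proj_hull(1)[OF linM l(2) _ pos])
    also have "(%i. proj_apply M (w i)) ` L f = w' ` L f" using app l(6)[OF True] by (intro image_cong) auto
    finally show ?thesis using True by (simp add: proj_image_def labelled_def)
   qed (simp add: proj_image_def labelled_def)
  qed
 qed
qed

lemma proj_image_labelled: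
 assumes lab: "labelling w I L D" and M: "projectivity_on M (body (labelled w L D))"
 obtains w' \<kappa> A where "proj_image M (labelled w L D) = labelled w' L D" "linear A"
  "inj_on A (span (hat w ` I))" "!!i. i : I ==> \<kappa> i > 0 & A (hat w i) = \<kappa> i *R hat w' i"
proof -
 note l = labellingD[OF lab]
 obtain N where N: "convex hull (w ` I) <= Rpow N" "projectivity N M" "finite_on M (convex hull (w ` I))"
  using M unfolding projectivity_on_def labelled_body[OF lab] by blast
 have linM: "linear M" and bijM: "bij_betw M (Rpow N \<times> UNIV) (Rpow N \<times> UNIV)" using N(2) by (simp_all add: projectivity_def)
 interpret linear M by fact
 \<comment> \<open>The sign is absorbed into the linear map: a map and its negative induce the same
   projectivity.\<close>
 obtain s :: real where s: "s ~= 0" "!!i. i : I ==> s * snd (M (hat w i)) > 0" using denominator_sign[OF linM N(3) l(2)]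
 proof
  assume "ALL i:I. snd (M (hat w i)) > 0" thus ?thesis by (intro that[of 1]) auto
 next
  assume "ALL i:I. snd (M (hat w i)) < 0" thus ?thesis by (intro that[of "-1"]) auto
 qed
 define w' where "w' i = proj_apply M (w i)" for i
 have subV: "subspace (Rpow N \<times> (UNIV :: real set))" by (intro subspace_Times subspace_Rpow subspace_UNIV)
 have "hat w ` I <= Rpow N \<times> UNIV" using N(1) hull_subset[of "w ` I" convex] by (auto simp: hat_def)
 hence S: "span (hat w ` I) <= Rpow N \<times> UNIV" by (intro span_minimal subV)
 show ?thesis
 proof (rule that)
  show "linear (%x. s *R M x)" by (intro linear_compose_scale_right linM)
  have "inj_on M (span (hat w ` I))" using bijM S by (auto simp: bij_betw_def intro: inj_on_subset)
  thus "inj_on (%x. s *R M x) (span (hat w ` I))" using s(1) by (simp add: inj_on_def)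
  fix i assume i: "i : I"
  have "snd (M (hat w i)) ~= 0" using s(2)[OF i] by auto
  hence "s *R M (hat w i) = (s * snd (M (hat w i))) *R hat w' i" by (intro prod_eqI) (simp_all add: w'_def proj_apply_def hat_def)
  thus "s * snd (M (hat w i)) > 0 & s *R M (hat w i) = (s * snd (M (hat w i))) *R hat w' i" using s(2)[OF i] by blast
 next
  show "proj_image M (labelled w L D) = labelled w' L D"
  proof
   fix f
   show "proj_image M (labelled w L D) f = labelled w' L D f"
   proof (cases "f : D")
    case True
    hence "proj_apply M ` (convex hull (w ` L f)) = convex hull ((%i. proj_apply M (w i)) ` L f)"
     using l(6) by (intro proj_hull(1)[OF linM l(2) _ s(2)])
    thus ?thesis using True by (simp add: proj_image_def labelled_def w'_def)
   qed (simp add: proj_image_def labelled_def)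
  qed
 qed
qed

section \<open>Order-preserving functions that respect one slope relation and hence fix all
  nonnegative algebraic numbers\<close>

section \<open>Numbers forced by order and four-point relations\<close>

text \<open>The relation between the slopes of a quadrangle path whose first edge is vertical. With
  the next two edges of slopes \<open>y\<close> and \<open>x\<close>, the chords that skip one point
  have slopes \<open>B\<close> and \<open>A\<close>, and the closing chord has slope
  \<open>C\<close>.\<close>

definition quad_rel :: "real => real => real => real => real => bool" where
 "quad_rel x A y B C \<longleftrightarrow> (C - A) * (y - x) = (B - y) * (A - x)"

text \<open>What another realization can do to slopes: \<open>0\<close> and \<open>1\<close> are
  normalized by the frame, triangles keep the order, and quadrangles keep \<open>quad_rel\<close>
  for the orderings \<open>x < A < y < B\<close> that can be built.\<close>

definition number_model :: "real set => (real => real) => bool" where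
 "number_model S h \<longleftrightarrow> h 0 = 0 & h 1 = 1 & (ALL x:S. ALL y:S. x < y --> h x < h y) &
   (ALL x:S. ALL A:S. ALL y:S. ALL B:S. ALL C:S. x < A & A < y & y < B & quad_rel x A y B C -->
    quad_rel (h x) (h A) (h y) (h B) (h C))"

text \<open>A filter as bookkeeping: \<open>numbers P\<close> means that relations on some finite
  set of nonnegative numbers enforce \<open>P\<close>. Forced facts can then be combined while the
  finite sets merge silently.\<close>

definition number_models :: "(real => real) filter" where
 "number_models = Abs_filter (%f. EX S. finite S & S <= {0..} & (ALL h. number_model S h --> f h))"

abbreviation numbers where "numbers P == eventually P number_models"

lemma number_model_mono: "number_model T h ==> S <= T ==> number_model S h"
 unfolding number_model_def by (meson subsetD)

lemma eventually_number_models: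
 "eventually f number_models \<longleftrightarrow> (EX S. finite S & S <= {0..} & (ALL h. number_model S h --> f h))"
 unfolding number_models_def
proof (rule eventually_Abs_filter, unfold_locales)
 fix P Q :: "(real => real) => bool"
 assume "EX S. finite S & S <= {0..} & (ALL h. number_model S h --> P h)"
  and "EX S. finite S & S <= {0..} & (ALL h. number_model S h --> Q h)"
 then obtain S T where "finite S" "S <= {0..}" "!!h. number_model S h ==> P h"
  "finite T" "T <= {0..}" "!!h. number_model T h ==> Q h" by blast
 thus "EX S. finite S & S <= {0..} & (ALL h. number_model S h --> P h & Q h)"
  using number_model_mono[of "S \<union> T" _ S] number_model_mono[of "S \<union> T" _ T] by (intro exI[of _ "S \<union> T"]) auto
qed auto

lemma forced_0: "numbers (%h. h 0 = 0)"
 and forced_1: "numbers (%h. h 1 = 1)"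
 unfolding eventually_number_models by (intro exI[of _ "{}"]; simp add: number_model_def)+

lemma forced_less:
 assumes "0 <= x" "x < y"
 shows "numbers (%h. h x < h y)" unfolding eventually_number_models using assms
 by (intro exI[of _ "{x, y}"]) (auto simp: number_model_def)

lemma forced_quad:
 assumes "0 <= x" "x < A" "A < y" "y < B" "quad_rel x A y B C" "0 <= C"
 shows "numbers (%h. quad_rel (h x) (h A) (h y) (h B) (h C))"
 unfolding eventually_number_models
proof (intro exI conjI allI impI)
 fix h assume "number_model {x, A, y, B, C} h"
 hence "ALL x':{x, A, y, B, C}. ALL A':{x, A, y, B, C}. ALL y':{x, A, y, B, C}. ALL B':{x, A, y, B, C}.
   ALL C':{x, A, y, B, C}. x' < A' & A' < y' & y' < B' & quad_rel x' A' y' B' C' -->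
    quad_rel (h x') (h A') (h y') (h B') (h C')" unfolding number_model_def by (elim conjE)
 from this[rule_format, of x A y B C] show "quad_rel (h x) (h A) (h y) (h B) (h C)" using assms by simp
qed (use assms in auto)

text \<open>With \<open>x = 0\<close> and \<open>y = 1\<close> the relation reads
  \<open>C = A * B\<close>, but it is available only for \<open>A < 1 < B\<close>. Inverses,
  obtained from the product 1, remove this restriction in the lemmas that follow.\<close>

lemma forced_mult_separated:
 assumes "0 < A" "A < 1" "1 < B"
 shows "numbers (%h. h (A * B) = h A * h B)"
proof -
 have "quad_rel 0 A 1 B (A * B)" by (simp add: quad_rel_def algebra_simps)
 hence "numbers (%h. quad_rel (h 0) (h A) (h 1) (h B) (h (A * B)))"
  using assms by (intro forced_quad) auto
 thus ?thesis using forced_0 forced_1 by eventually_elim (simp add: quad_rel_def algebra_simps)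
qed

lemma forced_inverse:
 assumes "0 < a"
 shows "numbers (%h. h a * h (1 / a) = 1)"
proof (cases a "1 :: real" rule: linorder_cases)
 case less
 hence "numbers (%h. h (a * (1 / a)) = h a * h (1 / a))"
  using assms by (intro forced_mult_separated) auto
 thus ?thesis using forced_1 by eventually_elim (use assms in simp)
next
 case equal
 thus ?thesis using forced_1 by (auto elim!: eventually_mono)
next
 case greater
 hence "numbers (%h. h (1 / a * a) = h (1 / a) * h a)" by (intro forced_mult_separated) auto
 thus ?thesis using forced_1 by eventually_elim (use assms in "simp add: mult.commute")
qed

lemma forced_mult_gt1:
 assumes "1 < a" "1 < b"
 shows "numbers (%h. h (a * b) = h a * h b)"
proof -
 have "1 < a * b" using assms by (simp add: less_1_mult)
 hence "numbers (%h. h (1 / a * (a * b)) = h (1 / a) * h (a * b))"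
  using assms by (intro forced_mult_separated) auto
 moreover have "numbers (%h. h a * h (1 / a) = 1)" using assms by (intro forced_inverse) simp
 ultimately show ?thesis
 proof eventually_elim
  case (elim h)
  have "h b = h (1 / a) * h (a * b)" using elim(1) assms by simp
  hence "h a * h b = (h a * h (1 / a)) * h (a * b)" by simp
  thus ?case using elim(2) by simp
 qed
qed

lemma forced_mult:
 assumes "0 <= a" "0 <= b"
 shows "numbers (%h. h (a * b) = h a * h b)"
proof -
 consider "a = 0 \<or> b = 0" | "a = 1 \<or> b = 1" | "1 < a" "1 < b" | "0 < a" "a < 1" "1 < b"
  | "0 < b" "b < 1" "1 < a" | "0 < a" "a < 1" "0 < b" "b < 1" using assms by linarith
 thus ?thesis
 proof cases
  case 1 thus ?thesis using forced_0 by (auto elim!: eventually_mono)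
 next
  case 2 thus ?thesis using forced_1 by (auto elim!: eventually_mono)
 next
  case 3 thus ?thesis by (rule forced_mult_gt1)
 next
  case 4 thus ?thesis by (rule forced_mult_separated)
 next
  case 5 thus ?thesis using forced_mult_separated[of b a] by (simp add: mult.commute)
 next
  case 6
  have "numbers (%h. h (1 / a * (1 / b)) = h (1 / a) * h (1 / b))"
   using 6 by (intro forced_mult_gt1) auto
  moreover have "numbers (%h. h a * h (1 / a) = 1)" using 6 by (intro forced_inverse)
  moreover have "numbers (%h. h b * h (1 / b) = 1)" using 6 by (intro forced_inverse)
  moreover have "numbers (%h. h (a * b) * h (1 / (a * b)) = 1)" using 6 by (intro forced_inverse) simp
  ultimately show ?thesis
  proof eventually_elim
   case (elim h)
   have "h (a * b) * (h (1 / a) * h (1 / b)) = 1" using elim(1,4) by simp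
   hence "h (a * b) * ((h a * h (1 / a)) * (h b * h (1 / b))) = h a * h b" by (simp only: ac_simps mult_1_right mult_1_left)
   thus ?case using elim(2,3) by simp
  qed
 qed
qed

text \<open>Multiplication and order alone would allow power functions, so additive information has
  to come from other instances of the relation. With \<open>u = h 2 - 1\<close>, two of them express
  \<open>h 3\<close> and \<open>h 5\<close> by \<open>u\<close>, and the third leaves a polynomial
  in \<open>u\<close> whose only positive root is 1.\<close>

lemma forced_2_3: "numbers (%g. g 2 = 2 & g 3 = 3)"
proof -
 have q: "numbers (%g. quad_rel (g 1) (g 2) (g 4) (g 16) (g 6))"
  "numbers (%g. quad_rel (g 1) (g 2) (g 3) (g 9) (g 5))"
  "numbers (%g. quad_rel (g 1) (g 3) (g 5) (g 9) (g 5))"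
  by (intro forced_quad; simp add: quad_rel_def)+
 have m: "numbers (%g. g 4 = g 2 * g 2)" "numbers (%g. g 16 = g 4 * g 4)"
  "numbers (%g. g 6 = g 2 * g 3)" "numbers (%g. g 9 = g 3 * g 3)"
  using forced_mult[of 2 2] forced_mult[of 4 4] forced_mult[of 2 3] forced_mult[of 3 3] by simp_all
 have l: "numbers (%g. g 1 < g 2)" "numbers (%g. g 1 < g 3)"
  by (intro forced_less; simp)+
 show ?thesis using q m l forced_1
 proof eventually_elim
  case (elim g)
  define u where "u = g 2 - 1"
  define h where "h = g 3"
  define c where "c = g 5"
  have t: "g 2 = 1 + u" by (simp add: u_def)
  have u: "u > 0" and h1: "h > 1" using elim(8,9,10) by (simp_all add: u_def h_def)
  have "((1 + u) * h - (1 + u)) * ((1 + u) * (1 + u) - 1) =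
    ((1 + u) * (1 + u) * ((1 + u) * (1 + u)) - (1 + u) * (1 + u)) * u" using elim(1,4,5,6,10) by (simp add: quad_rel_def t h_def)
  hence "(1 + u) * (u * (2 + u)) * (h - 1 - u * (1 + u)) = 0" by (simp add: algebra_simps)
  moreover have "(1 + u) * (u * (2 + u)) ~= 0" using u by simp
  ultimately have "h - 1 - u * (1 + u) = 0" by (metis mult_eq_0_iff)
  hence h: "h = 1 + u + u * u" by (simp add: algebra_simps)
  have "(c - (1 + u)) * (h - 1) = (h * h - h) * u" using elim(2,7,10) by (simp add: quad_rel_def t h_def c_def)
  hence "(h - 1) * (c - (1 + u) - h * u) = 0" by (simp add: algebra_simps)
  hence c: "c = 1 + u + h * u" using h1 by simp
  have "(c - h) * (c - 1) = (h * h - c) * (h - 1)" using elim(3,7,10) by (simp add: quad_rel_def h_def c_def)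
  moreover have "(c - h) * (c - 1) - (h * h - c) * (h - 1) = u * u * (2 + u + u * u) * (1 - u)" unfolding c h by (simp add: algebra_simps)
  ultimately have "u * u * (2 + u + u * u) * (1 - u) = 0" by simp
  moreover have "2 + u + u * u > 0" using u by (intro add_pos_pos) auto
  ultimately have "u = 1" using u by auto
  thus ?case using t h by (simp add: h_def)
 qed
qed

text \<open>Once \<open>h 2\<close> and \<open>h 3\<close> are known, an instance containing 1, 2,
  3, \<open>z\<close> and the mean of \<open>z\<close> and 1 determines the value at that mean, and
  doubling gives \<open>h (z + 1)\<close>. Two instances are needed because the ordering changes at
  3; arguments below 1 are reached by inversion.\<close>

lemma forced_plus1:
 assumes "0 < z"
 shows "numbers (%h. h (z + 1) = h z + 1)"
proof -
 have gt: "numbers (%h. h (z + 1) = h z + 1)" if "1 <= z" for z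
 proof -
  have two: "2 * ((z + 1) / 2) = z + 1" for z :: real by simp
  consider "z = 1" | "z = 3" | "3 < z" | "1 < z" "z < 3" using \<open>1 <= z\<close> by linarith
  thus ?thesis
  proof cases
   case 1
   show ?thesis using forced_2_3 forced_1 unfolding 1 by eventually_elim simp
  next
   case 2
   have "numbers (%h. h 4 = h 2 * h 2)" using forced_mult[of 2 2] by simp
   thus ?thesis using forced_2_3 unfolding 2 by eventually_elim simp
  next
   case 3
   hence "numbers (%h. quad_rel (h 1) (h 2) (h 3) (h z) (h ((z + 1) / 2)))"
    by (intro forced_quad) (auto simp: quad_rel_def field_simps)
   moreover have "numbers (%h. h (z + 1) = h 2 * h ((z + 1) / 2))"
    using 3 forced_mult[of 2 "(z + 1) / 2", unfolded two] by simp
   ultimately show ?thesis using forced_2_3 forced_1 by eventually_elim (simp add: quad_rel_def)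
  next
   case 4
   hence "numbers (%h. quad_rel (h 1) (h ((z + 1) / 2)) (h 2) (h 3) (h z))"
    by (intro forced_quad) (auto simp: quad_rel_def field_simps)
   moreover have "numbers (%h. h (z + 1) = h 2 * h ((z + 1) / 2))"
    using 4 forced_mult[of 2 "(z + 1) / 2", unfolded two] by simp
   ultimately show ?thesis using forced_2_3 forced_1 by eventually_elim (simp add: quad_rel_def)
  qed
 qed
 show ?thesis
 proof (cases "1 <= z")
  case False
  hence "1 <= 1 / z" using assms by (simp add: field_simps)
  hence "numbers (%h. h (1 / z + 1) = h (1 / z) + 1)" by (rule gt)
  moreover have "numbers (%h. h (z * (1 / z + 1)) = h z * h (1 / z + 1))"
   using assms by (intro forced_mult) auto
  moreover have "numbers (%h. h z * h (1 / z) = 1)" using assms by (rule forced_inverse)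
  ultimately show ?thesis
  proof eventually_elim
   case (elim h)
   have "z * (1 / z + 1) = z + 1" using assms by (simp add: field_simps)
   thus ?case using elim by (simp add: algebra_simps)
  qed
 qed (rule gt)
qed

lemma forced_add:
 assumes "0 <= a" "0 <= b"
 shows "numbers (%h. h (a + b) = h a + h b)"
proof (cases "a = 0 \<or> b = 0")
 case True
 thus ?thesis using forced_0 by (auto elim!: eventually_mono)
next
 case False
 hence ab: "0 < a" "0 < b" using assms by auto
 have "numbers (%h. h (a / b + 1) = h (a / b) + 1)" using ab by (intro forced_plus1) simp
 moreover have "numbers (%h. h (b * (a / b + 1)) = h b * h (a / b + 1))"
  using ab by (intro forced_mult) auto
 moreover have "numbers (%h. h (b * (a / b)) = h b * h (a / b))"
  using ab by (intro forced_mult) auto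
 ultimately show ?thesis
 proof eventually_elim
  case (elim h)
  have "b * (a / b + 1) = a + b" "b * (a / b) = a" using ab by (simp_all add: field_simps)
  thus ?case using elim by (simp add: algebra_simps)
 qed
qed

lemma forced_nat: "numbers (%h. h (real n) = real n)"
proof (induction n)
 case 0 thus ?case using forced_0 by simp
next
 case (Suc n)
 have "numbers (%h. h (real n + 1) = h (real n) + h 1)" by (intro forced_add) auto
 thus ?case using Suc forced_1 by eventually_elim (simp add: add.commute)
qed

lemma forced_rat:
 assumes "q : \<rat>" "0 <= q"
 shows "numbers (%h. h q = q)"
proof -
 obtain m n :: nat where q: "n ~= 0" "q = real m / real n" using Rats_abs_nat_div_natE[OF assms(1)] assms(2) by (metis abs_of_nonneg)
 have "numbers (%h. h (real n * q) = h (real n) * h q)" using assms by (intro forced_mult) auto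
 thus ?thesis using forced_nat[of n] forced_nat[of m]
 proof eventually_elim
  case (elim h)
  have "real n * q = real m" using q by simp
  hence "real m = real n * h q" using elim by metis
  hence "real n * h q = real n * q" using \<open>real n * q = real m\<close> by linarith
  thus ?case using q(1) by (metis mult_left_cancel of_nat_eq_0_iff)
 qed
qed

lemma forced_nat_poly:
 assumes "0 <= a"
 shows "numbers (%h. h (\<Sum>i<n. real (c i) * a ^ i) = (\<Sum>i<n. real (c i) * h a ^ i))"
proof (induction n)
 case 0 thus ?case using forced_0 by simp
next
 case (Suc n)
 have pow: "numbers (%h. h (a ^ k) = h a ^ k)" for k
 proof (induction k)
  case 0 thus ?case using forced_1 by simp
 next
  case (Suc k)
  have "numbers (%h. h (a * a ^ k) = h a * h (a ^ k))" using assms by (intro forced_mult) auto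
  thus ?case using Suc by eventually_elim simp
 qed
 have "numbers (%h. h ((\<Sum>i<n. real (c i) * a ^ i) + real (c n) * a ^ n) =
   h (\<Sum>i<n. real (c i) * a ^ i) + h (real (c n) * a ^ n))" using assms by (intro forced_add sum_nonneg) auto
 moreover have "numbers (%h. h (real (c n) * a ^ n) = h (real (c n)) * h (a ^ n))"
  using assms by (intro forced_mult) auto
 ultimately show ?case using Suc pow[of n] forced_nat[of "c n"] by eventually_elim simp
qed

text \<open>\<open>h\<close> respects polynomials with natural coefficients. An integer polynomial
  for \<open>c\<close>, split by the signs of its coefficients, thus has \<open>h c\<close> as a
  root, and monotonicity between fixed rationals confines \<open>h c\<close> to an interval that
  contains no root other than \<open>c\<close>.\<close>

theorem forced_algebraic:
 assumes "algebraic c" "0 <= c"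
 shows "numbers (%h. h c = c)"
proof (cases "c = 0")
 case True thus ?thesis using forced_0 by simp
next
 case False
 hence pos: "0 < c" using assms(2) by simp
 obtain p :: "real poly" where p: "!!i. coeff p i : \<int>" "p ~= 0" "poly p c = 0" using assms(1) by (auto simp: algebraic_def)
 have fin: "finite {x. poly p x = 0}" by (rule poly_roots_finite[OF p(2)])
 \<comment> \<open>Radius around \<open>c\<close> that is free of other roots. The entry
   \<open>c\<close> keeps \<open>c - e\<close> nonnegative, so that the lower rational bound stays
   in the range where numbers are forced.\<close>
 define e where "e = Min (insert c ((%x. \<bar>x - c\<bar>) ` ({x. poly p x = 0} - {c})))"
 have epos: "e > 0" unfolding e_def using fin pos by (subst Min_gr_iff) auto
 have iso: "x = c" if "poly p x = 0" "\<bar>x - c\<bar> < e" for x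
 proof (rule ccontr)
  assume "x ~= c"
  hence "e <= \<bar>x - c\<bar>" unfolding e_def using fin that(1) by (intro Min_le) auto
  thus False using that(2) by simp
 qed
 have "e <= c" unfolding e_def using fin by (intro Min_le) auto
 obtain r s where rs: "r : \<rat>" "c - e < r" "r < c" "s : \<rat>" "c < s" "s < c + e"
  using Rats_dense_in_real[of "c - e" c] Rats_dense_in_real[of c "c + e"] epos by auto
 have r0: "0 <= r" using rs(2) \<open>e <= c\<close> by simp
 define N where "N = Suc (degree p)"
 define a where "a i = nat \<lfloor>coeff p i\<rfloor>" for i
 define b where "b i = nat \<lfloor>- coeff p i\<rfloor>" for i
 have ab: "coeff p i = real (a i) - real (b i)" for i
 proof -
  obtain z where "coeff p i = real_of_int z" using p(1)[of i] by (elim Ints_cases)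
  thus ?thesis by (simp add: a_def b_def)
 qed
 have poly: "poly p x = (\<Sum>i<N. real (a i) * x ^ i) - (\<Sum>i<N. real (b i) * x ^ i)" for x
  by (simp add: poly_altdef N_def lessThan_Suc_atMost ab left_diff_distrib sum_subtractf)
 have eq: "(\<Sum>i<N. real (a i) * c ^ i) = (\<Sum>i<N. real (b i) * c ^ i)" using p(3) poly by simp
 have "numbers (%h. h r < h c)" "numbers (%h. h c < h s)"
  using r0 rs pos by (auto intro!: forced_less)
 moreover have "numbers (%h. h r = r)" "numbers (%h. h s = s)"
  using r0 rs pos by (auto intro!: forced_rat)
 ultimately show ?thesis using forced_nat_poly[OF assms(2), of a N] forced_nat_poly[OF assms(2), of b N]
 proof eventually_elim
  case (elim h)
  have "poly p (h c) = 0" using elim(5,6) eq by (simp add: poly)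
  moreover have "\<bar>h c - c\<bar> < e" using elim(1-4) rs by linarith
  ultimately show ?case by (rule iso)
 qed
qed

section \<open>Finite point clusters, visible from one direction, and their images in other
  realizations\<close>

section \<open>Clusters and their models\<close>

definition ip :: "nat => pt => pt => real" where
 "ip d c x = (\<Sum>k<d. coord c k * coord x k)"

text \<open>The direction with all coordinates -1. The functionals \<open>- basis_pt i\<close> have
  value 1 on it, and so the frame fits.\<close>

definition up :: "nat => pt" where
 "up d = - (\<Sum>k<d. basis_pt k)"

lemma linear_ip: "linear (ip d c)" by (rule linearI) (simp_all add: ip_def lookup_add sum.distrib sum_distrib_left algebra_simps)

lemma ip_commute: "ip d c x = ip d x c" by (simp add: ip_def mult.commute)

lemmas ip_simps = linear_add[OF linear_ip] linear_diff[OF linear_ip] linear_scale[OF linear_ip]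
 linear_neg[OF linear_ip] linear_sum[OF linear_ip] linear_0[OF linear_ip]

lemma ip_add_left: "ip d (b + c) x = ip d b x + ip d c x" and ip_diff_left: "ip d (b - c) x = ip d b x - ip d c x"
 and ip_scaleR_left: "ip d (a *R c) x = a * ip d c x" by (simp_all add: ip_commute[of d _ x] ip_simps)

lemma ip_basis_pt [simp]: "k < d ==> ip d c (basis_pt k) = coord c k" by (simp add: ip_def if_distrib[of "(*) _"] cong: if_cong)

lemma ip_up: "ip d c (up d) = - (\<Sum>k<d. coord c k)" by (simp add: up_def ip_simps)

lemma up_in_Rpow: "up d : Rpow d" unfolding up_def by (intro subspace_neg subspace_sum subspace_Rpow) (simp add: basis_pt_in_Rpow)

text \<open>Every point is a vertex that is visible from infinity in direction \<open>up d\<close>.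
  Exposing functionals that are positive on \<open>up d\<close> are the ones that stay negative on
  the rays of the stamp.\<close>

definition admissible :: "nat => pt set => bool" where
 "admissible d X \<longleftrightarrow> finite X & X <= Rpow d &
   (ALL p:X. EX c:Rpow d. ip d c (up d) > 0 & (ALL q:X - {p}. ip d c q < ip d c p))"

lemma admissible_subset: "admissible d X ==> Y <= X ==> admissible d Y"
 unfolding admissible_def by (blast intro: finite_subset)

lemma admissibleD:
 assumes "admissible d X" "p : X"
 obtains c where "c : Rpow d" "ip d c (up d) > 0" "!!q. q : X ==> q ~= p ==> ip d c q < ip d c p"
 using assms unfolding admissible_def by blast

text \<open>Of three collinear points the middle one could not be strictly exposed; the three
  functionals confine the ratio \<open>\<gamma>\<close> contradictorily.\<close>

lemma admissible_not_collinear: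
 assumes X: "admissible d X" and pqr: "p : X" "q : X" "r : X" "p ~= q" "q ~= r" "p ~= r"
  and eq: "a *R (q - p) = b *R (r - p)"
 shows "a = 0 & b = 0"
proof (rule ccontr)
 assume "~ (a = 0 & b = 0)"
 hence "b ~= 0" using eq pqr(4) by auto
 define \<gamma> where "\<gamma> = a / b"
 have r: "r - p = \<gamma> *R (q - p)"
 proof -
  have "(1 / b) *R (a *R (q - p)) = (1 / b) *R (b *R (r - p))" by (simp only: eq)
  thus ?thesis using \<open>b ~= 0\<close> by (simp add: \<gamma>_def)
 qed
 have val: "ip d c r - ip d c p = \<gamma> * (ip d c q - ip d c p)" for c
 proof -
  have "ip d c (r - p) = ip d c (\<gamma> *R (q - p))" by (simp only: r)
  thus ?thesis by (simp only: ip_simps real_scaleR_def)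
 qed
 obtain cp where cp: "!!s. s : X ==> s ~= p ==> ip d cp s < ip d cp p" by (rule admissibleD[OF X pqr(1)]) blast
 obtain cq where cq: "!!s. s : X ==> s ~= q ==> ip d cq s < ip d cq q" by (rule admissibleD[OF X pqr(2)]) blast
 obtain cr where cr: "!!s. s : X ==> s ~= r ==> ip d cr s < ip d cr r" by (rule admissibleD[OF X pqr(3)]) blast
 have "\<gamma> * (ip d cp q - ip d cp p) < 0" "ip d cp q - ip d cp p < 0" using val[of cp] cp[of q] cp[of r] pqr by auto
 hence g0: "\<gamma> > 0" by (auto simp: mult_less_0_iff)
 have cq': "ip d cq p < ip d cq q" "ip d cq r < ip d cq q" using cq pqr by auto
 hence "\<gamma> * (ip d cq q - ip d cq p) < 1 * (ip d cq q - ip d cq p)" unfolding val[symmetric] by simp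
 hence g1: "\<gamma> < 1" using cq'(1) by (simp only: mult_less_cancel_right_pos diff_gt_0_iff_gt)
 have *: "0 < \<gamma> * (ip d cr q - ip d cr p)" "ip d cr q - ip d cr p < \<gamma> * (ip d cr q - ip d cr p)"
  using val[of cr] cr[of p] cr[of q] pqr by auto
 hence "0 < ip d cr q - ip d cr p" using g0 by (auto simp: zero_less_mult_iff)
 hence "\<gamma> * (ip d cr q - ip d cr p) < 1 * (ip d cr q - ip d cr p)" using g1 by (intro mult_strict_right_mono)
 thus False using *(2) by simp
qed

definition frame :: "nat => pt set" where
 "frame d = insert 0 (basis_pt ` {..<d})"

definition frame_vec :: "nat => (pt set => pt => 'a::real_vector) => nat => 'a" where
 "frame_vec d x' k = x' (frame d) (basis_pt k) - x' (frame d) 0"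

text \<open>What the stamp guarantees about its clusters in another realization: parallel chords,
  also of different clusters, stay parallel with the same orientation, and the frame does not
  degenerate. Positions and sizes of the clusters remain unrelated.\<close>

definition cluster_model :: "nat => pt set set => (pt set => pt => 'a::real_vector) => bool" where
 "cluster_model d \<X> x' \<longleftrightarrow>
  (ALL X:\<X>. ALL Y:\<X>. ALL p:X. ALL q:X. ALL r:Y. ALL t:Y. ALL k>0. p ~= q & q - p = k *R (t - r) -->
   (EX k'>0. x' X q - x' X p = k' *R (x' Y t - x' Y r))) &
  (ALL a. (\<Sum>k<d. a k *R frame_vec d x' k) = 0 --> (ALL k<d. a k = 0))"

text \<open>The same bookkeeping as for \<open>numbers\<close>: a property is forced if finitely
  many auxiliary admissible clusters enforce it.\<close>

definition cluster_models :: "nat => (pt set => pt => 'a::real_vector) filter" where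
 "cluster_models d = Abs_filter (%f. EX \<X>. finite \<X> & (ALL X:\<X>. admissible d X) &
   (ALL x'. cluster_model d \<X> x' --> f x'))"

abbreviation clusters where "clusters d P == eventually P (cluster_models d)"

lemma cluster_model_mono: "cluster_model d \<Y> x' ==> \<X> <= \<Y> ==> cluster_model d \<X> x'"
 unfolding cluster_model_def by (meson subsetD)

lemma eventually_cluster_models:
 "eventually f (cluster_models d) \<longleftrightarrow> (EX \<X>. finite \<X> & (ALL X:\<X>. admissible d X) &
   (ALL x'. cluster_model d \<X> x' --> f x'))" unfolding cluster_models_def
proof (rule eventually_Abs_filter, unfold_locales)
 fix P Q :: "(pt set => pt => 'a) => bool"
 assume "EX \<X>. finite \<X> & (ALL X:\<X>. admissible d X) & (ALL x'. cluster_model d \<X> x' --> P x')"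
  and "EX \<X>. finite \<X> & (ALL X:\<X>. admissible d X) & (ALL x'. cluster_model d \<X> x' --> Q x')"
 then obtain S T where "finite S" "ALL X:S. admissible d X" "!!x'. cluster_model d S x' ==> P x'"
  "finite T" "ALL X:T. admissible d X" "!!x'. cluster_model d T x' ==> Q x'" by blast
 moreover have "cluster_model d S x' & cluster_model d T x'" if "cluster_model d (S \<union> T) x'"
  for x' :: "pt set => pt => 'a" using cluster_model_mono[OF that] by auto
 ultimately show "EX \<X>. finite \<X> & (ALL X:\<X>. admissible d X) & (ALL x'. cluster_model d \<X> x' --> P x' & Q x')"
  by (intro exI[of _ "S \<union> T"]) auto
qed auto

text \<open>Two-point clusters serve as standards of direction: all chords in direction
  \<open>v\<close> are compared with the image of the chord from 0 to \<open>v\<close>.\<close>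

definition sv :: "(pt set => pt => 'a::real_vector) => pt => 'a" where
 "sv x' v = x' {0, v} v - x' {0, v} 0"

lemma admissible_pair:
 assumes X: "admissible d X" and pq: "p : X" "q : X" "p ~= q" and v: "q - p = k *R v" "k > 0"
 shows "admissible d {0, v}" "v ~= 0"
proof -
 show "v ~= 0" using v pq by auto
 have vR: "v : Rpow d"
 proof -
  have "q - p : Rpow d" using X pq by (intro subspace_diff[OF subspace_Rpow]) (auto simp: admissible_def)
  hence "(1 / k) *R (q - p) : Rpow d" by (intro subspace_scale[OF subspace_Rpow])
  thus ?thesis using v by simp
 qed
 have val: "ip d c q - ip d c p = k * ip d c v" for c using arg_cong[OF v(1), of "ip d c"] by (simp only: ip_simps real_scaleR_def)
 obtain c1 where c1: "c1 : Rpow d" "ip d c1 (up d) > 0" "ip d c1 q < ip d c1 p" by (rule admissibleD[OF X pq(1)]) (use pq in auto)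
 obtain c2 where c2: "c2 : Rpow d" "ip d c2 (up d) > 0" "ip d c2 p < ip d c2 q" by (rule admissibleD[OF X pq(2)]) (use pq in auto)
 have "k * ip d c1 v < 0" "0 < k * ip d c2 v" using val[of c1] val[of c2] c1 c2 by simp_all
 hence "ip d c1 v < 0" "0 < ip d c2 v" using v(2) by (auto simp: mult_less_0_iff zero_less_mult_iff)
 thus "admissible d {0, v}" unfolding admissible_def using vR c1 c2 subspace_0[OF subspace_Rpow] by (auto simp: ip_simps)
qed

definition pos_par :: "'a::real_vector => 'a => bool" where
 "pos_par a b \<longleftrightarrow> (EX g>0. a = g *R b)"

lemma pos_par_refl: "pos_par a a" unfolding pos_par_def by (intro exI[of _ 1]) simp

lemma pos_par_sym: "pos_par a b ==> pos_par b a"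
proof -
 assume "pos_par a b"
 then obtain g where "g > 0" "a = g *R b" by (auto simp: pos_par_def)
 thus ?thesis unfolding pos_par_def by (intro exI[of _ "1 / g"]) auto
qed

lemma pos_par_trans: "pos_par a b ==> pos_par b c ==> pos_par a c"
 unfolding pos_par_def by (metis mult_pos_pos scaleR_scaleR)

lemma pos_par_scale: "r > 0 ==> pos_par (r *R a) b \<longleftrightarrow> pos_par a b"
 and pos_par_scale': "r > 0 ==> pos_par a (r *R b) \<longleftrightarrow> pos_par a b"
proof -
 assume r: "r > 0"
 have "pos_par (r *R x) x" for x :: 'a using r by (auto simp: pos_par_def)
 thus "pos_par (r *R a) b \<longleftrightarrow> pos_par a b" "pos_par a (r *R b) \<longleftrightarrow> pos_par a b"
  using pos_par_trans pos_par_sym by blast+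
qed

lemma pos_par_minus: "pos_par (- a) (- b) \<longleftrightarrow> pos_par a b" by (simp add: pos_par_def)

lemma eventually_impI: "(P ==> \<forall>\<^sub>F x in F. Q x) ==> \<forall>\<^sub>F x in F. P --> Q x"
 by (cases P) simp_all

lemma model_parallel:
 assumes "admissible d X" "admissible d Y" "p : X" "q : X" "r : Y" "t : Y" "p ~= q" "q - p = k *R (t - r)" "k > 0"
 shows "clusters d (%x'. EX k'>0. x' X q - x' X p = k' *R (x' Y t - x' Y r))" unfolding eventually_cluster_models
proof (intro exI[of _ "{X, Y}"] conjI allI impI)
 fix x' :: "pt set => pt => 'a" assume "cluster_model d {X, Y} x'"
 hence "ALL X':{X, Y}. ALL Y':{X, Y}. ALL p:X'. ALL q:X'. ALL r:Y'. ALL t:Y'. ALL k>0. p ~= q & q - p = k *R (t - r) -->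
   (EX k'>0. x' X' q - x' X' p = k' *R (x' Y' t - x' Y' r))" unfolding cluster_model_def by (elim conjE)
 from this[rule_format, of X Y p q r t k]
 show "EX k'>0. x' X q - x' X p = k' *R (x' Y t - x' Y r)" using assms by simp
qed (use assms in auto)

lemma model_direction:
 assumes X: "admissible d X" "p : X" "q : X" "p ~= q" "q - p = k *R v" "k > 0"
 shows "clusters d (%x'. pos_par (x' X q - x' X p) (sv x' v))" unfolding sv_def pos_par_def using X admissible_pair[OF X]
 by (intro model_parallel[where k = k]) auto

lemma model_frame:
 "clusters d (%x'. ALL a. (\<Sum>k<d. a k *R frame_vec d x' k) = 0 --> (ALL k<d. a k = 0))"
 unfolding eventually_cluster_models by (intro exI[of _ "{}"]) (simp add: cluster_model_def)

lemma sum_two: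
 fixes f :: "nat => 'b::comm_monoid_add"
 assumes "i < d" "j < d" "i ~= j" "!!k. k ~= i ==> k ~= j ==> f k = 0"
 shows "(\<Sum>k<d. f k) = f i + f j"
proof -
 have "(\<Sum>k<d. f k) = (\<Sum>k\<in>{i, j}. f k)" using assms by (intro sum.mono_neutral_right) auto
 thus ?thesis using assms(3) by simp
qed

lemma model_frame_pair:
 assumes "i < d" "j < d" "i ~= j"
 shows "clusters d (%x'. ALL a b. a *R frame_vec d x' i + b *R (- frame_vec d x' j) = 0 --> a = 0 & b = 0)"
 using model_frame
proof eventually_elim
 case (elim x')
 show ?case
 proof (intro allI impI)
  fix a b assume ab: "a *R frame_vec d x' i + b *R (- frame_vec d x' j) = 0"
  let ?a = "%k. if k = i then a else if k = j then - b else 0"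
  have "(\<Sum>k<d. ?a k *R frame_vec d x' k) = ?a i *R frame_vec d x' i + ?a j *R frame_vec d x' j"
   by (rule sum_two[OF assms]) simp
  also have "\<dots> = 0" using ab assms(3) by simp
  finally have "(\<Sum>k<d. ?a k *R frame_vec d x' k) = 0" .
  from elim[rule_format, OF this, of i] elim[rule_format, OF this, of j] show "a = 0 & b = 0" using assms by auto
 qed
qed

lemma admissible_frame:
 assumes "2 <= d"
 shows "admissible d (frame d)" unfolding admissible_def
proof (intro conjI ballI)
 show "frame d <= Rpow d" using subspace_0[OF subspace_Rpow] by (auto simp: frame_def basis_pt_in_Rpow)
 fix p assume p: "p : frame d"
 \<comment> \<open>With 1 at the point to be exposed and -2 elsewhere the coordinate sum is
   \<open>3 - 2 * d\<close>, or \<open>- 2 * d\<close> at the origin; both are negative, as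
   positivity on \<open>up d\<close> demands.\<close>
 define f where "f k = (if p = basis_pt k then 1 else -2 :: real)" for k
 let ?c = "\<Sum>k<d. f k *R basis_pt k"
 have c: "coord ?c k = f k" if "k < d" for k using that by (simp only: coord_comb) simp
 have inj: "basis_pt i = basis_pt k \<longleftrightarrow> i = k" for i k :: nat by (metis coord_basis_pt zero_neq_one)
 have nz: "basis_pt k ~= 0" for k by (metis coord_basis_pt lookup_zero zero_neq_one)
 show "EX c:Rpow d. ip d c (up d) > 0 & (ALL q:frame d - {p}. ip d c q < ip d c p)"
 proof (intro bexI conjI ballI)
  show "?c : Rpow d" by (rule Rpow_comb)
  have "(\<Sum>k<d. f k) < 0"
  proof (cases "p = 0")
   case True
   hence "f k = -2" for k using nz[of k] by (auto simp: f_def)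
   thus ?thesis using assms by simp
  next
   case False
   then obtain i where i: "p = basis_pt i" "i < d" using p by (auto simp: frame_def)
   have "(\<Sum>k<d. f k) = (\<Sum>k<d. (if k = i then 3 else 0) - 2)" by (intro sum.cong) (auto simp: f_def i inj)
   also have "\<dots> = 3 - 2 * real d" using i(2) by (simp add: sum_subtractf)
   finally show ?thesis using assms by simp
  qed
  thus "ip d ?c (up d) > 0" by (simp add: ip_up c)
  fix q assume q: "q : frame d - {p}"
  then consider "q = 0" "p ~= 0" | k where "q = basis_pt k" "k < d" "p ~= q" by (auto simp: frame_def)
  thus "ip d ?c q < ip d ?c p"
  proof cases
   case 1
   then obtain i where i: "p = basis_pt i" "i < d" using p by (auto simp: frame_def)
   thus ?thesis using 1 c[of i] by (simp add: ip_simps f_def)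
  next
   case (2 k)
   have "ip d ?c q = -2" using 2 c[of k] by (simp add: f_def)
   moreover have "ip d ?c p >= 0"
   proof (cases "p = 0")
    case False
    then obtain i where i: "p = basis_pt i" "i < d" using p by (auto simp: frame_def)
    thus ?thesis using c[of i] by (simp add: f_def)
   qed (simp add: ip_simps)
   ultimately show ?thesis by simp
  qed
 qed
qed (simp add: frame_def)

section \<open>Triangles and quadrangles in coordinate planes, and the directions that they
  force\<close>

section \<open>Planar clusters\<close>

definition pl :: "nat => nat => real => real => pt" where
 "pl i j s t = s *R basis_pt i + t *R basis_pt j"

abbreviation dir :: "nat => nat => real => pt" where
 "dir i j k \<equiv> pl i j 1 (- k)"

lemma pl_diff: "pl i j s t - pl i j s' t' = pl i j (s - s') (t - t')" and pl_scale: "r *R pl i j s t = pl i j (r * s) (r * t)"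
 and pl_0: "pl i j 0 0 = 0" by (simp_all add: pl_def algebra_simps)

lemma pl_inject: "i ~= j ==> pl i j s t = pl i j s' t' \<longleftrightarrow> s = s' & t = t'"
proof
 assume ij: "i ~= j" and eq: "pl i j s t = pl i j s' t'"
 have "coord (pl i j s t) i = coord (pl i j s' t') i" "coord (pl i j s t) j = coord (pl i j s' t') j" by (simp_all only: eq)
 thus "s = s' & t = t'" using ij by (simp add: pl_def lookup_add)
qed simp

text \<open>In dimension 2 the functional on the plane must itself be positive on
  \<open>up d\<close>, which means \<open>a + b < 0\<close>. From dimension 3 on, the remaining
  coordinates of the functional can be made negative enough.\<close>

lemma admissible_planar:
 assumes ij: "i < d" "j < d" "i ~= j" and "finite P"
  and ex: "!!s t. (s, t) : P ==> EX a b. (a + b < 0 \<or> 3 <= d) &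
   (ALL (s', t'):P - {(s, t)}. a * s' + b * t' < a * s + b * t)"
 shows "admissible d ((%(s, t). pl i j s t) ` P)" unfolding admissible_def
proof (intro conjI ballI)
 show "(%(s, t). pl i j s t) ` P <= Rpow d"
  using ij by (auto simp: pl_def basis_pt_in_Rpow intro!: subspace_add[OF subspace_Rpow] subspace_scale[OF subspace_Rpow])
 fix p assume "p : (%(s, t). pl i j s t) ` P"
 then obtain s t where st: "(s, t) : P" "p = pl i j s t" by auto
 obtain a b where ab: "a + b < 0 \<or> 3 <= d" and lt: "!!s' t'. (s', t') : P ==> (s', t') ~= (s, t) ==> a * s' + b * t' < a * s + b * t"
  using ex[OF st(1)] by blast
 define \<gamma> where "\<gamma> = - (\<bar>a\<bar> + \<bar>b\<bar> + 1)"
 define f where "f k = (if k = i then a else if k = j then b else \<gamma>)" for k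
 let ?c = "\<Sum>k<d. f k *R basis_pt k"
 have c: "coord ?c k = f k" if "k < d" for k using that by (simp only: coord_comb) simp
 have val: "ip d ?c (pl i j s t) = a * s + b * t" for s t using ij c by (simp add: pl_def ip_simps f_def mult.commute)
 show "EX c:Rpow d. ip d c (up d) > 0 & (ALL q:(%(s, t). pl i j s t) ` P - {p}. ip d c q < ip d c p)"
 proof (intro bexI conjI ballI)
  show "?c : Rpow d" by (rule Rpow_comb)
  have split: "{..<d} = insert i (insert j ({..<d} - {i, j}))" using ij by auto
  have "(\<Sum>k<d. f k) = a + b + (\<Sum>k\<in>{..<d} - {i, j}. f k)" by (subst split) (use ij in "simp add: f_def")
  also have "(\<Sum>k\<in>{..<d} - {i, j}. f k) = (\<Sum>k\<in>{..<d} - {i, j}. \<gamma>)" by (intro sum.cong) (auto simp: f_def)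
  also have "\<dots> = real (d - 2) * \<gamma>" using ij by (simp add: card_Diff_subset numeral_2_eq_2)
  finally have s: "(\<Sum>k<d. f k) = a + b + real (d - 2) * \<gamma>" .
  have \<gamma>: "a + b + \<gamma> < 0" "\<gamma> < 0" by (auto simp: \<gamma>_def)
  have "(\<Sum>k<d. f k) < 0"
  proof (cases "3 <= d")
   case True
   hence "real (d - 2) * \<gamma> <= 1 * \<gamma>" using \<gamma>(2) by (intro mult_right_mono_neg) auto
   thus ?thesis unfolding s using \<gamma>(1) by linarith
  next
   case False
   moreover have "real (d - 2) * \<gamma> <= 0" using \<gamma>(2) by (simp add: mult_le_0_iff)
   ultimately show ?thesis unfolding s using ab by linarith
  qed
  thus "ip d ?c (up d) > 0" by (simp add: ip_up c)
  fix q assume "q : (%(s, t). pl i j s t) ` P - {p}"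
  then obtain s' t' where "(s', t') : P" "q = pl i j s' t'" "q ~= p" by auto
  thus "ip d ?c q < ip d ?c p" using lt[of s' t'] st(2) by (auto simp: val)
 qed
qed (use assms(4) in simp)

text \<open>The quadrangle behind \<open>quad_rel\<close>: a path that goes straight down by
  \<open>c\<close>, then along \<open>dir i j y\<close>, then along \<open>a\<close> times
  \<open>dir i j x\<close>.\<close>

definition chain4 :: "nat => nat => real => real => real => real => pt set" where
 "chain4 i j c a y x = (%(s, t). pl i j s t) ` {(0, 0), (0, -c), (1, - c - y), (1 + a, - c - y - a * x)}"

text \<open>The bound -1 comes from the last point: in the plane it is exposed by a functional
  \<open>(b, -1)\<close> with \<open>- x < b < 1\<close>, and this interval is nonempty exactly if
  \<open>-1 < x\<close>.\<close>

lemma chain4_admissible: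
 assumes ij: "i < d" "j < d" "i ~= j" and pos: "c > 0" "a > 0" and xy: "x < y" and x: "-1 < x \<or> 3 <= d"
 shows "admissible d (chain4 i j c a y x)" unfolding chain4_def
proof (rule admissible_planar[OF ij])
 fix s t assume "(s, t) : {(0, 0), (0, -c), (1, - c - y), (1 + a, - c - y - a * x)}"
 then consider "s = 0" "t = 0" | "s = 0" "t = -c" | "s = 1" "t = - c - y" | "s = 1 + a" "t = - c - y - a * x" by auto
 thus "EX b g. (b + g < 0 \<or> 3 <= d) & (ALL (s', t'):{(0, 0), (0, -c), (1, - c - y), (1 + a, - c - y - a * x)} - {(s, t)}.
   b * s' + g * t' < b * s + g * t)"
 proof cases
  case 1
  define b where "b = - (\<bar>x\<bar> + \<bar>y\<bar> + 2)"
  have "a * (b - x) < 0" by (rule mult_pos_neg[OF pos(2)]) (auto simp: b_def)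
  hence "a * b < a * x" by (simp only: right_diff_distrib diff_less_0_iff_less)
  moreover have "b < y" "b + 1 < 0" by (auto simp: b_def)
  ultimately have "b * (1 + a) < c + y + a * x" "b < c + y" "b < -1" using pos(1) by (simp_all add: algebra_simps)
  thus ?thesis using 1 pos by (rule_tac exI[of _ b], rule_tac exI[of _ 1]) (auto simp: algebra_simps)
 next
  case 2
  define b where "b = - (\<bar>x\<bar> + \<bar>y\<bar> + 2)"
  have "a * (b + x) < 0" by (rule mult_pos_neg[OF pos(2)]) (auto simp: b_def)
  hence "a * b + a * x < 0" by (simp only: distrib_left)
  moreover have "b + y < 0" "b - 1 < 0" by (auto simp: b_def)
  ultimately have "b * (1 + a) + y + a * x < 0" "b + y < 0" "b - 1 < 0" by (simp_all add: algebra_simps)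
  thus ?thesis using 2 pos by (rule_tac exI[of _ b], rule_tac exI[of _ "-1"]) (auto simp: algebra_simps)
 next
  case 3
  define b where "b = - ((x + y) / 2)"
  have "a * (b + x) < 0" by (rule mult_pos_neg[OF pos(2)]) (use xy in "auto simp: b_def")
  hence "a * b + a * x < 0" by (simp only: distrib_left)
  moreover have "b + y > 0" "b - 1 < 0 \<or> 3 <= d" using xy x by (auto simp: b_def)
  ultimately show ?thesis using 3 pos by (rule_tac exI[of _ b], rule_tac exI[of _ "-1"]) (auto simp: algebra_simps)
 next
  case 4
  define b where "b = (if -1 < x then (1 - x) / 2 else 1 - x)"
  have "b + x > 0" "b - 1 < 0 \<or> 3 <= d" using x by (auto simp: b_def field_simps)
  hence "a * b + a * x > 0" "b + y > 0" "b - 1 < 0 \<or> 3 <= d"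
   using pos xy mult_pos_pos[OF pos(2), of "b + x"] by (auto simp: distrib_left)
  thus ?thesis using 4 pos by (rule_tac exI[of _ b], rule_tac exI[of _ "-1"]) (auto simp: algebra_simps)
 qed
qed simp

definition triangle_of :: "'a::real_vector => 'a => 'a => bool" where
 "triangle_of u v w \<longleftrightarrow> (EX p q r. pos_par (q - p) u & pos_par (r - q) v & pos_par (r - p) w)"

definition quadrangle_of :: "'a::real_vector => 'a => 'a => 'a => 'a => 'a => bool" where
 "quadrangle_of u v w u' v' w' \<longleftrightarrow> (EX p q r s. pos_par (q - p) u & pos_par (r - q) v & pos_par (s - r) w &
   pos_par (r - p) u' & pos_par (s - q) v' & pos_par (s - p) w')"

lemma chain4_relations:
 assumes ij: "i < d" "j < d" "i ~= j" and xy: "x < A" "A < y" "y < B" and q: "quad_rel x A y B C" and x: "-1 < x \<or> 3 <= d"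
 shows "clusters d (%x'. quadrangle_of (sv x' (pl i j 0 (-1))) (sv x' (dir i j y)) (sv x' (dir i j x))
  (sv x' (dir i j B)) (sv x' (dir i j A)) (sv x' (dir i j C)))"
proof -
 \<comment> \<open>\<open>c\<close> and \<open>a\<close> are solved from the wanted slopes: the path
   has chords of slopes \<open>y + c\<close> and \<open>(y + a * x) / (1 + a)\<close>, which should
   be \<open>B\<close> and \<open>A\<close>.\<close>
 define c where "c = B - y"
 define a where "a = (y - A) / (A - x)"
 have pos: "c > 0" "a > 0" using xy by (auto simp: c_def a_def)
 let ?X = "chain4 i j c a y x"
 let ?p0 = "pl i j 0 0" and ?p1 = "pl i j 0 (-c)" and ?p2 = "pl i j 1 (- c - y)"
 let ?p3 = "pl i j (1 + a) (- c - y - a * x)"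
 have X: "admissible d ?X" using ij pos xy x by (intro chain4_admissible) auto
 have A: "(1 + a) * A = y + a * x"
 proof -
  have "a * (A - x) = y - A" using xy by (simp add: a_def)
  thus ?thesis by (simp add: algebra_simps)
 qed
 have a1: "(1 + a) * (A - x) = y - x" using xy by (simp add: a_def field_simps)
 have "(C - A) * ((1 + a) * (A - x)) = c * (A - x)" using q unfolding a1 quad_rel_def c_def .
 hence "((1 + a) * (C - A)) * (A - x) = c * (A - x)" by (simp add: ac_simps)
 hence "(1 + a) * (C - A) = c" using xy by simp
 hence C: "(1 + a) * C = c + y + a * x" using A by (simp add: right_diff_distrib)
 have inX: "?p0 : ?X" "?p1 : ?X" "?p2 : ?X" "?p3 : ?X" by (auto simp: chain4_def)
 have v: "?p0 ~= ?p1" "?p1 - ?p0 = c *R pl i j 0 (-1)" "?p1 ~= ?p2" "?p2 - ?p1 = 1 *R dir i j y"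
  "?p2 ~= ?p3" "?p3 - ?p2 = a *R dir i j x" "?p0 ~= ?p2" "?p2 - ?p0 = 1 *R dir i j B"
  "?p1 ~= ?p3" "?p3 - ?p1 = (1 + a) *R dir i j A" "?p0 ~= ?p3" "?p3 - ?p0 = (1 + a) *R dir i j C" "0 < 1 + a"
  using pos ij A C by (auto simp: pl_diff pl_scale pl_inject c_def)
 note m = model_direction[OF X]
 show ?thesis using m[OF inX(1,2) v(1,2) pos(1)] m[OF inX(2,3) v(3,4) zero_less_one] m[OF inX(3,4) v(5,6) pos(2)]
   m[OF inX(1,3) v(7,8) zero_less_one] m[OF inX(2,4) v(9,10,13)] m[OF inX(1,4) v(11-13)] unfolding quadrangle_of_def by eventually_elim blast
qed

text \<open>The first triangle of a quadrangle whose other slopes \<open>x\<close> and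
  \<open>A\<close> are placed freely below \<open>k\<close>.\<close>

lemma chain3_relation:
 assumes ij: "i < d" "j < d" "i ~= j" and k: "-1 < k \<or> 3 <= d" and "k < l"
 shows "clusters d (%x'. triangle_of (sv x' (pl i j 0 (-1))) (sv x' (dir i j k)) (sv x' (dir i j l)))"
proof -
 define x where "x = (if -1 < k then (k - 1) / 2 else k - 1)"
 have x: "x < k" "-1 < x \<or> 3 <= d" using k by (auto simp: x_def)
 define A where "A = (x + k) / 2"
 have A: "x < A" "A < k" using x(1) by (auto simp: A_def)
 have "quad_rel x A k l (A + (l - k) * (A - x) / (k - x))" using x(1) by (simp add: quad_rel_def)
 from chain4_relations[OF ij A assms(5) this x(2)] show ?thesis by (rule eventually_mono) (unfold triangle_of_def quadrangle_of_def, blast)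
qed

definition indep_pair :: "'a::real_vector => 'a => bool" where
 "indep_pair U V \<longleftrightarrow> (ALL a b. a *R U + b *R V = 0 --> a = 0 & b = 0)"

lemma indep_pairD:
 assumes "indep_pair U V" "a *R U + b *R V = a' *R U + b' *R V"
 shows "a = a'" "b = b'"
proof -
 have "(a - a') *R U + (b - b') *R V = 0" using assms(2) by (simp add: algebra_simps)
 hence "a - a' = 0 & b - b' = 0" using assms(1) unfolding indep_pair_def by blast
 thus "a = a'" "b = b'" by auto
qed

lemma pos_par_unique:
 assumes "indep_pair U V" "pos_par a (U + t *R V)" "pos_par a (U + t' *R V)"
 shows "t = t'"
proof -
 obtain g where g1: "g > 0" "a = g *R (U + t *R V)" using assms(2) by (auto simp: pos_par_def)
 obtain g' where g2: "g' > 0" "a = g' *R (U + t' *R V)" using assms(3) by (auto simp: pos_par_def)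
 note g = g1 g2
 have "g *R (U + t *R V) = g' *R (U + t' *R V)" using g(2,4) by (rule subst)
 hence "g *R U + (g * t) *R V = g' *R U + (g' * t') *R V" by (simp add: algebra_simps)
 from indep_pairD[OF assms(1) this] g show ?thesis by simp
qed

lemma triangle_cases:
 assumes "triangle_of u v w" "pos_par u u'" "pos_par v v'" "pos_par w w'"
 obtains a b c where "0 < a" "0 < b" "0 < c" "a *R u' + b *R v' = c *R w'"
proof -
 obtain p q r where "pos_par (q - p) u'" "pos_par (r - q) v'" "pos_par (r - p) w'" using assms pos_par_trans unfolding triangle_of_def by blast
 then obtain a b c where "0 < a" "q - p = a *R u'" "0 < b" "r - q = b *R v'" "0 < c" "r - p = c *R w'"
  unfolding pos_par_def by blast
 moreover have "(q - p) + (r - q) = r - p" by simp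
 ultimately show ?thesis using that by metis
qed

lemma chain3_linear:
 assumes UV: "indep_pair U V" and s: "pos_par sV V" "pos_par sk (U + t *R V)" "pos_par sl (U + t' *R V)" and tri: "triangle_of sV sk sl"
 shows "t < t'"
proof -
 obtain a b c where abc: "0 < a" "0 < b" "0 < c" "a *R V + b *R (U + t *R V) = c *R (U + t' *R V)"
  by (rule triangle_cases[OF tri s])
 hence "c *R U + (c * t') *R V = b *R U + (a + b * t) *R V" by (simp add: algebra_simps)
 from indep_pairD[OF UV this] have "c * t < c * t'" using abc(1) by simp
 thus ?thesis using abc(3) by simp
qed

text \<open>Comparing coefficients of \<open>U\<close> and \<open>V\<close> along the closed paths
  gives the step lengths in terms of the slopes; eliminating them leaves the slope relation.\<close>

lemma chain4_linear:
 assumes UV: "indep_pair U V" and s: "pos_par sV V" "pos_par sx (U + x *R V)" "pos_par sA (U + A *R V)"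
   "pos_par sy (U + y *R V)" "pos_par sB (U + B *R V)" "pos_par sC (U + C *R V)" and quad: "quadrangle_of sV sy sx sB sA sC"
 shows "quad_rel x A y B C"
proof -
 obtain p q r z where "pos_par (q - p) V" "pos_par (r - q) (U + y *R V)" "pos_par (z - r) (U + x *R V)"
  "pos_par (r - p) (U + B *R V)" "pos_par (z - q) (U + A *R V)" "pos_par (z - p) (U + C *R V)"
  using quad s pos_par_trans unfolding quadrangle_of_def by blast
 then obtain a1 a2 a3 b1 b2 b3 where a: "0 < a2" "0 < a3" and e: "q - p = a1 *R V" "r - q = a2 *R (U + y *R V)"
  "z - r = a3 *R (U + x *R V)" "r - p = b1 *R (U + B *R V)" "z - q = b2 *R (U + A *R V)" "z - p = b3 *R (U + C *R V)"
  unfolding pos_par_def by blast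
 have "a1 *R V + a2 *R (U + y *R V) = b1 *R (U + B *R V)" unfolding e[symmetric] by simp
 hence e1: "a2 *R U + (a1 + a2 * y) *R V = b1 *R U + (b1 * B) *R V" by (simp add: algebra_simps)
 have "a2 *R (U + y *R V) + a3 *R (U + x *R V) = b2 *R (U + A *R V)" unfolding e[symmetric] by simp
 hence e2: "(a2 + a3) *R U + (a2 * y + a3 * x) *R V = b2 *R U + (b2 * A) *R V" by (simp add: algebra_simps)
 have "a1 *R V + a2 *R (U + y *R V) + a3 *R (U + x *R V) = b3 *R (U + C *R V)" unfolding e[symmetric] by simp
 hence e3: "(a2 + a3) *R U + (a1 + a2 * y + a3 * x) *R V = b3 *R U + (b3 * C) *R V" by (simp add: algebra_simps)
 note i = indep_pairD[OF UV e1] indep_pairD[OF UV e2] indep_pairD[OF UV e3]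
 have 1: "a2 * (B - y) = a1" and A: "(a2 + a3) * A = a2 * y + a3 * x" and C: "(a2 + a3) * C = a1 + a2 * y + a3 * x"
  using i by (simp_all add: algebra_simps)
 have 2: "(a2 + a3) * (A - x) = a2 * (y - x)" using A by (simp add: algebra_simps)
 have 3: "(a2 + a3) * (C - A) = a1" using A C by (simp add: algebra_simps)
 have "(a2 + a3) * ((C - A) * (y - x)) = a1 * (y - x)" unfolding 3[symmetric] by (simp only: ac_simps)
 also have "\<dots> = (B - y) * (a2 * (y - x))" unfolding 1[symmetric] by (simp only: ac_simps)
 also have "\<dots> = (a2 + a3) * ((B - y) * (A - x))" unfolding 2[symmetric] by (simp only: ac_simps)
 finally show ?thesis using a by (simp add: quad_rel_def)
qed

context
 fixes d i j :: nat
 assumes ij: "i < d" "j < d" "i ~= j"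
begin

lemma frame_directions:
 "clusters d (%x'. pos_par (sv x' (pl i j 0 (-1))) (- frame_vec d x' j))" (is ?A)
 "clusters d (%x'. pos_par (sv x' (dir i j 0)) (frame_vec d x' i))" (is ?B)
 "clusters d (%x'. pos_par (sv x' (dir i j 1)) (frame_vec d x' i + 1 *R (- frame_vec d x' j)))" (is ?C)
proof -
 have F: "admissible d (frame d)" using ij by (intro admissible_frame) auto
 have m: "0 : frame d" "basis_pt i : frame d" "basis_pt j : frame d" using ij by (auto simp: frame_def)
 have ne: "basis_pt k ~= 0" "basis_pt i ~= basis_pt j" for k :: nat using ij(3) by (metis coord_basis_pt lookup_zero zero_neq_one)+
 have v: "0 - basis_pt j = 1 *R pl i j 0 (-1)" "basis_pt i - 0 = 1 *R dir i j 0" "basis_pt i - basis_pt j = 1 *R dir i j 1"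
  by (simp_all add: pl_def)
 note n = model_direction[OF F _ _ _ _ zero_less_one]
 show ?A using n[OF m(3,1) ne(1) v(1)] by (rule eventually_mono) (rule pos_par_sym, simp add: frame_vec_def)
 show ?B using n[OF m(1,2) ne(1)[symmetric] v(2)] by (rule eventually_mono) (rule pos_par_sym, simp add: frame_vec_def)
 show ?C using n[OF m(3,2) ne(2)[symmetric] v(3)] by (rule eventually_mono) (rule pos_par_sym, simp add: frame_vec_def)
qed

lemma planar_indep: "clusters d (%x'. indep_pair (frame_vec d x' i) (- frame_vec d x' j))"
 using model_frame_pair[OF ij] unfolding indep_pair_def .

text \<open>A triangle with the vertical and horizontal directions shows that every slope
  \<open>z\<close> acquires some slope \<open>h z\<close> relative to the frame vectors. Triangles
  make \<open>h\<close> monotone and quadrangles preserve \<open>quad_rel\<close>, so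
  \<open>h\<close> is a number model and fixes the algebraic number \<open>k\<close>.\<close>

lemma direction_nonneg:
 assumes k: "algebraic k" "0 <= k"
 shows "clusters d (%x'. pos_par (sv x' (dir i j k)) (frame_vec d x' i + k *R (- frame_vec d x' j)))"
proof -
 obtain S0 where S0: "finite S0" "S0 <= {0..}" "!!h. number_model S0 h ==> h k = k"
  using forced_algebraic[OF k] unfolding eventually_number_models by blast
 define S where "S = insert 0 (insert 1 (insert k S0))"
 have S: "finite S" "S <= {0..}" using S0 k by (auto simp: S_def)
 let ?s = "%x' k. sv x' (dir i j k)" and ?v = "%x'. sv x' (pl i j 0 (-1))"
 have x: "-1 < x \<or> 3 <= d" if "x : S" for x using S(2) that by force
 have e2: "clusters d (%x'. ALL x:S. ALL y:S. x < y --> triangle_of (?v x') (?s x' x) (?s x' y))"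
  using x by (intro eventually_ball_finite S(1) ballI eventually_impI chain3_relation[OF ij]) auto
 have e3: "clusters d (%x'. ALL x:S. ALL A:S. ALL y:S. ALL B:S. ALL C:S. x < A & A < y & y < B & quad_rel x A y B C -->
   quadrangle_of (?v x') (?s x' y) (?s x' x) (?s x' B) (?s x' A) (?s x' C))"
  using x by (intro eventually_ball_finite S(1) ballI eventually_impI chain4_relations[OF ij]) auto
 show ?thesis using frame_directions planar_indep e2 e3
 proof eventually_elim
  case (elim x')
  define U where "U = frame_vec d x' i"
  define V where "V = - frame_vec d x' j"
  note elim = elim[folded U_def V_def]
  have "ALL z:S. EX t. pos_par (sv x' (dir i j z)) (U + t *R V)"
  proof
   fix z assume z: "z : S"
   show "EX t. pos_par (sv x' (dir i j z)) (U + t *R V)"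
   proof (cases "z = 0")
    case True
    thus ?thesis using elim(2) by (intro exI[of _ 0]) simp
   next
    case False
    hence "0 < z" using z S(2) by force
    moreover have "0 : S" by (simp add: S_def)
    ultimately have "triangle_of (?v x') (?s x' 0) (?s x' z)" using elim(5) z by blast
    then obtain a b c where abc: "0 < a" "0 < b" "0 < c" "a *R V + b *R U = c *R ?s x' z"
     by (rule triangle_cases[OF _ elim(1,2) pos_par_refl])
    have "c *R ?s x' z = b *R (U + (a / b) *R V)" unfolding abc(4)[symmetric] using abc(2) by (simp add: scaleR_add_right)
    hence "pos_par (c *R ?s x' z) (U + (a / b) *R V)" unfolding pos_par_def using abc(2) by blast
    hence "pos_par (?s x' z) (U + (a / b) *R V)" by (simp add: pos_par_scale[OF abc(3)])
    thus ?thesis by blast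
   qed
  qed
  from bchoice[OF this] obtain h where h: "ALL z:S. pos_par (sv x' (dir i j z)) (U + h z *R V)"
   by (elim exE) (rule that)
  have "number_model S h" unfolding number_model_def
  proof (intro conjI ballI impI)
   show "h 0 = 0" using h elim(2) by (intro pos_par_unique[OF elim(4), of "sv x' (dir i j 0)"]) (auto simp: S_def)
   show "h 1 = 1" using h elim(3) by (intro pos_par_unique[OF elim(4), of "sv x' (dir i j 1)"]) (auto simp: S_def)
  next
   fix x y assume xy: "x : S" "y : S" "x < y"
   hence "triangle_of (?v x') (?s x' x) (?s x' y)" using elim(5) by blast
   thus "h x < h y" by (rule chain3_linear[OF elim(4,1) h[rule_format, OF xy(1)] h[rule_format, OF xy(2)]])
  next
   fix x A y B C assume m: "x : S" "A : S" "y : S" "B : S" "C : S"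
    and c: "x < A & A < y & y < B & quad_rel x A y B C"
   show "quad_rel (h x) (h A) (h y) (h B) (h C)"
    by (rule chain4_linear[OF elim(4,1) h[rule_format, OF m(1)] h[rule_format, OF m(2)]
      h[rule_format, OF m(3)] h[rule_format, OF m(4)] h[rule_format, OF m(5)] elim(6)[rule_format, OF m c]])
  qed
  hence "h k = k" by (intro S0(3)) (rule number_model_mono, auto simp: S_def)
  thus ?case using h[rule_format, of k] by (simp add: S_def U_def V_def)
 qed
qed

text \<open>A negative slope is caught by one quadrangle whose other slopes 0, 1, 2 and
  \<open>C\<close> are nonnegative and therefore already forced; \<open>C\<close> solves
  \<open>quad_rel k 0 1 2 C\<close>.\<close>

lemma direction_planar:
 assumes k: "algebraic k" "0 <= k \<or> 3 <= d"
 shows "clusters d (%x'. pos_par (sv x' (dir i j k)) (frame_vec d x' i + k *R (- frame_vec d x' j)))"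
proof (cases "0 <= k")
 case True
 thus ?thesis using direction_nonneg k(1) by blast
next
 case False
 hence k0: "k < 0" and d: "-1 < k \<or> 3 <= d" using k(2) by auto
 define C where "C = - k / (1 - k)"
 have "0 <= C" unfolding C_def using k0 by (intro divide_nonneg_pos) auto
 moreover have "C * (1 - k) = - k" using k0 by (auto simp: C_def)
 ultimately have C: "0 <= C" "C * (1 - k) = - k" by auto
 have "algebraic (0 - k)" "algebraic (1 - k)" using k(1) by (intro algebraic_diff; simp)+
 hence algC: "algebraic C" unfolding C_def using algebraic_divide[of "0 - k" "1 - k"] by simp
 have q: "quad_rel k 0 1 2 C" using C by (simp add: quad_rel_def)
 have e: "clusters d (%x'. pos_par (sv x' (dir i j l)) (frame_vec d x' i + l *R (- frame_vec d x' j)))"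
  if "l : {0, 1, 2, C}" for l using direction_nonneg[of l] that C algC by auto
 have es: "clusters d (%x'. pos_par (sv x' (dir i j 1)) (frame_vec d x' i + 1 *R (- frame_vec d x' j)))"
  "clusters d (%x'. pos_par (sv x' (dir i j 2)) (frame_vec d x' i + 2 *R (- frame_vec d x' j)))"
  "clusters d (%x'. pos_par (sv x' (dir i j C)) (frame_vec d x' i + C *R (- frame_vec d x' j)))" by (rule e; simp)+
 have k1: "k < 1" using k0 by simp
 have "(0::real) < 1" "(1::real) < 2" by auto
 note c4 = chain4_relations[OF ij k0 this q d]
 show ?thesis using frame_directions(1) planar_indep e[OF insertI1] es c4 chain3_relation[OF ij d k1]
 proof eventually_elim
  case (elim x')
  define U where "U = frame_vec d x' i"
  define V where "V = - frame_vec d x' j"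
  note elim = elim[folded U_def V_def]
  have s: "pos_par (sv x' (dir i j l)) (U + l *R V)" if "l : {0, 1, 2, C}" for l using elim(3-6) that by auto
  obtain a b c where abc: "0 < a" "0 < b" "0 < c" "a *R V + b *R sv x' (dir i j k) = c *R (U + 1 *R V)"
   by (rule triangle_cases[OF elim(8,1) pos_par_refl s[of 1]]) auto
  define t where "t = 1 - a / c"
  have "b *R sv x' (dir i j k) = c *R (U + t *R V)"
   using arg_cong[OF abc(4), of "%z. z - a *R V"] abc(3) by (simp add: t_def algebra_simps)
  hence "pos_par (b *R sv x' (dir i j k)) (U + t *R V)" unfolding pos_par_def using abc(3) by blast
  hence sk: "pos_par (sv x' (dir i j k)) (U + t *R V)" by (simp add: pos_par_scale[OF abc(2)])
  have "quad_rel t 0 1 2 C" by (rule chain4_linear[OF elim(2,1) sk s s s s elim(7)]) auto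
  hence "C * (1 - t) = C * (1 - k) + (k - t)" using C by (simp add: quad_rel_def)
  hence "(k - t) * (1 - C) = 0" by (simp add: algebra_simps)
  moreover have "C < 1"
  proof (rule ccontr)
   assume "~ C < 1"
   hence "1 * (1 - k) <= C * (1 - k)" using k0 by (intro mult_right_mono) auto
   thus False using C(2) by simp
  qed
  ultimately have "t = k" by auto
  thus ?case using sk unfolding U_def V_def by simp
 qed
qed

end

definition frame_map :: "nat => (pt set => pt => 'a::real_vector) => pt => 'a" where
 "frame_map d x' y = (\<Sum>k<d. coord y k *R frame_vec d x' k)"

lemma linear_frame_map: "linear (frame_map d x')"
 by (rule linearI) (simp_all add: frame_map_def lookup_add scaleR_add_left sum.distrib scaleR_sum_right)

lemmas frame_map_simps = linear_add[OF linear_frame_map] linear_diff[OF linear_frame_map]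
 linear_scale[OF linear_frame_map] linear_sum[OF linear_frame_map] linear_0[OF linear_frame_map]

lemma frame_map_basis: "k < d ==> frame_map d x' (basis_pt k) = frame_vec d x' k"
 by (simp add: frame_map_def if_distrib[of "%a. a *R _"] cong: if_cong)

lemma frame_map_injective:
 "clusters d (%x'. ALL y:Rpow d. frame_map d x' y = 0 --> y = 0)" using model_frame
proof eventually_elim
 case (elim x')
 show ?case
 proof (intro ballI impI)
  fix y assume y: "y : Rpow d" "frame_map d x' y = 0"
  hence "ALL k<d. coord y k = 0" using elim unfolding frame_map_def by blast
  moreover have "coord y k = 0" if "~ k < d" for k using y(1) that by (simp add: Rpow_def)
  ultimately show "y = 0" by (intro poly_mapping_eqI) (simp, blast)
 qed
qed

lemma model_step:
 assumes X: "admissible d X" "p : X" "q : X" "q - p = l *R basis_pt i" "l ~= 0" "i < d" "2 <= d"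
 shows "clusters d (%x'. pos_par (x' X q - x' X p) (l *R frame_vec d x' i))"
proof -
 have F: "admissible d (frame d)" using assms by (intro admissible_frame) auto
 have m: "0 : frame d" "basis_pt i : frame d" using assms by (auto simp: frame_def)
 have nz: "basis_pt i ~= 0" by (metis coord_basis_pt lookup_zero zero_neq_one)
 have ne: "p ~= q" using X(4,5) nz by auto
 show ?thesis
 proof (cases "l > 0")
  case True
  have "clusters d (%x'. EX k'>0. x' X q - x' X p = k' *R (x' (frame d) (basis_pt i) - x' (frame d) 0))"
   by (rule model_parallel[OF X(1) F X(2,3) m ne, where k = l]) (use X True in auto)
  thus ?thesis by (rule eventually_mono) (simp add: pos_par_scale'[OF True], simp add: pos_par_def frame_vec_def)
 next
  case False
  hence l: "- l > 0" using X(5) by simp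
  have "clusters d (%x'. EX k'>0. x' X q - x' X p = k' *R (x' (frame d) 0 - x' (frame d) (basis_pt i)))"
   by (rule model_parallel[OF X(1) F X(2,3) m(2,1) ne, where k = "- l"]) (use X l in auto)
  thus ?thesis
  proof (rule eventually_mono)
   fix x' :: "pt set => pt => 'a"
   assume "EX k'>0. x' X q - x' X p = k' *R (x' (frame d) 0 - x' (frame d) (basis_pt i))"
   hence "pos_par (x' X q - x' X p) (- frame_vec d x' i)" by (simp add: pos_par_def frame_vec_def)
   hence "pos_par (x' X q - x' X p) ((- l) *R (- frame_vec d x' i))" using pos_par_scale'[OF l] by blast
   thus "pos_par (x' X q - x' X p) (l *R frame_vec d x' i)" by simp
  qed
 qed
qed

lemma model_two_steps:
 assumes X: "admissible d X" "p : X" "q : X" "q - p = pl i j l l'" "l ~= 0" "algebraic l" "algebraic l'"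
  and ij: "i < d" "j < d" "i ~= j" and sgn: "l * l' < 0 \<or> 3 <= d"
 shows "\<forall>\<^sub>F x' in (cluster_models d :: (pt set => pt => 'a::real_vector) filter). pos_par (x' X q - x' X p) (l *R frame_vec d x' i + l' *R frame_vec d x' j)"
proof -
 define k where "k = - l' / l"
 have lk: "l * k = - l'" using X(5) by (simp add: k_def)
 have "algebraic (0 - l')" using X(7) by (intro algebraic_diff) auto
 hence "algebraic k" unfolding k_def using algebraic_divide[of "0 - l'" l] X(6) by simp
 moreover have "0 <= k \<or> 3 <= d" using sgn by (auto simp: k_def mult_less_0_iff divide_le_0_iff)
 ultimately have dirk: "clusters d (%x'. pos_par (sv x' (dir i j k)) (frame_vec d x' i + k *R (- frame_vec d x' j)))"
  by (rule direction_planar[OF ij])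
 have ne: "p ~= q" using X(4,5) ij pl_inject[of i j l l' 0 0] by (auto simp: pl_0)
 have comb: "l *R (U + k *R (- V)) = l *R U + l' *R V" for U V :: 'a
 proof -
  have "l *R (U + k *R (- V)) = l *R U - (l * k) *R V" by (simp add: algebra_simps)
  thus ?thesis unfolding lk by simp
 qed
 show ?thesis
 proof (cases "l > 0")
  case True
  have "clusters d (%x'. pos_par (x' X q - x' X p) (sv x' (dir i j k)))"
   by (rule model_direction[OF X(1-3) ne, where k = l]) (use X True lk in "auto simp: pl_scale")
  thus ?thesis using dirk
  proof eventually_elim
   case (elim x')
   from pos_par_trans[OF elim] show ?case unfolding comb[symmetric] pos_par_scale'[OF True] .
  qed
 next
  case False
  hence l: "- l > 0" using X(5) by simp
  have "p - q = pl i j (- l) (- l')" using arg_cong[OF X(4), of uminus] by (simp add: pl_def)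
  hence "p - q = (- l) *R dir i j k" using lk by (simp add: pl_scale)
  hence "clusters d (%x'. pos_par (x' X p - x' X q) (sv x' (dir i j k)))"
   by (intro model_direction[OF X(1,3,2) not_sym[OF ne], where k = "- l"]) (use l in auto)
  thus ?thesis using dirk
  proof eventually_elim
   case (elim x')
   from pos_par_trans[OF elim] have "pos_par (- (x' X q - x' X p)) (frame_vec d x' i + k *R (- frame_vec d x' j))" by simp
   hence "pos_par (- (x' X q - x' X p)) ((- l) *R (frame_vec d x' i + k *R (- frame_vec d x' j)))" using pos_par_scale'[OF l] by blast
   hence "pos_par (- (x' X q - x' X p)) (- (l *R (frame_vec d x' i + k *R (- frame_vec d x' j))))" by simp
   thus ?case unfolding comb pos_par_minus .
  qed
 qed
qed

lemma three_le:
 assumes "i < d" "j < d" "k < (d::nat)" "i ~= j" "j ~= k" "i ~= k"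
 shows "3 <= d"
proof -
 have "card {i, j, k} <= card {..<d}" using assms by (intro card_mono) auto
 thus ?thesis using assms by simp
qed

text \<open>A vector with coordinates of both signs is the last point of a path of multiples of basis vectors. The path is
 admissible if it starts with a negative multiple, and the planar case determines the ratios of consecutive steps.\<close>

lemma direction_mixed_sign:
 assumes v: "v : Rpow d" "algebraic_pt v" and neg: "i0 < d" "coord v i0 < 0" and pos: "j0 < d" "coord v j0 > 0"
 shows "clusters d (%x'. pos_par (sv x' v) (frame_map d x' v))"
proof -
 have ne: "i0 ~= j0" using neg pos by auto
 hence d2: "2 <= d" using neg(1) pos(1) by linarith
 define \<pi> where "\<pi> = i0 # sorted_list_of_set ({k. k < d & coord v k ~= 0} - {i0})"
 have \<pi>: "distinct \<pi>" "set \<pi> = {k. k < d & coord v k ~= 0}" using neg by (auto simp: \<pi>_def)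
 define m where "m = length \<pi>"
 define e where "e r = \<pi> ! r" for r
 define lam where "lam r = coord v (e r)" for r
 have m0: "0 < m" "e 0 = i0" by (simp_all add: m_def \<pi>_def e_def)
 have er: "e r < d" "lam r ~= 0" if "r < m" for r using nth_mem[of r \<pi>] that \<pi>(2) by (auto simp: m_def e_def lam_def)
 have einj: "e r = e s \<longleftrightarrow> r = s" if "r < m" "s < m" for r s using nth_eq_iff_index_eq[OF \<pi>(1)] that by (simp add: m_def e_def)
 have bij: "bij_betw e {..<m} (set \<pi>)" unfolding m_def e_def by (rule bij_betw_nth[OF \<pi>(1)]) auto
 have ex: "EX r<m. e r = k" if "k < d" "coord v k ~= 0" for k
 proof -
  have "k : e ` {..<m}" using bij that \<pi>(2) by (auto simp: bij_betw_def)
  thus ?thesis by auto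
 qed
 define n where "n l = (\<Sum>r<l. lam r *R basis_pt (e r))" for l
 have n0: "n 0 = 0" by (simp add: n_def)
 have nm: "n m = v"
 proof -
  have "n m = (\<Sum>k\<in>set \<pi>. coord v k *R basis_pt k)"
   unfolding n_def lam_def by (rule sum.reindex_bij_betw[OF bij, of "%k. coord v k *R basis_pt k"])
  also have "\<dots> = (\<Sum>k<d. coord v k *R basis_pt k)" using \<pi>(2) by (intro sum.mono_neutral_left) auto
  finally show ?thesis using Rpow_expansion[OF v(1)] by simp
 qed
 define X where "X = n ` {..m}"
 have nX: "n l : X" if "l <= m" for l using that by (simp add: X_def)
 have nR: "n l : Rpow d" if "l <= m" for l
  unfolding n_def using that er by (intro subspace_sum subspace_scale subspace_Rpow) (auto simp: basis_pt_in_Rpow)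
 have X: "admissible d X" unfolding admissible_def
 proof (intro conjI ballI)
  show "finite X" by (simp add: X_def)
  show "X <= Rpow d" using nR by (auto simp: X_def)
  fix p assume "p : X"
  then obtain l where l: "l <= m" "p = n l" by (auto simp: X_def)
  \<comment> \<open>The exposing functional increases along the path up to \<open>n l\<close> and
    decreases afterwards. A step helps positivity on \<open>up d\<close> if it is negative before
    \<open>l\<close> or positive from \<open>l\<close> on: the first step is negative, and for
    \<open>l = 0\<close> the positive coordinate \<open>j0\<close> is available.\<close>
  obtain r0 where r0: "r0 < m" "(if r0 < l then -1 else 1) * lam r0 > 0"
  proof (cases "l = 0")
   case True
   obtain r where "r < m" "e r = j0" using ex[of j0] pos by auto
   thus ?thesis using pos True by (intro that[of r]) (auto simp: lam_def)
  next
   case False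
   thus ?thesis using m0 neg by (intro that[of 0]) (auto simp: lam_def)
  qed
  define Q where "Q = (\<Sum>r<m. 1 / \<bar>lam r\<bar>)"
  have Q0: "0 <= Q" unfolding Q_def by (intro sum_nonneg) auto
  \<comment> \<open>Weight of the helpful step, chosen so that it contributes \<open>1 + Q\<close>
    to \<open>ip d ?c (up d)\<close>; the other steps, with weight 1, can take away at most
    \<open>Q\<close>.\<close>
  define N where "N = \<bar>lam r0\<bar> * (1 + Q)"
  have N0: "N > 0" using er(2)[OF r0(1)] Q0 by (simp add: N_def)
  define t where "t r = (if r < l then 1 else -1) * (if r = r0 then N else 1)" for r
  have tpos: "t r > 0" if "r < l" for r using N0 that by (simp add: t_def)
  have tneg: "t r < 0" if "~ r < l" for r using N0 that by (simp add: t_def)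
  let ?c = "\<Sum>r<m. (t r / lam r) *R basis_pt (e r)"
  have cR: "?c : Rpow d" using er by (intro subspace_sum subspace_scale subspace_Rpow) (auto simp: basis_pt_in_Rpow)
  have coord: "coord ?c (e s) = t s / lam s" if "s < m" for s
  proof -
   have "coord ?c (e s) = (\<Sum>r<m. if r = s then t s / lam s else 0)" unfolding lookup_sum using that by (intro sum.cong) (auto simp: einj)
   thus ?thesis using that by simp
  qed
  have val: "ip d ?c (n l') = (\<Sum>r<l'. t r)" if "l' <= m" for l'
  proof -
   have "ip d ?c (n l') = (\<Sum>r<l'. lam r * ip d ?c (basis_pt (e r)))" by (simp add: n_def ip_simps)
   also have "\<dots> = (\<Sum>r<l'. t r)" using that er coord by (intro sum.cong) auto
   finally show ?thesis .
  qed
  have "ip d ?c (up d) = ip d (up d) ?c" by (rule ip_commute)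
  also have "\<dots> = (\<Sum>r<m. (t r / lam r) * ip d (up d) (basis_pt (e r)))" by (simp add: ip_simps)
  also have "\<dots> = (\<Sum>r<m. - (t r / lam r))"
  proof (intro sum.cong refl)
   fix r assume "r : {..<m}"
   hence "e r < d" using er by simp
   hence "ip d (up d) (basis_pt (e r)) = -1" by (simp add: up_def lookup_sum if_distrib cong: if_cong)
   thus "(t r / lam r) * ip d (up d) (basis_pt (e r)) = - (t r / lam r)" by simp
  qed
  also have "\<dots> >= (\<Sum>r<m. (if r = r0 then 1 + Q else 0) - 1 / \<bar>lam r\<bar>)"
  proof (rule sum_mono)
   fix r assume "r : {..<m}"
   show "(if r = r0 then 1 + Q else 0) - 1 / \<bar>lam r\<bar> <= - (t r / lam r)"
   proof (cases "r = r0")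
    case True
    have "- (t r0 / lam r0) = N / \<bar>lam r0\<bar>" using r0(2) by (auto simp: t_def split: if_splits)
    also have "\<dots> = 1 + Q" using er(2)[OF r0(1)] by (simp add: N_def)
    finally show ?thesis using True by simp
   next
    case False
    have "\<bar>t r / lam r\<bar> = 1 / \<bar>lam r\<bar>" using False by (simp add: t_def abs_mult)
    hence "t r / lam r <= 1 / \<bar>lam r\<bar>" by (metis abs_ge_self)
    thus ?thesis using False by simp
   qed
  qed
  moreover have "(\<Sum>r<m. (if r = r0 then 1 + Q else 0) - 1 / \<bar>lam r\<bar>) = 1" using r0(1) by (simp add: sum_subtractf Q_def)
  ultimately have up: "ip d ?c (up d) > 0" by linarith
  show "EX c:Rpow d. ip d c (up d) > 0 & (ALL q:X - {p}. ip d c q < ip d c p)"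
  proof (intro bexI[OF _ cR] conjI up ballI)
   fix q assume "q : X - {p}"
   then obtain l' where l': "l' <= m" "q = n l'" "l' ~= l" using l by (auto simp: X_def)
   show "ip d ?c q < ip d ?c p"
   proof (cases "l' < l")
    case True
    have "(\<Sum>r<l. t r) = (\<Sum>r<l'. t r) + (\<Sum>r\<in>{l'..<l}. t r)"
     using sum.atLeastLessThan_concat[of 0 l' l t] True by (simp add: atLeast0LessThan)
    moreover have "(\<Sum>r\<in>{l'..<l}. t r) > 0" using True tpos by (intro sum_pos) auto
    ultimately show ?thesis using val l l' by simp
   next
    case False
    have "(\<Sum>r<l'. t r) = (\<Sum>r<l. t r) + (\<Sum>r\<in>{l..<l'}. t r)"
     using sum.atLeastLessThan_concat[of 0 l l' t] False by (simp add: atLeast0LessThan)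
    moreover have "(\<Sum>r\<in>{l..<l'}. - t r) > 0" using False l'(3) tneg by (intro sum_pos) auto
    ultimately show ?thesis using val l l' by (simp add: sum_negf)
   qed
  qed
 qed
 have e1: "clusters d (%x'. ALL l:{..<m}. pos_par (x' X (n (Suc l)) - x' X (n l)) (lam l *R frame_vec d x' (e l)))"
 proof (intro eventually_ball_finite ballI)
  fix l assume "l : {..<m}"
  thus "clusters d (%x'. pos_par (x' X (n (Suc l)) - x' X (n l)) (lam l *R frame_vec d x' (e l)))"
   using er d2 by (intro model_step[OF X nX nX]) (auto simp: n_def)
 qed simp
 have e2: "clusters d (%x'. ALL l:{..<m-1}. pos_par (x' X (n (Suc (Suc l))) - x' X (n l))
   (lam l *R frame_vec d x' (e l) + lam (Suc l) *R frame_vec d x' (e (Suc l))))"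
 proof (intro eventually_ball_finite ballI)
  fix l assume "l : {..<m-1}"
  hence l: "l < m" "Suc l < m" by auto
  \<comment> \<open>Two consecutive steps of equal sign leave the opposite sign to a third
    coordinate, so the dimension is at least 3 and a slope of either sign is forced.\<close>
  have sgn: "lam l * lam (Suc l) < 0 \<or> 3 <= d"
  proof (rule ccontr)
   assume h: "~ (lam l * lam (Suc l) < 0 \<or> 3 <= d)"
   hence s: "(lam l > 0 & lam (Suc l) > 0) \<or> (lam l < 0 & lam (Suc l) < 0)"
    using er[OF l(1)] er[OF l(2)] by (auto simp: mult_less_0_iff)
   have "EX z<d. z ~= e l & z ~= e (Suc l)" using s
   proof
    assume "lam l > 0 & lam (Suc l) > 0"
    thus ?thesis using neg by (intro exI[of _ i0]) (auto simp: lam_def)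
   next
    assume "lam l < 0 & lam (Suc l) < 0"
    thus ?thesis using pos by (intro exI[of _ j0]) (auto simp: lam_def)
   qed
   then obtain z where "z < d" "z ~= e l" "z ~= e (Suc l)" by blast
   hence "3 <= d" using er[OF l(1)] er[OF l(2)] einj[OF l] by (intro three_le[of "e l" d "e (Suc l)" z]) auto
   thus False using h by simp
  qed
  show "clusters d (%x'. pos_par (x' X (n (Suc (Suc l))) - x' X (n l))
   (lam l *R frame_vec d x' (e l) + lam (Suc l) *R frame_vec d x' (e (Suc l))))" by (rule model_two_steps[OF X nX nX])
    (use l er einj[OF l] sgn v(2) in "auto simp: n_def pl_def lam_def algebraic_pt_def")
 qed simp
 have e3: "clusters d (%x'. ALL i:{..<d}. ALL j:{..<d}. i ~= j --> indep_pair (frame_vec d x' i) (- frame_vec d x' j))"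
 proof (intro eventually_ball_finite ballI)
  fix i j assume "i : {..<d}" "j : {..<d}"
  thus "clusters d (%x'. i ~= j --> indep_pair (frame_vec d x' i) (- frame_vec d x' j))"
   using planar_indep[of i d j] by (cases "i = j") auto
 qed auto
 have vn: "v ~= 0" using neg by auto
 have e4: "clusters d (%x'. pos_par (x' X (n m) - x' X (n 0)) (sv x' v))"
  by (rule model_direction[OF X nX nX, where k = 1]) (use nm n0 vn in auto)
 show ?thesis using e1 e2 e3 e4
 proof eventually_elim
  case (elim x')
  have "ALL l:{..<m}. EX \<kappa>. \<kappa> > 0 & x' X (n (Suc l)) - x' X (n l) = \<kappa> *R (lam l *R frame_vec d x' (e l))"
   using elim(1) by (simp add: pos_par_def)
  from bchoice[OF this] obtain \<kappa> where "ALL l:{..<m}. \<kappa> l > 0 &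
    x' X (n (Suc l)) - x' X (n l) = \<kappa> l *R (lam l *R frame_vec d x' (e l))" by (elim exE) (rule that)
  hence \<kappa>: "!!l. l < m ==> \<kappa> l > 0"
   "!!l. l < m ==> x' X (n (Suc l)) - x' X (n l) = \<kappa> l *R (lam l *R frame_vec d x' (e l))" by auto
  \<comment> \<open>The chord over two steps has a forced direction, and this equates the scale
    factors of the two steps.\<close>
  have step: "\<kappa> (Suc l) = \<kappa> l" if l: "Suc l < m" for l
  proof -
   define U where "U = frame_vec d x' (e l)"
   define V where "V = - frame_vec d x' (e (Suc l))"
   have l1: "l < m" using l by simp
   have UV: "indep_pair U V" using elim(3) er[OF l] er[OF l1] einj[OF l1 l] unfolding U_def V_def by auto
   obtain g where "x' X (n (Suc (Suc l))) - x' X (n l) = g *R (lam l *R frame_vec d x' (e l) + lam (Suc l) *R frame_vec d x' (e (Suc l)))"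
    using elim(2) l by (fastforce simp: pos_par_def)
   moreover have "x' X (n (Suc (Suc l))) - x' X (n l) =
     (x' X (n (Suc (Suc l))) - x' X (n (Suc l))) + (x' X (n (Suc l)) - x' X (n l))" by simp
   ultimately have "(g * lam l) *R U + (- g * lam (Suc l)) *R V = (\<kappa> l * lam l) *R U + (- \<kappa> (Suc l) * lam (Suc l)) *R V"
    unfolding \<kappa>(2)[OF l] \<kappa>(2)[OF l1] by (simp add: U_def V_def scaleR_add_right algebra_simps)
   from indep_pairD[OF UV this] show ?thesis using er[OF l] er[OF l1] by simp
  qed
  have \<kappa>0: "\<kappa> l = \<kappa> 0" if "l < m" for l using that by (induction l) (auto simp: step)
  have "x' X (n l) - x' X (n 0) = \<kappa> 0 *R (\<Sum>r<l. lam r *R frame_vec d x' (e r))" if "l <= m" for l using that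
  proof (induction l)
   case (Suc l)
   have "x' X (n (Suc l)) - x' X (n 0) = (x' X (n (Suc l)) - x' X (n l)) + (x' X (n l) - x' X (n 0))" by simp
   also have "\<dots> = \<kappa> l *R (lam l *R frame_vec d x' (e l)) + \<kappa> 0 *R (\<Sum>r<l. lam r *R frame_vec d x' (e r))"
    using Suc by (simp only: \<kappa>(2) Suc_le_eq)
   finally show ?case using \<kappa>0[of l] Suc.prems by (simp add: scaleR_add_right)
  qed simp
  from this[of m] have "x' X (n m) - x' X (n 0) = \<kappa> 0 *R (\<Sum>r<m. lam r *R frame_vec d x' (e r))" by simp
  also have "(\<Sum>r<m. lam r *R frame_vec d x' (e r)) = frame_map d x' (n m)" using er by (simp add: n_def frame_map_simps frame_map_basis)
  finally have "pos_par (x' X (n m) - x' X (n 0)) (frame_map d x' v)" using \<kappa>(1)[OF m0(1)] nm by (auto simp: pos_par_def)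
  moreover have "pos_par (x' X (n m) - x' X (n 0)) (sv x' v)" using elim(4) .
  ultimately show ?case using pos_par_sym pos_par_trans by blast
 qed
qed

text \<open>By flatness each chord has coordinates of both signs, so its direction is forced. The
  three sides of a triangle close up, and as no three points are collinear their scale factors
  agree; hence one factor serves the whole cluster.\<close>

theorem cluster_rigid:
 assumes X: "admissible d X" and alg: "!!p. p : X ==> algebraic_pt p"
  and flat: "!!p q. p : X ==> q : X ==> p ~= q ==> EX i<d. coord p i < coord q i"
 shows "clusters d (%x'. EX \<kappa>>0. ALL p:X. ALL q:X. x' X q - x' X p = \<kappa> *R frame_map d x' (q - p))"
proof -
 have fin: "finite X" and XR: "X <= Rpow d" using X by (auto simp: admissible_def)
 have diff: "q - p : Rpow d" if "p : X" "q : X" for p q using XR that by (intro subspace_diff[OF subspace_Rpow]) auto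
 have ev: "clusters d (%x'. ALL p:X. ALL q:X. p ~= q --> pos_par (x' X q - x' X p) (frame_map d x' (q - p)))"
 proof (intro eventually_ball_finite fin ballI)
  fix p q assume pq: "p : X" "q : X"
  show "clusters d (%x'. p ~= q --> pos_par (x' X q - x' X p) (frame_map d x' (q - p)))"
  proof (cases "p = q")
   case False
   obtain i where i: "i < d" "coord q i < coord p i" using flat[OF pq(2,1)] False by auto
   obtain j where j: "j < d" "coord p j < coord q j" using flat[OF pq] False by auto
   have "clusters d (%x'. pos_par (x' X q - x' X p) (sv x' (q - p)))"
    by (rule model_direction[OF X pq False, where k = 1]) auto
   moreover have "clusters d (%x'. pos_par (sv x' (q - p)) (frame_map d x' (q - p)))"
    using i j alg[OF pq(1)] alg[OF pq(2)] diff[OF pq]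
    by (intro direction_mixed_sign[of _ _ i j]) (auto simp: algebraic_pt_def lookup_minus intro: algebraic_diff)
   ultimately show ?thesis by eventually_elim (auto intro: pos_par_trans)
  qed simp
 qed
 show ?thesis using ev frame_map_injective
 proof eventually_elim
  case (elim x')
  note T0 = elim(2)
  have "ALL z:X \<times> X. EX g. fst z ~= snd z --> g > 0 & x' X (snd z) - x' X (fst z) = g *R frame_map d x' (snd z - fst z)"
  proof
   fix z assume "z : X \<times> X"
   hence "fst z ~= snd z --> pos_par (x' X (snd z) - x' X (fst z)) (frame_map d x' (snd z - fst z))" using elim(1) by auto
   thus "EX g. fst z ~= snd z --> g > 0 & x' X (snd z) - x' X (fst z) = g *R frame_map d x' (snd z - fst z)"
    unfolding pos_par_def by blast
  qed
  from bchoice[OF this] obtain g' where g': "ALL z:X \<times> X. fst z ~= snd z --> g' z > 0 &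
    x' X (snd z) - x' X (fst z) = g' z *R frame_map d x' (snd z - fst z)" by (elim exE) (rule that)
  define g where "g p q = g' (p, q)" for p q
  have g: "g p q > 0" "x' X q - x' X p = g p q *R frame_map d x' (q - p)" if "p : X" "q : X" "p ~= q" for p q
   using g'[rule_format, of "(p, q)"] that by (auto simp: g_def)
  have sym: "g p q = g q p" if "p : X" "q : X" "p ~= q" for p q
  proof -
   have "frame_map d x' (p - q) = - frame_map d x' (q - p)" by (simp add: frame_map_simps)
   moreover have "g p q *R frame_map d x' (q - p) = - (g q p *R frame_map d x' (p - q))"
    using g(2)[OF that] g(2)[OF that(2,1) not_sym[OF that(3)]] by (metis minus_diff_eq)
   ultimately have "g p q *R frame_map d x' (q - p) = g q p *R frame_map d x' (q - p)" by simp
   moreover have "frame_map d x' (q - p) ~= 0" using T0 diff[OF that(1,2)] that(3) by auto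
   ultimately show ?thesis by simp
  qed
  have star: "g p q = g p r" if "p : X" "q : X" "r : X" "p ~= q" "p ~= r" for p q r
  proof (cases "q = r")
   case False
   have "x' X r - x' X p = (x' X r - x' X q) + (x' X q - x' X p)" by simp
   hence "g p r *R frame_map d x' (r - p) = g q r *R frame_map d x' (r - q) + g p q *R frame_map d x' (q - p)"
    using g(2) that False by simp
   hence "frame_map d x' ((g p q - g q r) *R (q - p) - (g p r - g q r) *R (r - p)) = 0" by (simp add: frame_map_simps algebra_simps)
   moreover have "(g p q - g q r) *R (q - p) - (g p r - g q r) *R (r - p) : Rpow d"
    using XR that by (intro subspace_diff subspace_scale subspace_Rpow) auto
   ultimately have "(g p q - g q r) *R (q - p) = (g p r - g q r) *R (r - p)" using T0 by fastforce
   thus ?thesis using admissible_not_collinear[OF X that(1-3) that(4) False that(5)] by fastforce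
  qed simp
  show ?case
  proof (cases "EX p0:X. EX q0:X. p0 ~= q0")
   case False
   thus ?thesis by (intro exI[of _ 1]) (auto simp: frame_map_simps)
  next
   case True
   then obtain p0 q0 where p0: "p0 : X" "q0 : X" "p0 ~= q0" by blast
   have all: "g p q = g p0 q0" if "p : X" "q : X" "p ~= q" for p q
   proof (cases "p = p0")
    case True
    thus ?thesis using star[OF p0(1) that(2) p0(2)] that p0 by simp
   next
    case False
    have "g p q = g p p0" using star[OF that(1,2) p0(1)] that False by simp
    also have "\<dots> = g p0 p" using sym that(1) p0(1) False by simp
    also have "\<dots> = g p0 q0" using star[OF p0(1) that(1) p0(2)] False p0 by simp
    finally show ?thesis .
   qed
   show ?thesis
   proof (intro exI[of _ "g p0 q0"] conjI ballI)
    show "g p0 q0 > 0" using g(1)[OF p0] .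
    fix p q assume "p : X" "q : X"
    thus "x' X q - x' X p = g p0 q0 *R frame_map d x' (q - p)" using g(2)[of p q] all[of p q] by (cases "p = q") (auto simp: frame_map_simps)
   qed
  qed
 qed
qed

section \<open>The stamp: fibres over a conic, rays and stars, and the faces that are needed\<close>

section \<open>The polytope that fixes a projective type\<close>

definition amax :: "nat => pt => pt set => pt set" where
 "amax d c A = {p : A. ALL q:A. ip d c q <= ip d c p}"

lemma amax_subset: "amax d c A <= A" by (auto simp: amax_def)

lemma amax_height:
 assumes "finite A" "A ~= {}"
 obtains h where "!!p. p : A ==> ip d c p <= h" "!!p. p : A ==> ip d c p = h \<longleftrightarrow> p : amax d c A"
proof -
 define h where "h = Max (ip d c ` A)"
 have le: "ip d c p <= h" if "p : A" for p using assms that by (simp add: h_def)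
 have "h : ip d c ` A" unfolding h_def using assms by (intro Max_in) auto
 then obtain q where q: "q : A" "h = ip d c q" by blast
 have "ip d c p = h \<longleftrightarrow> p : amax d c A" if "p : A" for p
 proof
  assume "ip d c p = h" thus "p : amax d c A" using le that by (auto simp: amax_def)
 next
  assume "p : amax d c A"
  hence "h <= ip d c p" using q by (auto simp: amax_def)
  thus "ip d c p = h" using le[OF that] by simp
 qed
 thus ?thesis using le that by blast
qed

lemma large_multiple:
 fixes f g :: "'z => real"
 assumes "finite A" "!!a. a : A ==> f a > 0"
 obtains N where "!!a. a : A ==> g a < N * f a"
proof -
 define N where "N = (\<Sum>a\<in>A. \<bar>g a\<bar> / f a) + 1"
 have "g a < N * f a" if a: "a : A" for a
 proof -
  have "\<bar>g a\<bar> / f a <= (\<Sum>a\<in>A. \<bar>g a\<bar> / f a)" using assms a by (intro member_le_sum) (auto simp: less_imp_le)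
  hence "\<bar>g a\<bar> / f a < N" by (simp add: N_def)
  hence "\<bar>g a\<bar> < N * f a" using assms(2)[OF a] by (simp add: pos_divide_less_eq)
  thus ?thesis by simp
 qed
 thus ?thesis by (rule that)
qed

datatype idx = Ray nat | Fib nat nat pt | Star pt

text \<open>Vectors \<open>(x, m0, m1, m2)\<close> are homogeneous coordinates. A fibre is a copy of a finite point set placed over
 the point \<open>(1, t, t^2)\<close> of a conic; the fibres of a block carry the same cluster, together with auxiliary edges
 in all directions in question (even positions) or single chords of the cluster (odd positions except the first).\<close>

locale stamp_data =
 fixes d N n :: nat and X Y :: "nat => pt set" and chord :: "nat => nat => pt set" and V :: "pt set"
  and ym yp :: "nat => pt => pt" and cv cm :: "pt => pt" and cp :: "nat => pt => pt" and Cs :: "pt set" and c0 :: pt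
  and \<delta> M \<eta> :: real
 assumes d: "2 <= d" and N: "0 < N" and n: "2 <= n" and Y: "!!j. j < N ==> finite (Y j) & Y j <= Rpow d"
  and X: "!!j. j < N ==> X j <= Y j & X j ~= {}" and chord0: "!!j. j < N ==> chord j 0 = X j"
  and chord_sub: "!!j k. j < N ==> k < n ==> chord j k <= X j & chord j k ~= {}"
  and chord_ex: "!!j p q. j < N ==> p : X j ==> q : X j ==> p ~= q ==>
   EX k1 k2 k3. k1 < k2 & k2 < k3 & k3 < n & chord j k1 = {p, q} & chord j k2 = {p, q} & chord j k3 = {p, q}"
  and V: "!!j p q. j < N ==> p : X j ==> q : X j ==> p ~= q ==> EX v:V. EX k. k ~= 0 & q - p = k *R v"
  and Cs: "finite Cs" "Cs <= Rpow d" "!!c. c : Cs ==> ip d c (up d) = 1"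
  and cv: "!!v. v : V ==> cv v : Cs & ip d (cv v) v = 0" "!!v. v : V ==> cm v : Cs & ip d (cm v) v < 0"
  and ym: "!!j v. j < N ==> v : V ==> amax d (cm v) (Y j) = {ym j v}"
  and yp: "!!j v. j < N ==> v : V ==> amax d (cv v) (Y j) = {ym j v, yp j v} & (EX k>0. yp j v - ym j v = k *R v)"
  and y_not_X: "!!j v. j < N ==> v : V ==> ym j v ~: X j & yp j v ~: X j"
  and cp: "!!j p. j < N ==> p : X j ==> cp j p : Cs & amax d (cp j p) (Y j) = {p}"
  and vert: "!!j p. j < N ==> p : Y j ==> EX c:Cs. amax d c (Y j) = {p}"
  and coordCs: "!!i. i < d ==> - basis_pt i : Cs" and frameX: "EX j<N. X j = frame d" and c0: "c0 : Cs"
  and \<delta>: "0 < \<delta>" "!!c k. c : Cs ==> k < d ==> \<delta> * coord c k < 1"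
  and M: "!!c i j p q. c : Cs ==> i < N ==> j < N ==> p : Y i ==> q : Y j ==> ip d c p - ip d c q < M / 2"
  and \<eta>: "0 < \<eta>"
   "!!i j r s p. i < N ==> j < N ==> r < 2*n+1 ==> s < 2*n+1 ==> p : X (N-1) ==>
    0 < (real N - 3/4 - (real i + real r / (4 * real (2*n+1)))) * (real N - 3/4 - (real j + real s / (4 * real (2*n+1)))) + \<eta> * ip d c0 p"
   "!!j r p. j < N ==> r < 2*n+1 ==> p : Y j ==>
    \<eta> * (ip d c0 p + M * ((real r / (4 * real (2*n+1)))\<^sup>2 - (real j + real r / (4 * real (2*n+1)) - (real N - 1))\<^sup>2)) <
     (real j + real r / (4 * real (2*n+1)) - (real N - 3/4))\<^sup>2"
begin

definition K :: nat where "K = 2*n+1"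
definition \<rho> :: "nat => real" where "\<rho> r = real r / (4 * real K)"
text \<open>Block \<open>j\<close> occupies conic parameters from \<open>j\<close> to below
  \<open>j + 1/4\<close>, so points of other blocks are more than 3/4 away from the parameter
  \<open>j\<close>.\<close>

definition \<tau> :: "nat => nat => real" where "\<tau> j r = real j + \<rho> r"
definition J :: nat where "J = N - 1"
definition ts :: real where "ts = real J + 1 / 4"

definition Z :: "nat => nat => pt set" where
 "Z j r = (if even r then Y j else chord j (r div 2))"

text \<open>The shift by \<open>M * (\<rho> r)\<^sup>2\<close> along \<open>up d\<close> lets one
  functional support a point in all fibres of a block at once. Stars sit behind the last fibre,
  where the shift would be \<open>M / 16\<close>, and are displaced from the conic by
  \<open>\<eta> * ip d c0 p\<close>: with the displacement they can vanish together under a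
  functional that is negative on the rays, and the matching extra shift keeps them in the spans of
  their block.\<close>

definition u :: "idx => pt \<times> real \<times> real \<times> real" where
 "u a = (case a of Ray k => (- up d + \<delta> *R basis_pt k, 0, 0, 0)
   | Fib j r p => (p + (M * (\<rho> r)\<^sup>2) *R up d, 1, \<tau> j r, (\<tau> j r)\<^sup>2)
   | Star p => (p + (M * (1 / 16 + \<eta> * ip d c0 p)) *R up d, 1, ts, ts\<^sup>2 + \<eta> * ip d c0 p))"

definition fibs :: "nat => nat => pt set => idx set" where
 "fibs j r A = Fib j r ` A"

definition rays :: "idx set" where "rays = Ray ` {..<d}"
definition stars :: "idx set" where "stars = Star ` X J"

definition I :: "idx set" where
 "I = rays \<union> (\<Union>j<N. \<Union>r<K. fibs j r (Z j r)) \<union> stars"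

definition phi :: "pt => real => real => real => pt \<times> real \<times> real \<times> real => real" where
 "phi c a0 a1 a2 = (%(x, m0, m1, m2). ip d c x - a0 * m0 - a1 * m1 - a2 * m2)"

lemma linear_phi: "linear (phi c a0 a1 a2)" by (rule linearI) (auto simp: phi_def ip_simps algebra_simps)

lemma Kpos: "0 < K" "5 <= K" using n by (auto simp: K_def)

lemma \<rho>_bounds: "0 <= \<rho> r" "r < K ==> \<rho> r < 1 / 4" using Kpos by (auto simp: \<rho>_def field_simps)

lemma \<rho>_less: "r < s \<longleftrightarrow> \<rho> r < \<rho> s" using Kpos by (auto simp: \<rho>_def divide_less_cancel)

lemma J: "J < N" "real J = real N - 1" "ts = real N - 3/4" using N by (auto simp: J_def ts_def of_nat_diff)

lemma half_less: "odd r ==> r < K ==> r div 2 < n" unfolding K_def by (auto elim!: oddE)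

lemma Z_sub: "j < N ==> r < K ==> Z j r <= Y j"
 using X[of j] chord_sub[of j "r div 2"] half_less[of r] unfolding Z_def by (cases "even r") auto

lemma Z_fin: "j < N ==> r < K ==> finite (Z j r) & Z j r ~= {}"
 using Z_sub[of j r] Y[of j] X[of j] chord_sub[of j "r div 2"] finite_subset[of "Z j r" "Y j"] half_less[of r] by (cases "even r") (auto simp: Z_def)

lemma I_cases:
 assumes "a : I"
 obtains (Ray) k where "k < d" "a = Ray k" | (Fib) j r p where "j < N" "r < K" "p : Z j r" "a = Fib j r p"
  | (Star) p where "p : X J" "a = Star p" using assms by (auto simp: I_def rays_def stars_def fibs_def)

lemma in_I [simp]: "Ray k : I \<longleftrightarrow> k < d" "Fib j r p : I \<longleftrightarrow> j < N & r < K & p : Z j r" "Star p : I \<longleftrightarrow> p : X J"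
 by (auto simp: I_def rays_def stars_def fibs_def)

lemma finite_I: "finite I"
proof -
 have "finite (X J)" using X[OF J(1)] Y[OF J(1)] finite_subset by blast
 thus ?thesis using Z_fin by (auto simp: I_def rays_def stars_def fibs_def)
qed

lemma phi_Ray: "k < d ==> phi c a0 a1 a2 (u (Ray k)) = \<delta> * coord c k - ip d c (up d)" by (simp add: phi_def u_def ip_simps)

lemma phi_Fib: "phi c a0 a1 a2 (u (Fib j r p)) =
  ip d c p + M * (\<rho> r)\<^sup>2 * ip d c (up d) - a0 - a1 * \<tau> j r - a2 * (\<tau> j r)\<^sup>2" by (simp add: phi_def u_def ip_simps)

lemma phi_Star: "phi c a0 a1 a2 (u (Star p)) =
  ip d c p + M * (1 / 16 + \<eta> * ip d c0 p) * ip d c (up d) - a0 - a1 * ts - a2 * (ts\<^sup>2 + \<eta> * ip d c0 p)"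
 by (simp add: phi_def u_def ip_simps)

lemma phi_Ray_neg: "c : Cs ==> k < d ==> phi c a0 a1 a2 (u (Ray k)) < 0"
 using \<delta>(2) Cs(3) by (simp add: phi_Ray)

lemma ip_0_left [simp]: "ip d 0 x = 0" by (simp add: ip_def)

lemma face_rays: "rays : cfaces u I"
proof (rule cfacesI[OF linear_phi[of 0 1 0 0]])
 show "rays <= I" by (auto simp: I_def)
 show "phi 0 1 0 0 (u a) = 0" if "a : rays" for a using that by (auto simp: rays_def phi_Ray)
 show "phi 0 1 0 0 (u a) < 0" if "a : I - rays" for a
 proof -
  have a: "a : I" using that by simp
  from a show ?thesis by (rule I_cases) (use that in "auto simp: rays_def phi_Fib phi_Star")
 qed
qed

lemma \<tau>_eq: 
 assumes "r < K" "s < K" shows "\<tau> i r = \<tau> j s \<longleftrightarrow> i = j & r = s"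
proof
 assume eq: "\<tau> i r = \<tau> j s"
 have b: "0 <= \<rho> r" "\<rho> r < 1/4" "0 <= \<rho> s" "\<rho> s < 1/4" using \<rho>_bounds assms by auto
 hence "\<bar>real i - real j\<bar> < 1" using eq unfolding \<tau>_def by linarith
 hence ij: "i = j" by linarith
 hence "\<rho> r = \<rho> s" using eq by (simp add: \<tau>_def)
 thus "i = j & r = s" using ij \<rho>_less by (metis less_irrefl linorder_neqE_nat)
qed simp

lemma star_gap: "i < N ==> j < N ==> r < K ==> s < K ==> p : X J ==> 0 < (ts - \<tau> i r) * (ts - \<tau> j s) + \<eta> * ip d c0 p"
 using \<eta>(2)[of i j r s p] by (simp add: \<tau>_def \<rho>_def K_def J(3) J_def)

text \<open>The functional is the tangent of the conic at the parameter of the fibre. It ignores the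
  first component, hence vanishes on the rays too.\<close>

lemma face_fibre:
 assumes j: "j < N" "r < K"
 shows "rays \<union> fibs j r (Z j r) : cfaces u I"
proof (rule cfacesI[OF linear_phi[of 0 "(\<tau> j r)\<^sup>2" "- 2 * \<tau> j r" 1]])
 show "rays \<union> fibs j r (Z j r) <= I" using j by (auto simp: I_def)
 show "phi 0 ((\<tau> j r)\<^sup>2) (- 2 * \<tau> j r) 1 (u a) = 0" if "a : rays \<union> fibs j r (Z j r)" for a
  using that by (auto simp: rays_def fibs_def phi_Ray phi_Fib power2_eq_square)
 show "phi 0 ((\<tau> j r)\<^sup>2) (- 2 * \<tau> j r) 1 (u a) < 0" if a: "a : I - (rays \<union> fibs j r (Z j r))" for a
 proof -
  have "a : I" using a by simp
  thus ?thesis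
  proof (cases rule: I_cases)
   case (Ray k) thus ?thesis using a by (auto simp: rays_def)
  next
   case (Fib i s p)
   hence "~ (i = j & s = r)" using a by (auto simp: fibs_def)
   hence "\<tau> i s - \<tau> j r ~= 0" using \<tau>_eq[OF Fib(2) j(2), of i j] by auto
   hence "0 < (\<tau> i s - \<tau> j r)\<^sup>2" by simp
   moreover have "phi 0 ((\<tau> j r)\<^sup>2) (- 2 * \<tau> j r) 1 (u a) = - ((\<tau> i s - \<tau> j r)\<^sup>2)"
    unfolding Fib(4) phi_Fib by (simp add: power2_eq_square algebra_simps)
   ultimately show ?thesis by simp
  next
   case (Star p)
   have "phi 0 ((\<tau> j r)\<^sup>2) (- 2 * \<tau> j r) 1 (u a) = - ((ts - \<tau> j r) * (ts - \<tau> j r) + \<eta> * ip d c0 p)"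
    unfolding Star(2) phi_Star by (simp add: power2_eq_square algebra_simps)
   thus ?thesis using star_gap[OF j(1) j(1) j(2) j(2) Star(1)] by simp
  qed
 qed
qed

definition adj :: "nat => nat => nat => nat => bool" where
 "adj j r i s \<longleftrightarrow> j < N & i < N & r < K & s < K & ((i = j & s = Suc r) \<or> (i = Suc j & r = K - 1 & s = 0))"

lemma adj_gap:
 assumes a: "adj j r i s" and b: "i' < N" "s' < K" "(i', s') ~= (j, r)" "(i', s') ~= (i, s)"
 shows "0 < (\<tau> i' s' - \<tau> j r) * (\<tau> i' s' - \<tau> i s)" "\<tau> j r < \<tau> i s"
proof -
 have bd: "0 <= \<rho> t" "t < K ==> \<rho> t < 1/4" for t using \<rho>_bounds by auto
 show lt: "\<tau> j r < \<tau> i s" using a bd(2)[of r] bd(1)[of s] \<rho>_less[of r s] unfolding adj_def \<tau>_def by auto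
 have "\<tau> i' s' < \<tau> j r \<or> \<tau> i s < \<tau> i' s'"
 proof (cases i' j rule: linorder_cases)
  case less
  hence "real i' + 1 <= real j" by simp
  hence "\<tau> i' s' < \<tau> j r" using bd(2)[OF b(2)] bd(1)[of r] unfolding \<tau>_def by linarith
  thus ?thesis ..
 next
  case equal
  show ?thesis
  proof (cases "s' < r")
   case True thus ?thesis using equal \<rho>_less[of s' r] by (simp add: \<tau>_def)
  next
   case False
   hence "r < s'" using b(3) equal by auto
   hence "i = j & s = Suc r" using a b(2) by (auto simp: adj_def)
   hence "s < s'" using \<open>r < s'\<close> b(4) equal by auto
   thus ?thesis using equal \<open>i = j & s = Suc r\<close> \<rho>_less[of s s'] by (simp add: \<tau>_def)
  qed
 next
  case greater
  have "\<tau> i s < \<tau> i' s'"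
  proof (cases "i = j")
   case True
   have "real j + 1 <= real i'" using greater by simp
   thus ?thesis using True a bd(2)[of s] bd(1)[of s'] unfolding \<tau>_def adj_def by linarith
  next
   case False
   hence i: "i = Suc j" "s = 0" using a by (auto simp: adj_def)
   show ?thesis
   proof (cases "i' = i")
    case True
    hence "0 < s'" using b(4) i by auto
    thus ?thesis using True i \<rho>_less[of 0 s'] by (simp add: \<tau>_def)
   next
    case False
    hence "real i + 1 <= real i'" using i greater by simp
    thus ?thesis using bd(1)[of s'] bd(2)[of s] a unfolding \<tau>_def adj_def by linarith
   qed
  qed
  thus ?thesis ..
 qed
 thus "0 < (\<tau> i' s' - \<tau> j r) * (\<tau> i' s' - \<tau> i s)" using lt by (auto simp: zero_less_mult_iff)
qed

text \<open>The secant through two neighbouring conic points, \<open>q\<close>, is positive at all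
  others, so a large multiple \<open>B\<close> of it suppresses everything but the two fibres and
  the rays. The affine term \<open>g0 + g1 * t\<close> levels the maxima of \<open>c\<close> on the
  two fibres, and the rays are negative because \<open>c\<close> is 1 on
  \<open>up d\<close>.\<close>

lemma face_adjacent:
 assumes a: "adj j r i s" and c: "c : Cs"
 shows "fibs j r (amax d c (Z j r)) \<union> fibs i s (amax d c (Z i s)) : cfaces u I"
proof -
 have ji: "j < N" "r < K" "i < N" "s < K" using a by (auto simp: adj_def)
 define t where "t = \<tau> j r"
 define t' where "t' = \<tau> i s"
 have tt: "t < t'" unfolding t_def t'_def using a \<rho>_bounds[of r] \<rho>_bounds[of s] \<rho>_less[of r s] unfolding adj_def \<tau>_def by auto
 obtain h where h: "!!p. p : Z j r ==> ip d c p <= h" "!!p. p : Z j r ==> ip d c p = h \<longleftrightarrow> p : amax d c (Z j r)"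
  using amax_height Z_fin[OF ji(1,2)] by metis
 obtain h' where h': "!!p. p : Z i s ==> ip d c p <= h'" "!!p. p : Z i s ==> ip d c p = h' \<longleftrightarrow> p : amax d c (Z i s)"
  using amax_height Z_fin[OF ji(3,4)] by metis
 define H where "H = h + M * (\<rho> r)\<^sup>2"
 define H' where "H' = h' + M * (\<rho> s)\<^sup>2"
 define g1 where "g1 = (H' - H) / (t' - t)"
 define g0 where "g0 = H - g1 * t"
 have "g1 * (t' - t) = H' - H" using tt by (simp add: g1_def)
 hence g: "g0 + g1 * t = H" "g0 + g1 * t' = H'" by (simp_all add: g0_def algebra_simps)
 define q where "q a = (snd (snd (snd (u a))) - (t + t') * fst (snd (snd (u a))) + t * t' * fst (snd (u a)))" for a
 let ?S = "fibs j r (Z j r) \<union> fibs i s (Z i s)"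
 have qpos: "q b > 0" if "b : I - (?S \<union> rays)" for b
 proof -
  have "b : I" using that by simp
  thus ?thesis
  proof (cases rule: I_cases)
   case (Ray k) thus ?thesis using that by (auto simp: rays_def)
  next
   case (Fib i' s' p)
   hence "(i', s') ~= (j, r)" "(i', s') ~= (i, s)" using that by (auto simp: fibs_def)
   from adj_gap(1)[OF a Fib(1,2) this] have "0 < (\<tau> i' s' - t) * (\<tau> i' s' - t')" by (simp add: t_def t'_def)
   thus ?thesis unfolding Fib(4) q_def u_def by (simp add: power2_eq_square algebra_simps)
  next
   case (Star p)
   have "0 < (ts - t) * (ts - t') + \<eta> * ip d c0 p" unfolding t_def t'_def using star_gap[OF ji(1,3,2,4) Star(1)] .
   thus ?thesis unfolding Star(2) q_def u_def by (simp add: power2_eq_square algebra_simps)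
  qed
 qed
 have "finite (I - (?S \<union> rays))" using finite_I by simp
 then obtain B where B: "!!b. b : I - (?S \<union> rays) ==> phi c g0 g1 0 (u b) < B * q b"
  using large_multiple[of "I - (?S \<union> rays)" q "%b. phi c g0 g1 0 (u b)"] qpos by blast
 let ?\<Phi> = "phi c (g0 + B * (t * t')) (g1 - B * (t + t')) B"
 have \<Phi>: "?\<Phi> (u b) = phi c g0 g1 0 (u b) - B * q b" for b unfolding phi_def q_def by (simp add: case_prod_beta algebra_simps)
 have \<Phi>j: "?\<Phi> (u (Fib j r p)) = ip d c p - h" for p
 proof -
  have "q (Fib j r p) = 0" by (simp add: q_def u_def t_def power2_eq_square algebra_simps)
  hence "?\<Phi> (u (Fib j r p)) = phi c g0 g1 0 (u (Fib j r p))" by (simp add: \<Phi>)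
  also have "\<dots> = ip d c p + M * (\<rho> r)\<^sup>2 * 1 - g0 - g1 * \<tau> j r - 0 * (\<tau> j r)\<^sup>2" by (simp only: phi_Fib Cs(3)[OF c])
  finally show ?thesis using g(1) by (simp add: H_def t_def)
 qed
 have \<Phi>i: "?\<Phi> (u (Fib i s p)) = ip d c p - h'" for p
 proof -
  have "q (Fib i s p) = 0" by (simp add: q_def u_def t'_def power2_eq_square algebra_simps)
  hence "?\<Phi> (u (Fib i s p)) = phi c g0 g1 0 (u (Fib i s p))" by (simp add: \<Phi>)
  also have "\<dots> = ip d c p + M * (\<rho> s)\<^sup>2 * 1 - g0 - g1 * \<tau> i s - 0 * (\<tau> i s)\<^sup>2" by (simp only: phi_Fib Cs(3)[OF c])
  finally show ?thesis using g(2) by (simp add: H'_def t'_def)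
 qed
 show ?thesis
 proof (rule cfacesI[OF linear_phi[of c "g0 + B * (t * t')" "g1 - B * (t + t')" B]])
  show "fibs j r (amax d c (Z j r)) \<union> fibs i s (amax d c (Z i s)) <= I"
   using ji by (auto simp: fibs_def dest: amax_subset[THEN subsetD])
  show "?\<Phi> (u b) = 0" if "b : fibs j r (amax d c (Z j r)) \<union> fibs i s (amax d c (Z i s))" for b
   using that h(2) h'(2) amax_subset[of d c "Z j r"] amax_subset[of d c "Z i s"] by (auto simp: fibs_def \<Phi>j \<Phi>i)
  show "?\<Phi> (u b) < 0" if b: "b : I - (fibs j r (amax d c (Z j r)) \<union> fibs i s (amax d c (Z i s)))" for b
  proof -
   consider "b : rays" | p where "p : Z j r" "b = Fib j r p" | p where "p : Z i s" "b = Fib i s p" | "b : I - (?S \<union> rays)"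
    using b by (auto simp: fibs_def)
   thus ?thesis
   proof cases
    case 1 thus ?thesis using phi_Ray_neg[OF c] by (auto simp: rays_def)
   next
    case (2 p)
    hence "p ~: amax d c (Z j r)" using b by (auto simp: fibs_def)
    thus ?thesis using h[OF 2(1)] by (auto simp: 2(2) \<Phi>j order_less_le)
   next
    case (3 p)
    hence "p ~: amax d c (Z i s)" using b by (auto simp: fibs_def)
    thus ?thesis using h'[OF 3(1)] by (auto simp: 3(2) \<Phi>i order_less_le)
   next
    case 4 thus ?thesis using B[OF 4] by (simp add: \<Phi>)
   qed
  qed
 qed
qed

lemma face_single:
 assumes j: "j < N" "r < K" and c: "c : Cs"
 shows "fibs j r (amax d c (Z j r)) : cfaces u I"
proof -
 obtain i s where "adj j r i s \<or> adj i s j r"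
 proof (cases "Suc r < K")
  case True thus ?thesis using j that[of j "Suc r"] by (simp add: adj_def)
 next
  case False
  hence "adj j (r - 1) j r" using j Kpos by (auto simp: adj_def)
  thus ?thesis using that by blast
 qed
 hence "(fibs j r (amax d c (Z j r)) \<union> fibs i s (amax d c (Z i s))) : cfaces u I" "(i, s) ~= (j, r)"
  using face_adjacent[OF _ c, of j r i s] face_adjacent[OF _ c, of i s j r] by (auto simp only: Un_commute) (auto simp: adj_def)
 from cfaces_Int[OF face_fibre[OF j] this(1)]
 have "(rays \<union> fibs j r (Z j r)) \<inter> (fibs j r (amax d c (Z j r)) \<union> fibs i s (amax d c (Z i s))) : cfaces u I" .
 also have "(rays \<union> fibs j r (Z j r)) \<inter> (fibs j r (amax d c (Z j r)) \<union> fibs i s (amax d c (Z i s))) = fibs j r (amax d c (Z j r))"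
  using amax_subset[of d c "Z j r"] \<open>(i, s) ~= (j, r)\<close> by (auto simp: rays_def fibs_def)
 finally show ?thesis .
qed

definition block :: "nat => pt set => idx set" where
 "block j A = (\<Union>r<K. fibs j r (Z j r \<inter> A)) \<union> (if j = J then Star ` (X J \<inter> A) else {})"

text \<open>The functional subtracts \<open>M\<close> times the squared distance of the parameter
  from \<open>j\<close>. Inside block \<open>j\<close> this cancels the shift of the fibres;
  elsewhere it costs at least \<open>M / 2\<close>, more than the values of functionals in
  \<open>Cs\<close> can vary.\<close>

lemma face_block:
 assumes j: "j < N" and c: "c : Cs"
 shows "block j (amax d c (Y j)) : cfaces u I"
proof -
 obtain h where h: "!!p. p : Y j ==> ip d c p <= h" "!!p. p : Y j ==> ip d c p = h \<longleftrightarrow> p : amax d c (Y j)"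
  using amax_height Y[OF j] X[OF j] by (metis subset_empty)
 obtain q where q: "q : Y j" using X[OF j] by blast
 let ?\<Phi> = "phi c (h + M * (real j)\<^sup>2) (- 2 * M * real j) M"
 have FibV: "?\<Phi> (u (Fib i r p)) = ip d c p - h + M * ((\<rho> r)\<^sup>2 - (\<tau> i r - real j)\<^sup>2)" for i r p
  unfolding phi_Fib Cs(3)[OF c] by (simp add: power2_eq_square algebra_simps)
 have StarV: "?\<Phi> (u (Star p)) = ip d c p - h + M * (1 / 16 - (ts - real j)\<^sup>2)" for p
  unfolding phi_Star Cs(3)[OF c] by (simp add: power2_eq_square algebra_simps)
 have M0: "0 < M" using M[OF c j j q q] by simp
 have far: "ip d c p - h + M * (a\<^sup>2 - b\<^sup>2) < 0" if p: "i < N" "p : Y i" and a: "0 <= a" "a <= 1/4" and b: "3/4 <= \<bar>b\<bar>" for i p a b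
 proof -
  have "a\<^sup>2 <= (1/4)\<^sup>2" using a by (intro power_mono) auto
  moreover have "(3/4)\<^sup>2 <= \<bar>b\<bar>\<^sup>2" using b by (intro power_mono) auto
  ultimately have "a\<^sup>2 - b\<^sup>2 <= - (1/2)" by (simp add: power2_eq_square)
  hence "M * (a\<^sup>2 - b\<^sup>2) <= M * (- (1/2))" using M0 by (intro mult_left_mono) auto
  moreover have "ip d c p - ip d c q < M / 2" by (rule M[OF c p(1) j p(2) q])
  ultimately show ?thesis using h(1)[OF q] by simp
 qed
 show ?thesis
 proof (rule cfacesI[OF linear_phi[of c "h + M * (real j)\<^sup>2" "- 2 * M * real j" M]])
  show "block j (amax d c (Y j)) <= I" using j by (auto simp: block_def fibs_def)
  show "?\<Phi> (u b) = 0" if bB: "b : block j (amax d c (Y j))" for b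
  proof -
   consider r p where "b = Fib j r p" "p : amax d c (Y j)" | p where "b = Star p" "j = J" "p : amax d c (Y j)"
    using bB by (auto simp: block_def fibs_def split: if_splits)
   thus ?thesis
   proof cases
    case (1 r p)
    thus ?thesis unfolding 1(1) FibV using h(2)[of p] amax_subset[of d c "Y j"] by (auto simp: \<tau>_def)
   next
    case (2 p)
    thus ?thesis unfolding 2(1) StarV using h(2)[of p] amax_subset[of d c "Y j"] by (auto simp: ts_def power2_eq_square)
   qed
  qed
  show "?\<Phi> (u b) < 0" if b: "b : I - block j (amax d c (Y j))" for b
  proof -
   have "b : I" using b by simp
   thus ?thesis
   proof (cases rule: I_cases)
    case (Ray k) thus ?thesis using phi_Ray_neg[OF c] by simp
   next
    case (Fib i r p)
    have pY: "p : Y i" using Fib Z_sub by blast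
    show ?thesis
    proof (cases "i = j")
     case True
     hence "p ~: amax d c (Y j)" using b Fib by (auto simp: block_def fibs_def)
     hence "ip d c p < h" using h[of p] pY True by (auto simp: order_less_le)
     thus ?thesis unfolding Fib(4) FibV using True by (simp add: \<tau>_def)
    next
     case False
     hence "1 <= \<bar>real i - real j\<bar>" by linarith
     hence "3/4 <= \<bar>\<tau> i r - real j\<bar>" using \<rho>_bounds[of r] Fib(2) unfolding \<tau>_def by linarith
     thus ?thesis unfolding Fib(4) FibV using \<rho>_bounds[of r] Fib(2) by (intro far[OF Fib(1) pY]) auto
    qed
   next
    case (Star p)
    have pY: "p : Y J" using Star X[OF J(1)] by blast
    show ?thesis
    proof (cases "j = J")
     case True
     hence "p ~: amax d c (Y j)" using b Star by (auto simp: block_def)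
     hence "ip d c p < h" using h[of p] pY True by (auto simp: order_less_le)
     thus ?thesis unfolding Star(2) StarV using True by (simp add: ts_def power2_eq_square)
    next
     case False
     hence "1 <= \<bar>real J - real j\<bar>" by linarith
     moreover have "real j <= real J" using j J by simp
     ultimately have "3/4 <= \<bar>ts - real j\<bar>" unfolding ts_def by linarith
     thus ?thesis unfolding Star(2) StarV using far[OF J(1) pY, of "1/4" "ts - real j"] by (simp add: power2_eq_square)
    qed
   qed
  qed
 qed
qed

text \<open>On the stars the displacement \<open>\<eta> * ip d c0 p\<close> cancels the variation of
  \<open>\<eta> *R c0\<close>. On the fibres the squared distance to \<open>ts\<close> prevails,
  since \<open>\<eta>\<close> is small.\<close>

lemma face_stars: "stars : cfaces u I"
proof -
 let ?\<Phi> = "phi (\<eta> *R c0) (ts\<^sup>2 + \<eta> * M * (real J)\<^sup>2) (- 2 * ts - \<eta> * M * 2 * real J) (1 + \<eta> * M)"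
 have c1: "ip d c0 (up d) = 1" using Cs(3) c0 by blast
 have FibV: "?\<Phi> (u (Fib i r p)) = \<eta> * (ip d c0 p + M * ((\<rho> r)\<^sup>2 - (\<tau> i r - real J)\<^sup>2)) - (\<tau> i r - ts)\<^sup>2" for i r p
  unfolding phi_Fib ip_scaleR_left c1 by (simp add: power2_eq_square algebra_simps)
 show ?thesis
 proof (rule cfacesI[OF linear_phi[of "\<eta> *R c0" "ts\<^sup>2 + \<eta> * M * (real J)\<^sup>2" "- 2 * ts - \<eta> * M * 2 * real J" "1 + \<eta> * M"]])
  show "stars <= I" by (auto simp: I_def)
  show "?\<Phi> (u b) = 0" if bS: "b : stars" for b
  proof -
   obtain p where "b = Star p" using bS by (auto simp: stars_def)
   thus ?thesis unfolding \<open>b = Star p\<close> phi_Star ip_scaleR_left c1 ts_def by (simp add: power2_eq_square algebra_simps add_divide_distrib)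
  qed
  show "?\<Phi> (u b) < 0" if b: "b : I - stars" for b
  proof -
   have "b : I" using b by simp
   thus ?thesis
   proof (cases rule: I_cases)
    case (Ray k)
    have "\<eta> * (\<delta> * coord c0 k - 1) < 0" using \<eta>(1) \<delta>(2)[OF c0 Ray(1)] by (simp add: mult_pos_neg)
    thus ?thesis using Ray c1 by (simp add: phi_Ray ip_scaleR_left algebra_simps)
   next
    case (Fib i r p)
    have "p : Y i" using Fib Z_sub by blast
    thus ?thesis using \<eta>(3)[of i r p] Fib(1,2) unfolding Fib(4) FibV by (simp add: \<tau>_def \<rho>_def K_def J(2,3))
   next
    case (Star p) thus ?thesis using b by (auto simp: stars_def)
   qed
  qed
 qed
qed

end

section \<open>Reading directions and projective position from an arbitrary realization of the
  stamp\<close>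

section \<open>Rigidity of the stars\<close>

lemma span_insertE:
 assumes "x : span (insert a S)"
 obtains k where "x - k *R a : span S" using assms by (auto simp: span_breakdown_eq)

lemma spanning_of_dim:
 assumes "finite A" "B <= A" "independent B" "dim A <= card B"
 shows "A <= span B"
proof (rule ccontr)
 assume "~ A <= span B"
 then obtain y where y: "y : A" "y ~: span B" by blast
 obtain C where C: "C <= A" "independent C" "A <= span C" "card C = dim A" by (rule basis_exists)
 have finC: "finite C" using C(1) assms(1) finite_subset by blast
 have "independent (insert y B)" using y(2) assms(3) by (rule independent_insertI)
 moreover have "insert y B <= span C" using y(1) assms(2) C(3) by blast
 ultimately have "card (insert y B) <= card C" using independent_span_bound[OF finC] by blast
 moreover have "y ~: B" using y(2) span_base by blast
 moreover have "finite B" using assms(1,2) finite_subset by blast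
 ultimately show False using C(4) assms(4) by simp
qed

lemma inj_on_span_of_dim:
 assumes f: "linear f" and A: "finite A" and dim: "dim A <= dim (f ` A)"
 shows "inj_on f (span A)"
proof (rule ccontr)
 assume "~ inj_on f (span A)"
 then obtain y where y: "y : span A" "f y = 0" "y ~= 0" using linear_injective_on_subspace_0[OF f subspace_span, of A] by blast
 obtain C where C: "C <= A" "independent C" "A <= span C" "card C = dim A" by (rule basis_exists)
 have finC: "finite C" using C(1) A finite_subset by blast
 have "y : span C" using y(1) C(3) span_minimal[OF C(3) subspace_span] by blast
 then obtain a where a: "y = (\<Sum>c\<in>C. a c *R c)" unfolding span_finite[OF finC] by auto
 then obtain c0 where c0: "c0 : C" "a c0 ~= 0" using y(3) by (metis (no_types, lifting) scaleR_zero_left sum.neutral)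
 have "0 = (\<Sum>c\<in>C. a c *R f c)" using y(2) unfolding a by (simp add: linear_sum[OF f] linear_scale[OF f])
 also have "\<dots> = a c0 *R f c0 + (\<Sum>c\<in>C-{c0}. a c *R f c)" using finC c0(1) by (simp add: sum.remove)
 finally have "a c0 *R f c0 = - (\<Sum>c\<in>C-{c0}. a c *R f c)" by (simp add: eq_neg_iff_add_eq_0)
 hence "a c0 *R f c0 : span (f ` (C - {c0}))" by (simp only:) (intro span_neg span_sum span_scale span_base imageI)
 hence "(1 / a c0) *R (a c0 *R f c0) : span (f ` (C - {c0}))" by (rule span_scale)
 hence fc0: "f c0 : span (f ` (C - {c0}))" using c0(2) by simp
 have "f ` C <= span (f ` (C - {c0}))"
 proof (rule image_subsetI)
  fix c assume "c : C"
  thus "f c : span (f ` (C - {c0}))" using fc0 by (cases "c = c0") (auto intro: span_base)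
 qed
 hence "span (f ` C) <= span (f ` (C - {c0}))" by (rule span_minimal) (rule subspace_span)
 moreover have "f ` A <= span (f ` C)" using C(3) linear_span_image[OF f, of C] by auto
 ultimately have "f ` A <= span (f ` (C - {c0}))" by (rule order_trans[rotated])
 hence "dim (f ` A) <= card (f ` (C - {c0}))" using finC by (intro dim_le_card) auto
 also have "\<dots> <= card (C - {c0})" using finC by (intro card_image_le) auto
 also have "\<dots> < card C" using finC c0(1) by (intro card_Diff1_less)
 finally show False using dim C(4) by simp
qed

locale stamp_copy = stamp_data +
 fixes w :: "idx => 'a::real_vector" and \<Psi> :: "'a => real"
 assumes same: "cfaces w I = cfaces u I" and lin\<Psi>: "linear \<Psi>"
  and \<Psi>_ray: "!!a. a : rays ==> \<Psi> (w a) = 0" and \<Psi>_one: "!!a. a : I - rays ==> \<Psi> (w a) = 1"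
begin

text \<open>In the model the rays span the whole space \<open>Rpow d\<close> of cluster directions,
  so \<open>L\<close> is where the chords of all fibres can be compared.\<close>

definition L :: "'a set" where "L = span (w ` rays)"

lemma subspace_L: "subspace L" by (simp add: L_def subspace_span)

lemmas L_closed = subspace_add[OF subspace_L] subspace_diff[OF subspace_L] subspace_scale[OF subspace_L]
 subspace_neg[OF subspace_L] subspace_0[OF subspace_L]

lemma \<Psi>_L: "y : L ==> \<Psi> y = 0"
 unfolding L_def by (induction rule: span_induct_alt) (auto simp: \<Psi>_ray linear_0[OF lin\<Psi>] linear_add[OF lin\<Psi>] linear_scale[OF lin\<Psi>])

lemma \<Psi>_Fib: "j < N ==> r < K ==> p : Z j r ==> \<Psi> (w (Fib j r p)) = 1"
 by (intro \<Psi>_one) (auto simp: rays_def)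

lemma ray_span:
 assumes y: "y : Rpow d"
 shows "(y, 0, 0, 0) : span (u ` rays)"
proof -
 let ?r = "%k. (- up d + \<delta> *R basis_pt k, 0::real, 0::real, 0::real)"
 have r: "?r k : span (u ` rays)" if "k < d" for k using that by (intro span_base image_eqI[of _ _ "Ray k"]) (auto simp: u_def rays_def)
 have s: "(\<Sum>k<d. ?r k) : span (u ` rays)" by (intro span_sum r) auto
 have "(\<Sum>k<d. - up d + \<delta> *R basis_pt k) = - ((real d + \<delta>) *R up d)"
 proof -
  have "(\<Sum>k<d. basis_pt k) = - up d" by (simp add: up_def)
  hence "(\<Sum>k<d. - up d + \<delta> *R basis_pt k) = real d *R (- up d) + \<delta> *R (- up d)"
   by (simp only: sum.distrib sum_constant_scaleR card_lessThan flip: scaleR_sum_right)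
  thus ?thesis by (simp add: algebra_simps)
 qed
 hence "(\<Sum>k<d. ?r k) = (- ((real d + \<delta>) *R up d), 0, 0, 0)" by (simp add: sum_prod)
 hence "(-1 / (real d + \<delta>)) *R (- ((real d + \<delta>) *R up d), 0, 0, 0) : span (u ` rays)" using s span_scale by metis
 hence up: "(up d, 0, 0, 0) : span (u ` rays)" using \<delta>(1) by simp
 have e: "(basis_pt k, 0, 0, 0) : span (u ` rays)" if "k < d" for k
 proof -
  have "(1 / \<delta>) *R (?r k + (up d, 0, 0, 0)) : span (u ` rays)" by (intro span_scale span_add up r that)
  thus ?thesis using \<delta>(1) by simp
 qed
 have "(y, 0, 0, 0) = (\<Sum>k<d. coord y k *R (basis_pt k, 0::real, 0::real, 0::real))" using Rpow_expansion[OF y] by (simp add: sum_prod)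
 also have "\<dots> : span (u ` rays)" by (intro span_sum span_scale e) auto
 finally show ?thesis .
qed

lemma Z_Rpow: "j < N ==> r < K ==> p : Z j r ==> p : Rpow d" using Z_sub Y by blast

text \<open>A fibre has rank one over the ray face in the model, and this transfers; the
  normalization by \<open>\<Psi>\<close> makes the coefficient 1.\<close>

lemma fibre_diff:
 assumes j: "j < N" "r < K" and pq: "p : Z j r" "q : Z j r"
 shows "w (Fib j r q) - w (Fib j r p) : L"
proof -
 have T: "(rays \<union> fibs j r (Z j r)) - rays = fibs j r (Z j r)" by (auto simp: rays_def fibs_def)
 have "w (Fib j r q) : span (insert (w (Fib j r p)) (w ` rays))"
 proof (rule cfaces_cover_transfer[OF finite_I same[symmetric] face_rays face_fibre[OF j]])
  fix a b assume "a : rays \<union> fibs j r (Z j r) - rays" "b : rays \<union> fibs j r (Z j r) - rays"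
  then obtain p q where ab: "a = Fib j r p" "b = Fib j r q" "p : Z j r" "q : Z j r" unfolding T by (auto simp: fibs_def)
  have "(q - p, 0, 0, 0) : span (u ` rays)" using ab Z_Rpow[OF j] by (intro ray_span subspace_diff[OF subspace_Rpow]) auto
  hence "(q - p, 0, 0, 0) : span (insert (u a) (u ` rays))" using span_mono[OF subset_insertI] by blast
  hence "u a + (q - p, 0, 0, 0) : span (insert (u a) (u ` rays))" by (intro span_add) (auto intro: span_base)
  moreover have "u b = u a + (q - p, 0, 0, 0)" by (simp add: ab u_def algebra_simps)
  ultimately show "u b : span (insert (u a) (u ` rays))" by simp
 qed (use pq T in "auto simp: fibs_def")
 then obtain k where k: "w (Fib j r q) - k *R w (Fib j r p) : L" unfolding L_def by (rule span_insertE)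
 from \<Psi>_L[OF this] have "k = 1" by (simp add: linear_diff[OF lin\<Psi>] linear_scale[OF lin\<Psi>] \<Psi>_Fib j pq)
 thus ?thesis using k by simp
qed

definition fibre_functional :: "nat => nat => ('a => real) => bool" where
 "fibre_functional j r g \<longleftrightarrow> linear g & (ALL y:L. g y = 0) & (ALL p:Z j r. g (w (Fib j r p)) = 0) &
  (ALL i<N. ALL s<K. ALL p:Z i s. (i, s) ~= (j, r) --> g (w (Fib i s p)) < 0)"

lemma ex_fibre_functional:
 assumes j: "j < N" "r < K"
 shows "EX g. fibre_functional j r g"
proof -
 have "rays \<union> fibs j r (Z j r) : cfaces w I" using face_fibre[OF j] same by simp
 then obtain g :: "'a => real" where g: "linear g" "!!a. a : rays \<union> fibs j r (Z j r) ==> g (w a) = 0"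
  "!!a. a : I - (rays \<union> fibs j r (Z j r)) ==> g (w a) < 0" by (rule cfacesE) blast
 have "g y = 0" if "y : L" for y using that unfolding L_def
  by (induction rule: span_induct_alt) (auto simp: g(2) linear_0[OF g(1)] linear_add[OF g(1)] linear_scale[OF g(1)])
 moreover have "g (w (Fib i s p)) < 0" if "i < N" "s < K" "p : Z i s" "(i, s) ~= (j, r)" for i s p
  using that by (intro g(3)) (auto simp: fibs_def rays_def)
 moreover have "g (w (Fib j r p)) = 0" if "p : Z j r" for p using that by (intro g(2)) (auto simp: fibs_def)
 ultimately have "fibre_functional j r g" unfolding fibre_functional_def using g(1) by blast
 thus ?thesis by blast
qed

text \<open>For each of the three fibres a functional vanishes on it and on \<open>L\<close> and is
  negative on the other two. Hence two coefficients at a time vanish together or have opposite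
  signs, and three nonzero numbers cannot have pairwise opposite signs.\<close>

lemma indep3:
 assumes f: "i < N" "r < K" "p : Z i r" "j < N" "s < K" "q : Z j s" "k < N" "t < K" "z : Z k t"
  and ne: "(i, r) ~= (j, s)" "(j, s) ~= (k, t)" "(i, r) ~= (k, t)"
  and L: "a *R w (Fib i r p) + b *R w (Fib j s q) + c *R w (Fib k t z) : L"
 shows "a = 0 & b = 0 & c = 0"
proof -
 obtain f1 where "fibre_functional i r f1" using ex_fibre_functional[OF f(1,2)] by blast
 hence f1: "linear f1" "!!y. y : L ==> f1 y = 0" "!!p. p : Z i r ==> f1 (w (Fib i r p)) = 0"
  "!!i' s' p. i' < N ==> s' < K ==> p : Z i' s' ==> (i', s') ~= (i, r) ==> f1 (w (Fib i' s' p)) < 0"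
  unfolding fibre_functional_def by blast+
 obtain f2 where "fibre_functional j s f2" using ex_fibre_functional[OF f(4,5)] by blast
 hence f2: "linear f2" "!!y. y : L ==> f2 y = 0" "!!p. p : Z j s ==> f2 (w (Fib j s p)) = 0"
  "!!i' s' p. i' < N ==> s' < K ==> p : Z i' s' ==> (i', s') ~= (j, s) ==> f2 (w (Fib i' s' p)) < 0"
  unfolding fibre_functional_def by blast+
 obtain f3 where "fibre_functional k t f3" using ex_fibre_functional[OF f(7,8)] by blast
 hence f3: "linear f3" "!!y. y : L ==> f3 y = 0" "!!p. p : Z k t ==> f3 (w (Fib k t p)) = 0"
  "!!i' s' p. i' < N ==> s' < K ==> p : Z i' s' ==> (i', s') ~= (k, t) ==> f3 (w (Fib i' s' p)) < 0"
  unfolding fibre_functional_def by blast+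
 have opp: "(x = 0 & y = 0) \<or> x * y < 0" if "x * g + y * h = 0" "g < 0" "h < 0" for x y g h :: real
 proof -
  consider "x * y < 0" | "0 <= x" "0 <= y" | "x <= 0" "y <= 0" by (cases "x * y < 0") (auto simp: not_less zero_le_mult_iff)
  thus ?thesis
  proof cases
   case 2
   hence "x * g <= 0" "y * h <= 0" using that by (auto simp: mult_nonneg_nonpos)
   hence "x * g = 0" "y * h = 0" using that(1) by linarith+
   thus ?thesis using that by auto
  next
   case 3
   hence "0 <= x * g" "0 <= y * h" using that by (auto simp: mult_nonpos_nonpos)
   hence "x * g = 0" "y * h = 0" using that(1) by linarith+
   thus ?thesis using that by auto
  qed simp
 qed
 have e1: "b * f1 (w (Fib j s q)) + c * f1 (w (Fib k t z)) = 0"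
  using f1(2)[OF L] f1(3)[OF f(3)] by (simp add: linear_add[OF f1(1)] linear_scale[OF f1(1)])
 have e2: "a * f2 (w (Fib i r p)) + c * f2 (w (Fib k t z)) = 0"
  using f2(2)[OF L] f2(3)[OF f(6)] by (simp add: linear_add[OF f2(1)] linear_scale[OF f2(1)])
 have e3: "a * f3 (w (Fib i r p)) + b * f3 (w (Fib j s q)) = 0"
  using f3(2)[OF L] f3(3)[OF f(9)] by (simp add: linear_add[OF f3(1)] linear_scale[OF f3(1)])
 have "(b = 0 & c = 0) \<or> b * c < 0" using f1(4) f ne by (intro opp[OF e1]) auto
 moreover have "(a = 0 & c = 0) \<or> a * c < 0" using f2(4) f ne by (intro opp[OF e2]) auto
 moreover have "(a = 0 & b = 0) \<or> a * b < 0" using f3(4) f ne by (intro opp[OF e3]) auto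
 ultimately show ?thesis by (auto simp: mult_less_0_iff)
qed

lemma indep2:
 assumes f: "i < N" "r < K" "p : Z i r" "j < N" "s < K" "q : Z j s" and ne: "(i, r) ~= (j, s)"
  and L: "a *R w (Fib i r p) + b *R w (Fib j s q) : L"
 shows "a = 0 & b = 0"
proof -
 obtain t where t: "t < K" "(i, r) ~= (i, t)" "(j, s) ~= (i, t)"
 proof -
  have "card {r, s} < card {..<K}" using Kpos(2) card_insert_le_m1[of 2 "{s}" r] by simp
  hence "~ {..<K} <= {r, s}" using card_mono[of "{r, s}" "{..<K}"] by auto
  then obtain t where "t < K" "t ~= r" "t ~= s" by auto
  thus ?thesis using that[of t] by simp
 qed
 obtain z where z: "z : Z i t" using Z_fin[OF f(1) t(1)] by blast
 have "a *R w (Fib i r p) + b *R w (Fib j s q) + 0 *R w (Fib i t z) : L" using L by simp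
 from indep3[OF f f(1) t(1) z ne t(3,2) this] show ?thesis by blast
qed

text \<open>Two parallel edges have rank one over their starting points, and this transfers.
  Independence of the two fibres modulo \<open>L\<close> turns the resulting relation into
  parallelism, and a functional exposing the starting points gives the orientation.\<close>

lemma edge_transfer:
 assumes f: "j < N" "r < K" "i < N" "s < K" "(j, r) ~= (i, s)" and Z: "a : Z j r" "b : Z j r" "a' : Z i s" "b' : Z i s"
  and S: "{Fib j r a, Fib i s a'} : cfaces u I" and T: "{Fib j r a, Fib i s a', Fib j r b, Fib i s b'} : cfaces u I"
  and par: "b - a = k *R (b' - a')" "k ~= 0" and ne: "b ~= a" "b' ~= a'"
 shows "pos_par (w (Fib j r b) - w (Fib j r a)) (w (Fib i s b') - w (Fib i s a'))"
proof -
 let ?S = "{Fib j r a, Fib i s a'}" and ?T = "{Fib j r a, Fib i s a', Fib j r b, Fib i s b'}"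
 have TS: "?T - ?S = {Fib j r b, Fib i s b'}" using ne f(5) by auto
 have ua: "u (Fib j r b) = u (Fib j r a) + k *R (u (Fib i s b') - u (Fib i s a'))"
 proof -
  have "b = a + k *R (b' - a')" using par(1) by (simp flip: par(1))
  thus ?thesis by (simp add: u_def)
 qed
 have ub: "u (Fib i s b') = u (Fib i s a') + (1 / k) *R (u (Fib j r b) - u (Fib j r a))" unfolding ua using par(2) by simp
 have "w (Fib j r b) : span (insert (w (Fib i s b')) (w ` ?S))"
 proof (rule cfaces_cover_transfer[OF finite_I same[symmetric] S T])
  fix x y assume "x : ?T - ?S" "y : ?T - ?S"
  hence xy: "x = Fib j r b \<or> x = Fib i s b'" "y = Fib j r b \<or> y = Fib i s b'" unfolding TS by auto
  have m: "u (Fib j r a) : span (insert z (u ` ?S))" "u (Fib i s a') : span (insert z (u ` ?S))"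
   "z : span (insert z (u ` ?S))" for z by (auto intro: span_base)
  have "u (Fib j r b) : span (insert (u (Fib i s b')) (u ` ?S))" by (subst ua) (intro span_add span_scale span_diff m)
  moreover have "u (Fib i s b') : span (insert (u (Fib j r b)) (u ` ?S))" by (subst ub) (intro span_add span_scale span_diff m)
  moreover have "u x : span (insert (u x) (u ` ?S))" by (rule span_base) simp
  ultimately show "u y : span (insert (u x) (u ` ?S))" using xy by (elim disjE) (simp_all only:)
 qed (use TS in auto)
 then obtain z where "w (Fib j r b) - z *R w (Fib i s b') : span (insert (w (Fib j r a)) {w (Fib i s a')})" by (rule span_insertE) simp
 then obtain x where "w (Fib j r b) - z *R w (Fib i s b') - x *R w (Fib j r a) : span {w (Fib i s a')}" by (rule span_insertE)
 then obtain y where "w (Fib j r b) - z *R w (Fib i s b') - x *R w (Fib j r a) = y *R w (Fib i s a')"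
  unfolding span_singleton by blast
 hence eq: "w (Fib j r b) = z *R w (Fib i s b') + x *R w (Fib j r a) + y *R w (Fib i s a')" by (simp add: algebra_simps)
 have l: "w (Fib j r b) - w (Fib j r a) : L" "z *R (w (Fib i s b') - w (Fib i s a')) : L"
  using fibre_diff f Z by (auto intro: L_closed)
 from L_closed(2)[OF l] have "(x - 1) *R w (Fib j r a) + (y + z) *R w (Fib i s a') : L" unfolding eq by (simp add: algebra_simps)
 from indep2[OF f(1,2) Z(1) f(3,4) Z(3) f(5) this] have xy: "x = 1" "y = - z" by auto
 have wz: "w (Fib j r b) - w (Fib j r a) = z *R (w (Fib i s b') - w (Fib i s a'))" unfolding eq xy by (simp add: algebra_simps)
 have "?S : cfaces w I" using S same by simp
 then obtain g :: "'a => real" where g: "linear g" "!!a. a : ?S ==> g (w a) = 0" "!!a. a : I - ?S ==> g (w a) < 0"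
  by (rule cfacesE) blast
 have "g (w (Fib j r b) - w (Fib j r a)) = z * g (w (Fib i s b') - w (Fib i s a'))" unfolding wz by (simp add: linear_scale[OF g(1)])
 hence "g (w (Fib j r b)) = z * g (w (Fib i s b'))" using g(2) by (simp add: linear_diff[OF g(1)])
 moreover have "g (w (Fib j r b)) < 0" "g (w (Fib i s b')) < 0" using f Z ne by (auto intro!: g(3))
 ultimately have "0 < z" by (auto simp: mult_less_0_iff)
 thus ?thesis using wz by (auto simp: pos_par_def)
qed

text \<open>The span of all copies of \<open>p\<close> in a block. Three copies in different fibres
  span it and it meets \<open>L\<close> only in 0; it is how the fibres of a block, and the stars,
  see each other.\<close>

definition TS :: "nat => pt => 'a set" where
 "TS j p = span (w ` block j {p})"

lemma face_empty: "{} : cfaces u I"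
proof -
 have "rays \<inter> stars = {}" by (auto simp: rays_def stars_def)
 thus ?thesis using cfaces_Int[OF face_rays face_stars] by simp
qed

text \<open>In the model the copies of \<open>p\<close> depend linearly on the three conic
  coordinates, because the upward shift is the quadratic expression
  \<open>m2 - 2 * j * m1 + j\<^sup>2 * m0\<close> in homogeneous form, times
  \<open>M\<close>.\<close>

lemma dim_block: "dim (u ` block j {p}) <= 3"
proof -
 define f :: "real \<times> real \<times> real => pt \<times> real \<times> real \<times> real" where
  "f = (%(m0, m1, m2). (m0 *R p + (M * (m2 - 2 * real j * m1 + (real j)\<^sup>2 * m0)) *R up d, m0, m1, m2))"
 have lin: "linear f" unfolding f_def by (rule linearI) (auto simp: algebra_simps)
 let ?B = "{f (1, 0, 0), f (0, 1, 0), f (0, 0, 1)}"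
 have fB: "f (a, b, c) : span ?B" for a b c
 proof -
  have "(a, b, c) = a *R (1, 0, 0) + b *R (0, 1, 0) + c *R (0, 0, 1::real)" by simp
  hence "f (a, b, c) = a *R f (1, 0, 0) + b *R f (0, 1, 0) + c *R f (0, 0, 1)"
   by (simp only: linear_add[OF lin] linear_scale[OF lin])
  thus ?thesis by (simp only:) (intro span_add span_scale span_base; simp)
 qed
 have "u ` block j {p} <= span ?B"
 proof (rule image_subsetI)
  fix a assume "a : block j {p}"
  then consider r where "a = Fib j r p" | "a = Star p" "j = J" by (auto simp: block_def fibs_def split: if_splits)
  thus "u a : span ?B"
  proof cases
   case (1 r)
   have "(\<tau> j r)\<^sup>2 - 2 * real j * \<tau> j r + (real j)\<^sup>2 = (\<rho> r)\<^sup>2"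
    by (simp add: \<tau>_def power2_eq_square algebra_simps)
   hence "u a = f (1, \<tau> j r, (\<tau> j r)\<^sup>2)" by (simp add: 1 u_def f_def)
   thus ?thesis using fB by simp
  next
   case 2
   have "ts\<^sup>2 + \<eta> * ip d c0 p - 2 * real j * ts + (real j)\<^sup>2 = 1 / 16 + \<eta> * ip d c0 p"
    by (simp add: 2 ts_def power2_eq_square algebra_simps add_divide_distrib)
   hence "u a = f (1, ts, ts\<^sup>2 + \<eta> * ip d c0 p)" by (simp add: 2 u_def f_def)
   thus ?thesis using fB by simp
  qed
 qed
 hence "dim (u ` block j {p}) <= card ?B" by (intro dim_le_card) auto
 also have "\<dots> <= 3" by (simp add: card_insert_if)
 finally show ?thesis .
qed

text \<open>The rank is at most 3 in the model and so in every realization, while three copies are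
  independent even modulo \<open>L\<close>.\<close>

lemma block_point:
 assumes j: "j < N" and face: "block j {p} : cfaces u I"
  and r: "r1 < K" "r2 < K" "r3 < K" "r1 ~= r2" "r2 ~= r3" "r1 ~= r3" "p : Z j r1" "p : Z j r2" "p : Z j r3"
 shows "TS j p = span {w (Fib j r1 p), w (Fib j r2 p), w (Fib j r3 p)}" "y : TS j p ==> y : L ==> y = 0"
proof -
 let ?x = "%r. w (Fib j r p)"
 let ?B = "{?x r1, ?x r2, ?x r3}"
 have i3: "a = 0 & b = 0 & c = 0" if "a *R ?x r1 + b *R ?x r2 + c *R ?x r3 : L" for a b c
  using r j by (intro indep3[OF j r(1,7) j r(2,8) j r(3,9) _ _ _ that]) auto
 have n1: "?x r3 ~: span {}" using i3[of 0 0 1] L_closed by auto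
 have n2: "?x r2 ~: span {?x r3}"
 proof
  assume "?x r2 : span {?x r3}"
  then obtain k where "?x r2 = k *R ?x r3" by (auto simp: span_singleton)
  hence "0 *R ?x r1 + 1 *R ?x r2 + (- k) *R ?x r3 : L" using L_closed by simp
  thus False using i3[of 0 1 "- k"] by simp
 qed
 have n3: "?x r1 ~: span {?x r2, ?x r3}"
 proof
  assume "?x r1 : span {?x r2, ?x r3}"
  then obtain k where "?x r1 - k *R ?x r2 : span {?x r3}" by (rule span_insertE)
  then obtain l where "?x r1 - k *R ?x r2 = l *R ?x r3" by (auto simp: span_singleton)
  hence "1 *R ?x r1 + (- k) *R ?x r2 + (- l) *R ?x r3 : L" using L_closed by (simp add: algebra_simps)
  thus False using i3[of 1 "- k" "- l"] by simp
 qed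
 have ind: "independent ?B" using n1 n2 n3 by (intro independent_insertI independent_empty) auto
 have card: "card ?B = 3" using n1 n2 n3 by (auto simp: card_insert_if intro: span_base)
 have sub: "?B <= w ` block j {p}" using r j by (auto simp: block_def fibs_def)
 have finb: "finite (block j {p})" using finite_I cfaces_subset[OF face] finite_subset by blast
 have "dim (w ` block j {p}) = dim (u ` block j {p})" using cfaces_dim_eq[OF finite_I same[symmetric] face_empty face] by simp
 hence "dim (w ` block j {p}) <= card ?B" using dim_block[of j p] card by simp
 hence "w ` block j {p} <= span ?B" using finb by (intro spanning_of_dim sub ind) auto
 thus eq: "TS j p = span ?B" unfolding TS_def using sub by (intro subset_antisym span_minimal subspace_span) (auto intro: span_base)
 show "y = 0" if y: "y : TS j p" "y : L"
 proof -
  obtain a where a: "y - a *R ?x r1 : span {?x r2, ?x r3}" using y(1) unfolding eq by (rule span_insertE)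
  obtain b where "y - a *R ?x r1 - b *R ?x r2 : span {?x r3}" using a by (rule span_insertE)
  then obtain c where c: "y - a *R ?x r1 - b *R ?x r2 = c *R ?x r3" by (auto simp: span_singleton)
  hence ye: "y = a *R ?x r1 + b *R ?x r2 + c *R ?x r3" by (simp add: algebra_simps)
  hence "a = 0 & b = 0 & c = 0" using y(2) by (intro i3) simp
  thus "y = 0" using ye by simp
 qed
qed

lemma even_Z: "even r ==> Z j r = Y j" by (simp add: Z_def)

lemma block_point_Y:
 assumes j: "j < N" and p: "p : Y j" and c: "c : Cs" "amax d c (Y j) = {p}" and y: "y : TS j p" "y : L"
 shows "y = 0"
proof -
 have face: "block j {p} : cfaces u I" using face_block[OF j c(1)] c(2) by simp
 show ?thesis using Kpos(2) p by (intro block_point(2)[OF j face, of 0 2 4 y] y) (auto simp: even_Z)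
qed

definition edge :: "nat => nat => pt => 'a" where
 "edge j r v = w (Fib j r (yp j v)) - w (Fib j r (ym j v))"

lemma y_in_Y:
 assumes "j < N" "v : V"
 shows "ym j v : Y j" "yp j v : Y j" "ym j v ~= yp j v"
proof -
 show "ym j v : Y j" "yp j v : Y j" using yp[OF assms] amax_subset[of d "cv v" "Y j"] by blast+
 obtain k where k: "k > 0" "yp j v - ym j v = k *R v" using yp[OF assms] by blast
 have "v ~= 0" using cv(2)[OF assms(2)] by (auto simp: ip_simps)
 thus "ym j v ~= yp j v" using k by auto
qed

lemma edge_L: "j < N ==> even r ==> r < K ==> v : V ==> edge j r v : L"
 unfolding edge_def using y_in_Y by (intro fibre_diff) (auto simp: even_Z)

lemma block_y:
 assumes "j < N" "A \<inter> X j = {}"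
 shows "block j A = {Fib j r p | r p. r < K & even r & p : Y j \<inter> A}"
proof -
 have "Z j r \<inter> A = {}" if "odd r" "r < K" for r using that assms chord_sub[OF assms(1) half_less[OF that]] by (auto simp: Z_def)
 hence "Z j r \<inter> A = (if even r then Y j \<inter> A else {})" if "r < K" for r using that by (simp add: even_Z)
 hence "(\<Union>r<K. fibs j r (Z j r \<inter> A)) = (\<Union>r<K. fibs j r (if even r then Y j \<inter> A else {}))" by simp
 moreover have "j = J ==> X J \<inter> A = {}" using assms by auto
 ultimately show ?thesis by (auto simp: block_def fibs_def split: if_splits)
qed

text \<open>The copies of one auxiliary edge in a block have rank one over the copies of its lower
  end. The error of parallelism then lies both in \<open>TS j (ym j v)\<close> and in
  \<open>L\<close>, so it is 0.\<close>

lemma edge_block: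
 assumes j: "j < N" and v: "v : V" and r: "even r" "r < K" "even s" "s < K"
 shows "pos_par (edge j s v) (edge j r v)"
proof -
 let ?S = "block j {ym j v}" and ?T = "block j {ym j v, yp j v}"
 let ?m = "ym j v" and ?p = "yp j v"
 note y = y_in_Y[OF j v] and nX = y_not_X[OF j v]
 have S: "?S : cfaces u I" using face_block[OF j, of "cm v"] cv(2)[OF v] ym[OF j v] by simp
 have T: "?T : cfaces u I" using face_block[OF j, of "cv v"] cv(1)[OF v] yp[OF j v] by simp
 have Se: "?S = {Fib j t ?m | t. t < K & even t}" using block_y[OF j, of "{?m}"] nX y by auto
 have Te: "?T = {Fib j t p | t p. t < K & even t & p : {?m, ?p}}" using block_y[OF j, of "{?m, ?p}"] nX y by auto
 have TS: "?T - ?S = {Fib j t ?p | t. t < K & even t}" unfolding Se Te using y(3) by auto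
 have sub: "?S <= ?T" unfolding Se Te by auto
 have "w (Fib j s ?p) : span (insert (w (Fib j r ?p)) (w ` ?S))"
 proof (rule cfaces_cover_transfer[OF finite_I same[symmetric] S T sub])
  fix a b assume "a : ?T - ?S" "b : ?T - ?S"
  then obtain t t' where ab: "a = Fib j t ?p" "b = Fib j t' ?p" "t < K" "even t" "t' < K" "even t'" unfolding TS by auto
  have "u b = u a + u (Fib j t' ?m) - u (Fib j t ?m)" by (simp add: ab u_def)
  also have "\<dots> : span (insert (u a) (u ` ?S))" using ab Se by (intro span_add span_diff span_base) auto
  finally show "u b : span (insert (u a) (u ` ?S))" .
 qed (use TS r in auto)
 then obtain k where k: "w (Fib j s ?p) - k *R w (Fib j r ?p) : span (w ` ?S)" by (rule span_insertE)
 have m: "w (Fib j t ?m) : span (w ` ?S)" if "t < K" "even t" for t using Se that by (intro span_base imageI) auto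
 have "(w (Fib j s ?p) - k *R w (Fib j r ?p)) - w (Fib j s ?m) + k *R w (Fib j r ?m) : TS j ?m"
  unfolding TS_def using r by (intro span_add span_diff span_scale k m) auto
 hence "edge j s v - k *R edge j r v : TS j ?m" by (simp add: edge_def algebra_simps)
 moreover have "edge j s v - k *R edge j r v : L" using edge_L j v r by (intro L_closed) auto
 ultimately have "edge j s v - k *R edge j r v = 0" using cv(2)[OF v] ym[OF j v] by (intro block_point_Y[OF j y(1)]) auto
 hence eq: "edge j s v = k *R edge j r v" by simp
 have "?S : cfaces w I" using S same by simp
 then obtain g :: "'a => real" where g: "linear g" "!!a. a : ?S ==> g (w a) = 0" "!!a. a : I - ?S ==> g (w a) < 0"
  by (rule cfacesE) blast
 have val: "g (edge j t v) < 0" if "t < K" "even t" for t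
 proof -
  have "g (w (Fib j t ?m)) = 0" using Se that by (intro g(2)) auto
  moreover have "g (w (Fib j t ?p)) < 0" using Se that j y by (intro g(3)) (auto simp: even_Z)
  ultimately show ?thesis by (simp add: edge_def linear_diff[OF g(1)])
 qed
 have "g (edge j s v) = k * g (edge j r v)" unfolding eq by (simp add: linear_scale[OF g(1)])
 hence "k > 0" using val[OF r(4,3)] val[OF r(2,1)] by (auto simp: mult_less_0_iff)
 thus ?thesis using eq by (auto simp: pos_par_def)
qed

end

section \<open>Ranks and faces under injective linear maps followed by positive rescaling\<close>

lemma dim_linear_image:
 assumes "linear f" "inj_on f (span S)"
 shows "dim (f ` S) = dim S"
proof -
 obtain C where C: "C <= S" "independent C" "S <= span C" "card C = dim S" by (rule basis_exists)
 have sp: "span C <= span S" using C(1) by (rule span_mono)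
 have inj: "inj_on f (span C)" using assms(2) sp inj_on_subset by blast
 have ind: "independent (f ` C)" using linear_independent_injective_image[OF assms(1) C(2) inj] .
 have "f ` S <= span (f ` C)" unfolding linear_span_image[OF assms(1)] using C(3) by blast
 hence "card (f ` C) = dim (f ` S)" using C(1) ind by (intro basis_card_eq_dim) auto
 moreover have "inj_on f C" using inj span_superset[of C] inj_on_subset by blast
 ultimately show ?thesis using C(4) by (simp add: card_image)
qed

lemma cfaces_linear_image:
 assumes "linear A" "inj_on A (span (v ` I))" "!!i. i : I ==> \<kappa> i > (0::real) & A (v i) = \<kappa> i *R w i"
 shows "cfaces w I = cfaces v I"
proof
 interpret A: linear A by fact
 have sgn: "f (A (v i)) = \<kappa> i * f (w i)" if "linear f" "i : I" for f :: "'b => real" and i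
  using assms(3)[OF that(2)] linear_scale[OF that(1)] by simp
 show "cfaces w I <= cfaces v I"
 proof
  fix S assume S: "S : cfaces w I"
  obtain f :: "_ => real" where f: "linear f" "S <= I" "!!i. i : S ==> f (w i) = 0"
   "!!i. i : I - S ==> f (w i) < 0" by (rule cfacesE[OF S]) blast
  show "S : cfaces v I"
  proof (rule cfacesI[of "%x. f (A x)"])
   show "linear (%x. f (A x))" using linear_compose[OF assms(1) f(1)] by (simp add: o_def)
   show "f (A (v i)) = 0" if "i : S" for i using sgn[OF f(1), of i] f(2,3) that by auto
   show "f (A (v i)) < 0" if "i : I - S" for i
    using sgn[OF f(1), of i] f(4)[OF that] assms(3)[of i] that by (auto simp: mult_pos_neg)
  qed fact
 qed
 obtain B where B: "linear B" "!!x. x : span (v ` I) ==> B (A x) = x"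
  using linear_exists_left_inverse_on[OF assms(1) subspace_span assms(2)] by auto
 show "cfaces v I <= cfaces w I"
 proof
  fix S assume S: "S : cfaces v I"
  obtain f :: "_ => real" where f: "linear f" "S <= I" "!!i. i : S ==> f (v i) = 0"
   "!!i. i : I - S ==> f (v i) < 0" by (rule cfacesE[OF S]) blast
  have val: "f (v i) = \<kappa> i * f (B (w i))" if "i : I" for i
  proof -
   have "v i = B (A (v i))" using B(2)[of "v i"] that by (simp add: span_base)
   hence "v i = \<kappa> i *R B (w i)" using assms(3)[OF that] linear_scale[OF B(1)] by simp
   from arg_cong[OF this, of f] show ?thesis by (simp add: linear_scale[OF f(1)])
  qed
  show "S : cfaces w I"
  proof (rule cfacesI[of "%x. f (B x)"])
   show "linear (%x. f (B x))" using linear_compose[OF B(1) f(1)] by (simp add: o_def)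
   show "f (B (w i)) = 0" if "i : S" for i
   proof -
    have "i : I" using f(2) that by blast
    thus ?thesis using val[of i] f(3)[OF that] assms(3)[of i] by auto
   qed
   show "f (B (w i)) < 0" if "i : I - S" for i using val[of i] f(4)[OF that] assms(3)[of i] that by (auto simp: mult_less_0_iff)
  qed fact
 qed
qed

lemma dim_linear_image_scaled:
 assumes "linear A" "inj_on A (span (v ` I))" "!!i. i : I ==> \<kappa> i > (0::real) & A (v i) = \<kappa> i *R w i"
 shows "dim (w ` I) = dim (v ` I)"
proof -
 have 1: "w ` I <= span (A ` v ` I)"
 proof (rule image_subsetI)
  fix i assume i: "i : I"
  hence "w i = (1 / \<kappa> i) *R A (v i)" using assms(3) by fastforce
  thus "w i : span (A ` v ` I)" using i by (simp add: span_base span_scale)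
 qed
 have 2: "A ` v ` I <= span (w ` I)" using assms(3) by (auto simp: span_base span_scale)
 have "span (w ` I) = span (A ` v ` I)" using span_minimal[OF 1 subspace_span] span_minimal[OF 2 subspace_span] by (rule subset_antisym)
 hence "dim (w ` I) = dim (A ` v ` I)" by (rule span_eq_dim)
 also have "\<dots> = dim (v ` I)" by (rule dim_linear_image[OF assms(1,2)])
 finally show ?thesis .
qed

lemma frame_map_inj:
 assumes "ALL a. (\<Sum>k<d. a k *R frame_vec d x' k) = 0 --> (ALL k<d. a k = 0)" "y : Rpow d" "frame_map d x' y = 0"
 shows "y = 0"
proof -
 have "ALL k<d. coord y k = 0" using assms(1,3) unfolding frame_map_def by blast
 moreover have "coord y k = 0" if "~ k < d" for k using assms(2) that by (simp add: Rpow_def)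
 ultimately show "y = 0" by (intro poly_mapping_eqI) (simp, blast)
qed

context stamp_copy
begin

text \<open>The last fibre of a block and the first of the next are neighbours on the conic. Both
  carry all auxiliary edges, because \<open>K\<close> is odd and position \<open>K - 1\<close> is
  therefore even.\<close>

lemma edge_next:
 assumes j: "Suc j < N" and v: "v : V"
 shows "pos_par (edge j (K - 1) v) (edge (Suc j) 0 v)"
proof -
 have j': "j < N" using j by simp
 have adj: "adj j (K - 1) (Suc j) 0" using j Kpos by (simp add: adj_def)
 have ev: "even (K - 1)" by (simp add: K_def)
 note y = y_in_Y[OF j' v] and y' = y_in_Y[OF j v]
 obtain k where k: "k > 0" "yp j v - ym j v = k *R v" using yp[OF j' v] by blast
 obtain k' where k': "k' > 0" "yp (Suc j) v - ym (Suc j) v = k' *R v" using yp[OF j v] by blast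
 show ?thesis unfolding edge_def
 proof (rule edge_transfer[where k = "k / k'"])
  have "fibs j (K - 1) (amax d (cm v) (Z j (K - 1))) \<union> fibs (Suc j) 0 (amax d (cm v) (Z (Suc j) 0)) : cfaces u I"
   using cv(2)[OF v] by (intro face_adjacent[OF adj]) simp
  thus "{Fib j (K - 1) (ym j v), Fib (Suc j) 0 (ym (Suc j) v)} : cfaces u I"
   using ev by (simp add: even_Z ym[OF j' v] ym[OF j v] fibs_def insert_commute)
  have "fibs j (K - 1) (amax d (cv v) (Z j (K - 1))) \<union> fibs (Suc j) 0 (amax d (cv v) (Z (Suc j) 0)) : cfaces u I"
   using cv(1)[OF v] by (intro face_adjacent[OF adj]) simp
  moreover have "amax d (cv v) (Y j) = {ym j v, yp j v}" "amax d (cv v) (Y (Suc j)) = {ym (Suc j) v, yp (Suc j) v}"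
   using yp[OF j' v] yp[OF j v] by blast+
  ultimately show "{Fib j (K - 1) (ym j v), Fib (Suc j) 0 (ym (Suc j) v), Fib j (K - 1) (yp j v), Fib (Suc j) 0 (yp (Suc j) v)} : cfaces u I"
   using ev by (simp add: even_Z fibs_def insert_commute)
  show "yp j v - ym j v = (k / k') *R (yp (Suc j) v - ym (Suc j) v)" using k k' by simp
 qed (use j j' Kpos ev y y' k k' in "auto simp: even_Z")
qed

definition sdir :: "pt => 'a" where
 "sdir v = edge 0 0 v"

text \<open>Parallelism travels within blocks by \<open>edge_block\<close> and between blocks by
  \<open>edge_next\<close>, so one reference vector per direction serves the whole stamp.\<close>

lemma edge_sdir:
 assumes "j < N" "v : V" "even r" "r < K"
 shows "pos_par (edge j r v) (sdir v)" using assms(1,3,4)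
proof (induction j arbitrary: r)
 case 0
 thus ?case using edge_block[OF 0(1) assms(2), of 0 r] Kpos by (simp add: sdir_def)
next
 case (Suc j)
 have ev: "even (K - 1)" by (simp add: K_def)
 have "pos_par (edge (Suc j) r v) (edge (Suc j) 0 v)" using edge_block[OF Suc.prems(1) assms(2), of 0 r] Suc.prems Kpos by simp
 moreover have "pos_par (edge (Suc j) 0 v) (edge j (K - 1) v)" using edge_next[OF Suc.prems(1) assms(2)] by (rule pos_par_sym)
 moreover have "pos_par (edge j (K - 1) v) (sdir v)" using Suc.prems ev Kpos by (intro Suc.IH) auto
 ultimately show ?case using pos_par_trans by blast
qed

lemma sdir_L: "v : V ==> sdir v : L" unfolding sdir_def using N Kpos by (intro edge_L) auto

lemma Z_odd: "Z j (2 * k + 1) = chord j k" "Z j (Suc (2 * k)) = chord j k" by (simp_all add: Z_def)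

text \<open>The fibre that carries the chord is followed by an even one, which has an auxiliary edge
  in the same direction.\<close>

lemma chord_sdir:
 assumes j: "j < N" and k: "k < n" and ch: "chord j k = {a, b}" and v: "v : V" and ab: "b - a = \<kappa> *R v" "\<kappa> > 0"
 shows "pos_par (w (Fib j (2*k+1) b) - w (Fib j (2*k+1) a)) (sdir v)"
proof -
 have r: "2*k+1 < K" "2*k+2 < K" using k by (auto simp: K_def)
 have adj: "adj j (2*k+1) j (2*k+2)" using j r by (simp add: adj_def)
 have ev: "even (2*k+2)" by simp
 note y = y_in_Y[OF j v]
 obtain k' where k': "k' > 0" "yp j v - ym j v = k' *R v" using yp[OF j v] by blast
 have val: "ip d c b = ip d c a + \<kappa> * ip d c v" for c using arg_cong[OF ab(1), of "ip d c"] by (simp add: ip_simps)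
 have neg: "\<kappa> * ip d (cm v) v < 0" using cv(2)[OF v] ab(2) by (simp add: mult_pos_neg)
 have vn: "v ~= 0" using cv(2)[OF v] by (auto simp: ip_simps)
 have ne: "b ~= a" using ab vn by auto
 have am: "amax d (cm v) {a, b} = {a}" "amax d (cv v) {a, b} = {a, b}" using val[of "cm v"] val[of "cv v"] neg cv(1)[OF v] by (auto simp: amax_def)
 have "pos_par (w (Fib j (2*k+1) b) - w (Fib j (2*k+1) a)) (w (Fib j (2*k+2) (yp j v)) - w (Fib j (2*k+2) (ym j v)))"
 proof (rule edge_transfer[where k = "\<kappa> / k'"])
  have "fibs j (2*k+1) (amax d (cm v) (Z j (2*k+1))) \<union> fibs j (2*k+2) (amax d (cm v) (Z j (2*k+2))) : cfaces u I"
   using cv(2)[OF v] by (intro face_adjacent[OF adj]) simp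
  thus "{Fib j (2*k+1) a, Fib j (2*k+2) (ym j v)} : cfaces u I"
   unfolding Z_odd ch even_Z[OF ev] ym[OF j v] am by (simp add: fibs_def insert_commute)
  have "fibs j (2*k+1) (amax d (cv v) (Z j (2*k+1))) \<union> fibs j (2*k+2) (amax d (cv v) (Z j (2*k+2))) : cfaces u I"
   using cv(1)[OF v] by (intro face_adjacent[OF adj]) simp
  moreover have "amax d (cv v) (Y j) = {ym j v, yp j v}" using yp[OF j v] by blast
  ultimately show "{Fib j (2*k+1) a, Fib j (2*k+2) (ym j v), Fib j (2*k+1) b, Fib j (2*k+2) (yp j v)} : cfaces u I"
   unfolding Z_odd ch even_Z[OF ev] am by (simp add: fibs_def insert_commute)
  show "b - a = (\<kappa> / k') *R (yp j v - ym j v)" using ab k' by simp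
  show "a : Z j (2*k+1)" "b : Z j (2*k+1)" unfolding Z_odd ch by auto
  show "ym j v : Z j (2*k+2)" "yp j v : Z j (2*k+2)" unfolding even_Z[OF ev] using y by auto
 qed (use j r ab k' ne y in auto)
 thus ?thesis using edge_sdir[OF j v ev r(2)] pos_par_trans unfolding edge_def by blast
qed

text \<open>Position 1 carries the full cluster, since \<open>chord j 0 = X j\<close>; this fibre is
  taken as the image of the cluster.\<close>

definition xx :: "nat => pt => 'a" where
 "xx j p = w (Fib j 1 p)"

lemma Z_1: "j < N ==> Z j 1 = X j" "j < N ==> Z j (Suc 0) = X j" by (simp_all add: Z_def chord0)

lemma one_less_K: "1 < K" using Kpos by simp

lemma xx_diff: "j < N ==> p : X j ==> q : X j ==> xx j q - xx j p : L"
 unfolding xx_def using one_less_K by (intro fibre_diff) (auto simp: Z_1)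

lemma face_point: "j < N ==> p : X j ==> block j {p} : cfaces u I"
 using face_block[of j "cp j p"] cp[of j p] by simp

lemma point_TS: "j < N ==> r < K ==> p : Z j r ==> w (Fib j r p) : TS j p"
 unfolding TS_def by (intro span_base imageI) (auto simp: block_def fibs_def)

lemma xx_TS: "j < N ==> p : X j ==> xx j p : TS j p"
 unfolding xx_def using one_less_K by (intro point_TS) (auto simp: Z_1)

lemma TS_L: "j < N ==> p : X j ==> y : TS j p ==> y : L ==> y = 0"
 using cp[of j p] X[of j] by (intro block_point_Y[of j p "cp j p" y]) auto

lemma chord_multiple:
 assumes j: "j < N" and k: "k < n" and ch: "chord j k = {p, q}" and v: "v : V" and pq: "q - p = \<kappa> *R v" "\<kappa> ~= 0"
 shows "EX z. w (Fib j (2*k+1) q) = w (Fib j (2*k+1) p) + z *R sdir v"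
proof (cases "\<kappa> > 0")
 case True
 then obtain z where "w (Fib j (2*k+1) q) - w (Fib j (2*k+1) p) = z *R sdir v" using chord_sdir[OF j k ch v pq(1)] by (auto simp: pos_par_def)
 thus ?thesis by (intro exI[of _ z]) (simp add: algebra_simps)
next
 case False
 have "p - q = (- \<kappa>) *R v" using arg_cong[OF pq(1), of uminus] by simp
 moreover have "chord j k = {q, p}" using ch by auto
 ultimately obtain z where "w (Fib j (2*k+1) p) - w (Fib j (2*k+1) q) = z *R sdir v"
  using chord_sdir[OF j k _ v, of q p "- \<kappa>"] False pq(2) by (auto simp: pos_par_def)
 thus ?thesis by (intro exI[of _ "- z"]) (simp add: algebra_simps)
qed

text \<open>The reason for listing each chord three times: three copies of \<open>q\<close> span
  \<open>TS j q\<close>, and in a fibre with only the chord \<open>{p, q}\<close> the copies of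
  \<open>p\<close> and \<open>q\<close> differ by a multiple of \<open>sdir v\<close>.\<close>

lemma TS_shift:
 assumes j: "j < N" and pq: "p : X j" "q : X j" "p ~= q" and v: "v : V" "q - p = \<kappa> *R v" "\<kappa> ~= 0"
  and y: "y : TS j q"
 shows "EX y':TS j p. EX t. y = y' + t *R sdir v"
proof -
 obtain k1 k2 k3 where k: "k1 < k2" "k2 < k3" "k3 < n" "chord j k1 = {p, q}" "chord j k2 = {p, q}" "chord j k3 = {p, q}"
  using chord_ex[OF j pq] by blast
 have kn: "k1 < n" "k2 < n" using k by auto
 let ?q = "%k. w (Fib j (2*k+1) q)" and ?p = "%k. w (Fib j (2*k+1) p)"
 have r: "2*k+1 < K" if "k < n" for k using that by (simp add: K_def)
 have "TS j q = span {?q k1, ?q k2, ?q k3}" using k kn r by (intro block_point(1)[OF j face_point[OF j pq(2)]]) (auto simp: Z_odd)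
 hence "y : span {?q k1, ?q k2, ?q k3}" using y by simp
 then obtain a where "y - a *R ?q k1 : span {?q k2, ?q k3}" by (rule span_insertE)
 then obtain b where "y - a *R ?q k1 - b *R ?q k2 : span {?q k3}" by (rule span_insertE)
 then obtain c where "y - a *R ?q k1 - b *R ?q k2 = c *R ?q k3" unfolding span_singleton by blast
 hence y: "y = a *R ?q k1 + b *R ?q k2 + c *R ?q k3" by (simp add: algebra_simps)
 obtain z1 where z1: "?q k1 = ?p k1 + z1 *R sdir v" using chord_multiple[OF j kn(1) k(4) v] by blast
 obtain z2 where z2: "?q k2 = ?p k2 + z2 *R sdir v" using chord_multiple[OF j kn(2) k(5) v] by blast
 obtain z3 where z3: "?q k3 = ?p k3 + z3 *R sdir v" using chord_multiple[OF j k(3) k(6) v] by blast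
 have m: "?p k : TS j p" if "k < n" "p : chord j k" for k using that by (intro point_TS[OF j r]) (auto simp: Z_odd)
 show ?thesis
 proof (intro bexI exI)
  show "y = (a *R ?p k1 + b *R ?p k2 + c *R ?p k3) + (a * z1 + b * z2 + c * z3) *R sdir v"
   unfolding y z1 z2 z3 by (simp add: algebra_simps)
  have "?p k1 : TS j p" "?p k2 : TS j p" "?p k3 : TS j p" using k kn by (simp_all only: m insertI1)
  thus "a *R ?p k1 + b *R ?p k2 + c *R ?p k3 : TS j p" unfolding TS_def by (intro span_add span_scale)
 qed
qed

lemma point_functional:
 assumes j: "j < N" and p: "p : X j"
 shows "EX g. linear g & (ALL y:TS j p. g y = (0::real)) & (ALL a:I - block j {p}. g (w a) < 0)"
proof -
 have "block j {p} : cfaces w I" using face_point[OF j p] same by simp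
 then obtain g :: "'a => real" where g: "linear g" "!!a. a : block j {p} ==> g (w a) = 0" "!!a. a : I - block j {p} ==> g (w a) < 0"
  by (rule cfacesE) blast
 have "g y = 0" if "y : TS j p" for y using that unfolding TS_def
  by (induction rule: span_induct_alt) (auto simp: g(2) linear_0[OF g(1)] linear_add[OF g(1)] linear_scale[OF g(1)])
 thus ?thesis using g(1,3) by blast
qed

lemma not_block: "q ~= p ==> Fib j r q ~: block i {p}" "q ~= p ==> Star q ~: block i {p}"
 by (auto simp: block_def fibs_def split: if_splits)

text \<open>Moving the copy of \<open>q\<close> along \<open>sdir v\<close> reaches a vector of
  \<open>TS j p\<close> whose difference from the copy of \<open>p\<close> is in \<open>L\<close>,
  so it is the copy of \<open>p\<close>. The orientation is that of a chord fibre, measured by a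
  functional that exposes \<open>p\<close>.\<close>

lemma xx_sdir:
 assumes j: "j < N" and pq: "p : X j" "q : X j" "p ~= q" and v: "v : V" "q - p = \<kappa> *R v" "\<kappa> > 0"
 shows "pos_par (xx j q - xx j p) (sdir v)"
proof -
 obtain y' t where y': "y' : TS j p" "xx j q = y' + t *R sdir v" using TS_shift[OF j pq v(1,2) _ xx_TS[OF j pq(2)]] v(3) by auto
 have "y' - xx j p : TS j p" using y'(1) xx_TS[OF j pq(1)] unfolding TS_def by (rule span_diff)
 moreover have e: "y' - xx j p = (xx j q - xx j p) - t *R sdir v" using y'(2) by simp
 have "y' - xx j p : L" unfolding e by (intro L_closed xx_diff j pq sdir_L v)
 ultimately have "y' - xx j p = 0" by (rule TS_L[OF j pq(1)])
 hence "y' = xx j p" by (simp only: right_minus_eq)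
 hence eq: "xx j q - xx j p = t *R sdir v" using y'(2) by simp
 obtain g :: "'a => real" where g: "linear g" "!!y. y : TS j p ==> g y = 0" "!!a. a : I - block j {p} ==> g (w a) < 0"
  using point_functional[OF j pq(1)] by blast
 obtain k where k: "k < n" "chord j k = {p, q}" using chord_ex[OF j pq] by blast
 obtain z where z: "z > 0" "w (Fib j (2*k+1) q) - w (Fib j (2*k+1) p) = z *R sdir v" using chord_sdir[OF j k v] by (auto simp: pos_par_def)
 have r: "2*k+1 < K" using k by (simp add: K_def)
 have "g (w (Fib j (2*k+1) q)) < 0" using j k r pq not_block(1) by (intro g(3)) (auto simp: Z_odd simp del: One_nat_def)
 moreover have "g (w (Fib j (2*k+1) p)) = 0" using j k r by (intro g(2) point_TS) (auto simp: Z_odd simp del: One_nat_def)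
 ultimately have "z * g (sdir v) < 0" using arg_cong[OF z(2), of g] by (simp add: linear_diff[OF g(1)] linear_scale[OF g(1)])
 hence neg: "g (sdir v) < 0" using z(1) by (auto simp: mult_less_0_iff)
 have "g (xx j q) < 0" unfolding xx_def using j pq one_less_K not_block(1) by (intro g(3)) (auto simp: Z_1 simp del: One_nat_def)
 moreover have "g (xx j p) = 0" using xx_TS[OF j pq(1)] by (rule g(2))
 ultimately have "t * g (sdir v) < 0" using arg_cong[OF eq, of g] by (simp add: linear_diff[OF g(1)] linear_scale[OF g(1)])
 hence "t > 0" using neg by (auto simp: mult_less_0_iff)
 thus ?thesis using eq by (auto simp: pos_par_def)
qed

lemma xx_parallel:
 assumes i: "i < N" "p : X i" "q : X i" and j: "j < N" "r : X j" "t : X j"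
  and pq: "p ~= q" "q - p = k *R (t - r)" "k > 0"
 shows "pos_par (xx i q - xx i p) (xx j t - xx j r)"
proof -
 obtain v \<kappa> where v: "v : V" "\<kappa> ~= 0" "q - p = \<kappa> *R v" using V[OF i pq(1)] by blast
 have "t - r = (1 / k) *R (q - p)" using pq by simp
 hence tr: "t - r = (\<kappa> / k) *R v" using v(3) by simp
 have rt: "r ~= t" using pq by auto
 show ?thesis
 proof (cases "\<kappa> > 0")
  case True
  hence "pos_par (xx i q - xx i p) (sdir v)" "pos_par (xx j t - xx j r) (sdir v)"
   using xx_sdir[OF i pq(1) v(1,3)] xx_sdir[OF j rt v(1) tr] pq(3) by auto
  thus ?thesis using pos_par_sym pos_par_trans by blast
 next
  case False
  have "p - q = (- \<kappa>) *R v" "r - t = (- (\<kappa> / k)) *R v"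
   using arg_cong[OF v(3), of uminus] arg_cong[OF tr, of uminus] by simp_all
  hence "pos_par (xx i p - xx i q) (sdir v)" "pos_par (xx j r - xx j t) (sdir v)"
   using xx_sdir[OF i(1,3,2) not_sym[OF pq(1)] v(1), of "- \<kappa>"] xx_sdir[OF j(1,3,2) not_sym[OF rt] v(1), of "- (\<kappa> / k)"] False pq(3) v(2)
   by (auto simp: divide_neg_pos)
  hence "pos_par (xx i p - xx i q) (xx j r - xx j t)" using pos_par_sym pos_par_trans by blast
  hence "pos_par (- (xx i q - xx i p)) (- (xx j t - xx j r))" by simp
  thus ?thesis unfolding pos_par_minus .
 qed
qed

text \<open>\<open>- basis_pt i\<close> exposes the facet of the frame opposite to
  \<open>basis_pt i\<close>; a functional for this face isolates one coefficient.\<close>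

lemma xx_frame:
 assumes j: "j < N" "X j = frame d" and s: "(\<Sum>k<d. a k *R (xx j (basis_pt k) - xx j 0)) = 0" and i: "i < d"
 shows "a i = 0"
proof -
 have inj: "basis_pt k = basis_pt l \<longleftrightarrow> k = l" for k l :: nat by (metis coord_basis_pt zero_neq_one)
 have nz: "basis_pt k ~= 0" for k by (metis coord_basis_pt lookup_zero zero_neq_one)
 have val: "ip d (- basis_pt i) x = - coord x i" for x
 proof -
  have "ip d (- basis_pt i) x = ip d x (- basis_pt i)" by (rule ip_commute)
  thus ?thesis using i by (simp add: ip_simps)
 qed
 have am: "amax d (- basis_pt i) (frame d) = frame d - {basis_pt i}" using i nz by (auto simp: amax_def val frame_def inj)
 have "fibs j 1 (amax d (- basis_pt i) (Z j 1)) : cfaces u I" using one_less_K coordCs[OF i] by (intro face_single j(1)) auto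
 hence "fibs j 1 (frame d - {basis_pt i}) : cfaces w I" using am j Z_1[OF j(1)] same by simp
 then obtain g :: "'a => real" where g: "linear g" "!!b. b : fibs j 1 (frame d - {basis_pt i}) ==> g (w b) = 0"
  "!!b. b : I - fibs j 1 (frame d - {basis_pt i}) ==> g (w b) < 0" by (rule cfacesE) blast
 have z: "g (xx j p) = 0" if "p : frame d" "p ~= basis_pt i" for p
  unfolding xx_def using that by (intro g(2)) (auto simp: fibs_def)
 have neg: "g (xx j (basis_pt i)) < 0"
  unfolding xx_def using i j one_less_K by (intro g(3)) (auto simp: fibs_def frame_def Z_1 simp del: One_nat_def)
 have "0 = (\<Sum>k<d. a k * (g (xx j (basis_pt k)) - g (xx j 0)))"
  using arg_cong[OF s, of g] by (simp add: linear_sum[OF g(1)] linear_scale[OF g(1)] linear_diff[OF g(1)] linear_0[OF g(1)])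
 also have "\<dots> = (\<Sum>k<d. if k = i then a i * g (xx j (basis_pt i)) else 0)" using z nz by (intro sum.cong) (auto simp: frame_def inj)
 also have "\<dots> = a i * g (xx j (basis_pt i))" using i by simp
 finally show ?thesis using neg by auto
qed

lemma xx_cluster_model:
 assumes inj: "inj_on X {..<N}"
 shows "cluster_model d (X ` {..<N}) (%C. xx (inv_into {..<N} X C))" unfolding cluster_model_def
proof (intro conjI ballI allI impI)
 have inv: "inv_into {..<N} X (X j) = j" if "j < N" for j using inv_into_f_f[OF inj] that by simp
 fix C D p q r t k assume "C : X ` {..<N}" "D : X ` {..<N}" and m: "p : C" "q : C" "r : D" "t : D" "0 < (k::real)"
  and pq: "p ~= q & q - p = k *R (t - r)"
 then obtain i j where ij: "i < N" "C = X i" "j < N" "D = X j" by auto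
 have "pos_par (xx i q - xx i p) (xx j t - xx j r)" using m pq ij by (intro xx_parallel[where k = k]) auto
 thus "EX k'>0. xx (inv_into {..<N} X C) q - xx (inv_into {..<N} X C) p =
   k' *R (xx (inv_into {..<N} X D) t - xx (inv_into {..<N} X D) r)" using inv ij by (simp add: pos_par_def)
next
 have inv: "inv_into {..<N} X (X j) = j" if "j < N" for j using inv_into_f_f[OF inj] that by simp
 fix a i assume s: "(\<Sum>k<d. a k *R frame_vec d (%C. xx (inv_into {..<N} X C)) k) = 0" and i: "i < d"
 obtain j where j: "j < N" "X j = frame d" using frameX by blast
 have "frame_vec d (%C. xx (inv_into {..<N} X C)) k = xx j (basis_pt k) - xx j 0" for k
  unfolding frame_vec_def using inv[OF j(1)] j(2) by simp
 thus "a i = 0" using xx_frame[OF j _ i] s by simp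
qed

text \<open>Three copies of \<open>p\<close> are independent modulo \<open>L\<close>, so dual
  functionals that vanish on \<open>L\<close> exist, and subtracting the corresponding multiples
  removes \<open>TS J p\<close>.\<close>

lemma ex_projection:
 assumes p: "p : X J"
 shows "EX P. linear P & (ALL y:L. P y = y) & (ALL y:TS J p. P y = 0)"
proof -
 let ?x = "%r. w (Fib J r p)"
 have pY: "p : Y J" using X[OF J(1)] p by blast
 have r: "0 < K" "2 < K" "4 < K" using Kpos by auto
 have Zr: "p : Z J 0" "p : Z J 2" "p : Z J 4" using pY by (auto simp: even_Z)
 have TS: "TS J p = span {?x 0, ?x 2, ?x 4}" by (rule block_point(1)[OF J(1) face_point[OF J(1) p] r]) (use Zr in auto)
 have i3: "a = 0 & b = 0 & c = 0" if "a *R ?x 0 + b *R ?x 2 + c *R ?x 4 : L" for a b c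
  by (rule indep3[OF J(1) r(1) Zr(1) J(1) r(2) Zr(2) J(1) r(3) Zr(3) _ _ _ that]) auto
 have sep: "EX g::'a => real. linear g & (ALL y:L. g y = 0) & g x1 = 1 & g x2 = 0 & g x3 = 0"
  if ind: "!!a b c. a *R x1 + b *R x2 + c *R x3 : L ==> a = 0 & b = 0 & c = 0" for x1 x2 x3
 proof -
  have "x1 ~: span (insert x2 (insert x3 (w ` rays)))"
  proof
   assume "x1 : span (insert x2 (insert x3 (w ` rays)))"
   then obtain b where "x1 - b *R x2 : span (insert x3 (w ` rays))" by (rule span_insertE)
   then obtain c where "x1 - b *R x2 - c *R x3 : L" unfolding L_def by (rule span_insertE)
   hence "1 *R x1 + (- b) *R x2 + (- c) *R x3 : L" by (simp add: algebra_simps)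
   from ind[OF this] show False by simp
  qed
  then obtain g :: "'a => real" where g: "linear g" "!!a. a : span (insert x2 (insert x3 (w ` rays))) ==> g a = 0" "g x1 = 1"
   by (rule linear_separate_span) blast
  have "w ` rays <= insert x2 (insert x3 (w ` rays))" by blast
  hence "L <= span (insert x2 (insert x3 (w ` rays)))" unfolding L_def by (rule span_mono)
  moreover have "x2 : span (insert x2 (insert x3 (w ` rays)))" "x3 : span (insert x2 (insert x3 (w ` rays)))" by (auto intro: span_base)
  ultimately show ?thesis using g(1,3) by (intro exI[of _ g] conjI ballI g(2)) auto
 qed
 have i3b: "a = 0 & b = 0 & c = 0" if "a *R ?x 2 + b *R ?x 0 + c *R ?x 4 : L" for a b c
  using i3[of b a c] that by (simp add: add.commute)
 have i3c: "a = 0 & b = 0 & c = 0" if "a *R ?x 4 + b *R ?x 0 + c *R ?x 2 : L" for a b c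
  using i3[of b c a] that by (simp add: add.commute add.left_commute)
 have si3: "EX g::'a => real. linear g & (ALL y:L. g y = 0) & g (?x 0) = 1 & g (?x 2) = 0 & g (?x 4) = 0"
  by (rule sep) (rule i3)
 have si3b: "EX g::'a => real. linear g & (ALL y:L. g y = 0) & g (?x 2) = 1 & g (?x 0) = 0 & g (?x 4) = 0"
  by (rule sep) (rule i3b)
 have si3c: "EX g::'a => real. linear g & (ALL y:L. g y = 0) & g (?x 4) = 1 & g (?x 0) = 0 & g (?x 2) = 0"
  by (rule sep) (rule i3c)
 obtain f1 :: "'a => real" where f1: "linear f1" "!!y. y : L ==> f1 y = 0" "f1 (?x 0) = 1" "f1 (?x 2) = 0" "f1 (?x 4) = 0"
  using si3 by blast
 obtain f2 :: "'a => real" where f2: "linear f2" "!!y. y : L ==> f2 y = 0" "f2 (?x 2) = 1" "f2 (?x 0) = 0" "f2 (?x 4) = 0"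
  using si3b by blast
 obtain f3 :: "'a => real" where f3: "linear f3" "!!y. y : L ==> f3 y = 0" "f3 (?x 4) = 1" "f3 (?x 0) = 0" "f3 (?x 2) = 0"
  using si3c by blast
 define P where "P y = y - f1 y *R ?x 0 - f2 y *R ?x 2 - f3 y *R ?x 4" for y
 have lin: "linear P" unfolding P_def by (rule linearI) (simp_all add: linear_add[OF f1(1)] linear_add[OF f2(1)] linear_add[OF f3(1)]
    linear_scale[OF f1(1)] linear_scale[OF f2(1)] linear_scale[OF f3(1)] algebra_simps)
 have "P y = 0" if "y : TS J p" for y using that unfolding TS by (induction rule: span_induct_alt)
   (auto simp: linear_0[OF lin] linear_add[OF lin] linear_scale[OF lin], auto simp: P_def f1 f2 f3)
 moreover have "P y = y" if "y : L" for y using that by (simp add: P_def f1 f2 f3)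
 ultimately show ?thesis using lin by blast
qed

text \<open>In the model the stars are the image of the homogenized cluster under a linear map that
  is injective because \<open>\<eta>\<close> is nonzero.\<close>

lemma dim_stars: "dim (w ` stars) = dim (hat (%x. x) ` X J)"
proof -
 define G :: "pt \<times> real => pt \<times> real \<times> real \<times> real" where
  "G = (%(y, t). (y + (M * (t / 16 + \<eta> * ip d c0 y)) *R up d, t, ts * t, ts\<^sup>2 * t + \<eta> * ip d c0 y))"
 have lin: "linear G" unfolding G_def by (rule linearI) (auto simp: algebra_simps ip_simps add_divide_distrib)
 have inj: "inj_on G (span (hat (%x. x) ` X J))"
 proof (rule inj_onI)
  fix x y assume "G x = G y"
  hence "G (x - y) = 0" by (simp add: linear_diff[OF lin])
  thus "x = y" using \<eta>(1) by (cases x; cases y) (auto simp: G_def zero_prod_def)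
 qed
 have "dim (w ` stars) = dim (u ` stars)" using cfaces_dim_eq[OF finite_I same[symmetric] face_empty face_stars] by simp
 also have "u ` stars = (%p. u (Star p)) ` X J" by (simp add: stars_def image_image)
 also have "dim ((%p. u (Star p)) ` X J) = dim (hat (%x. x) ` X J)"
  by (rule dim_linear_image_scaled[OF lin inj, where \<kappa> = "%_. 1"]) (simp add: G_def u_def hat_def)
 finally show ?thesis .
qed

text \<open>Projected to \<open>L\<close> along \<open>TS J p0\<close>, the star of \<open>p\<close>
  becomes a multiple of \<open>xx J p - xx J p0\<close>. Comparison with the projection along
  \<open>TS J q0\<close> shows that this multiple is the value at the star of one linear functional
  \<open>g\<close>. Hence \<open>(P, g)\<close> sends the stars to the homogenized cluster up to
  positive factors and an injective linear map, and equality of ranks makes it injective on their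
  span.\<close>

theorem stars_rigid:
 assumes inj: "inj_on X {..<N}" and adm: "admissible d (X J)" and two: "p0 : X J" "q0 : X J" "p0 ~= q0"
  and rigid: "!!x' :: pt set => pt => 'a. cluster_model d (X ` {..<N}) x' ==>
   EX \<kappa>>0. ALL p:X J. ALL q:X J. x' (X J) q - x' (X J) p = \<kappa> *R frame_map d x' (q - p)"
 shows "EX A \<kappa>. linear A & inj_on A (span (hat (%x. x) ` X J)) &
  (ALL p:X J. \<kappa> p > 0 & A (p, 1) = \<kappa> p *R w (Star p))"
proof -
 define x' where "x' C = xx (inv_into {..<N} X C)" for C
 have model: "cluster_model d (X ` {..<N}) x'" unfolding x'_def by (rule xx_cluster_model[OF inj])
 have invJ: "inv_into {..<N} X (X J) = J" using inv_into_f_f[OF inj, of J] J(1) by simp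
 define T where "T = frame_map d x'"
 have linT: "linear T" unfolding T_def by (rule linear_frame_map)
 have T0: "y = 0" if "y : Rpow d" "T y = 0" for y using model that unfolding cluster_model_def T_def by (intro frame_map_inj[of d x' y]) auto
 obtain \<kappa>0 where \<kappa>0: "\<kappa>0 > 0" and x: "!!p q. p : X J ==> q : X J ==> xx J q - xx J p = \<kappa>0 *R T (q - p)"
  using rigid[OF model] unfolding x'_def invJ T_def by blast
 have XR: "X J <= Rpow d" using adm by (simp add: admissible_def)
 have R: "q - p : Rpow d" if "p : X J" "q : X J" for p q using XR that by (intro subspace_diff[OF subspace_Rpow]) auto
 have xne: "xx J q - xx J p ~= 0" if "p : X J" "q : X J" "p ~= q" for p q
  using x[OF that(1,2)] \<kappa>0 T0[OF R[OF that(1,2)]] that(3) by auto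
 have shift: "EX y':TS J p. EX t. y = y' + t *R (xx J q - xx J p)"
  if pqy: "p : X J" "q : X J" "y : TS J q" for p q y
 proof (cases "p = q")
  case True thus ?thesis using pqy by (intro bexI[of _ y] exI[of _ 0]) auto
 next
  case False
  obtain v \<kappa> where v: "v : V" "\<kappa> ~= 0" "q - p = \<kappa> *R v" using V[OF J(1) pqy(1,2) False] by blast
  obtain y' t where y': "y' : TS J p" "y = y' + t *R sdir v" using TS_shift[OF J(1) pqy(1,2) False v(1,3,2) pqy(3)] by blast
  obtain z t' where z: "z : TS J p" "xx J q = z + t' *R sdir v"
   using TS_shift[OF J(1) pqy(1,2) False v(1,3,2) xx_TS[OF J(1) pqy(2)]] by blast
  have "z - xx J p : TS J p" using z(1) xx_TS[OF J(1) pqy(1)] unfolding TS_def by (rule span_diff)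
  moreover have e: "z - xx J p = (xx J q - xx J p) - t' *R sdir v" using z(2) by simp
  have "z - xx J p : L" unfolding e by (intro L_closed xx_diff J pqy sdir_L v)
  ultimately have "z - xx J p = 0" by (rule TS_L[OF J(1) pqy(1)])
  hence "z = xx J p" by (simp only: right_minus_eq)
  hence e: "xx J q - xx J p = t' *R sdir v" using z(2) by simp
  hence "t' ~= 0" using xne[OF pqy(1,2) False] by auto
  hence "sdir v = (1 / t') *R (xx J q - xx J p)" using e by simp
  thus ?thesis using y' by (intro bexI[OF _ y'(1)] exI[of _ "t / t'"]) simp
 qed
 have starTS: "w (Star p) : TS J p" if "p : X J" for p unfolding TS_def using that by (intro span_base imageI) (auto simp: block_def)
 obtain P where P: "linear P" "!!y. y : L ==> P y = y" "!!y. y : TS J p0 ==> P y = 0" using ex_projection[OF two(1)] by blast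
 obtain Q where Q: "linear Q" "!!y. y : L ==> Q y = y" "!!y. y : TS J q0 ==> Q y = 0" using ex_projection[OF two(2)] by blast
 have xL: "xx J q - xx J p : L" if "p : X J" "q : X J" for p q using xx_diff[OF J(1) that] .
 define s0 where "s0 = xx J q0 - xx J p0"
 have s0: "s0 ~= 0" "s0 : L" using xne[OF two] xL[OF two(1,2)] by (auto simp: s0_def)
 obtain f :: "'a => real" where f: "linear f" "f s0 = 1" using linear_separate_span[of s0 "{}"] s0(1) by auto
 define g where "g y = f (P y - Q y)" for y
 have ling: "linear g" unfolding g_def using linear_compose[OF linear_compose_sub[OF P(1) Q(1)] f(1)] by (simp add: o_def)
 have PQ: "P (w (Star p)) - Q (w (Star p)) = g (w (Star p)) *R s0" if p: "p : X J" for p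
 proof -
  obtain y1 t where y1: "y1 : TS J q0" "w (Star p) = y1 + t *R (xx J p - xx J q0)" using shift[OF two(2) p starTS[OF p]] by blast
  obtain y' t' where y': "y' : TS J p0" "y1 = y' + t' *R s0" using shift[OF two(1,2) y1(1)] unfolding s0_def by blast
  have "P y1 = t' *R s0" unfolding y'(2) using P y'(1) s0(2) by (simp add: linear_add[OF P(1)] linear_scale[OF P(1)])
  hence "P (w (Star p)) - Q (w (Star p)) = t' *R s0" unfolding y1(2) using P(2) Q(2,3) y1(1) xL[OF two(2) p]
   by (simp add: linear_add[OF P(1)] linear_scale[OF P(1)] linear_add[OF Q(1)] linear_scale[OF Q(1)])
  thus ?thesis using f by (simp add: g_def linear_scale[OF f(1)])
 qed
 have PS: "P (w (Star p)) = g (w (Star p)) *R (xx J p - xx J p0)" if p: "p : X J" for p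
 proof -
  obtain y0 a where y0: "y0 : TS J p0" "w (Star p) = y0 + a *R (xx J p - xx J p0)" using shift[OF two(1) p starTS[OF p]] by blast
  have Pa: "P (w (Star p)) = a *R (xx J p - xx J p0)" unfolding y0(2)
   using P y0(1) xL[OF two(1) p] by (simp add: linear_add[OF P(1)] linear_scale[OF P(1)])
  consider "p = p0" | "p = q0" | "p ~= p0" "p ~= q0" by blast
  thus ?thesis
  proof cases
   case 1 thus ?thesis using Pa by simp
  next
   case 2
   hence "Q (w (Star p)) = 0" using Q(3) starTS[OF p] by simp
   thus ?thesis using PQ[OF p] 2 by (simp add: s0_def)
  next
   \<comment> \<open>Both projections of the star are known up to a factor, and their difference is
     \<open>g\<close> times \<open>s0\<close>. As \<open>p\<close>, \<open>p0\<close> and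
     \<open>q0\<close> are not collinear, this determines the factors.\<close>
   case 3
   obtain y1 b where y1: "y1 : TS J q0" "w (Star p) = y1 + b *R (xx J p - xx J q0)" using shift[OF two(2) p starTS[OF p]] by blast
   have Qb: "Q (w (Star p)) = b *R (xx J p - xx J q0)" unfolding y1(2)
    using Q y1(1) xL[OF two(2) p] by (simp add: linear_add[OF Q(1)] linear_scale[OF Q(1)])
   define c where "c = a - g (w (Star p))"
   define \<beta> where "\<beta> = b - g (w (Star p))"
   have "c *R (xx J p - xx J p0) = \<beta> *R (xx J p - xx J q0)"
    using PQ[OF p] unfolding Pa Qb by (simp add: s0_def c_def \<beta>_def algebra_simps)
   hence "\<kappa>0 *R (c *R T (p - p0) - \<beta> *R T (p - q0)) = 0"
    unfolding x[OF two(1) p] x[OF two(2) p] by (simp add: scaleR_diff_right mult.commute)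
   hence "T (c *R (p - p0) - \<beta> *R (p - q0)) = 0"
    using \<kappa>0 by (simp only: linear_diff[OF linT, of "c *R (p - p0)"] linear_scale[OF linT]) simp
   hence "c *R (p - p0) - \<beta> *R (p - q0) = 0" using XR p two by (intro T0 subspace_diff subspace_scale subspace_Rpow) auto
   hence "c *R (p0 - p) = \<beta> *R (q0 - p)" by (simp add: algebra_simps)
   hence "c = 0" using admissible_not_collinear[OF adm p two(1,2) 3(1) two(3) 3(2)] by blast
   thus ?thesis using Pa by (simp add: c_def)
  qed
 qed
 have pos: "g (w (Star p)) > 0" if p: "p : X J" for p
 proof (cases "p = p0")
  case False
  obtain y0 a where y0: "y0 : TS J p0" "w (Star p) = y0 + a *R (xx J p - xx J p0)" using shift[OF two(1) p starTS[OF p]] by blast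
  have "P (w (Star p)) = a *R (xx J p - xx J p0)" unfolding y0(2)
   using P y0(1) xL[OF two(1) p] by (simp add: linear_add[OF P(1)] linear_scale[OF P(1)])
  hence a: "a = g (w (Star p))" using PS[OF p] xne[OF two(1) p not_sym[OF False]] by simp
  obtain h :: "'a => real" where h: "linear h" "!!y. y : TS J p0 ==> h y = 0" "!!a. a : I - block J {p0} ==> h (w a) < 0"
   using point_functional[OF J(1) two(1)] by blast
  have "h (xx J p) < 0" unfolding xx_def using J p one_less_K not_block(1)[OF False] by (intro h(3)) (auto simp: Z_1 simp del: One_nat_def)
  moreover have "h (w (Star p)) < 0" using p not_block(2)[OF False] by (intro h(3)) auto
  moreover have "h (w (Star p)) = a * h (xx J p)" unfolding y0(2)
   using h(2)[OF y0(1)] h(2)[OF xx_TS[OF J(1) two(1)]] by (simp add: linear_add[OF h(1)] linear_scale[OF h(1)] linear_diff[OF h(1)])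
  ultimately have "a * h (xx J p) < 0" "h (xx J p) < 0" by simp_all
  hence "a > 0" by (auto simp: mult_less_0_iff)
  thus ?thesis using a by simp
 next
  case True
  obtain y1 b where y1: "y1 : TS J q0" "w (Star p0) = y1 + b *R (xx J p0 - xx J q0)" using shift[OF two(2,1) starTS[OF two(1)]] by blast
  have "Q (w (Star p0)) = b *R (xx J p0 - xx J q0)" unfolding y1(2)
   using Q y1(1) xL[OF two(2,1)] by (simp add: linear_add[OF Q(1)] linear_scale[OF Q(1)])
  hence "Q (w (Star p0)) = - (b *R s0)" by (simp add: s0_def algebra_simps)
  moreover have "P (w (Star p0)) = 0" using P(3) starTS[OF two(1)] by blast
  ultimately have b: "b = g (w (Star p0))" using PQ[OF two(1)] s0(1) by simp
  obtain h :: "'a => real" where h: "linear h" "!!y. y : TS J q0 ==> h y = 0" "!!a. a : I - block J {q0} ==> h (w a) < 0"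
   using point_functional[OF J(1) two(2)] by blast
  have "h (xx J p0) < 0" unfolding xx_def using J two one_less_K not_block(1)[OF two(3)] by (intro h(3)) (auto simp: Z_1 simp del: One_nat_def)
  moreover have "h (w (Star p0)) < 0" using two not_block(2)[OF two(3)] by (intro h(3)) auto
  moreover have "h (w (Star p0)) = b * h (xx J p0)" unfolding y1(2)
   using h(2)[OF y1(1)] h(2)[OF xx_TS[OF J(1) two(2)]] by (simp add: linear_add[OF h(1)] linear_scale[OF h(1)] linear_diff[OF h(1)])
  ultimately have "b * h (xx J p0) < 0" "h (xx J p0) < 0" by simp_all
  hence "b > 0" by (auto simp: mult_less_0_iff)
  thus ?thesis using b True by simp
 qed
 define \<omega> where "\<omega> y = (P y, g y)" for y
 have lin\<omega>: "linear \<omega>" unfolding \<omega>_def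
  by (rule linearI) (simp_all add: linear_add[OF P(1)] linear_scale[OF P(1)] linear_add[OF ling] linear_scale[OF ling])
 define B where "B z = (\<kappa>0 *R T (fst z - snd z *R p0), snd z)" for z :: "pt \<times> real"
 have linB: "linear B" unfolding B_def by (rule linearI) (simp_all add: linear_add[OF linT] linear_scale[OF linT] linear_diff[OF linT] algebra_simps)
 have subV: "subspace (Rpow d \<times> (UNIV :: real set))" by (intro subspace_Times subspace_Rpow subspace_UNIV)
 have spanR: "span (hat (%x. x) ` X J) <= Rpow d \<times> UNIV" using XR by (intro span_minimal subV) (auto simp: hat_def)
 have injB: "inj_on B (span (hat (%x. x) ` X J))"
 proof (rule inj_onI)
  fix y z assume yz: "y : span (hat (%x. x) ` X J)" "z : span (hat (%x. x) ` X J)" "B y = B z"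
  have snd: "snd y = snd z" using arg_cong[OF yz(3), of snd] by (simp add: B_def)
  have T: "T (fst y - snd y *R p0) = T (fst z - snd z *R p0)" using arg_cong[OF yz(3), of fst] \<kappa>0 by (simp add: B_def)
  have "T (fst y - fst z) = 0" using T snd by (simp add: linear_diff[OF linT])
  moreover have "fst y - fst z : Rpow d" using spanR yz(1,2) by (intro subspace_diff[OF subspace_Rpow]) auto
  ultimately have "fst y - fst z = 0" using T0 by blast
  thus "y = z" using snd by (intro prod_eqI) auto
 qed
 have BS: "B (hat (%x. x) p) = (1 / g (w (Star p))) *R \<omega> (w (Star p))" if p: "p : X J" for p
  using pos[OF p] by (simp add: B_def hat_def \<omega>_def PS[OF p] x[OF two(1) p])
 have "dim ((%p. \<omega> (w (Star p))) ` X J) = dim (hat (%x. x) ` X J)"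
  by (rule dim_linear_image_scaled[OF linB injB, where \<kappa> = "%p. 1 / g (w (Star p))"]) (use pos BS in auto)
 moreover have "(%p. \<omega> (w (Star p))) ` X J = \<omega> ` w ` stars" by (simp add: stars_def image_image)
 ultimately have "dim (w ` stars) <= dim (\<omega> ` w ` stars)" using dim_stars by simp
 moreover have "finite (w ` stars)" using adm by (simp add: stars_def admissible_def)
 ultimately have inj\<omega>: "inj_on \<omega> (span (w ` stars))" by (intro inj_on_span_of_dim[OF lin\<omega>])
 obtain R' where R': "linear R'" "!!y. y : span (w ` stars) ==> R' (\<omega> y) = y"
  using linear_exists_left_inverse_on[OF lin\<omega> subspace_span inj\<omega>] by auto
 have inS: "w (Star p) : span (w ` stars)" if "p : X J" for p using that by (intro span_base) (auto simp: stars_def)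
 show ?thesis
 proof (rule exI[of _ "%y. R' (B y)"], rule exI[of _ "%p. 1 / g (w (Star p))"], intro conjI ballI)
  show "linear (%y. R' (B y))" using linear_compose[OF linB R'(1)] by (simp add: o_def)
  show "inj_on (%y. R' (B y)) (span (hat (%x. x) ` X J))"
  proof (rule inj_onI)
   fix y z assume yz: "y : span (hat (%x. x) ` X J)" "z : span (hat (%x. x) ` X J)" "R' (B y) = R' (B z)"
   have "B ` span (hat (%x. x) ` X J) = span (B ` hat (%x. x) ` X J)" by (rule linear_span_image[OF linB, symmetric])
   also have "\<dots> <= \<omega> ` span (w ` stars)" unfolding linear_span_image[OF lin\<omega>, symmetric]
   proof (rule span_minimal[OF image_subsetI subspace_span])
    fix z' assume "z' : hat (%x. x) ` X J"
    then obtain p where p: "p : X J" and z': "z' = hat (%x. x) p" by blast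
    have "\<omega> (w (Star p)) : span (\<omega> ` w ` stars)" using p by (intro span_base) (auto simp: stars_def)
    thus "B z' : span (\<omega> ` w ` stars)" unfolding z' BS[OF p] by (rule span_scale)
   qed
   finally obtain y' z' where "B y = \<omega> y'" "y' : span (w ` stars)" "B z = \<omega> z'" "z' : span (w ` stars)" using yz(1,2) by blast
   hence "B y = B z" using yz(3) R'(2) by metis
   thus "y = z" using injB yz(1,2) by (simp add: inj_on_def)
  qed
  fix p assume p: "p : X J"
  show "0 < 1 / g (w (Star p))" using pos[OF p] by simp
  show "R' (B (p, 1)) = (1 / g (w (Star p))) *R w (Star p)"
   using BS[OF p] R'(2)[OF inS[OF p]] by (simp add: hat_def linear_scale[OF R'(1)])
 qed
qed

end

section \<open>Choosing functionals, auxiliary edges and small constants for a family of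
  clusters\<close>

section \<open>Existence of the auxiliary data\<close>

text \<open>Small constants are taken from \<open>at_right 0\<close>, so that finitely many strict
  inequalities can be met at once.\<close>

lemma eventually_small:
 assumes "(0::real) < a"
 shows "\<forall>\<^sub>F t in at_right 0. 0 < a + t * b"
proof -
 have "((%t. a + t * b) \<longlongrightarrow> a + 0 * b) (at_right 0)" by (intro tendsto_intros)
 thus ?thesis using assms by (intro order_tendstoD(1)) auto
qed

lemma at_right_witness:
 assumes "\<forall>\<^sub>F t in at_right (0::real). P t"
 obtains t where "0 < t" "P t" using eventually_happens'[OF trivial_limit_at_right_real eventually_conj[OF assms eventually_at_right_less]] that
 by (elim exE conjE)

lemma exists_maximizer:
 fixes f :: "'a => real"
 assumes "finite X" "X ~= {}"
 shows "EX q. q : X & (ALL x:X. f x <= f q)"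
proof -
 have "Max (f ` X) : f ` X" using assms by (intro Max_in) auto
 then obtain q where "q : X" "Max (f ` X) = f q" by (elim imageE)
 thus ?thesis using assms(1) by (metis Max_ge finite_imageI imageI)
qed

lemma avoid_zeros:
 assumes "finite F" "!!a b. (a, b) : F ==> a ~= 0 \<or> b ~= (0::real)"
 shows "EX t. ALL (a, b):F. a + t * b ~= 0"
proof -
 have "finite (\<Union>(a, b)\<in>F. {t. a + t * b = 0})"
 proof (intro finite_UN_I assms(1))
  fix z assume "z : F"
  moreover obtain a b where z: "z = (a, b)" by (cases z)
  ultimately have ab: "a ~= 0 \<or> b ~= 0" using assms(2) by blast
  have "{t. a + t * b = 0} <= {- a / b}" using ab by (cases "b = 0") (auto simp: field_simps add_eq_0_iff)
  hence "finite {t. a + t * b = 0}" by (rule finite_subset) simp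
  thus "finite (case z of (a, b) => {t. a + t * b = 0})" unfolding z by simp
 qed
 then obtain t where "t ~: (\<Union>(a, b)\<in>F. {t. a + t * b = 0})" using infinite_UNIV_char_0 ex_new_if_finite by blast
 thus ?thesis by (intro exI[of _ t]) auto
qed

lemma ip_pos:
 assumes "x : Rpow d" "x ~= 0"
 shows "0 < ip d x x"
proof -
 obtain k where k: "coord x k ~= 0" using assms(2) by (metis poly_mapping_eqI lookup_zero)
 hence "k < d" using assms(1) by (auto simp: Rpow_def not_less[symmetric])
 thus ?thesis unfolding ip_def using k by (intro sum_pos2[of _ k]) (auto simp: zero_less_mult_iff less_le)
qed

lemma ip_represents:
 assumes "linear g"
 shows "EX e:Rpow d. ALL x:Rpow d. ip d e x = g x"
proof (intro bexI ballI)
 let ?e = "\<Sum>k<d. g (basis_pt k) *R basis_pt k"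
 show "?e : Rpow d" by (rule Rpow_comb)
 fix x assume x: "x : Rpow d"
 have "g x = g (\<Sum>k<d. coord x k *R basis_pt k)" using Rpow_expansion[OF x] by simp
 also have "\<dots> = (\<Sum>k<d. coord x k * g (basis_pt k))" by (simp add: linear_sum[OF assms] linear_scale[OF assms])
 finally show "ip d ?e x = g x" unfolding ip_def by (simp only: coord_comb) (simp add: mult.commute)
qed

lemma direction_representatives:
 assumes "finite D" "0 ~: D"
 shows "EX V<=D. (ALL x:D. EX v:V. EX k. k ~= 0 & x = k *R v) &
  (ALL v:V. ALL u:V. v ~= u --> (ALL k. u ~= k *R (v :: 'a::real_vector)))" using assms
proof (induction D rule: finite_induct)
 case (insert x D)
 then obtain V where V: "V <= D" "ALL y:D. EX v:V. EX k. k ~= 0 & y = k *R v"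
  "ALL v:V. ALL u:V. v ~= u --> (ALL k. u ~= k *R v)" by auto
 have x0: "x ~= 0" using insert.prems by auto
 show ?case
 proof (cases "EX v:V. EX k. x = k *R v")
  case True
  then obtain v k where "v : V" "x = k *R v" by blast
  hence "EX v:V. EX k. k ~= 0 & x = k *R v" using x0 by (intro bexI[of _ v] exI[of _ k]) auto
  thus ?thesis using V by (intro exI[of _ V]) auto
 next
  case False
  have "v ~= k *R x" if "v : V" for v k
  proof
   assume h: "v = k *R x"
   have "v ~= 0" using V(1) that insert.prems by auto
   hence "k ~= 0" using h by auto
   hence "x = (1 / k) *R v" using h by simp
   thus False using False that by blast
  qed
  moreover have "EX v:insert x V. EX k. k ~= 0 & y = k *R v" if "y : insert x D" for y
  proof (cases "y = x")
   case True thus ?thesis by (intro bexI[of _ x] exI[of _ 1]) auto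
  next
   case False thus ?thesis using V(2) that by blast
  qed
  ultimately show ?thesis using V(1,3) False by (intro exI[of _ "insert x V"]) blast
 qed
qed simp

definition upward :: "nat => pt => bool" where
 "upward d c \<longleftrightarrow> c : Rpow d & ip d c (up d) = 1"

lemma upward_comb: "upward d a ==> upward d b ==> upward d (a + t *R (b - a))" unfolding upward_def
 by (auto simp: ip_add_left ip_diff_left ip_scaleR_left intro!: subspace_add subspace_diff subspace_scale subspace_Rpow)

lemma upward_normalize:
 assumes "c : Rpow d" "ip d c (up d) > 0"
 shows "EX r>0. upward d (r *R c)" using assms by (intro exI[of _ "1 / ip d c (up d)"])
  (auto simp: upward_def ip_scaleR_left intro: subspace_scale[OF subspace_Rpow])

lemma admissible_exposer:
 assumes X: "admissible d X" "p : X"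
 shows "EX c. upward d c & (ALL q:X - {p}. ip d c q < ip d c p)"
proof -
 obtain c where c: "c : Rpow d" "ip d c (up d) > 0" "!!q. q : X ==> q ~= p ==> ip d c q < ip d c p"
  by (rule admissibleD[OF X]) blast
 obtain r where "r > 0" "upward d (r *R c)" using upward_normalize[OF c(1,2)] by blast
 thus ?thesis using c(3) by (intro exI[of _ "r *R c"]) (auto simp: ip_scaleR_left)
qed

lemma nonvertical:
 assumes X: "admissible d X" "p : X" "q : X" "p ~= q"
 shows "EX a b. upward d a & upward d b & ip d a (q - p) < 0 & 0 < ip d b (q - p)"
 using admissible_exposer[OF X(1,2)] admissible_exposer[OF X(1,3)] X(2-4) by (force simp: ip_simps)

text \<open>Functionals of opposite sign at \<open>v\<close> have an upward affine combination that
  kills \<open>v\<close>. Each further \<open>u\<close> is avoided by adding a multiple of some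
  \<open>e\<close> that vanishes on \<open>v\<close> and \<open>up d\<close>; such an
  \<open>e\<close> with nonzero value at \<open>u\<close> exists when \<open>c\<close> vanishes at
  \<open>u\<close>, because then \<open>u\<close> is outside their span.\<close>

lemma generic_functional:
 assumes ab: "upward d a" "upward d b" "ip d a v < 0" "0 < ip d b v" and v: "v : Rpow d"
  and U: "finite U" "U <= Rpow d" "!!u k. u : U ==> u ~= k *R v"
 shows "EX c. upward d c & ip d c v = 0 & (ALL u:U. ip d c u ~= 0)" using U
proof (induction U rule: finite_induct)
 case empty
 let ?t = "- ip d a v / (ip d b v - ip d a v)"
 have "ip d (a + ?t *R (b - a)) v = 0" using ab(3,4) by (simp add: ip_add_left ip_scaleR_left ip_diff_left)
 thus ?case using upward_comb[OF ab(1,2), of ?t] by blast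
next
 case (insert u U)
 then obtain c where c: "upward d c" "ip d c v = 0" "ALL u:U. ip d c u ~= 0" by blast
 have "EX e:Rpow d. ip d e v = 0 & ip d e (up d) = 0 & (ip d c u ~= 0 \<or> ip d e u ~= 0)"
 proof (cases "ip d c u = 0")
  case True
  have "u ~: span {v, up d}"
  proof
   assume "u : span {v, up d}"
   then obtain k where "u - k *R v : span {up d}" by (rule span_insertE)
   then obtain l where l: "u - k *R v = l *R up d" unfolding span_singleton by blast
   hence "ip d c (u - k *R v) = ip d c (l *R up d)" by simp
   hence "l = 0" using True c by (simp add: ip_simps upward_def)
   thus False using l insert.prems(2)[of u k] by simp
  qed
  then obtain g :: "pt => real" where g: "linear g" "!!a. a : span {v, up d} ==> g a = 0" "g u = 1"
   by (rule linear_separate_span) blast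
  obtain e where "e : Rpow d" "ALL x:Rpow d. ip d e x = g x" using ip_represents[OF g(1)] by blast
  thus ?thesis using g(2)[of v] g(2)[of "up d"] g(3) v up_in_Rpow insert.prems(1) by (intro bexI[of _ e]) (auto simp: span_base)
 next
  case False
  thus ?thesis using subspace_0[OF subspace_Rpow] by (intro bexI[of _ 0]) (auto simp: ip_def)
 qed
 then obtain e where e: "e : Rpow d" "ip d e v = 0" "ip d e (up d) = 0" "ip d c u ~= 0 \<or> ip d e u ~= 0" by blast
 have "EX t. ALL (x, y):(%u. (ip d c u, ip d e u)) ` insert u U. x + t * y ~= 0"
  using insert.hyps(1) e(4) c(3) by (intro avoid_zeros) auto
 then obtain t where t: "ALL u':insert u U. ip d c u' + t * ip d e u' ~= 0" by auto
 have "upward d (c + t *R e)"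
  using c(1) e unfolding upward_def by (auto simp: ip_add_left ip_scaleR_left intro!: subspace_add subspace_scale subspace_Rpow)
 thus ?case using t c(2) e(2) by (intro exI[of _ "c + t *R e"]) (auto simp: ip_add_left ip_scaleR_left)
qed

text \<open>Exposing is an open condition. Moving along \<open>basis_pt 0 - basis_pt 1\<close> keeps
  the value on \<open>up d\<close> and misses the finite set \<open>C\<close> for almost all small
  steps.\<close>

lemma exposer_avoiding:
 assumes X: "admissible d X" "p : X" and d: "2 <= d" and C: "finite C"
 shows "EX c. upward d c & (ALL q:X - {p}. ip d c q < ip d c p) & c ~: C"
proof -
 obtain c where c: "upward d c" "ALL q:X - {p}. ip d c q < ip d c p" using admissible_exposer[OF X] by blast
 define e where "e = basis_pt 0 - basis_pt 1"
 have e: "e : Rpow d" "ip d e (up d) = 0" "coord e 0 = 1"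
 proof -
  show "e : Rpow d" using d by (auto simp: e_def basis_pt_in_Rpow intro!: subspace_diff[OF subspace_Rpow])
  have "ip d e (up d) = ip d (up d) (basis_pt 0) - ip d (up d) (basis_pt 1)" by (simp only: e_def ip_commute[of d _ "up d"] ip_simps)
  also have "\<dots> = 0" using d by (simp add: up_def lookup_sum cong: if_cong)
  finally show "ip d e (up d) = 0" .
 qed (simp add: e_def lookup_minus)
 have fin: "finite X" using X(1) by (simp add: admissible_def)
 have "\<forall>\<^sub>F t in at_right 0. ALL q:X - {p}. 0 < (ip d c p - ip d c q) + t * (ip d e p - ip d e q)"
  using fin c(2) by (intro eventually_ball_finite ballI eventually_small) auto
 moreover have "\<forall>\<^sub>F t in at_right 0. ALL b:C. t ~= coord b 0 - coord c 0"
  using C by (intro eventually_ball_finite ballI eventually_neq_at_within)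
 ultimately have "\<forall>\<^sub>F t in at_right 0. (ALL q:X - {p}. 0 < (ip d c p - ip d c q) + t * (ip d e p - ip d e q)) &
   (ALL b:C. t ~= coord b 0 - coord c 0)" by (rule eventually_conj)
 then obtain t :: real where "(ALL q:X - {p}. 0 < (ip d c p - ip d c q) + t * (ip d e p - ip d e q)) &
   (ALL b:C. t ~= coord b 0 - coord c 0)" by (rule at_right_witness)
 note t = conjunct1[OF this] conjunct2[OF this]
 show ?thesis
 proof (intro exI[of _ "c + t *R e"] conjI ballI)
  show "upward d (c + t *R e)"
   using c(1) e unfolding upward_def by (auto simp: ip_add_left ip_scaleR_left intro!: subspace_add subspace_scale subspace_Rpow)
  show "ip d (c + t *R e) q < ip d (c + t *R e) p" if "q : X - {p}" for q
   using t(1) that by (fastforce simp: ip_add_left ip_scaleR_left algebra_simps)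
  have "coord (c + t *R e) 0 = coord c 0 + t" using e(3) by (simp add: lookup_add)
  thus "c + t *R e ~: C" using t(2) by force
 qed
qed

text \<open>The carrier of a cluster: with \<open>m c = c - (|c|^2/2) up\<close> the value of \<open>c\<close> at \<open>m c'\<close> is
 \<open>(|c|^2 - |c - c'|^2)/2\<close>, so the points \<open>q + s (m (cv v) - m (cp q))\<close> are exposed by the functionals \<open>cv v\<close>.\<close>

lemma carrier_exists:
 assumes X: "finite X" "X ~= {}" "X <= Rpow d" and cp: "!!p. p : X ==> upward d (cp p)"
   "!!p q. p : X ==> q : X ==> q ~= p ==> ip d (cp p) q < ip d (cp p) p"
  and V: "finite V" "V <= Rpow d" and cv: "!!v. v : V ==> upward d (cv v) & ip d (cv v) v = 0" "inj_on cv V"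
  and ne: "!!p v. p : X ==> v : V ==> cp p ~= cv v"
 shows "EX ym yp \<mu>. 0 < \<mu> & (ALL v:V. ym v : Rpow d & yp v - ym v = \<mu> *R v & ym v ~: X & yp v ~: X) &
  (ALL v:V. ALL y:X \<union> ym ` V \<union> yp ` V. y ~= ym v & y ~= yp v --> ip d (cv v) y < ip d (cv v) (ym v)) &
  (ALL p:X. ALL y:X \<union> ym ` V \<union> yp ` V. y ~= p --> ip d (cp p) y < ip d (cp p) p)"
proof -
 define sq where "sq x = ip d x x" for x
 define m where "m c = c - (sq c / 2) *R up d" for c
 have im: "ip d c (m c') = (sq c - sq (c - c')) / 2" if "upward d c" for c c'
  using that by (simp add: m_def sq_def ip_simps ip_diff_left upward_def ip_commute[of d c' c] field_simps)
 have sqpos: "0 < sq (c - c')" if "upward d c" "upward d c'" "c ~= c'" for c c'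
  unfolding sq_def using that by (intro ip_pos subspace_diff[OF subspace_Rpow]) (auto simp: upward_def)
 have sq0: "0 <= sq (c - c')" for c c' unfolding sq_def ip_def by (intro sum_nonneg) simp
 have "\<forall>\<^sub>F s in at_right 0. ALL p:X. ALL q:X - {p}. 0 < (ip d (cp p) p - ip d (cp p) q) + s * (- sq (cp p - cp q) / 2)"
  using X(1) cp(2) by (intro eventually_ball_finite ballI eventually_small) auto
 then obtain s where s0: "0 < s" and s: "ALL p:X. ALL q:X - {p}. 0 < (ip d (cp p) p - ip d (cp p) q) + s * (- sq (cp p - cp q) / 2)"
  by (rule at_right_witness)
 note s = s s0
 \<comment> \<open>The height that \<open>cv v\<close> gives to the midpoint of the new edge if the
   edge is hung at \<open>x\<close>; the point \<open>q v\<close> of \<open>X\<close> that makes it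
   largest is used.\<close>
 define g where "g v x = ip d (cv v) x + s / 2 * sq (cv v - cp x)" for v x
 have "ALL v. EX q. q : X & (ALL x:X. g v x <= g v q)" using exists_maximizer[OF X(1,2)] by (rule allI)
 hence "EX q. ALL v. q v : X & (ALL x:X. g v x <= g v (q v))" by (rule choice)
 then obtain q where q0: "ALL v. q v : X & (ALL x:X. g v x <= g v (q v))" by (elim exE)
 have q: "q v : X" "x : X ==> ip d (cv v) x + s / 2 * sq (cv v - cp x) <= ip d (cv v) (q v) + s / 2 * sq (cv v - cp (q v))" for v x
  using q0[rule_format, of v] by (simp_all add: g_def)
 define b where "b v = q v - s *R m (cp (q v)) + s *R m (cv v)" for v
 have ib: "ip d c (b v) = ip d c (q v) + s / 2 * (sq (c - cp (q v)) - sq (c - cv v))" if "upward d c" for c v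
  unfolding b_def by (simp only: ip_simps im[OF that]) (simp add: field_simps)
 have bR: "b v : Rpow d" if "v : V" for v
 proof -
  have "m c : Rpow d" if "upward d c" for c
   unfolding m_def using that up_in_Rpow by (intro subspace_diff[OF subspace_Rpow] subspace_scale[OF subspace_Rpow]) (auto simp: upward_def)
  thus ?thesis unfolding b_def using q(1) X(3) cp cv that
   by (intro subspace_add[OF subspace_Rpow] subspace_diff[OF subspace_Rpow] subspace_scale[OF subspace_Rpow]) auto
 qed
 have sq00: "sq 0 = 0" by (simp add: sq_def ip_def)
 have bX: "ip d (cv v) x < ip d (cv v) (b v)" if "v : V" "x : X" for v x
 proof -
  have "0 < sq (cv v - cp x)" using cv cp ne[OF that(2,1)] that by (intro sqpos) auto
  hence "ip d (cv v) x < ip d (cv v) x + s / 2 * sq (cv v - cp x)" using s(2) by simp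
  also have "\<dots> <= ip d (cv v) (b v)" using q(2)[OF that(2), of v] cv(1)[OF that(1)] by (simp add: ib sq00)
  finally show ?thesis .
 qed
 have bV: "ip d (cv v) (b v') < ip d (cv v) (b v)" if "v : V" "v' : V" "v' ~= v" for v v'
 proof -
  have "0 < sq (cv v - cv v')" using cv that by (intro sqpos) (auto simp: inj_on_def)
  hence "s / 2 * (sq (cv v - cp (q v')) - sq (cv v - cv v')) < s / 2 * sq (cv v - cp (q v'))" using s(2) by simp
  thus ?thesis using q(2)[OF q(1), of v v'] cv(1)[OF that(1)] by (simp add: ib sq00)
 qed
 have bp: "ip d (cp p) (b v) < ip d (cp p) p" if "v : V" "p : X" for v p
 proof (cases "q v = p")
  case True
  have "0 < sq (cp p - cv v)" using cv cp ne[OF that(2,1)] that by (intro sqpos) auto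
  hence "0 < s / 2 * sq (cp p - cv v)" using s(2) by simp
  thus ?thesis using True cp(1)[OF that(2)] by (simp add: ib sq00)
 next
  case False
  have "0 < (ip d (cp p) p - ip d (cp p) (q v)) + s * (- sq (cp p - cp (q v)) / 2)" using s(1) that(2) q(1) False by blast
  moreover have "0 <= s / 2 * sq (cp p - cv v)" using s(2) sq0 by simp
  ultimately show ?thesis using cp(1)[OF that(2)] by (simp add: ib right_diff_distrib)
 qed
 have ev: "\<forall>\<^sub>F t in at_right 0. ALL v:V. ALL v':V - {v}. ALL e:{-1, 1}. 0 < (ip d (cv v) (b v) - ip d (cv v) (b v')) + t * (e * ip d (cv v) v')"
  "\<forall>\<^sub>F t in at_right 0. ALL p:X. ALL v:V. ALL e:{-1, 1}. 0 < (ip d (cp p) p - ip d (cp p) (b v)) + t * (e * ip d (cp p) v)"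
  using V(1) X(1) bV bp by (intro eventually_ball_finite ballI eventually_small; simp)+
 obtain t where t0: "0 < t"
  and t': "(ALL v:V. ALL v':V - {v}. ALL e:{-1, 1}. 0 < (ip d (cv v) (b v) - ip d (cv v) (b v')) + t * (e * ip d (cv v) v')) &
   (ALL p:X. ALL v:V. ALL e:{-1, 1}. 0 < (ip d (cp p) p - ip d (cp p) (b v)) + t * (e * ip d (cp p) v))"
  by (rule at_right_witness[OF eventually_conj[OF ev]])
 have t: "0 < (ip d (cv v) (b v) - ip d (cv v) (b v')) + t * (e * ip d (cv v) v')"
  if "v : V" "v' : V" "v' ~= v" "e : {-1, 1}" for v v' e using conjunct1[OF t'] that by blast
 have t2: "0 < (ip d (cp p) p - ip d (cp p) (b v)) + t * (e * ip d (cp p) v)" if "p : X" "v : V" "e : {-1, 1}" for p v e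
  using conjunct2[OF t'] that by blast
 define ym where "ym v = b v - t *R v" for v
 define yp where "yp v = b v + t *R v" for v
 have val: "ip d c (ym v) = ip d c (b v) - t * ip d c v" "ip d c (yp v) = ip d c (b v) + t * ip d c v" for c v
  by (simp_all add: ym_def yp_def ip_simps)
 have top: "ip d (cv v) (ym v) = ip d (cv v) (b v)" "ip d (cv v) (yp v) = ip d (cv v) (b v)" if "v : V" for v
  using cv(1)[OF that] by (simp_all add: val)
 have nX: "ym v ~: X" "yp v ~: X" if "v : V" for v using bX[OF that] top[OF that] by (metis less_irrefl)+
 show ?thesis
 proof (rule exI[of _ ym], rule exI[of _ yp], rule exI[of _ "2 * t"], intro conjI ballI impI)
  show "0 < 2 * t" using t0 by simp
  show "ym v : Rpow d" if "v : V" for v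
   unfolding ym_def using bR[OF that] V(2) that by (intro subspace_diff[OF subspace_Rpow] subspace_scale[OF subspace_Rpow]) auto
  show "yp v - ym v = (2 * t) *R v" for v
  proof -
   have "yp v - ym v = t *R v + t *R v" by (simp add: ym_def yp_def)
   thus ?thesis by (simp flip: scaleR_add_left)
  qed
  show "ym v ~: X" "yp v ~: X" if "v : V" for v using nX[OF that] .
  show "ip d (cv v) y < ip d (cv v) (ym v)" if v: "v : V" and y: "y : X \<union> ym ` V \<union> yp ` V" "y ~= ym v & y ~= yp v" for v y
  proof -
   consider "y : X" | v' where "v' : V" "v' ~= v" "y = ym v'" | v' where "v' : V" "v' ~= v" "y = yp v'" using y by blast
   thus ?thesis
   proof cases
    case 1 thus ?thesis using bX[OF v] top(1)[OF v] by simp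
   next
    case (2 v') thus ?thesis using t[OF v 2(1,2), of 1] unfolding top(1)[OF v] 2(3) by (simp add: val[of _ v'])
   next
    case (3 v') thus ?thesis using t[OF v 3(1,2), of "-1"] unfolding top(1)[OF v] 3(3) by (simp add: val[of _ v'])
   qed
  qed
  show "ip d (cp p) y < ip d (cp p) p" if p: "p : X" and y: "y : X \<union> ym ` V \<union> yp ` V" "y ~= p" for p y
  proof -
   consider "y : X" | v' where "v' : V" "y = ym v'" | v' where "v' : V" "y = yp v'" using y by blast
   thus ?thesis
   proof cases
    case 1 thus ?thesis using cp(2)[OF p 1] y(2) by simp
   next
    case (2 v') thus ?thesis using t2[OF p 2(1), of 1] by (simp add: val)
   next
    case (3 v') thus ?thesis using t2[OF p 3(1), of "-1"] by (simp add: val)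
   qed
  qed
 qed
qed

lemma amax_singleton:
 assumes "p : A" "!!q. q : A ==> q ~= p ==> ip d c q < ip d c p"
 shows "amax d c A = {p}"
proof (intro equalityI subsetI)
 fix q assume "q : amax d c A"
 hence "q : A" "ip d c p <= ip d c q" using assms(1) by (auto simp: amax_def)
 thus "q : {p}" using assms(2)[of q] by (cases "q = p") auto
next
 fix q assume "q : {p}"
 hence "!!r. r : A ==> ip d c r <= ip d c q" using assms(2) by (metis less_imp_le order_refl singletonD)
 thus "q : amax d c A" using \<open>q : {p}\<close> assms(1) by (auto simp: amax_def)
qed

lemma amax_pair:
 assumes "p : A" "p' : A" "ip d c p' = ip d c p" "!!q. q : A ==> q ~= p ==> q ~= p' ==> ip d c q < ip d c p"
 shows "amax d c A = {p, p'}"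
proof (intro equalityI subsetI)
 fix q assume "q : amax d c A"
 hence "q : A" "ip d c p <= ip d c q" using assms(1) by (auto simp: amax_def)
 thus "q : {p, p'}" using assms(4)[of q] by (cases "q = p \<or> q = p'") auto
next
 fix q assume q: "q : {p, p'}"
 hence "!!r. r : A ==> ip d c r <= ip d c q" using assms(3,4) by (metis empty_iff insert_iff less_imp_le order_refl)
 thus "q : amax d c A" using q assms(1,2) by (auto simp: amax_def)
qed

lemma chords_exist:
 fixes X :: "nat => 'a set"
 assumes XX: "ALL j<N. finite (X j) & X j ~= {}"
 shows "EX (n::nat) chord. 2 <= n & (ALL j<N. chord j 0 = X j) & (ALL j<N. ALL k<n. chord j k <= X j & chord j k ~= {}) &
  (ALL j<N. ALL p:X j. ALL q:X j. p ~= q --> (EX k1 k2 k3. k1 < k2 & k2 < k3 & k3 < n &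
   chord j k1 = {p, q} & chord j k2 = {p, q} & chord j k3 = {p, q}))"
proof -
 note X = XX[rule_format]
 have "EX ps. j < N --> set ps = (%(p, q). {p, q}) ` (X j \<times> X j)" for j
  using finite_list[of "(%(p, q). {p, q}) ` (X j \<times> X j)"] X[of j] by (cases "j < N") auto
 hence "ALL j. EX ps. j < N --> set ps = (%(p, q). {p, q}) ` (X j \<times> X j)" by (rule allI)
 hence "EX ps. ALL j. j < N --> set (ps j) = (%(p, q). {p, q}) ` (X j \<times> X j)" by (rule choice)
 then obtain ps where "ALL j. j < N --> set (ps j) = (%(p, q). {p, q}) ` (X j \<times> X j)" by (elim exE)
 note ps = this[rule_format]
 \<comment> \<open>Entry 0 is the full cluster, then the list of chords appears three times, as
   \<open>TS_shift\<close> needs. Positions beyond the list are filled with the full cluster, so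
   that all blocks have equal length.\<close>
 define L where "L j = X j # ps j @ ps j @ ps j" for j
 define chord where "chord j k = (if k < length (L j) then L j ! k else X j)" for j k
 define n where "n = 2 + (\<Sum>j<N. length (L j))"
 have len: "length (L j) <= n" if "j < N" for j using member_le_sum[of j "{..<N}" "%j. length (L j)"] that by (simp add: n_def)
 have sub: "chord j k <= X j & chord j k ~= {}" if "j < N" for j k
 proof -
  have "chord j k : insert (X j) (set (ps j))" unfolding chord_def using nth_mem[of k "L j"] by (auto simp: L_def)
  thus ?thesis using ps[OF that] X[OF that] by auto
 qed
 have ex: "EX k1 k2 k3. k1 < k2 & k2 < k3 & k3 < n & chord j k1 = {p, q} & chord j k2 = {p, q} & chord j k3 = {p, q}"
  if "j < N" "p : X j" "q : X j" for j p q
 proof -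
  have "{p, q} : set (ps j)" using ps[OF that(1)] that(2,3) by (auto intro!: image_eqI[of _ _ "(p, q)"])
  then obtain i where i: "i < length (ps j)" "ps j ! i = {p, q}" by (metis in_set_conv_nth)
  let ?l = "length (ps j)"
  have "chord j (1 + i) = {p, q}" "chord j (1 + ?l + i) = {p, q}" "chord j (1 + ?l + ?l + i) = {p, q}"
   using i by (simp_all add: chord_def L_def nth_append)
  moreover have "1 + i < 1 + ?l + i" "1 + ?l + i < 1 + ?l + ?l + i" "1 + ?l + ?l + i < n" using i(1) len[OF that(1)] by (auto simp: L_def)
  ultimately show ?thesis by blast
 qed
 show ?thesis
 proof (rule exI[of _ n], rule exI[of _ chord], intro conjI allI impI ballI)
  show "2 <= n" by (simp add: n_def)
  show "chord j 0 = X j" for j by (simp add: chord_def L_def)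
 qed (use sub in blast, use sub in blast, rule ex)
qed

text \<open>One representative per line of directions suffices for all chords. The functionals
  \<open>cv\<close> are chosen generic so that they are distinct, and the \<open>cp\<close> are
  chosen away from them, since edges hung according to equal functionals would compete for the same
  maximum.\<close>

lemma stamp_data_exists:
 assumes d: "2 <= d" and N: "0 < N" and adm: "!!j. j < N ==> admissible d (X j)" and ne: "!!j. j < N ==> X j ~= {}"
  and frameX: "EX j<N. X j = frame d"
 shows "EX n Y chord V ym yp cv cm cp Cs c0 \<delta> M \<eta>. stamp_data d N n X Y chord V ym yp cv cm cp Cs c0 \<delta> M \<eta>"
proof -
 have fX: "finite (X j)" and XR: "X j <= Rpow d" if "j < N" for j using adm[OF that] by (auto simp: admissible_def)
 define D where "D = (\<Union>j<N. (%(p, q). q - p) ` (X j \<times> X j)) - {0}"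
 have "finite D" unfolding D_def using fX by auto
 then obtain V where VD: "V <= D" and Vrep: "!!x. x : D ==> EX v:V. EX k. k ~= 0 & x = k *R v"
  and Vind: "!!v u k. v : V ==> u : V ==> v ~= u ==> u ~= k *R v"
  using direction_representatives[of D] by (auto simp: D_def)
 have fV: "finite V" using VD \<open>finite D\<close> by (rule finite_subset)
 have V: "EX v:V. EX k. k ~= 0 & q - p = k *R v" if "j < N" "p : X j" "q : X j" "p ~= q" for j p q
  using that by (intro Vrep) (force simp: D_def)
 have Vdiff: "EX j<N. EX p:X j. EX q:X j. p ~= q & v = q - p" if "v : V" for v
  using that VD by (force simp: D_def)
 have VR: "V <= Rpow d"
 proof
  fix v assume "v : V"
  then obtain j p q where "j < N" "p : X j" "q : X j" "v = q - p" using Vdiff by blast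
  thus "v : Rpow d" using XR by (auto intro: subspace_diff[OF subspace_Rpow])
 qed
 have Vsep: "EX a b. upward d a & upward d b & ip d a v < 0 & 0 < ip d b v" if v: "v : V" for v
 proof -
  obtain j p q where j: "j < N" "p : X j" "q : X j" "p ~= q" "v = q - p" using Vdiff[OF v] by blast
  show ?thesis using nonvertical[OF adm[OF j(1)] j(2,3,4)] by (simp only: j(5))
 qed
 have "ALL v:V. EX c. upward d c & ip d c v = 0 & (ALL u:V - {v}. ip d c u ~= 0)"
 proof
  fix v assume v: "v : V"
  obtain a b where ab: "upward d a" "upward d b" "ip d a v < 0" "0 < ip d b v" using Vsep[OF v] by blast
  show "EX c. upward d c & ip d c v = 0 & (ALL u:V - {v}. ip d c u ~= 0)"
  proof (rule generic_functional[OF ab])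
   show "u ~= k *R v" if "u : V - {v}" for u k using Vind[OF v, of u k] that by auto
  qed (use v VR fV in auto)
 qed
 hence "EX cv. ALL v:V. upward d (cv v) & ip d (cv v) v = 0 & (ALL u:V - {v}. ip d (cv v) u ~= 0)" by (rule bchoice)
 then obtain cv where cv: "ALL v:V. upward d (cv v) & ip d (cv v) v = 0 & (ALL u:V - {v}. ip d (cv v) u ~= 0)" by (elim exE)
 hence cvu: "upward d (cv v)" and cv0: "ip d (cv v) v = 0" if "v : V" for v using that by auto
 have cv_inj: "inj_on cv V"
 proof (rule inj_onI, rule ccontr)
  fix v u assume h: "v : V" "u : V" "cv v = cv u" "v ~= u"
  have "ip d (cv v) u ~= 0" using cv[rule_format, OF h(1)] h(2,4) by blast
  thus False using cv0[OF h(2)] h(3) by simp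
 qed
 have "ALL v:V. EX f. f : Rpow d & ip d f (up d) = 0 & 0 < ip d f v"
 proof
  fix v assume "v : V"
  then obtain a b where ab: "upward d a" "upward d b" "ip d a v < 0" "0 < ip d b v" using Vsep by blast
  thus "EX f. f : Rpow d & ip d f (up d) = 0 & 0 < ip d f v"
   by (intro exI[of _ "b - a"]) (auto simp: upward_def ip_diff_left intro: subspace_diff[OF subspace_Rpow])
 qed
 hence "EX f. ALL v:V. f v : Rpow d & ip d (f v) (up d) = 0 & 0 < ip d (f v) v" by (rule bchoice)
 then obtain f where f: "ALL v:V. f v : Rpow d & ip d (f v) (up d) = 0 & 0 < ip d (f v) v" by (elim exE)
 define cp where "cp j p = (SOME c. upward d c & (ALL q:X j - {p}. ip d c q < ip d c p) & c ~: cv ` V)" for j p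
 have cp: "upward d (cp j p) & (ALL q:X j - {p}. ip d (cp j p) q < ip d (cp j p) p) & cp j p ~: cv ` V"
  if "j < N" "p : X j" for j p unfolding cp_def using fV by (rule someI_ex[OF exposer_avoiding[OF adm[OF that(1)] that(2) d finite_imageI]])
 define Q where "Q j ym yp \<mu> \<longleftrightarrow> 0 < \<mu> & (ALL v:V. ym v : Rpow d & yp v - ym v = \<mu> *R v & ym v ~: X j & yp v ~: X j) &
  (ALL v:V. ALL y:X j \<union> ym ` V \<union> yp ` V. y ~= ym v & y ~= yp v --> ip d (cv v) y < ip d (cv v) (ym v)) &
  (ALL p:X j. ALL y:X j \<union> ym ` V \<union> yp ` V. y ~= p --> ip d (cp j p) y < ip d (cp j p) p)" for j ym yp \<mu>
 define ym where "ym j = (SOME ym. EX yp \<mu>. Q j ym yp \<mu>)" for j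
 define yp where "yp j = (SOME yp. EX \<mu>. Q j (ym j) yp \<mu>)" for j
 have Qex: "EX \<mu>. Q j (ym j) (yp j) \<mu>" if j: "j < N" for j
 proof -
  have "EX ym yp \<mu>. Q j ym yp \<mu>"
   unfolding Q_def using cp[OF j] cvu cv0 by (intro carrier_exists fX[OF j] ne[OF j] XR[OF j] fV VR cv_inj) auto
  hence "EX yp \<mu>. Q j (ym j) yp \<mu>" unfolding ym_def by (rule someI_ex)
  thus ?thesis unfolding yp_def by (rule someI_ex)
 qed
 define Y where "Y j = X j \<union> ym j ` V \<union> yp j ` V" for j
 have ymR: "ym j v : Rpow d" and yX: "ym j v ~: X j & yp j v ~: X j" and ypm: "EX k>0. yp j v - ym j v = k *R v"
  and ytop: "!!y. y : Y j ==> y ~= ym j v ==> y ~= yp j v ==> ip d (cv v) y < ip d (cv v) (ym j v)"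
  if j: "j < N" "v : V" for j v using Qex[OF j(1)] j(2) unfolding Q_def Y_def by blast+
 have ptop: "amax d (cp j p) (Y j) = {p}" if "j < N" "p : X j" for j p
  using Qex[OF that(1)] that(2) unfolding Q_def Y_def by (intro amax_singleton) blast+
 have YR: "finite (Y j) & Y j <= Rpow d" if j: "j < N" for j
 proof -
  have "yp j v : Rpow d" if v: "v : V" for v
  proof -
   obtain k where "yp j v - ym j v = k *R v" using ypm[OF j v] by blast
   hence "yp j v = ym j v + k *R v" by (simp add: algebra_simps)
   thus ?thesis using ymR[OF j v] VR v by (auto intro!: subspace_add[OF subspace_Rpow] subspace_scale[OF subspace_Rpow])
  qed
  thus ?thesis unfolding Y_def using fX[OF j] XR[OF j] ymR[OF j] fV by auto
 qed
 have yin: "ym j v : Y j" "yp j v : Y j" if "v : V" for j v using that by (auto simp: Y_def)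
 have eqv: "ip d (cv v) (yp j v) = ip d (cv v) (ym j v)" and fless: "ip d (f v) (ym j v) < ip d (f v) (yp j v)" if j: "j < N" "v : V" for j v
 proof -
  obtain k where k: "k > 0" "yp j v - ym j v = k *R v" using ypm[OF j] by blast
  have h: "ip d c (yp j v) - ip d c (ym j v) = k * ip d c v" for c using arg_cong[OF k(2), of "ip d c"] by (simp add: ip_simps)
  show "ip d (cv v) (yp j v) = ip d (cv v) (ym j v)" using h[of "cv v"] cv0[OF j(2)] by simp
  have "0 < k * ip d (f v) v" using k(1) f j(2) by simp
  thus "ip d (f v) (ym j v) < ip d (f v) (yp j v)" using h[of "f v"] by simp
 qed
 have evk: "\<forall>\<^sub>F t in at_right 0. ALL j:{..<N}. ALL v:V. ALL y:Y j - {ym j v, yp j v}.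
   0 < (ip d (cv v) (ym j v) - ip d (cv v) y) + t * (ip d (f v) y - ip d (f v) (ym j v))"
  "\<forall>\<^sub>F t in at_right 0. ALL j:{..<N}. ALL v:V. ALL y:Y j - {ym j v, yp j v}.
   0 < (ip d (cv v) (yp j v) - ip d (cv v) y) + t * (ip d (f v) (yp j v) - ip d (f v) y)"
  using YR fV ytop eqv by (intro eventually_ball_finite ballI eventually_small; simp)+
 obtain t where t0: "0 < t" and t: "(ALL j:{..<N}. ALL v:V. ALL y:Y j - {ym j v, yp j v}.
   0 < (ip d (cv v) (ym j v) - ip d (cv v) y) + t * (ip d (f v) y - ip d (f v) (ym j v))) &
  (ALL j:{..<N}. ALL v:V. ALL y:Y j - {ym j v, yp j v}.
   0 < (ip d (cv v) (yp j v) - ip d (cv v) y) + t * (ip d (f v) (yp j v) - ip d (f v) y))" by (rule at_right_witness[OF eventually_conj[OF evk]])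
 \<comment> \<open>A slight tilt of \<open>cv v\<close> along \<open>f v\<close>, which vanishes on
   \<open>up d\<close>, singles out one end of the auxiliary edge and uncovers no other
   point.\<close>
 define cm where "cm v = cv v - t *R f v" for v
 define cq where "cq v = cv v + t *R f v" for v
 have cmu: "upward d (cm v)" "upward d (cq v)" if "v : V" for v using cvu[OF that] f that unfolding upward_def cm_def cq_def
  by (auto simp: ip_add_left ip_diff_left ip_scaleR_left intro!: subspace_add[OF subspace_Rpow] subspace_diff[OF subspace_Rpow] subspace_scale[OF subspace_Rpow])
 have cm0: "ip d (cm v) v < 0" if "v : V" for v using f t0 cv0[OF that] that by (auto simp: cm_def ip_diff_left ip_scaleR_left)
 have ymtop: "amax d (cm v) (Y j) = {ym j v}" if j: "j < N" "v : V" for j v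
 proof (intro amax_singleton yin[OF j(2)])
  fix q assume q: "q : Y j" "q ~= ym j v"
  show "ip d (cm v) q < ip d (cm v) (ym j v)"
  proof (cases "q = yp j v")
   case True
   thus ?thesis using eqv[OF j] mult_strict_left_mono[OF fless[OF j] t0] by (simp add: cm_def ip_diff_left ip_scaleR_left)
  next
   case False
   have "0 < (ip d (cv v) (ym j v) - ip d (cv v) q) + t * (ip d (f v) q - ip d (f v) (ym j v))" using conjunct1[OF t] j q False by blast
   thus ?thesis by (simp add: cm_def ip_diff_left ip_scaleR_left right_diff_distrib)
  qed
 qed
 have yptop: "amax d (cq v) (Y j) = {yp j v}" if j: "j < N" "v : V" for j v
 proof (intro amax_singleton yin[OF j(2)])
  fix q assume q: "q : Y j" "q ~= yp j v"
  show "ip d (cq v) q < ip d (cq v) (yp j v)"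
  proof (cases "q = ym j v")
   case True
   thus ?thesis using eqv[OF j] mult_strict_left_mono[OF fless[OF j] t0] by (simp add: cq_def ip_add_left ip_scaleR_left)
  next
   case False
   have "0 < (ip d (cv v) (yp j v) - ip d (cv v) q) + t * (ip d (f v) (yp j v) - ip d (f v) q)" using conjunct2[OF t] j q False by blast
   thus ?thesis by (simp add: cq_def ip_add_left ip_scaleR_left right_diff_distrib)
  qed
 qed
 have cvtop: "amax d (cv v) (Y j) = {ym j v, yp j v}" if j: "j < N" "v : V" for j v
  using ytop[OF j] eqv[OF j] by (intro amax_pair yin[OF j(2)]) auto
 define Cs where "Cs = (\<Union>j<N. cp j ` X j) \<union> cv ` V \<union> cm ` V \<union> cq ` V \<union> (%i. - basis_pt i) ` {..<d}"
 have fCs: "finite Cs" unfolding Cs_def using fX fV by auto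
 have upb: "upward d (- basis_pt i)" if "i < d" for i
 proof -
  have "ip d (- basis_pt i) (up d) = 1" using that by (simp add: ip_commute[of d _ "up d"] ip_simps) (simp add: up_def lookup_sum cong: if_cong)
  thus ?thesis using that basis_pt_in_Rpow[of i d] by (auto simp: upward_def intro: subspace_neg[OF subspace_Rpow])
 qed
 have Cs_up: "upward d c" if "c : Cs" for c using that cp cvu cmu upb unfolding Cs_def by blast
 have "\<forall>\<^sub>F t in at_right 0. ALL c:Cs. ALL k:{..<d}. 0 < 1 + t * (- coord c k)"
  using fCs by (intro eventually_ball_finite ballI eventually_small) auto
 then obtain \<delta> where \<delta>: "0 < \<delta>" "ALL c:Cs. ALL k:{..<d}. 0 < 1 + \<delta> * (- coord c k)" by (rule at_right_witness)
 have fin: "finite (Cs \<times> (\<Union>j<N. Y j) \<times> (\<Union>j<N. Y j))" using fCs YR by auto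
 obtain M where M: "!!z. z : Cs \<times> (\<Union>j<N. Y j) \<times> (\<Union>j<N. Y j) ==> (%(c, p, q). ip d c p - ip d c q) z < M * (1 / 2)"
  by (rule large_multiple[OF fin, of "%_. 1 / 2" "%(c, p, q). ip d c p - ip d c q"]) (simp, rule that)
 have fXne: "ALL j<N. finite (X j) & X j ~= {}" using fX ne by simp
 obtain n :: nat and chord where ch: "2 <= n" "ALL j<N. chord j 0 = X j" "ALL j<N. ALL k<n. chord j k <= X j & chord j k ~= {}"
  "ALL j<N. ALL p:X j. ALL q:X j. p ~= q --> (EX k1 k2 k3. k1 < k2 & k2 < k3 & k3 < n &
   chord j k1 = {p, q} & chord j k2 = {p, q} & chord j k3 = {p, q})" using chords_exist[OF fXne] by (elim exE conjE) (rule that)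
 define c0 where "c0 = - basis_pt 0"
 define s where "s j r = real N - 3/4 - (real j + real r / (4 * real (2*n+1)))" for j r :: nat
 have s: "0 < s j r" if "j < N" "r < 2*n+1" for j r
 proof -
  have "real r / (4 * real (2*n+1)) < 1 / 4" using that(2) by (simp add: field_simps)
  moreover have "real j <= real N - 1" using that(1) by linarith
  ultimately have "0 < real N - 3/4 - (real j + real r / (4 * real (2*n+1)))" by linarith
  thus ?thesis unfolding s_def .
 qed
 have eve: "\<forall>\<^sub>F \<eta> in at_right 0. ALL i:{..<N}. ALL j:{..<N}. ALL r:{..<2*n+1}. ALL r':{..<2*n+1}. ALL p:X (N-1).
   0 < s i r * s j r' + \<eta> * ip d c0 p"
  "\<forall>\<^sub>F \<eta> in at_right 0. ALL j:{..<N}. ALL r:{..<2*n+1}. ALL p:Y j.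
   0 < (s j r)\<^sup>2 + \<eta> * (- (ip d c0 p + M * ((real r / (4 * real (2*n+1)))\<^sup>2 - (real j + real r / (4 * real (2*n+1)) - (real N - 1))\<^sup>2)))"
  using s fX[of "N - 1"] N YR by (intro eventually_ball_finite ballI eventually_small; fastforce)+
 obtain \<eta> where \<eta>0: "0 < \<eta>" and \<eta>: "(ALL i:{..<N}. ALL j:{..<N}. ALL r:{..<2*n+1}. ALL r':{..<2*n+1}. ALL p:X (N-1).
   0 < s i r * s j r' + \<eta> * ip d c0 p) &
  (ALL j:{..<N}. ALL r:{..<2*n+1}. ALL p:Y j.
   0 < (s j r)\<^sup>2 + \<eta> * (- (ip d c0 p + M * ((real r / (4 * real (2*n+1)))\<^sup>2 - (real j + real r / (4 * real (2*n+1)) - (real N - 1))\<^sup>2))))"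
  by (rule at_right_witness[OF eventually_conj[OF eve]])
 have "stamp_data d N n X Y chord V ym yp cv cm cp Cs c0 \<delta> M \<eta>"
 proof (unfold_locales, goal_cases)
  case 1 thus ?case by (rule d)
 next case 2 thus ?case by (rule N)
 next case 3 thus ?case by (rule ch(1))
 next case (4 j) thus ?case by (rule YR)
 next case (5 j) thus ?case using ne by (auto simp: Y_def)
 next case (6 j) thus ?case using ch(2) by blast
 next case (7 j k) thus ?case using ch(3) by blast
 next case (8 j p q) thus ?case using ch(4) by blast
 next case (9 j p q) thus ?case by (rule V)
 next case 10 thus ?case by (rule fCs)
 next case 11 thus ?case using Cs_up by (auto simp: upward_def)
 next case (12 c) thus ?case using Cs_up by (auto simp: upward_def)
 next case (13 v) thus ?case using cv0 by (auto simp: Cs_def)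
 next case (14 v) thus ?case using cm0 by (auto simp: Cs_def)
 next case (15 j v) thus ?case by (rule ymtop)
 next case (16 j v) thus ?case using cvtop ypm by blast
 next case (17 j v) thus ?case by (rule yX)
 next case (18 j p) thus ?case using ptop by (auto simp: Cs_def)
 next case (19 j p)
  then consider "p : X j" | v where "v : V" "p = ym j v" | v where "v : V" "p = yp j v" by (auto simp: Y_def)
  thus ?case
  proof cases
   case 1 thus ?thesis using ptop[OF 19(1)] 19(1) by (intro bexI[of _ "cp j p"]) (auto simp: Cs_def)
  next
   case (2 v) thus ?thesis using ymtop[OF 19(1)] by (intro bexI[of _ "cm v"]) (auto simp: Cs_def)
  next
   case (3 v) thus ?thesis using yptop[OF 19(1)] by (intro bexI[of _ "cq v"]) (auto simp: Cs_def)
  qed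
 next case (20 i) thus ?case by (auto simp: Cs_def)
 next case 21 thus ?case by (rule frameX)
 next case 22 thus ?case using d by (auto simp: Cs_def c0_def)
 next case 23 thus ?case by (rule \<delta>(1))
 next case (24 c k) thus ?case using \<delta>(2) by fastforce
 next case (25 c i j p q) thus ?case using M[of "(c, p, q)"] by auto
 next case 26 thus ?case by (rule \<eta>0)
 next case (27 i j r r' p)
  hence "0 < s i r * s j r' + \<eta> * ip d c0 p" using conjunct1[OF \<eta>] by blast
  thus ?case by (simp only: s_def)
 next case (28 j r p)
  hence "0 < (s j r)\<^sup>2 + \<eta> * (- (ip d c0 p + M * ((real r / (4 * real (2*n+1)))\<^sup>2 - (real j + real r / (4 * real (2*n+1)) - (real N - 1))\<^sup>2)))"
   using conjunct2[OF \<eta>] by blast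
  moreover have "(s j r)\<^sup>2 = (real j + real r / (4 * real (2*n+1)) - (real N - 3/4))\<^sup>2" unfolding s_def by (rule power2_commute)
  ultimately show ?case by (simp only: mult_minus_right)
 qed
 thus ?thesis by blast
qed

text \<open>The interface to the remaining proof. Ranks are linear, hence one more than dimensions.
  The last clause puts a projective copy of \<open>E\<close> on the starred vertices of every
  realization.\<close>

definition stamp :: "pt set => (nat => pt) => nat set => (pt => nat) => bool" where
 "stamp E v I star \<longleftrightarrow> vconf v I & v ` I <= Rpow (dim (hat (%x. x) ` E) + 1) &
   dim (hat v ` I) = dim (hat (%x. x) ` E) + 2 & inj_on star E & star ` E : cfaces (hat v) I &
   (ALL v' :: nat => pt. cfaces (hat v') I = cfaces (hat v) I --> (EX A \<kappa>. linear A & inj_on A (span (hat (%x. x) ` E)) &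
    (ALL e:E. \<kappa> e > 0 & A (e, 1) = \<kappa> e *R hat v' (star e))))"

lemma independent_dual:
 fixes B :: "'a::real_vector set"
 assumes "!!b. b : B ==> EX f :: 'a => real. linear f & f b ~= 0 & (ALL c:B - {b}. f c = 0)"
 shows "independent B"
proof
 assume "dependent B"
 then obtain b where b: "b : B" "b : span (B - {b})" by (auto simp: dependent_def)
 obtain f :: "'a => real" where f: "linear f" "f b ~= 0" "ALL c:B - {b}. f c = 0" using assms[OF b(1)] by blast
 have "f y = 0" if "y : span (B - {b})" for y using that by (induction rule: span_induct_alt)
   (use f(3) in "auto simp: linear_0[OF f(1)] linear_add[OF f(1)] linear_scale[OF f(1)]")
 thus False using f(2) b(2) by simp
qed

lemma coord_up: "coord (up d) i = (if i < d then - 1 else 0)" by (simp add: up_def lookup_sum if_distrib cong: if_cong)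

lemma ip_up_up: "ip d (up d) (up d) = real d"
proof -
 have "(\<Sum>i<d. coord (up d) i) = (\<Sum>i<d. - 1)" by (intro sum.cong) (auto simp: coord_up)
 thus ?thesis by (simp add: ip_up)
qed

lemma dim_Rpow_prod3: "dim (Rpow d \<times> (UNIV :: (real \<times> real \<times> real) set)) = d + 3"
proof -
 define E where "E = (%k. (basis_pt k, 0::real, 0::real, 0::real)) ` {..<d}"
 define F where "F = {(0::pt, 1::real, 0::real, 0::real), (0, 0, 1, 0), (0, 0, 0, 1)}"
 let ?V = "Rpow d \<times> (UNIV :: (real \<times> real \<times> real) set)"
 have lin: "linear (%z :: pt \<times> real \<times> real \<times> real. coord (fst z) k)" "linear (%z :: pt \<times> real \<times> real \<times> real. fst (snd z))"
  "linear (%z :: pt \<times> real \<times> real \<times> real. fst (snd (snd z)))" "linear (%z :: pt \<times> real \<times> real \<times> real. snd (snd (snd z)))" for k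
  by (rule linearI; simp add: lookup_add)+
 have "independent (E \<union> F)"
 proof (rule independent_dual)
  fix b assume "b : E \<union> F"
  then consider k where "k < d" "b = (basis_pt k, 0, 0, 0)" | "b = (0, 1, 0, 0)" | "b = (0, 0, 1, 0)" | "b = (0, 0, 0, 1)" by (auto simp: E_def F_def)
  thus "EX f :: pt \<times> real \<times> real \<times> real => real. linear f & f b ~= 0 & (ALL c:E \<union> F - {b}. f c = 0)"
  proof cases
   case (1 k)
   show ?thesis by (rule exI, intro conjI, rule lin(1)[of k]) (auto simp: 1 E_def F_def split: if_splits)
  next
   case 2 show ?thesis by (rule exI, intro conjI, rule lin(2)) (auto simp: 2 E_def F_def)
  next
   case 3 show ?thesis by (rule exI, intro conjI, rule lin(3)) (auto simp: 3 E_def F_def)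
  next
   case 4 show ?thesis by (rule exI, intro conjI, rule lin(4)) (auto simp: 4 E_def F_def)
  qed
 qed
 moreover have "?V <= span (E \<union> F)"
 proof
  fix z assume "z : ?V"
  then obtain x a b c where z: "z = (x, a, b, c)" "x : Rpow d" by (cases z) auto
  have x: "(x, 0, 0, 0) = (\<Sum>k<d. coord x k *R (basis_pt k, 0::real, 0::real, 0::real))"
   using Rpow_expansion[OF z(2)] by (simp add: sum_prod)
  have "z = (\<Sum>k<d. coord x k *R (basis_pt k, 0::real, 0::real, 0::real)) + a *R (0, 1, 0, 0) + b *R (0, 0, 1, 0) + c *R (0, 0, 0, 1)"
   by (simp only: x[symmetric]) (simp add: z(1))
  thus "z : span (E \<union> F)" by (simp only:) (intro span_add span_sum span_scale span_base; simp add: E_def F_def)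
 qed
 moreover have "E \<union> F <= ?V" by (auto simp: E_def F_def basis_pt_in_Rpow subspace_0[OF subspace_Rpow])
 ultimately have "card (E \<union> F) = dim ?V" by (intro basis_card_eq_dim)
 moreover have "card (E \<union> F) = d + 3"
 proof -
  have "inj_on (%k. (basis_pt k, 0::real, 0::real, 0::real)) {..<d}"
  proof (rule inj_onI)
   fix k l assume "(basis_pt k, 0::real, 0::real, 0::real) = (basis_pt l, 0, 0, 0)"
   hence "coord (basis_pt k) k = coord (basis_pt l) k" by simp
   thus "k = l" by (simp split: if_splits)
  qed
  hence "card E = d" by (simp add: E_def card_image)
  moreover have "E \<inter> F = {}" by (auto simp: E_def F_def)
  moreover have "card F = 3" by (simp add: F_def)
  ultimately show ?thesis using card_Un_disjoint[of E F] by (simp add: E_def F_def)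
 qed
 ultimately show ?thesis by simp
qed

text \<open>Divided differences of three points of the conic produce the three coordinate
  vectors.\<close>

lemma span_conic:
 fixes a b c :: real
 assumes "distinct [s, t, r :: real]" and p: "(0::pt, 1, s, s\<^sup>2) : span A" "(0, 1, t, t\<^sup>2) : span A" "(0, 1, r, r\<^sup>2) : span A"
 shows "(0, a, b, c) : span A"
proof -
 have chord: "(0, 0, 1, x + y) : span A" if "(0::pt, 1::real, x, x\<^sup>2) : span A" "(0, 1, y, y\<^sup>2) : span A" "x ~= y" for x y
 proof -
  have "(1 / (x - y)) *R ((0::pt, 1::real, x, x\<^sup>2) - (0, 1, y, y\<^sup>2)) : span A" using that by (intro span_scale span_diff)
  moreover have "x\<^sup>2 - y\<^sup>2 = (x + y) * (x - y)" by (simp add: power2_eq_square algebra_simps)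
  ultimately show ?thesis using that(3) by simp
 qed
 have "(1 / (t - r)) *R ((0::pt, 0::real, 1::real, s + t) - (0, 0, 1, s + r)) : span A"
  using p assms(1) by (intro span_scale span_diff chord) auto
 hence e3: "(0, 0, 0, 1) : span A" using assms(1) by simp
 have "(0, 0, 1, s + t) - (s + t) *R (0::pt, 0::real, 0::real, 1) : span A" using p assms(1) by (intro span_scale span_diff chord e3) auto
 hence e2: "(0, 0, 1, 0) : span A" by simp
 have "(0, 1, s, s\<^sup>2) - s *R (0::pt, 0::real, 1::real, 0::real) - s\<^sup>2 *R (0, 0, 0, 1) : span A"
  by (intro span_scale span_diff p e2 e3)
 hence e1: "(0, 1, 0, 0) : span A" by (simp add: zero_prod_def)
 have "a *R (0::pt, 1::real, 0::real, 0::real) + b *R (0::pt, 0::real, 1::real, 0::real) + c *R (0, 0, 0, 1) : span A"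
  by (intro span_scale span_add e1 e2 e3)
 thus ?thesis by simp
qed

context stamp_data
begin

lemma Z_Rp: "j < N ==> r < K ==> p : Z j r ==> p : Rpow d" using Z_sub Y by blast

lemma u_Rpow: "a : I ==> u a : Rpow d \<times> UNIV"
proof (erule I_cases)
 have XJ: "p : Rpow d" if "p : X J" for p using X[OF J(1)] Y[OF J(1)] that by blast
 note c = subspace_add[OF subspace_Rpow] subspace_diff[OF subspace_Rpow] subspace_scale[OF subspace_Rpow] subspace_neg[OF subspace_Rpow] up_in_Rpow
 show "u a : Rpow d \<times> UNIV" if "k < d" "a = Ray k" for k unfolding that(2) u_def using that(1) by (simp add: basis_pt_in_Rpow c)
 show "u a : Rpow d \<times> UNIV" if "j < N" "r < K" "p : Z j r" "a = Fib j r p" for j r p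
  unfolding that(4) u_def using Z_Rp[OF that(1-3)] by (simp add: c)
 show "u a : Rpow d \<times> UNIV" if "p : X J" "a = Star p" for p unfolding that(2) u_def using XJ[OF that(1)] by (simp add: c)
qed

lemma span_u: "span (u ` I) = Rpow d \<times> UNIV"
proof
 have sub: "subspace (Rpow d \<times> (UNIV :: (real \<times> real \<times> real) set))"
  using subspace_Rpow[of d] by (auto simp: subspace_def zero_prod_def)
 show "span (u ` I) <= Rpow d \<times> UNIV" by (rule span_minimal[OF image_subsetI[OF u_Rpow] sub])
 interpret stamp_copy d N n X Y chord V ym yp cv cm cp Cs c0 \<delta> M \<eta> u "%z. fst (snd z)"
 proof (intro stamp_copy.intro stamp_data_axioms stamp_copy_axioms.intro refl)
  show "linear (%z :: pt \<times> real \<times> real \<times> real. fst (snd z))" by (rule linearI) simp_all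
  show "fst (snd (u a)) = 0" if "a : rays" for a using that by (auto simp: rays_def u_def)
  show "fst (snd (u a)) = 1" if a: "a : I - rays" for a
  proof -
   have "a : I" using a by simp
   thus ?thesis by (rule I_cases) (use a in "auto simp: rays_def u_def")
  qed
 qed
 have rays: "(y, 0, 0, 0) : span (u ` I)" if "y : Rpow d" for y using ray_span[OF that] span_mono[of "u ` rays" "u ` I"] by (auto simp: I_def)
 have pt: "(0, 1, \<tau> 0 r, (\<tau> 0 r)\<^sup>2) : span (u ` I)" if r: "r < K" for r
 proof -
  obtain p where p: "p : Z 0 r" using Z_fin[OF N r] by blast
  let ?y = "p + (M * (\<rho> r)\<^sup>2) *R up d"
  have "?y : Rpow d" using Z_Rp[OF N r p] up_in_Rpow by (intro subspace_add[OF subspace_Rpow] subspace_scale[OF subspace_Rpow])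
  hence "u (Fib 0 r p) - (?y, 0, 0, 0) : span (u ` I)" using N r p by (intro span_diff rays) (auto intro: span_base)
  thus ?thesis by (simp add: u_def)
 qed
 have K: "0 < K" "1 < K" "2 < K" using Kpos by auto
 have "distinct [\<tau> 0 0, \<tau> 0 1, \<tau> 0 2]" using \<tau>_eq[OF K(1,2)] \<tau>_eq[OF K(1,3)] \<tau>_eq[OF K(2,3)] by simp
 hence m: "(0, a, b, c) : span (u ` I)" for a b c by (rule span_conic[OF _ pt[OF K(1)] pt[OF K(2)] pt[OF K(3)]])
 show "Rpow d \<times> UNIV <= span (u ` I)"
 proof
  fix z assume "z : Rpow d \<times> (UNIV :: (real \<times> real \<times> real) set)"
  then obtain x a b c where z: "z = (x, a, b, c)" "x : Rpow d" by (cases z) auto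
  have "(x, 0, 0, 0) + (0, a, b, c) : span (u ` I)" using rays[OF z(2)] m by (intro span_add)
  thus "z : span (u ` I)" by (simp add: z)
 qed
qed

lemma dim_u: "dim (u ` I) = d + 3"
proof -
 have "dim (u ` I) = dim (span (u ` I))" by simp
 thus ?thesis by (simp only: span_u dim_Rpow_prod3)
qed

lemma vertex_Ray:
 assumes k: "k < d"
 shows "{Ray k} : cfaces u I"
proof (rule cfaces_trans[OF finite_I face_rays])
 \<comment> \<open>The coefficient of \<open>basis_pt k\<close> is solved from vanishing at
   \<open>Ray k\<close>; the other rays then share one negative value.\<close>
 define c where "c = up d + ((real d - 1) / (1 + \<delta>) + 1) *R basis_pt k"
 have ci: "coord c i = (if i = k then (real d - 1) / (1 + \<delta>) else -1)" if "i < d" for i using that k by (simp add: c_def lookup_add coord_up)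
 have cup: "ip d c (up d) = real d - ((real d - 1) / (1 + \<delta>) + 1)"
 proof -
  have "ip d (basis_pt k) (up d) = -1" using k by (simp add: ip_commute[of d _ "up d"] coord_up)
  thus ?thesis by (simp add: c_def ip_add_left ip_scaleR_left ip_up_up)
 qed
 define e where "e = - \<delta> - \<delta> * (real d - 1) / (1 + \<delta>)"
 have val: "phi c 0 0 0 (u (Ray i)) = (if i = k then 0 else e)" if "i < d" for i
  unfolding e_def using \<delta>(1) by (simp add: phi_Ray[OF that] ci[OF that] cup divide_simps) (simp add: algebra_simps)
 have "0 <= \<delta> * (real d - 1) / (1 + \<delta>)" using d \<delta>(1) by simp
 hence neg: "e < 0" unfolding e_def using \<delta>(1) by linarith
 show "{Ray k} : cfaces u rays"
  by (rule cfacesI[OF linear_phi[of c 0 0 0]]) (use k neg in "auto simp: rays_def val split: if_splits")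
qed

lemma vertex: "a : I ==> {a} : cfaces u I"
proof (erule I_cases)
 show "{a} : cfaces u I" if "k < d" "a = Ray k" for k using vertex_Ray that by simp
 show "{a} : cfaces u I" if a: "j < N" "r < K" "p : Z j r" "a = Fib j r p" for j r p
 proof -
  have "p : Y j" using Z_sub a by blast
  then obtain c where c: "c : Cs" "amax d c (Y j) = {p}" using vert[OF a(1)] by blast
  have "ip d c q < ip d c p" if q: "q : Y j" "q ~= p" for q
  proof -
   have "q ~: amax d c (Y j)" "p : amax d c (Y j)" using c(2) q(2) by auto
   thus ?thesis using q(1) by (force simp: amax_def)
  qed
  hence "amax d c (Z j r) = {p}" using Z_sub[OF a(1,2)] a(3) by (intro amax_singleton) auto
  thus ?thesis using face_single[OF a(1,2) c(1)] a(4) by (simp add: fibs_def)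
 qed
 show "{a} : cfaces u I" if p: "p : X J" "a = Star p" for p
 proof -
  have "stars \<inter> block J {p} : cfaces u I" using cfaces_Int[OF face_stars face_block[OF J(1), of "cp J p"]] cp[OF J(1) p(1)] by simp
  moreover have "stars \<inter> block J {p} = {a}" using p by (auto simp: stars_def block_def fibs_def)
  ultimately show ?thesis by simp
 qed
qed

lemma stamp_polytope:
 assumes inj: "inj_on X {..<N}" and adm: "admissible d (X J)" and two: "p0 : X J" "q0 : X J" "p0 ~= q0"
  and rigid: "!!x' :: pt set => pt => pt \<times> real. cluster_model d (X ` {..<N}) x' ==>
   EX \<kappa>>0. ALL p:X J. ALL q:X J. x' (X J) q - x' (X J) p = \<kappa> *R frame_map d x' (q - p)"
  and dimX: "dim (hat (%x. x) ` X J) = d + 1"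
 shows "EX v I star. stamp (X J) v I star"
proof -
 have m0: "0 < fst (snd (u a))" if a: "a : I - rays" for a
 proof -
  have "a : I" using a by simp
  thus ?thesis by (rule I_cases) (use a in "auto simp: rays_def u_def")
 qed
 obtain B0 where B0: "!!a. a : I - rays ==> ip d (up d) (fst (u a)) < B0 * fst (snd (u a))"
  by (rule large_multiple[of "I - rays" "%a. fst (snd (u a))" "%a. ip d (up d) (fst (u a))"]) (use finite_I m0 that in auto)
 define B where "B = max B0 1"
 have B: "ip d (up d) (fst (u a)) < B * fst (snd (u a))" if "a : I - rays" for a
 proof -
  have "B0 * fst (snd (u a)) <= B * fst (snd (u a))" using m0[OF that] by (intro mult_right_mono) (auto simp: B_def)
  thus ?thesis using B0[OF that] by linarith
 qed
 \<comment> \<open>Dehomogenization into \<open>Rpow (d + 2)\<close>: \<open>m1\<close> and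
   \<open>m2\<close> become two new coordinates, and the denominator
   \<open>B * m0 - ip d (up d) x\<close> is \<open>d + \<delta>\<close> on the rays and positive
   elsewhere by the choice of \<open>B\<close>.\<close>
 define G where "G = (%(x, m0, m1, m2). (x + m1 *R basis_pt d + m2 *R basis_pt (d + 1), B * m0 - ip d (up d) x))"
 have linG: "linear G" unfolding G_def by (rule linearI) (auto simp: algebra_simps ip_simps)
 have G0: "z = 0" if z: "z : span (u ` I)" "G z = 0" for z
 proof -
  obtain x a b c where zz: "z = (x, a, b, c)" "x : Rpow d" using z(1) span_u by (cases z) auto
  have e: "x + b *R basis_pt d + c *R basis_pt (d + 1) = 0" "B * a = ip d (up d) x"
   using z(2) by (simp_all add: zz(1) G_def zero_prod_def)
  have x: "coord x d = 0" "coord x (d + 1) = 0" using zz(2) by (simp_all add: Rpow_def)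
  have "b = 0" "c = 0" using arg_cong[OF e(1), of "%y. coord y d"] arg_cong[OF e(1), of "%y. coord y (d + 1)"] x
   by (simp_all add: lookup_add)
  hence x0: "x = 0" using e(1) by simp
  moreover have "B ~= 0" by (simp add: B_def)
  ultimately have "a = 0" using e(2) by (simp add: linear_0[OF linear_ip])
  thus ?thesis using x0 \<open>b = 0\<close> \<open>c = 0\<close> zz(1) by (simp add: zero_prod_def)
 qed
 have injG: "inj_on G (span (u ` I))"
 proof (rule inj_onI)
  fix y z assume h: "y : span (u ` I)" "z : span (u ` I)" "G y = G z"
  hence "y - z : span (u ` I)" "G (y - z) = 0" by (auto simp: span_diff linear_diff[OF linG])
  hence "y - z = 0" by (rule G0)
  thus "y = z" by simp
 qed
 have pos: "0 < snd (G (u a))" if a: "a : I" for a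
 proof (cases "a : rays")
  case True
  then obtain k where k: "k < d" "a = Ray k" by (auto simp: rays_def)
  have "ip d (up d) (basis_pt k) = -1" using k by (simp add: coord_up)
  hence "snd (G (u a)) = real d + \<delta>" by (simp add: k(2) u_def G_def ip_simps ip_up_up)
  thus ?thesis using \<delta>(1) by simp
 next
  case False
  thus ?thesis using B[of a] a by (auto simp: G_def split: prod.splits)
 qed
 define p where "p a = (1 / snd (G (u a))) *R fst (G (u a))" for a
 have Gp: "snd (G (u a)) > 0 & G (u a) = snd (G (u a)) *R hat p a" if "a : I" for a
  using pos[OF that] by (simp add: p_def hat_def prod_eq_iff)
 have faces_p: "cfaces (hat p) I = cfaces u I" by (rule cfaces_linear_image[OF linG injG Gp])
 have dim_p: "dim (hat p ` I) = d + 3" using dim_linear_image_scaled[OF linG injG Gp] dim_u by simp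
 have Rpow_p: "p a : Rpow (d + 2)" if "a : I" for a
 proof -
  have "fst (u a) : Rpow (d + 2)" using u_Rpow[OF that] Rpow_mono[of d "d + 2"] by auto
  hence "fst (G (u a)) : Rpow (d + 2)"
   by (auto simp: G_def basis_pt_in_Rpow split: prod.splits intro!: subspace_add[OF subspace_Rpow] subspace_scale[OF subspace_Rpow])
  thus ?thesis unfolding p_def by (rule subspace_scale[OF subspace_Rpow])
 qed
 obtain enc :: "idx => nat" where enc: "inj_on enc I" using finite_imp_inj_to_nat_seg[OF finite_I] by blast
 define v where "v = p \<circ> inv_into I enc"
 have v: "v (enc a) = p a" if "a : I" for a using that enc by (simp add: v_def)
 have transfer: "enc ` S : cfaces (hat v) (enc ` I) \<longleftrightarrow> S : cfaces u I" if "S <= I" for S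
 proof -
  have "cfaces (%a. hat v (enc a)) I = cfaces (hat p) I"
   by (rule cfaces_linear_image[of id _ _ "%_. 1"]) (auto simp: hat_def v intro: linear_id[unfolded id_def[symmetric]])
  thus ?thesis using cfaces_reindex[OF enc that, of "hat v"] faces_p by simp
 qed
 have st: "enc (Star x) = enc (Star y) \<longleftrightarrow> x = y" if "x : X J" "y : X J" for x y
  using inj_on_eq_iff[OF enc, of "Star x" "Star y"] that by simp
 have star_image: "(enc \<circ> Star) ` X J = enc ` stars" by (simp add: stars_def image_comp)
 have rig: "EX A \<kappa>. linear A & inj_on A (span (hat (%x. x) ` X J)) &
   (ALL e:X J. \<kappa> e > 0 & A (e, 1) = \<kappa> e *R hat v' ((enc \<circ> Star) e))"
  if v': "cfaces (hat v') (enc ` I) = cfaces (hat v) (enc ` I)" for v' :: "nat => pt"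
 proof -
  define w0 where "w0 a = hat v' (enc a)" for a
  have same0: "cfaces w0 I = cfaces u I"
  proof (rule set_eqI)
   fix S
   have "S : cfaces w0 I \<longleftrightarrow> S : cfaces u I" if "S <= I"
    using cfaces_reindex[OF enc that, of "hat v'"] transfer[OF that] v' by (simp add: w0_def[abs_def])
   thus "S : cfaces w0 I \<longleftrightarrow> S : cfaces u I" using cfaces_subset[of S w0 I] cfaces_subset[of S u I] by blast
  qed
  have "rays : cfaces w0 I" using face_rays same0 by simp
  then obtain g :: "_ => real" where g: "linear g" "!!a. a : rays ==> g (w0 a) = 0" "!!a. a : I - rays ==> g (w0 a) < 0"
   by (rule cfacesE) blast
  \<comment> \<open>Rescaling by a functional of the ray face produces the normalization that
    \<open>stamp_copy\<close> asks for; positive factors do not change faces.\<close>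
  define \<mu> where "\<mu> a = (if a : rays then 1 else - g (w0 a))" for a
  have \<mu>: "0 < \<mu> a" if "a : I" for a using g(3)[of a] that by (simp add: \<mu>_def)
  define w where "w a = (1 / \<mu> a) *R w0 a" for a
  have w: "w0 a = \<mu> a *R w a" if "a : I" for a using \<mu>[OF that] by (simp add: w_def)
  have "cfaces w I = cfaces w0 I" by (rule cfaces_linear_image[of id _ _ \<mu>]) (auto simp: w \<mu> intro: linear_id[unfolded id_def[symmetric]])
  hence same: "cfaces w I = cfaces u I" using same0 by simp
  interpret stamp_copy d N n X Y chord V ym yp cv cm cp Cs c0 \<delta> M \<eta> w "%z. - g z"
  proof (intro stamp_copy.intro stamp_data_axioms stamp_copy_axioms.intro same)
   show "linear (%z. - g z)" using g(1) by (rule linear_compose_neg)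
   show "- g (w a) = 0" if "a : rays" for a using g(2)[OF that] by (simp add: w_def linear_scale[OF g(1)])
   show "- g (w a) = 1" if "a : I - rays" for a
    using \<mu>[of a] that by (simp add: w_def linear_scale[OF g(1)] linear_neg[OF g(1)] \<mu>_def)
  qed
  obtain A \<kappa> where A: "linear A" "inj_on A (span (hat (%x. x) ` X J))"
   "!!p. p : X J ==> \<kappa> p > 0 & A (p, 1) = \<kappa> p *R w (Star p)"
   using stars_rigid[OF inj adm two rigid] by blast
  show ?thesis
  proof (rule exI[of _ A], rule exI[of _ "%e. \<kappa> e / \<mu> (Star e)"], intro conjI ballI A(1,2))
   fix e assume e: "e : X J"
   hence I: "Star e : I" by simp
   show "0 < \<kappa> e / \<mu> (Star e)" using A(3)[OF e] \<mu>[OF I] by simp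
   show "A (e, 1) = (\<kappa> e / \<mu> (Star e)) *R hat v' ((enc \<circ> Star) e)" using A(3)[OF e] by (simp add: w_def w0_def)
  qed
 qed
 have "stamp (X J) v (enc ` I) (enc \<circ> Star)" unfolding stamp_def dimX
 proof (intro conjI allI impI)
  show "vconf v (enc ` I)" unfolding vconf_def using finite_I transfer[of "{_}"] vertex by auto
  show "v ` enc ` I <= Rpow (d + 1 + 1)" using v Rpow_p by auto
  have "hat v ` enc ` I = hat p ` I" using v by (auto simp: hat_def image_iff)
  thus "dim (hat v ` enc ` I) = d + 1 + 2" using dim_p by simp
  show "inj_on (enc \<circ> Star) (X J)" using st by (auto simp: inj_on_def)
  show "(enc \<circ> Star) ` X J : cfaces (hat v) (enc ` I)" unfolding star_image using transfer[of stars] face_stars by (auto simp: I_def)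
 qed (rule rig)
 thus ?thesis by blast
qed

end

lemma cluster_model_insert_empty: "cluster_model d S x' ==> cluster_model d (insert {} S) x'" unfolding cluster_model_def by auto

theorem cluster_stamp:
 assumes d: "2 <= d" and AX: "admissible d X" and alg: "!!p. p : X ==> algebraic_pt p"
  and flat: "!!p q. p : X ==> q : X ==> p ~= q ==> EX i<d. coord p i < coord q i"
  and dimX: "dim (hat (%x. x) ` X) = d + 1"
 shows "EX v I star. stamp X v I star"
proof -
 have fX: "finite X" using AX by (simp add: admissible_def)
 obtain p0 q0 where two: "p0 : X" "q0 : X" "p0 ~= q0"
 proof -
  have "d + 1 <= card (hat (%x. x) ` X)" using dim_le_card[OF span_superset, of "hat (%x. x) ` X"] fX dimX by simp
  also have "\<dots> <= card X" using fX by (rule card_image_le)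
  finally have "2 <= card X" using d by simp
  hence "~ (ALL p:X. ALL q:X. p = q)" using card_le_Suc0_iff_eq[OF fX] by simp
  thus ?thesis using that by blast
 qed
 have "\<forall>\<^sub>F x' in (cluster_models d :: (pt set => pt => pt \<times> real) filter).
   EX \<kappa>>0. ALL p:X. ALL q:X. x' X q - x' X p = \<kappa> *R frame_map d x' (q - p)"
  by (rule cluster_rigid[OF AX alg flat])
 then obtain \<X> where fin: "finite \<X>" and adm: "ALL C:\<X>. admissible d C"
  and rigid: "!!x' :: pt set => pt => pt \<times> real. cluster_model d \<X> x' ==>
   EX \<kappa>>0. ALL p:X. ALL q:X. x' X q - x' X p = \<kappa> *R frame_map d x' (q - p)"
  unfolding eventually_cluster_models by blast
 \<comment> \<open>\<open>X\<close> is taken out because it must be the last block, which bears the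
   stars, and the empty cluster because fibres must be nonempty.\<close>
 define \<Y> where "\<Y> = insert (frame d) \<X> - {X, {}}"
 define m where "m = card \<Y>"
 have finY: "finite \<Y>" using fin by (simp add: \<Y>_def)
 obtain h where h: "bij_betw h {..<m} \<Y>" using ex_bij_betw_nat_finite[OF finY] by (auto simp: m_def atLeast0LessThan)
 define C where "C j = (if j < m then h j else X)" for j
 have hY: "h j : \<Y>" if "j < m" for j using bij_betwE[OF h] that by blast
 have C: "admissible d (C j)" "C j ~= {}" if "j < Suc m" for j
  using that hY[of j] adm AX two(1) admissible_frame[OF d] by (auto simp: C_def \<Y>_def)
 have img: "C ` {..<Suc m} = insert X \<Y>"
 proof -
  have "C ` {..<m} = h ` {..<m}" by (intro image_cong) (simp_all add: C_def)
  hence "C ` {..<m} = \<Y>" using bij_betw_imp_surj_on[OF h] by simp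
  moreover have "C m = X" by (simp add: C_def)
  ultimately show ?thesis by (simp add: lessThan_Suc)
 qed
 have inj: "inj_on C {..<Suc m}"
 proof -
  have "inj_on C {..<m}" using bij_betw_imp_inj_on[OF h] by (simp add: C_def inj_on_def)
  moreover have "C m ~: C ` {..<m}" using hY by (auto simp: C_def \<Y>_def)
  ultimately show ?thesis by (simp add: lessThan_Suc)
 qed
 have "frame d : C ` {..<Suc m}" unfolding img by (auto simp: \<Y>_def frame_def)
 hence frameC: "EX j<Suc m. C j = frame d" by (metis imageE lessThan_iff)
 have "EX n Y chord V ym yp cv cm cp Cs c0 \<delta> M \<eta>. stamp_data d (Suc m) n C Y chord V ym yp cv cm cp Cs c0 \<delta> M \<eta>"
  by (rule stamp_data_exists[OF d _ _ _ frameC]) (use C in auto)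
 then obtain n Y chord V ym yp cv cm cp Cs c0 \<delta> M \<eta> where SD: "stamp_data d (Suc m) n C Y chord V ym yp cv cm cp Cs c0 \<delta> M \<eta>"
  by (elim exE) (rule that)
 interpret stamp_data d "Suc m" n C Y chord V ym yp cv cm cp Cs c0 \<delta> M \<eta> by (rule SD)
 have CJ: "C J = X" by (simp add: J_def C_def)
 have rigid': "EX \<kappa>>0. ALL p:C J. ALL q:C J. x' (C J) q - x' (C J) p = \<kappa> *R frame_map d x' (q - p)"
  if "cluster_model d (C ` {..<Suc m}) x'" for x' :: "pt set => pt => pt \<times> real"
 proof -
  have "cluster_model d (insert {} (C ` {..<Suc m})) x'" using that by (rule cluster_model_insert_empty)
  hence "cluster_model d \<X> x'" by (rule cluster_model_mono) (auto simp: img \<Y>_def)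
  thus ?thesis unfolding CJ by (rule rigid)
 qed
 have "EX v I star. stamp (C J) v I star" by (rule stamp_polytope[OF inj _ _ _ _ rigid']) (use AX two dimX in "auto simp: CJ")
 thus ?thesis by (simp only: CJ)
qed

section \<open>Projective coordinates in which the vertices become an admissible, flat and algebraic
  cluster\<close>

section \<open>A normal form for algebraic polytopes\<close>

text \<open>A projective coordinate system for the vertices; the factors \<open>\<kappa>\<close>
  must be positive, so the hyperplane sent to infinity misses the polytope.\<close>

definition chart :: "nat => pt set => (pt \<times> real => pt \<times> real) => (pt => real) => (pt => pt) => bool" where
 "chart d E R \<kappa> x \<longleftrightarrow> linear R & inj_on x E & admissible d (x ` E) &
   (ALL e:E. \<kappa> e > 0 & (e, 1) = \<kappa> e *R R (x e, 1))"

text \<open>An antichain in the coordinatewise order, so that every difference has coordinates of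
  both signs, as \<open>direction_mixed_sign\<close> requires.\<close>

definition flat :: "nat => pt set => bool" where
 "flat d X \<longleftrightarrow> (ALL p:X. ALL q:X. p ~= q --> (EX i<d. coord p i < coord q i))"

text \<open>A smallest face properly above a vertex covers it, so it has rank at most 2 and is a
  proper face.\<close>

lemma wide_face:
 assumes E: "vconf w E" and dim: "3 <= dim (hat w ` E)"
 obtains S p q where "S : cfaces (hat w) E" "S ~= E" "p : S" "q : S" "p ~= q"
proof -
 have fin: "finite E" using E by (simp add: vconf_def)
 have "dim (hat w ` E) <= card E" using dim_le_card[OF span_superset, of "hat w ` E"] card_image_le[OF fin, of "hat w"] fin by simp
 hence "E ~= {}" using dim by auto
 then obtain p where p: "p : E" by blast
 have pf: "{p} : cfaces (hat w) E" using E p by (simp add: vconf_def)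
 have dp: "dim (hat w ` {p}) <= 1" using dim_le_card[OF span_superset, of "{hat w p}"] by simp
 define P where "P U \<longleftrightarrow> U : cfaces (hat w) E & {p} \<subset> U" for U
 have "P E" using p dp dim by (auto simp: P_def cfaces_top)
 then obtain S where S: "P S" "!!U. P U ==> card S <= card U" using exists_least_iff[of "%n. EX U. P U & card U = n"]
  by (metis not_less)
 have SE: "S <= E" using S(1) cfaces_subset by (auto simp: P_def)
 have "dim (hat w ` S) = Suc (dim (hat w ` {p}))"
 proof (rule cfaces_dim_cover[OF fin _ pf])
  fix U assume U: "U : cfaces (hat w) E" "{p} \<subset> U"
  show "~ U \<subset> S"
  proof
   assume "U \<subset> S"
   hence "card U < card S" using SE fin by (meson finite_subset psubset_card_mono)
   thus False using S(2)[of U] U by (simp add: P_def)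
  qed
 qed (use S(1) in "auto simp: P_def")
 hence "S ~= E" using dim dp by auto
 moreover obtain q where "q : S" "q ~= p" using S(1) by (auto simp: P_def)
 ultimately show ?thesis using that[of S p q] S(1) by (auto simp: P_def)
qed

text \<open>The hyperplane \<open>l = 0\<close> sent to infinity just misses a face \<open>S\<close>
  with at least two vertices. As \<open>t\<close> tends to 0, \<open>\<omega>\<close> tends to a
  negative multiple of the sum over \<open>S\<close>. A functional exposing a vertex is negative at
  that sum, since \<open>S\<close> has another vertex; so for small \<open>t\<close> all of them are
  positive at \<open>\<omega>\<close>, which becomes \<open>up d\<close> in the new
  coordinates.\<close>

lemma chart_exists:
 assumes E: "vconf (%x. x) E" and d: "2 <= d" and dim: "dim (hat (%x. x) ` E) = d + 1"
 shows "EX R \<kappa> x. chart d E R \<kappa> x"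
proof -
 define h where "h = hat (%x::pt. x)"
 have fin: "finite E" using E by (simp add: vconf_def)
 obtain S p q where S: "S : cfaces h E" "S ~= E" "p : S" "q : S" "p ~= q"
  using wide_face[OF E] dim d unfolding h_def by (metis Suc_eq_plus1 Suc_le_mono numeral_3_eq_3 numeral_2_eq_2)
 obtain m :: "_ => real" where m: "linear m" "S <= E" "!!i. i : S ==> m (h i) = 0" "!!i. i : E - S ==> m (h i) < 0"
  by (rule cfacesE[OF S(1)]) blast
 have finS: "finite S" using m(2) fin by (rule finite_subset)
 have "ALL e:E. EX \<alpha> :: pt \<times> real => real. linear \<alpha> & \<alpha> (h e) = 0 & (ALL e':E - {e}. \<alpha> (h e') < 0)"
 proof
  fix e assume "e : E"
  hence "{e} : cfaces h E" using E by (simp add: vconf_def h_def)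
  then obtain \<alpha> :: "_ => real" where "linear \<alpha>" "!!i. i : {e} ==> \<alpha> (h i) = 0" "!!i. i : E - {e} ==> \<alpha> (h i) < 0"
   by (rule cfacesE) blast
  thus "EX \<alpha> :: pt \<times> real => real. linear \<alpha> & \<alpha> (h e) = 0 & (ALL e':E - {e}. \<alpha> (h e') < 0)" by blast
 qed
 hence "EX \<alpha>. ALL e:E. linear (\<alpha> e :: pt \<times> real => real) & \<alpha> e (h e) = 0 & (ALL e':E - {e}. \<alpha> e (h e') < 0)" by (rule bchoice)
 then obtain \<alpha> where \<alpha>: "ALL e:E. linear (\<alpha> e :: pt \<times> real => real) & \<alpha> e (h e) = 0 & (ALL e':E - {e}. \<alpha> e (h e') < 0)"
  by (elim exE)
 have lin\<alpha>: "linear (\<alpha> e)" if "e : E" for e using \<alpha> that by blast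
 define sS where "sS = (\<Sum>e\<in>S. h e)"
 define sE where "sE = (\<Sum>e\<in>E. h e)"
 define a where "a = - m sE"
 have "m sE = (\<Sum>e\<in>E. m (h e))" by (simp add: sE_def linear_sum[OF m(1)])
 moreover have "(\<Sum>e\<in>E. m (h e)) < 0"
 proof -
  obtain b where b: "b : E - S" using S(2) m(2) by blast
  have "0 < (\<Sum>e\<in>E. - m (h e))"
   using fin b m(3,4) by (intro sum_pos2[of E b]) (auto simp: less_imp_le, metis DiffI less_imp_le order_refl)
  thus ?thesis by (simp add: sum_negf)
 qed
 ultimately have a: "0 < a" by (simp add: a_def)
 have \<alpha>S: "\<alpha> e sS < 0" if e: "e : E" for e
 proof -
  obtain b where b: "b : S" "b ~= e" using S(3-5) by blast
  have le: "\<alpha> e (h e') <= 0" if "e' : E" for e' using \<alpha> e that by (cases "e' = e") (auto intro: less_imp_le)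
  have "0 < (\<Sum>e'\<in>S. - \<alpha> e (h e'))" using finS b \<alpha> e m(2) le by (intro sum_pos2[of S b]) auto
  thus ?thesis by (simp add: sS_def linear_sum[OF lin\<alpha>[OF e]] sum_negf)
 qed
 have "\<forall>\<^sub>F t in at_right 0. ALL e:E. 0 < - (a * \<alpha> e sS) + t * (real (card S) * \<alpha> e sE - real (card E) * \<alpha> e sS)"
  using fin a \<alpha>S by (intro eventually_ball_finite ballI eventually_small) (auto simp: mult_pos_neg)
 then obtain t where t: "0 < t" "ALL e:E. 0 < - (a * \<alpha> e sS) + t * (real (card S) * \<alpha> e sE - real (card E) * \<alpha> e sS)"
  by (rule at_right_witness)
 define l where "l z = t * snd z - m z" for z
 have linl: "linear l" unfolding l_def by (rule linearI) (auto simp: linear_add[OF m(1)] linear_scale[OF m(1)] algebra_simps)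
 have snd_sum: "snd sS = card S" "snd sE = card E" by (simp_all add: sS_def sE_def h_def hat_def snd_sum)
 have lS: "l sS = t * card S" using m(3) by (simp add: l_def snd_sum) (simp add: sS_def linear_sum[OF m(1)])
 have lE: "l sE = a + t * card E" by (simp add: l_def snd_sum a_def)
 have lE0: "0 < l sE" unfolding lE using a t(1) by (simp add: add_pos_nonneg)
 have lpos: "0 < l (h e)" if "e : E" for e
  using m(3)[of e] m(4)[of e] t(1) that by (cases "e : S") (auto simp: l_def h_def hat_def add_pos_nonneg)
 define \<omega> where "\<omega> = l sS *R sE - l sE *R sS"
 have l\<omega>: "l \<omega> = 0" by (simp add: \<omega>_def linear_diff[OF linl] linear_scale[OF linl])
 have \<alpha>\<omega>: "0 < \<alpha> e \<omega>" if "e : E" for e using t(2) that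
  by (simp only: \<omega>_def linear_diff[OF lin\<alpha>] linear_scale[OF lin\<alpha>] lS lE real_scaleR_def) (simp add: algebra_simps)
 define W where "W = span (h ` E)"
 have subW: "subspace W" by (simp add: W_def subspace_span)
 have hW: "h e : W" if "e : E" for e using that by (simp add: W_def span_base)
 have sW: "sS : W" "sE : W" unfolding sS_def sE_def using m(2) hW by (auto intro!: subspace_sum[OF subW])
 define K where "K = {z : W. l z = 0}"
 have subK: "subspace K" unfolding K_def using subW by (auto simp: subspace_def linear_0[OF linl] linear_add[OF linl] linear_scale[OF linl])
 have \<omega>K: "\<omega> : K" unfolding K_def \<omega>_def using sW l\<omega>[unfolded \<omega>_def] by (auto intro!: subspace_diff[OF subW] subspace_scale[OF subW])
 have \<omega>0: "\<omega> ~= 0" using \<alpha>\<omega>[of p] S(3) m(2) linear_0[OF lin\<alpha>[of p]] by auto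
 obtain B where B: "{\<omega>} <= B" "B <= K" "independent B" "K <= span B"
  using maximal_independent_subset_extend[of "{\<omega>}" K] \<omega>K \<omega>0 by auto
 have sEB: "sE ~: span B"
 proof
  assume "sE : span B"
  hence "sE : K" using span_minimal[OF B(2) subK] by blast
  thus False using lE0 by (simp add: K_def)
 qed
 have indep: "independent (insert sE B)" using sEB B(3) by (rule independent_insertI)
 have "W <= span (insert sE B)"
 proof
  fix z assume z: "z : W"
  have "z - (l z / l sE) *R sE : K"
   unfolding K_def using z sW lE0 by (auto simp: linear_diff[OF linl] linear_scale[OF linl] intro!: subspace_diff[OF subW] subspace_scale[OF subW])
  hence "z - (l z / l sE) *R sE : span B" using B(4) by blast
  thus "z : span (insert sE B)" by (auto simp: span_breakdown_eq)
 qed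
 moreover have "insert sE B <= W" using B(2) sW by (auto simp: K_def)
 ultimately have "card (insert sE B) = dim W" using indep by (intro basis_card_eq_dim)
 moreover have "dim W = d + 1" unfolding W_def h_def using dim by simp
 moreover have finB: "finite B" using independent_span_bound[of "h ` E" B] B(2,3) fin by (auto simp: K_def W_def)
 moreover have "sE ~: B" using sEB span_base by blast
 ultimately have cardB: "card B = d" by simp
 hence "card (B - {\<omega>}) = d - 1" using B(1) by simp
 then obtain f where f: "bij_betw f {..<d - 1} (B - {\<omega>})"
  using ex_bij_betw_nat_finite[of "B - {\<omega>}"] finB by (auto simp: atLeast0LessThan)
 \<comment> \<open>The last vector is chosen so that all \<open>d\<close> of them add up to
   \<open>- \<omega>\<close>, which makes \<open>\<omega>\<close> the image of
   \<open>up d\<close>.\<close>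
 define g where "g k = (if k < d - 1 then f k else - \<omega> - (\<Sum>k<d - 1. f k))" for k
 define R where "R z = (\<Sum>k<d. coord (fst z) k *R g k) + (snd z / l sE) *R sE" for z
 have linR: "linear R"
  unfolding R_def by (rule linearI) (simp_all add: lookup_add scaleR_add_left sum.distrib scaleR_sum_right add_divide_distrib scaleR_add_right algebra_simps)
 define r where "r x = R (x, 0)" for x
 have linr: "linear r" unfolding r_def by (rule linearI)
  (metis add.left_neutral add_Pair linR linear_add, metis linR linear_scale scaleR_Pair scaleR_zero_right)
 have rk: "r (basis_pt k) = g k" if "k < d" for k
 proof -
  have "r (basis_pt k) = (\<Sum>j<d. coord (basis_pt k) j *R g j)" by (simp add: r_def R_def)
  also have "\<dots> = (\<Sum>j<d. (if k = j then g j else 0))" by (intro sum.cong) auto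
  finally show ?thesis using that by simp
 qed
 have "r (up d) = - (\<Sum>k<d. g k)" unfolding up_def linear_neg[OF linr] linear_sum[OF linr] using rk by simp
 moreover have "(\<Sum>k<d. g k) = - \<omega>"
 proof -
  have "d = Suc (d - 1)" using d by simp
  hence "(\<Sum>k<d. g k) = (\<Sum>k<d - 1. g k) + g (d - 1)" by (metis sum.lessThan_Suc)
  thus ?thesis by (simp add: g_def)
 qed
 ultimately have rup: "r (up d) = \<omega>" by simp
 have onto: "K <= r ` Rpow d"
 proof -
  have "B <= r ` Rpow d"
  proof
   fix b assume b: "b : B"
   show "b : r ` Rpow d"
   proof (cases "b = \<omega>")
    case True thus ?thesis using rup up_in_Rpow by blast
   next
    case False
    hence "b : f ` {..<d - 1}" using b bij_betw_imp_surj_on[OF f] by simp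
    then obtain k where k: "k < d - 1" "b = f k" by auto
    hence "b = r (basis_pt k)" using rk[of k] by (simp add: g_def)
    moreover have "basis_pt k : Rpow d" using k by (simp add: basis_pt_in_Rpow)
    ultimately show ?thesis by blast
   qed
  qed
  hence "span B <= r ` Rpow d" by (intro span_minimal linear_subspace_image linr subspace_Rpow)
  thus ?thesis using B(4) by blast
 qed
 have "ALL e:E. EX x. x : Rpow d & r x = (1 / l (h e)) *R h e - (1 / l sE) *R sE"
 proof
  fix e assume e: "e : E"
  have "(1 / l (h e)) *R h e - (1 / l sE) *R sE : K" unfolding K_def using lpos[OF e] lE0 hW[OF e] sW
   by (auto simp: linear_diff[OF linl] linear_scale[OF linl] intro!: subspace_diff[OF subW] subspace_scale[OF subW])
  thus "EX x. x : Rpow d & r x = (1 / l (h e)) *R h e - (1 / l sE) *R sE" using onto by force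
 qed
 hence "EX x. ALL e:E. x e : Rpow d & r (x e) = (1 / l (h e)) *R h e - (1 / l sE) *R sE" by (rule bchoice)
 then obtain x where x: "ALL e:E. x e : Rpow d & r (x e) = (1 / l (h e)) *R h e - (1 / l sE) *R sE" by (elim exE)
 have exp: "EX c:Rpow d. 0 < ip d c (up d) & (ALL e':E - {e}. ip d c (x e') < ip d c (x e))" if e: "e : E" for e
 proof -
  have "linear (%x. \<alpha> e (r x))" using linear_compose[OF linr lin\<alpha>[OF e]] by (simp add: o_def)
  then obtain c where c: "c : Rpow d" "ALL x:Rpow d. ip d c x = \<alpha> e (r x)" using ip_represents by blast
  have v: "ip d c (x e') = \<alpha> e (h e') / l (h e') - \<alpha> e sE / l sE" if "e' : E" for e'
   using c(2) x that by (simp add: linear_diff[OF lin\<alpha>[OF e]] linear_scale[OF lin\<alpha>[OF e]])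
  show ?thesis
  proof (intro bexI[OF _ c(1)] conjI ballI)
   show "0 < ip d c (up d)" using c(2) up_in_Rpow rup \<alpha>\<omega>[OF e] by simp
   fix e' assume e': "e' : E - {e}"
   hence "\<alpha> e (h e') < 0" "\<alpha> e (h e) = 0" "0 < l (h e')" using \<alpha> e lpos by auto
   thus "ip d c (x e') < ip d c (x e)" using e e' by (simp add: v divide_neg_pos)
  qed
 qed
 have inj: "inj_on x E"
 proof (rule inj_onI, rule ccontr)
  fix e e' assume h: "e : E" "e' : E" "x e = x e'" "e ~= e'"
  hence "e' : E - {e}" by simp
  thus False using exp[OF h(1)] h(3) by auto
 qed
 have "admissible d (x ` E)" unfolding admissible_def
 proof (intro conjI ballI)
  fix p assume "p : x ` E"
  then obtain e where e: "e : E" "p = x e" by blast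
  obtain c where c: "c : Rpow d" "0 < ip d c (up d)" "ALL e':E - {e}. ip d c (x e') < ip d c (x e)" using exp[OF e(1)] by blast
  thus "EX c:Rpow d. 0 < ip d c (up d) & (ALL q:x ` E - {p}. ip d c q < ip d c p)"
   unfolding e(2) by (intro bexI[OF _ c(1)]) auto
 qed (use fin x in auto)
 moreover have "(e, 1) = l (h e) *R R (x e, 1)" if e: "e : E" for e
 proof -
  have "R (x e, 1) = r (x e) + R (0, 1)" unfolding r_def linear_add[OF linR, symmetric] by simp
  also have "R (0, 1) = (1 / l sE) *R sE" by (simp add: R_def)
  also have "r (x e) + (1 / l sE) *R sE = (1 / l (h e)) *R h e" using x e by simp
  finally show ?thesis using lpos[OF e] by (simp add: h_def hat_def)
 qed
 ultimately have "chart d E R (%e. l (h e)) x" unfolding chart_def using linR inj lpos by blast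
 thus ?thesis by blast
qed

text \<open>Compression along \<open>up d\<close>: in the limit all coordinate sums agree, so
  distinct points differ in both directions, and a slightly weaker compression keeps this. Distinct
  points stay distinct in the limit because no chord of an admissible set is parallel to
  \<open>up d\<close>.\<close>

lemma flatten:
 assumes X: "admissible d X" and d: "0 < d"
 obtains F G where "linear F" "linear G" "!!x. G (F x) = x" "admissible d (F ` X)" "flat d (F ` X)"
proof -
 define m where "m x = ip d (up d) x / real d" for x
 have linm: "linear m" unfolding m_def by (rule linearI) (auto simp: ip_simps add_divide_distrib)
 have mup: "m (up d) = 1" using d by (simp add: m_def ip_up_up)
 define T where "T s x = x + ((s - 1) * m x) *R up d" for s x
 have linT: "linear (T s)" for s unfolding T_def by (rule linearI) (auto simp: linear_add[OF linm] linear_scale[OF linm] algebra_simps)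
 have mT: "m (T s x) = s * m x" for s x unfolding T_def linear_add[OF linm] linear_scale[OF linm] mup by (simp add: algebra_simps)
 have inv: "T (1 / s) (T s x) = x" if "s ~= 0" for s x
 proof -
  have "T (1 / s) (T s x) = x + ((s - 1) * m x + (1 / s - 1) * (s * m x)) *R up d"
   unfolding T_def[of "1 / s"] mT by (simp only: T_def add.assoc scaleR_add_left)
  also have "(s - 1) * m x + (1 / s - 1) * (s * m x) = 0" using that by (simp add: algebra_simps)
  finally show ?thesis by simp
 qed
 have TR: "T s x : Rpow d" if "x : Rpow d" for s x
  unfolding T_def using that up_in_Rpow by (intro subspace_add[OF subspace_Rpow] subspace_scale[OF subspace_Rpow])
 have adj: "ip d (T s c) x = ip d c (T s x)" for s c x by (simp add: T_def ip_add_left ip_scaleR_left ip_simps m_def ip_commute[of d c "up d"])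
 define \<iota> where "\<iota> p q i \<longleftrightarrow> i < d & 0 < coord (T 0 (q - p)) i" for p q i
 have pos: "EX i. \<iota> p q i" if pq: "p : X" "q : X" "p ~= q" for p q
 proof (rule ccontr)
  assume no: "~ (EX i. \<iota> p q i)"
  have le: "coord (T 0 (q - p)) i <= 0" if "i < d" for i
  proof -
   have "~ \<iota> p q i" using no by blast
   thus ?thesis using that by (simp add: \<iota>_def)
  qed
  have "m (T 0 (q - p)) = 0" by (simp add: mT)
  hence "(\<Sum>i<d. - coord (T 0 (q - p)) i) = 0" using d by (simp add: m_def ip_commute[of d "up d"] ip_up sum_negf)
  hence z: "coord (T 0 (q - p)) i = 0" if "i < d" for i using sum_nonneg_eq_0_iff[of "{..<d}" "%i. - coord (T 0 (q - p)) i"] le that by simp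
  have "T 0 (q - p) : Rpow d" using X pq by (intro TR subspace_diff[OF subspace_Rpow]) (auto simp: admissible_def)
  hence "T 0 (q - p) = 0" using Rpow_expansion[of "T 0 (q - p)" d] z by simp
  hence v: "q - p = m (q - p) *R up d" by (simp add: T_def)
  obtain a b where ab: "upward d a" "upward d b" "ip d a (q - p) < 0" "0 < ip d b (q - p)" using nonvertical[OF X pq] by blast
  have "ip d c (q - p) = m (q - p)" if "upward d c" for c
   using that arg_cong[OF v, of "ip d c"] by (simp only: linear_scale[OF linear_ip]) (simp add: upward_def)
  thus False using ab by simp
 qed
 have "\<forall>\<^sub>F s in at_right 0. ALL p:X. ALL q:X - {p}. ALL i:{i. i < d & \<iota> p q i}. 0 < coord (T 0 (q - p)) i + s * (m (q - p) * coord (up d) i)"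
  using X by (intro eventually_ball_finite ballI eventually_small) (auto simp: admissible_def \<iota>_def)
 then obtain s where s: "0 < s" "ALL p:X. ALL q:X - {p}. ALL i:{i. i < d & \<iota> p q i}. 0 < coord (T 0 (q - p)) i + s * (m (q - p) * coord (up d) i)"
  by (rule at_right_witness)
 have coT: "coord (T s v) i = coord (T 0 v) i + s * (m v * coord (up d) i)" for v i
  unfolding T_def by (simp add: lookup_add lookup_minus) (simp add: algebra_simps)
 show ?thesis
 proof (rule that[of "T s" "T (1 / s)"])
  show "T (1 / s) (T s x) = x" for x using inv s(1) by simp
  show "flat d (T s ` X)" unfolding flat_def
  proof (intro ballI impI)
   fix p' q' assume h: "p' : T s ` X" "q' : T s ` X" "p' ~= q'"
   then obtain p q where pq: "p : X" "q : X" "p' = T s p" "q' = T s q" "p ~= q" by blast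
   obtain i where i: "\<iota> p q i" using pos[OF pq(1,2,5)] by blast
   hence "0 < coord (T s (q - p)) i" unfolding coT using s(2) pq by (auto simp: \<iota>_def)
   hence "coord p' i < coord q' i" unfolding linear_diff[OF linT] pq(3,4) by (simp add: lookup_minus)
   thus "EX i<d. coord p' i < coord q' i" using i by (auto simp: \<iota>_def)
  qed
  show "admissible d (T s ` X)" unfolding admissible_def
  proof (intro conjI ballI)
   fix p' assume "p' : T s ` X"
   then obtain p where p: "p : X" "p' = T s p" by blast
   obtain c where c: "c : Rpow d" "ip d c (up d) > 0" "!!q. q : X ==> q ~= p ==> ip d c q < ip d c p"
    by (rule admissibleD[OF X p(1)]) blast
   have val: "ip d (T (1 / s) c) (T s q) = ip d c q" for q using inv s(1) by (simp add: adj)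
   have "T (1 / s) (up d) = (1 / s) *R up d" by (simp add: T_def mup algebra_simps)
   hence "0 < ip d (T (1 / s) c) (up d)" using c(2) s(1) by (simp add: adj ip_simps)
   thus "EX c:Rpow d. 0 < ip d c (up d) & (ALL q:T s ` X - {p'}. ip d c q < ip d c p')"
   proof (intro bexI[OF _ TR[OF c(1), of "1 / s"]] conjI ballI)
    fix q' assume "q' : T s ` X - {p'}"
    then obtain q where "q : X" "q ~= p" "q' = T s q" using p(2) by blast
    thus "ip d (T (1 / s) c) q' < ip d (T (1 / s) c) p'" using c(3) by (simp add: val p(2))
   qed
  qed (use X TR in "auto simp: admissible_def")
 qed (rule linT)+
qed

lemma flat_chart_exists:
 assumes E: "vconf (%x. x) E" and d: "2 <= d" and dim: "dim (hat (%x. x) ` E) = d + 1"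
 shows "EX R \<kappa> x. chart d E R \<kappa> x & flat d (x ` E)"
proof -
 obtain R \<kappa> x where c: "chart d E R \<kappa> x" using chart_exists[OF assms] by blast
 then obtain F G where FG: "linear F" "linear G" "!!y. G (F y) = y" "admissible d (F ` x ` E)" "flat d (F ` x ` E)"
  using flatten[of d "x ` E"] d unfolding chart_def by auto
 have linR: "linear R" using c by (simp add: chart_def)
 have "linear (%z. R (G (fst z), snd z))"
  by (rule linearI) (simp_all add: linear_add[OF FG(2)] linear_scale[OF FG(2)] flip: linear_add[OF linR] linear_scale[OF linR])
 moreover have "inj_on (%e. F (x e)) E" using c FG(3) unfolding chart_def inj_on_def by metis
 ultimately have "chart d E (%z. R (G (fst z), snd z)) \<kappa> (%e. F (x e))" using c FG(3,4) by (simp add: chart_def image_image)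
 thus ?thesis using FG(5) by (auto simp: image_image)
qed

datatype chart_unknown = Pos pt nat | Scale pt | Mat nat nat | Expose pt nat

text \<open>Being a flat chart is a finite system of equations and strict inequalities once a
  coordinate \<open>\<iota> e e'\<close> is fixed for each pair; its coefficients are algebraic
  because the vertices are.\<close>

lemma algebraic_chart_exists:
 assumes E: "finite E" "!!e. e : E ==> algebraic_pt e" and c: "chart d E R0 \<kappa>0 x0" and fl: "flat d (x0 ` E)"
 shows "EX R \<kappa> x. chart d E R \<kappa> x & flat d (x ` E) & (ALL e:E. algebraic_pt (x e))"
proof -
 obtain N where N: "E <= Rpow N" using finite_subset_Rpow[OF E(1)] by blast
 have linR0: "linear R0" and inj0: "inj_on x0 E" and adm0: "admissible d (x0 ` E)"
  and R0: "!!e. e : E ==> \<kappa>0 e > 0 & (e, 1) = \<kappa>0 e *R R0 (x0 e, 1)" using c by (auto simp: chart_def)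
 have x0R: "x0 e : Rpow d" if "e : E" for e using adm0 that by (auto simp: admissible_def)
 have "ALL e:E. EX a. ip d a (up d) > 0 & (ALL e':E - {e}. ip d a (x0 e') < ip d a (x0 e))"
 proof
  fix e assume e: "e : E"
  obtain a where a: "a : Rpow d" "ip d a (up d) > 0" "!!q. q : x0 ` E ==> q ~= x0 e ==> ip d a q < ip d a (x0 e)"
   by (rule admissibleD[OF adm0 imageI[OF e]]) blast
  thus "EX a. ip d a (up d) > 0 & (ALL e':E - {e}. ip d a (x0 e') < ip d a (x0 e))"
   using inj0 e by (intro exI[of _ a]) (auto simp: inj_on_def)
 qed
 hence "EX a. ALL e:E. ip d (a e) (up d) > 0 & (ALL e':E - {e}. ip d (a e) (x0 e') < ip d (a e) (x0 e))" by (rule bchoice)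
 then obtain a where a: "ALL e:E. ip d (a e) (up d) > 0 & (ALL e':E - {e}. ip d (a e) (x0 e') < ip d (a e) (x0 e))" by (elim exE)
 define \<iota> where "\<iota> e e' = (SOME i. i < d & coord (x0 e) i < coord (x0 e') i)" for e e'
 have \<iota>: "\<iota> e e' < d & coord (x0 e) (\<iota> e e') < coord (x0 e') (\<iota> e e')" if "e : E" "e' : E" "e ~= e'" for e e'
 proof -
  have "x0 e ~= x0 e'" using inj_on_eq_iff[OF inj0 that(1,2)] that(3) by simp
  hence "EX i. i < d & coord (x0 e) i < coord (x0 e') i" using fl that(1,2) unfolding flat_def by blast
  thus ?thesis unfolding \<iota>_def by (rule someI_ex)
 qed
 define U where "U = (%(e, k). Pos e k) ` (E \<times> {..<d}) \<union> Scale ` E \<union> (%(i, k). Mat i k) ` ({..N} \<times> {..d}) \<union>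
  (%(e, k). Expose e k) ` (E \<times> {..<d})"
 have finU: "finite U" using E(1) by (simp add: U_def)
 have inU: "e : E ==> k < d ==> Pos e k : U" "e : E ==> Scale e : U" "i <= N ==> k <= d ==> Mat i k : U"
  "e : E ==> k < d ==> Expose e k : U" for e i k by (auto simp: U_def)
 define target where "target e i = (if i < N then coord e i else 1)" for e i
 let ?P = "%y. (ALL e:E. 0 < y (Scale e) & 0 < (\<Sum>k<d. y (Expose e k) * coord (up d) k) &
  (ALL i:{..N}. y (Scale e) * ((\<Sum>k<d. y (Mat i k) * y (Pos e k)) + y (Mat i d)) = target e i) &
  (ALL e':E - {e}. (\<Sum>k<d. y (Expose e k) * y (Pos e' k)) < (\<Sum>k<d. y (Expose e k) * y (Pos e k)) &
   y (Pos e (\<iota> e e')) < y (Pos e' (\<iota> e e'))))"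
 define y0 where "y0 z = (case z of Pos e k => coord (x0 e) k | Scale e => \<kappa>0 e
  | Mat i k => (let v = (if k < d then R0 (basis_pt k, 0) else R0 (0, 1)) in if i < N then coord (fst v) i else snd v)
  | Expose e k => coord (a e) k)" for z
 have R0x: "R0 (x0 e, 1) = (\<Sum>k<d. coord (x0 e) k *R R0 (basis_pt k, 0)) + R0 (0, 1)" if "e : E" for e
 proof -
  have "(x0 e, 1) = (\<Sum>k<d. coord (x0 e) k *R (basis_pt k, 0::real)) + (0, 1)"
   using Rpow_expansion[OF x0R[OF that]] by (simp add: sum_prod)
  thus ?thesis by (simp only: linear_add[OF linR0] linear_sum[OF linR0] linear_scale[OF linR0])
 qed
 have eqn0: "\<kappa>0 e * ((\<Sum>k<d. y0 (Mat i k) * coord (x0 e) k) + y0 (Mat i d)) = target e i" if e: "e : E" for e i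
 proof (cases "i < N")
  case True
  have "coord e i = coord (fst (\<kappa>0 e *R R0 (x0 e, 1))) i" using R0[OF e] by (metis fst_conv)
  thus ?thesis unfolding R0x[OF e] using True by (simp add: y0_def target_def lookup_add lookup_sum fst_sum mult.commute)
 next
  case False
  have "1 = snd (\<kappa>0 e *R R0 (x0 e, 1))" using R0[OF e] by (metis snd_conv)
  thus ?thesis unfolding R0x[OF e] using False by (simp add: y0_def target_def snd_sum mult.commute)
 qed
 have alg_target: "algebraic (target e i)" if "e : E" for e i using E(2)[OF that] by (auto simp: target_def algebraic_pt_def)
 have alg_up: "algebraic (coord (up d) k)" for k by (simp add: coord_up)
 have PU: "poly_cond U ?P" by (intro poly_cond_conj poly_cond_ball poly_cond_eq poly_cond_less polyfun_sum polyfun.mult polyfun.add polyfun.var inU;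
   (rule polyfun.const)?) (use E(1) \<iota> alg_target alg_up in auto)
 have Py0: "?P y0" using eqn0 a \<iota>[OF _ _ not_sym] R0 by (auto simp: y0_def[of "Pos _ _"] y0_def[of "Scale _"] y0_def[of "Expose _ _"] ip_def)
 from algebraic_solution[OF finU PU, OF Py0] obtain y where "(ALL u:U. algebraic (y u)) & ?P y" by (elim exE)
 note alg = conjunct1[OF this] and y = conjunct2[OF this]
 define x where "x e = (\<Sum>k<d. y (Pos e k) *R basis_pt k)" for e
 define b where "b e = (\<Sum>k<d. y (Expose e k) *R basis_pt k)" for e
 define row where "row i z = (\<Sum>k<d. y (Mat i k) * coord (fst z) k) + y (Mat i d) * snd z" for i and z :: "pt \<times> real"
 define R where "R z = (\<Sum>i<N. row i z *R basis_pt i, row N z)" for z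
 have row: "row i (z + z') = row i z + row i z'" "row i (s *R z) = s * row i z" for i z z' s
  by (simp_all add: row_def lookup_add distrib_left sum.distrib sum_distrib_left mult_ac)
 have "linear R" unfolding R_def by (rule linearI) (simp_all add: row scaleR_add_left sum.distrib scaleR_sum_right)
 moreover have key: "0 < y (Scale e) & (e, 1) = y (Scale e) *R R (x e, 1)" if e: "e : E" for e
 proof -
  have pos: "0 < y (Scale e)" using y e by blast
  have r: "y (Scale e) * row i (x e, 1) = target e i" if "i <= N" for i using y e that by (simp add: row_def x_def coord_comb)
  have "e = y (Scale e) *R (\<Sum>i<N. row i (x e, 1) *R basis_pt i)"
  proof -
   have "e = (\<Sum>i<N. target e i *R basis_pt i)" using Rpow_expansion[of e N] N e by (auto simp: target_def)
   also have "\<dots> = (\<Sum>i<N. (y (Scale e) * row i (x e, 1)) *R basis_pt i)" using r by simp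
   finally show ?thesis by (simp add: scaleR_sum_right)
  qed
  moreover have "1 = y (Scale e) * row N (x e, 1)" using r[of N] by (simp add: target_def)
  ultimately show ?thesis using pos by (simp add: R_def)
 qed
 have ipb: "ip d (b e) z = (\<Sum>k<d. y (Expose e k) * coord z k)" for e z by (simp add: ip_def b_def coord_comb)
 have up_b: "0 < ip d (b e) (up d)" if "e : E" for e using y that by (simp add: ipb)
 have less_b: "ip d (b e) (x e') < ip d (b e) (x e)" and flat: "\<iota> e e' < d & coord (x e) (\<iota> e e') < coord (x e') (\<iota> e e')"
  if "e : E" "e' : E" "e ~= e'" for e e' using y \<iota>[OF that] that by (auto simp: ipb x_def coord_comb)
 have inj: "inj_on x E" using less_b by (metis inj_onI less_irrefl)
 have "admissible d (x ` E)" unfolding admissible_def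
 proof (intro conjI ballI)
  fix p assume "p : x ` E"
  then obtain e where e: "e : E" "p = x e" by blast
  have bR: "b e : Rpow d" unfolding b_def by (rule Rpow_comb)
  show "EX c:Rpow d. 0 < ip d c (up d) & (ALL q:x ` E - {p}. ip d c q < ip d c p)"
   using up_b[OF e(1)] less_b[OF e(1)] unfolding e(2) by (intro bexI[OF _ bR]) auto
 qed (use E(1) in "auto simp: x_def Rpow_comb")
 ultimately have "chart d E R (%e. y (Scale e)) x" using inj key unfolding chart_def by blast
 moreover have "flat d (x ` E)" unfolding flat_def
 proof (intro ballI impI)
  fix p q assume "p : x ` E" "q : x ` E" "p ~= q"
  then obtain e e' where "e : E" "e' : E" "p = x e" "q = x e'" "e ~= e'" by blast
  thus "EX i<d. coord p i < coord q i" using flat by blast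
 qed
 moreover have "algebraic_pt (x e)" if "e : E" for e using alg inU(1)[OF that] by (auto simp: algebraic_pt_def x_def coord_comb)
 ultimately show ?thesis by blast
qed

lemma dim_hat_le:
 assumes "E <= Rpow d"
 shows "dim (hat (%x. x) ` E) <= d + 1"
proof -
 let ?B = "insert (0, 1) ((%k. (basis_pt k, 0::real)) ` {..<d})"
 have "hat (%x. x) ` E <= span ?B"
 proof (rule image_subsetI)
  fix e assume "e : E"
  hence "e : Rpow d" using assms by blast
  hence "hat (%x. x) e = (\<Sum>k<d. coord e k *R (basis_pt k, 0::real)) + (0, 1)"
   using Rpow_expansion[of e d] by (simp add: hat_def sum_prod)
  also have "\<dots> : span ?B" by (intro span_add span_sum span_scale span_base) auto
  finally show "hat (%x. x) e : span ?B" .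
 qed
 hence "dim (hat (%x. x) ` E) <= card ?B" by (intro dim_le_card) auto
 also have "\<dots> <= Suc (card ((%k. (basis_pt k, 0::real)) ` {..<d}))" by (rule card_insert_le_m1) auto
 also have "\<dots> <= d + 1" using card_image_le[of "{..<d}" "%k. (basis_pt k, 0::real)"] by simp
 finally show ?thesis .
qed

lemma chart_span:
 assumes c: "chart d E R \<kappa> x" and fin: "finite E" and dim: "dim (hat (%x. x) ` E) = d + 1"
 shows "inj_on R (span (hat (%x. x) ` x ` E))" "dim (hat (%x. x) ` x ` E) = d + 1"
proof -
 let ?H = "hat (%x. x) ` x ` E"
 have linR: "linear R" and xR: "x ` E <= Rpow d" and \<kappa>: "!!e. e : E ==> \<kappa> e > 0 & (e, 1) = \<kappa> e *R R (x e, 1)"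
  using c by (auto simp: chart_def admissible_def)
 have 1: "hat (%x. x) ` E <= span (R ` ?H)"
 proof (rule image_subsetI)
  fix e assume e: "e : E"
  have "R (x e, 1) : R ` ?H" using e by (auto simp: hat_def)
  hence "\<kappa> e *R R (x e, 1) : span (R ` ?H)" by (intro span_scale span_base)
  thus "hat (%x. x) e : span (R ` ?H)" using \<kappa>[OF e] by (simp add: hat_def)
 qed
 have 2: "R ` ?H <= span (hat (%x. x) ` E)"
 proof (unfold image_image[of R], unfold image_image, rule image_subsetI)
  fix e assume e: "e : E"
  have "(1 / \<kappa> e) *R (e, 1) : span (hat (%x. x) ` E)" using e by (intro span_scale span_base) (auto simp: hat_def)
  also have "(1 / \<kappa> e) *R (e, 1) = R (x e, 1)" 
  proof -
   have "(1 / \<kappa> e) *R (e, 1) = (1 / \<kappa> e) *R (\<kappa> e *R R (x e, 1))" using \<kappa>[OF e] by (simp only:)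
   thus ?thesis using \<kappa>[OF e] by simp
  qed
  finally show "R (hat (%x. x) (x e)) : span (hat (%x. x) ` E)" by (simp add: hat_def)
 qed
 have "span (hat (%x. x) ` E) = span (R ` ?H)"
  using span_minimal[OF 1 subspace_span] span_minimal[OF 2 subspace_span] by (rule subset_antisym)
 hence "dim (hat (%x. x) ` E) = dim (R ` ?H)" by (rule span_eq_dim)
 hence dimR: "dim (R ` ?H) = d + 1" using dim by simp
 have "dim ?H <= d + 1" by (rule dim_hat_le[OF xR])
 thus inj: "inj_on R (span ?H)" using fin dimR by (intro inj_on_span_of_dim linR) auto
 show "dim ?H = d + 1" using dim_linear_image[OF linR inj] dimR by simp
qed

lemma stamp_of_chart:
 assumes c: "chart d E R \<kappa> x" and fin: "finite E" and dim: "dim (hat (%x. x) ` E) = d + 1" and st: "stamp (x ` E) v I star"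
 shows "stamp E v I (star \<circ> x)" unfolding stamp_def dim
proof (intro conjI allI impI)
 let ?H = "hat (%x. x) ` x ` E"
 note cs = chart_span[OF c fin dim]
 have linR: "linear R" and injx: "inj_on x E" and \<kappa>: "!!e. e : E ==> \<kappa> e > 0 & (e, 1) = \<kappa> e *R R (x e, 1)"
  using c by (auto simp: chart_def)
 show "vconf v I" using st by (simp add: stamp_def)
 show "v ` I <= Rpow (d + 1 + 1)" "dim (hat v ` I) = d + 1 + 2" using st cs(2) by (simp_all add: stamp_def)
 show "inj_on (star \<circ> x) E" using st injx by (auto simp: stamp_def intro: comp_inj_on)
 show "(star \<circ> x) ` E : cfaces (hat v) I" using st by (simp add: stamp_def image_comp)
 fix v' :: "nat => pt" assume v': "cfaces (hat v') I = cfaces (hat v) I"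
 have "EX A \<mu>. linear A & inj_on A (span ?H) & (ALL e:x ` E. \<mu> e > 0 & A (e, 1) = \<mu> e *R hat v' (star e))"
  using st v' unfolding stamp_def by blast
 then obtain A \<mu> where A: "linear A" "inj_on A (span ?H)" "!!e. e : E ==> \<mu> (x e) > 0 & A (x e, 1) = \<mu> (x e) *R hat v' (star (x e))"
  by blast
 obtain L where L: "linear L" "!!z. z : span ?H ==> L (R z) = z"
  using linear_exists_left_inverse_on[OF linR subspace_span cs(1)] by auto
 have in_span: "(x e, 1) : span ?H" if "e : E" for e using that by (intro span_base) (auto simp: hat_def)
 show "EX A \<mu>. linear A & inj_on A (span (hat (%x. x) ` E)) &
   (ALL e:E. \<mu> e > 0 & A (e, 1) = \<mu> e *R hat v' ((star \<circ> x) e))"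
 proof (rule exI[of _ "A \<circ> L"], rule exI[of _ "%e. \<kappa> e * \<mu> (x e)"], intro conjI ballI)
  show "linear (A \<circ> L)" using L(1) A(1) by (rule linear_compose)
  have "span (hat (%x. x) ` E) <= R ` span ?H"
  proof (intro span_minimal linear_subspace_image linR subspace_span image_subsetI)
   fix e assume e: "e : E"
   hence "hat (%x. x) e = R (\<kappa> e *R (x e, 1))" using \<kappa>[OF e] unfolding linear_scale[OF linR] by (simp add: hat_def)
   thus "hat (%x. x) e : R ` span ?H" using span_scale[OF in_span[OF e]] by blast
  qed
  moreover have "inj_on (A \<circ> L) (R ` span ?H)"
  proof (rule inj_onI)
   fix y z assume "y : R ` span ?H" "z : R ` span ?H" and eq: "(A \<circ> L) y = (A \<circ> L) z"
   then obtain y' z' where yz: "y = R y'" "z = R z'" "y' : span ?H" "z' : span ?H" by blast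
   hence "A y' = A z'" using eq L(2) by simp
   thus "y = z" using inj_onD[OF A(2)] yz by blast
  qed
  ultimately show "inj_on (A \<circ> L) (span (hat (%x. x) ` E))" by (rule inj_on_subset[rotated])
  fix e assume e: "e : E"
  show "\<kappa> e * \<mu> (x e) > 0" using \<kappa>[OF e] A(3)[OF e] by simp
  have "(A \<circ> L) (e, 1) = A (L (R (\<kappa> e *R (x e, 1))))" using \<kappa>[OF e] unfolding linear_scale[OF linR] by simp
  also have "\<dots> = \<kappa> e *R A (x e, 1)" unfolding L(2)[OF span_scale[OF in_span[OF e]]] by (rule linear_scale[OF A(1)])
  finally show "(A \<circ> L) (e, 1) = (\<kappa> e * \<mu> (x e)) *R hat v' ((star \<circ> x) e)" using A(3)[OF e] by simp
 qed
qed

text \<open>Rank at most 2 leaves at most two vertices: one of three would be a positive combination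
  of the other two and could not be exposed.\<close>

lemma independent_hat:
 assumes E: "vconf w E" and dim: "dim (hat w ` E) <= 2"
 shows "independent (hat w ` E)"
proof -
 have fin: "finite E" using E by (simp add: vconf_def)
 have ex: "EX a :: 'b \<times> real => real. linear a & a (hat w e) = 0 & (ALL e':E - {e}. a (hat w e') < 0)" if "e : E" for e
 proof -
  have "{e} : cfaces (hat w) E" using E that by (simp add: vconf_def)
  then obtain a :: "_ => real" where "linear a" "!!i. i : {e} ==> a (hat w i) = 0" "!!i. i : E - {e} ==> a (hat w i) < 0"
   by (rule cfacesE) blast
  thus ?thesis by blast
 qed
 have no3: False if d: "p : E" "q : E" "r : E" "p ~= q" "q ~= r" "p ~= r" for p q r
 proof -
  obtain a where a: "linear a" "a (hat w p) = (0::real)" "!!e'. e' : E ==> e' ~= p ==> a (hat w e') < 0" using ex[OF d(1)] by blast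
  obtain \<beta> where \<beta>: "linear \<beta>" "\<beta> (hat w q) = (0::real)" "!!e'. e' : E ==> e' ~= q ==> \<beta> (hat w e') < 0" using ex[OF d(2)] by blast
  obtain \<gamma> where \<gamma>: "linear \<gamma>" "\<gamma> (hat w r) = (0::real)" "!!e'. e' : E ==> e' ~= r ==> \<gamma> (hat w e') < 0" using ex[OF d(3)] by blast
  have "independent {hat w q, hat w r}"
  proof (rule independent_dual)
   fix b assume "b : {hat w q, hat w r}"
   thus "EX h. linear h & h b ~= (0::real) & (ALL c:{hat w q, hat w r} - {b}. h c = 0)"
   proof
    assume b: "b = hat w q"
    show ?thesis using \<gamma>(3)[OF d(2,5)] by (intro exI[of _ \<gamma>]) (use \<gamma>(1,2) b in auto)
   next
    assume "b : {hat w r}"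
    thus ?thesis using \<beta>(3)[OF d(3) d(5)[symmetric]] by (intro exI[of _ \<beta>]) (use \<beta>(1,2) in auto)
   qed
  qed
  moreover have "card {hat w q, hat w r} = 2"
  proof -
   have "hat w q ~= hat w r" using \<gamma>(2) \<gamma>(3)[OF d(2,5)] by auto
   thus ?thesis by simp
  qed
  ultimately have "hat w ` E <= span {hat w q, hat w r}" using fin d dim by (intro spanning_of_dim) auto
  hence "hat w p : span {hat w q, hat w r}" using d(1) by blast
  then obtain b where "hat w p - b *R hat w q : span {hat w r}" by (rule span_insertE)
  then obtain c where "hat w p - b *R hat w q = c *R hat w r" by (auto simp: span_singleton)
  hence e: "hat w p = b *R hat w q + c *R hat w r" by (simp add: diff_eq_eq add.commute)
  have v: "h (hat w p) = b * h (hat w q) + c * h (hat w r)" if "linear h" for h :: "'b \<times> real => real"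
   unfolding e linear_add[OF that] linear_scale[OF that] by simp
  have "c * \<beta> (hat w r) < 0" using v[OF \<beta>(1)] \<beta>(2) \<beta>(3)[OF d(1,4)] by simp
  hence c: "0 < c" using \<beta>(3)[OF d(3) d(5)[symmetric]] by (simp add: mult_less_0_iff)
  have "b * \<gamma> (hat w q) < 0" using v[OF \<gamma>(1)] \<gamma>(2) \<gamma>(3)[OF d(1,6)] by simp
  hence b: "0 < b" using \<gamma>(3)[OF d(2,5)] by (simp add: mult_less_0_iff)
  have "b * a (hat w q) < 0" "c * a (hat w r) < 0"
   using b c a(3)[OF d(2) d(4)[symmetric]] a(3)[OF d(3) d(6)[symmetric]] by (simp_all add: mult_pos_neg)
  thus False using v[OF a(1)] a(2) by simp
 qed
 show ?thesis
 proof (rule independent_dual)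
  fix b assume "b : hat w ` E"
  then obtain e where e: "e : E" "b = hat w e" by blast
  show "EX h. linear h & h b ~= (0::real) & (ALL c:hat w ` E - {b}. h c = 0)"
  proof (cases "E = {e}")
   case True
   have "linear (snd :: 'b \<times> real => real)" by (rule linearI) simp_all
   thus ?thesis unfolding e(2) True by (intro exI[of _ snd]) (simp add: hat_def)
  next
   case False
   then obtain f where f: "f : E" "f ~= e" using e(1) by blast
   obtain a where a: "linear a" "a (hat w f) = (0::real)" "!!e'. e' : E ==> e' ~= f ==> a (hat w e') < 0" using ex[OF f(1)] by blast
   have "c = hat w f" if c: "c : hat w ` E - {b}" for c
   proof -
    obtain g where "g : E" "c = hat w g" "g ~= e" using c e(2) by blast
    thus ?thesis using no3[OF e(1) f(1), of g] f(2) by metis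
   qed
   hence "ALL c:hat w ` E - {b}. a c = 0" using a(2) by metis
   moreover have "a b ~= 0" using a(3)[OF e(1) f(2)[symmetric]] e(2) by simp
   ultimately show ?thesis using a(1) by blast
  qed
 qed
qed

text \<open>Covers the polytopes of dimension at most 1, to which the cluster construction with
  \<open>2 <= d\<close> does not apply. A simplex with two more vertices serves as stamp, since all
  realizations of a simplex are projectively equivalent.\<close>

lemma simplex_stamp:
 assumes fin: "finite E" and ind: "independent (hat (%x. x) ` E)"
 shows "EX v I star. stamp E v I star"
proof -
 let ?h = "hat (%x::pt. x)"
 define k where "k = card E"
 have injh: "inj_on ?h E" by (auto simp: inj_on_def hat_def)
 have dimE: "dim (?h ` E) = k" using dim_eq_card_independent[OF ind] card_image[OF injh] by (simp add: k_def)
 obtain star where star: "bij_betw star E {..<k}" using ex_bij_betw_finite_nat[OF fin] by (auto simp: k_def atLeast0LessThan)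
 define I where "I = {..k + 1}"
 define v where "v i = (if i <= k then basis_pt i else 0)" for i
 have func: "EX f. linear f & (ALL i:I. f (hat v i) = s i)" for s :: "nat => real"
 proof (intro exI conjI ballI)
  let ?f = "%z. (\<Sum>i\<le>k. (s i - s (k + 1)) * coord (fst z) i) + snd z * s (k + 1)"
  show "linear ?f" by (rule linearI) (simp_all add: lookup_add distrib_left distrib_right sum.distrib sum_distrib_left mult_ac)
  fix i assume i: "i : I"
  show "?f (hat v i) = s i"
  proof (cases "i <= k")
   case True
   hence "(\<Sum>j\<le>k. (s j - s (k + 1)) * coord (v i) j) = (\<Sum>j\<le>k. if i = j then s j - s (k + 1) else 0)"
    by (intro sum.cong) (auto simp: v_def)
   thus ?thesis using True by (simp add: hat_def)
  next
   case False
   thus ?thesis using i by (simp add: hat_def v_def I_def le_Suc_eq)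
  qed
 qed
 have faces: "S : cfaces (hat v) I" if "S <= I" for S
 proof -
  obtain f :: "_ => real" where f: "linear f" "ALL i:I. f (hat v i) = (if i : S then 0 else - 1)"
   using func[of "%i. if i : S then 0 else - 1"] by blast
  show ?thesis by (rule cfacesI[OF f(1) that]) (use f(2) that in auto)
 qed
 have dual: "card (hat u ` T) = card T & independent (hat u ` T)"
  if T: "finite T" "T <= I" and u: "!!S. S <= I ==> S : cfaces (hat u) I" for u :: "nat => pt" and T
 proof -
  have ex: "EX f :: pt \<times> real => real. linear f & f (hat u i) ~= 0 & (ALL j:I - {i}. f (hat u j) = 0)" if i: "i : T" for i
  proof -
   have "I - {i} : cfaces (hat u) I" by (intro u) auto
   then obtain f :: "_ => real" where "linear f" "!!j. j : I - {i} ==> f (hat u j) = 0" "!!j. j : I - (I - {i}) ==> f (hat u j) < 0"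
    by (rule cfacesE) blast
   thus ?thesis using i T(2) by (intro exI[of _ f]) force
  qed
  have "inj_on (hat u) T"
  proof (rule inj_onI, rule ccontr)
   fix i j assume h: "i : T" "j : T" "hat u i = hat u j" "i ~= j"
   hence "j : I - {i}" using T(2) by blast
   thus False using ex[OF h(1)] h(3) by metis
  qed
  moreover have "independent (hat u ` T)"
  proof (rule independent_dual)
   fix b assume "b : hat u ` T"
   then obtain i where i: "i : T" "b = hat u i" by blast
   obtain f :: "pt \<times> real => real" where f: "linear f" "f (hat u i) ~= 0" "ALL j:I - {i}. f (hat u j) = 0" using ex[OF i(1)] by blast
   have "f c = 0" if c: "c : hat u ` T - {b}" for c
   proof -
    obtain j where "j : T" "c = hat u j" "j ~= i" using c i(2) by blast
    thus ?thesis using f(3) T(2) by blast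
   qed
   thus "EX f. linear f & f b ~= (0::real) & (ALL c:hat u ` T - {b}. f c = 0)" using f(1,2) i(2) by blast
  qed
  ultimately show ?thesis by (simp add: card_image)
 qed
 have starI: "star ` E <= I" using bij_betw_imp_surj_on[OF star] by (auto simp: I_def)
 have "stamp E v I star" unfolding stamp_def dimE
 proof (intro conjI allI impI)
  show "vconf v I" unfolding vconf_def using faces by (auto simp: I_def)
  show "v ` I <= Rpow (k + 1)" using subspace_0[OF subspace_Rpow] by (auto simp: v_def basis_pt_in_Rpow)
  have cv: "card (hat v ` I) = card I" "independent (hat v ` I)" using dual[of I v] faces by (auto simp: I_def)
  show "dim (hat v ` I) = k + 2" unfolding dim_eq_card_independent[OF cv(2)] cv(1) by (simp add: I_def)
  show "inj_on star E" using star by (rule bij_betw_imp_inj_on)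
  show "star ` E : cfaces (hat v) I" by (rule faces[OF starI])
  fix v' :: "nat => pt" assume v': "cfaces (hat v') I = cfaces (hat v) I"
  obtain A where A: "linear A" "ALL z:?h ` E. A z = hat v' (star (fst z))"
   using linear_independent_extend[OF ind, of "%z. hat v' (star (fst z))"] by blast
  have Ae: "A (e, 1) = hat v' (star e)" if "e : E" for e using A(2) that by (auto simp: hat_def)
  have "A ` ?h ` E = hat v' ` star ` E" using A(2) by (auto simp: hat_def image_iff)
  moreover have "card (hat v' ` star ` E) = card (star ` E)" "independent (hat v' ` star ` E)" using dual[of "star ` E" v'] faces v' fin starI by auto
  moreover have "card (star ` E) = k" using bij_betw_imp_surj_on[OF star] by simp
  ultimately have "dim (A ` ?h ` E) = k" using dim_eq_card_independent[of "hat v' ` star ` E"] by simp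
  hence inj: "inj_on A (span (?h ` E))" using fin dimE by (intro inj_on_span_of_dim A(1)) auto
  show "EX A \<kappa>. linear A & inj_on A (span (?h ` E)) & (ALL e:E. \<kappa> e > 0 & A (e, 1) = \<kappa> e *R hat v' (star e))"
   by (rule exI[of _ A], rule exI[of _ "%_. 1"]) (simp add: A(1) inj Ae)
 qed
 thus ?thesis by blast
qed

theorem stamp_exists:
 assumes E: "vconf (%x. x) E" and alg: "!!e. e : E ==> algebraic_pt e"
 shows "EX v I star. stamp E v I star"
proof (cases "dim (hat (%x. x) ` E) <= 2")
 case True
 have "finite E" using E by (simp add: vconf_def)
 thus ?thesis by (rule simplex_stamp[OF _ independent_hat[OF E True]])
next
 case False
 define d where "d = dim (hat (%x. x) ` E) - 1"
 have d: "2 <= d" "dim (hat (%x. x) ` E) = d + 1" using False by (simp_all add: d_def)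
 have fin: "finite E" using E by (simp add: vconf_def)
 obtain R0 \<kappa>0 x0 where "chart d E R0 \<kappa>0 x0" "flat d (x0 ` E)" using flat_chart_exists[OF E d] by blast
 then obtain R \<kappa> x where c: "chart d E R \<kappa> x" and fl: "flat d (x ` E)" and ax: "ALL e:E. algebraic_pt (x e)"
  using algebraic_chart_exists[OF fin alg] by blast
 have "EX v I star. stamp (x ` E) v I star"
 proof (rule cluster_stamp[OF d(1)])
  show "admissible d (x ` E)" using c by (simp add: chart_def)
  show "EX i<d. coord p i < coord q i" if "p : x ` E" "q : x ` E" "p ~= q" for p q using fl that unfolding flat_def by blast
  show "dim (hat (%x. x) ` x ` E) = d + 1" by (rule chart_span(2)[OF c fin d(2)])
 qed (use ax in auto)
 thus ?thesis using stamp_of_chart[OF c fin d(2)] by blast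
qed

section \<open>Transfer of the predicate between combinatorial and projective types\<close>

section \<open>From combinatorial to projective types\<close>

lemma realization_indexed:
 "realization r F \<longleftrightarrow> indexed_polytope F & index_order F = r"
 unfolding indexed_polytope_def using realization_index_order by auto

lemma labelled_comp: "labelled (%i. w (s i)) L D = labelled w (%f. s ` L f) D" by (simp add: labelled_def image_image fun_eq_iff)

text \<open>The labels of \<open>E\<close> are kept for the faces of the star face and fresh numbers
  label all other faces, so that restricting a realization to this face yields the index poset of
  the given polytope without renaming.\<close>

lemma extend_labelling:
 assumes lab: "labelling w E L D" and v: "vconf v I" and star: "inj_on star E" "star ` E : cfaces (hat v) I"
  and same: "cfaces (hat (%e. v (star e))) E = cfaces (hat w) E"
 obtains L' D' where "labelling v I L' D'" "D <= D'" "!!f. f : D ==> L' f = star ` L f"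
  "{g : D'. L' g <= star ` E} = D"
proof -
 note l = labellingD[OF lab]
 have finI: "finite I" using v by (simp add: vconf_def)
 let ?C = "cfaces (hat v) I" and ?B = "{S : cfaces (hat v) I. S <= star ` E}"
 have finC: "finite ?C" by (rule finite_subset[of _ "Pow I"]) (use finI cfaces_subset in auto)
 have "finite (cfaces (hat w) E)" by (rule finite_subset[of _ "Pow E"]) (use l(2) cfaces_subset in auto)
 hence finD: "finite D" using lab bij_betw_finite by (auto simp: labelling_def)
 have C0: "?B = (%S. star ` S) ` cfaces (hat w) E"
 proof -
  have "?B = cfaces (hat v) (star ` E)" using cfaces_face[OF finI star(2)] by simp
  also have "\<dots> = (%S. star ` S) ` cfaces (%e. hat v (star e)) E"
  proof
   show "cfaces (hat v) (star ` E) <= (%S. star ` S) ` cfaces (%e. hat v (star e)) E"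
   proof
    fix T assume T: "T : cfaces (hat v) (star ` E)"
    then obtain S where S: "S <= E" "T = star ` S" using cfaces_subset subset_imageE by metis
    thus "T : (%S. star ` S) ` cfaces (%e. hat v (star e)) E" using T cfaces_reindex[OF star(1) S(1)] by blast
   qed
   show "(%S. star ` S) ` cfaces (%e. hat v (star e)) E <= cfaces (hat v) (star ` E)"
    using cfaces_reindex[OF star(1) cfaces_subset] by blast
  qed
  also have "(%e. hat v (star e)) = hat (%e. v (star e))" by (simp add: hat_def fun_eq_iff)
  finally show ?thesis using same by simp
 qed
 have bij0: "bij_betw (%f. star ` L f) D ?B" unfolding C0 bij_betw_def
 proof
  show "inj_on (%f. star ` L f) D"
  proof (rule inj_onI)
   fix f g assume "f : D" "g : D" "star ` L f = star ` L g"
   thus "f = g" using inj_on_image_eq_iff[OF star(1) l(6) l(6), of f g] l(3) by (simp add: inj_on_def)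
  qed
  have "L ` D = cfaces (hat w) E" using lab by (simp add: labelling_def bij_betw_def)
  thus "(%f. star ` L f) ` D = (%S. star ` S) ` cfaces (hat w) E" by (metis image_image)
 qed
 obtain N where N: "ALL f:D. f < N" using finD unfolding finite_nat_set_iff_bounded by blast
 define D1 where "D1 = {N..<N + card (?C - ?B)}"
 have "card D1 = card (?C - ?B)" by (simp add: D1_def)
 then obtain h where h: "bij_betw h D1 (?C - ?B)" using finite_same_card_bij[of D1 "?C - ?B"] finC by (auto simp: D1_def)
 have dis: "D \<inter> D1 = {}" using N by (auto simp: D1_def)
 define L' where "L' f = (if f : D then star ` L f else h f)" for f
 have b0: "bij_betw L' D ?B" using bij0 by (subst bij_betw_cong[where g = "%f. star ` L f"]) (auto simp: L'_def)
 have b1: "bij_betw L' D1 (?C - ?B)" using h dis by (subst bij_betw_cong[where g = h]) (auto simp: L'_def)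
 have "bij_betw L' (D \<union> D1) (?B \<union> (?C - ?B))" by (rule bij_betw_combine[OF b0 b1]) blast
 moreover have "?B \<union> (?C - ?B) = ?C" by blast
 ultimately have bij: "bij_betw L' (D \<union> D1) ?C" by (simp only:)
 show ?thesis
 proof (rule that)
  show "labelling v I L' (D \<union> D1)" using v bij by (simp add: labelling_def)
  show "L' f = star ` L f" if "f : D" for f using that by (simp add: L'_def)
  have "L' g : ?B" if "g : D" for g using b0 that by (auto simp: bij_betw_def)
  moreover have "L' g : ?C - ?B" if "g : D1" for g using bij_betwE[OF b1] that by blast
  ultimately show "{g : D \<union> D1. L' g <= star ` E} = D" by blast
 qed blast
qed

text \<open>The face with index \<open>f\<close> is a projective copy of \<open>F\<close> in every
  realization \<open>H\<close>. The statement allows a further projectivity \<open>M\<close> because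
  inheritance yields \<open>\<psi>\<close> only after some projectivity has been applied to the
  ridge.\<close>

theorem stamp_forces:
 assumes F: "algebraic_indexed F"
 obtains G f where "algebraic_indexed G" "ridge (index_order G) f"
  "pdim (body G) = pdim (body F) + 2"
  "!!d. body F <= Rpow d ==> EX ps. set ps <= Ralg_pow (d + 2) & body G = convex hull (set ps)"
  "!!H M. H : algebraic_realizations (index_order G) ==> projectivity_on M (body (face H f)) ==>
   proj_equivalent F (proj_image M (face H f))"
proof -
 obtain E L where lab: "labelling (%x. x) E L (dom F)" and Feq: "F = labelled (%x. x) L (dom F)" and bodyF: "body F = convex hull E"
  using indexed_polytopeE F unfolding algebraic_indexed_def by metis
 define D where "D = dom F"
 note lab = lab[folded D_def] and Feq = Feq[folded D_def]
 note l = labellingD[OF lab]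
 have algE: "algebraic_pt e" if "e : E" for e using F algebraic_labelled[OF lab] that unfolding Feq[symmetric] by simp
 obtain v0 I star where st: "stamp E v0 I star" using stamp_exists[OF l(1)] algE by blast
 let ?k = "dim (hat (%x. x) ` E)"
 have v0: "vconf v0 I" "v0 ` I <= Rpow (?k + 1)" "dim (hat v0 ` I) = ?k + 2" "inj_on star E"
  "star ` E : cfaces (hat v0) I" using st by (simp_all add: stamp_def)
 have force: "EX A \<kappa>. linear A & inj_on A (span (hat (%x. x) ` E)) &
    (ALL e:E. \<kappa> e > 0 & A (hat (%x. x) e) = \<kappa> e *R hat (%e. v' (star e)) e)"
  if "cfaces (hat v') I = cfaces (hat v0) I" for v' :: "nat => pt" using st that unfolding stamp_def hat_def by blast
 obtain v where v: "vconf v I" "cfaces (hat v) I = cfaces (hat v0) I" "v ` I <= Ralg_pow (?k + 1)" using algebraic_vconf[OF v0(1,2)] by blast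
 have finI: "finite I" using v(1) by (simp add: vconf_def)
 obtain A \<kappa> where A: "linear A" "inj_on A (span (hat (%x. x) ` E))"
  "!!e. e : E ==> \<kappa> e > 0 & A (hat (%x. x) e) = \<kappa> e *R hat (%e. v (star e)) e"
  using force[OF v(2)] by blast
 have same: "cfaces (hat (%e. v (star e))) E = cfaces (hat (%x. x)) E" by (rule cfaces_linear_image[OF A])
 have starI: "star ` E <= I" using v0(5) by (rule cfaces_subset)
 have starC: "star ` E : cfaces (hat v) I" using v0(5) v(2) by simp
 obtain L' D' where lab': "labelling v I L' D'" and D': "D <= D'" "!!f. f : D ==> L' f = star ` L f"
  "{g : D'. L' g <= star ` E} = D" using extend_labelling[OF lab v(1) v0(4) starC same] by blast
 obtain f where f: "f : D" "L f = E" using l(5)[OF cfaces_top] by blast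
 define G where "G = labelled v L' D'"
 have G: "indexed_polytope G" unfolding G_def by (rule labelled_indexed_polytope[OF lab'])
 have algG: "algebraic_indexed G" unfolding G_def algebraic_labelled[OF lab'] using v(3) by (auto simp: Ralg_pow_def)
 have fD': "f : D'" "L' f = star ` E" using f D' by auto
 have dimv: "dim (hat v ` I) = ?k + 2" using cfaces_dim_eq[OF finI v(2) cfaces_hat_empty cfaces_top] v0(3) by simp
 have "hat v ` star ` E = hat (%e. v (star e)) ` E" by (simp add: image_image hat_def)
 hence dimE: "dim (hat v ` L' f) = ?k" using dim_linear_image_scaled[OF A] fD'(2) by simp
 have pG: "pdim (body G) = int ?k + 1" "pdim (the (G f)) = int ?k - 1" unfolding G_def using pdim_labelled[OF lab'] fD'(1) dimv dimE by simp_all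
 have pF: "pdim (body F) = int ?k - 1" using pdim_labelled(1)[OF lab] unfolding Feq[symmetric] .
 show ?thesis
 proof (rule that[OF algG])
  have "f : Field (index_order G)" unfolding G_def labelled_order[OF lab'] using fD' by (auto simp: Field_def)
  moreover have "realization (index_order G) G" using G by (simp add: realization_indexed)
  ultimately show "ridge (index_order G) f" unfolding ridge_def using pG by auto
  show "pdim (body G) = pdim (body F) + 2" using pG pF by simp
  show "EX ps. set ps <= Ralg_pow (d + 2) & body G = convex hull (set ps)" if d: "body F <= Rpow d" for d
  proof -
   have "E <= Rpow d" using d bodyF hull_subset[of E convex] by auto
   hence "?k <= d + 1" by (rule dim_hat_le)
   hence "v ` I <= Ralg_pow (d + 2)" using v(3) Rpow_mono[of "?k + 1" "d + 2"] by (auto simp: Ralg_pow_def)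
   moreover obtain ps where "set ps = v ` I" using finite_list[of "v ` I"] finI by auto
   ultimately show ?thesis unfolding G_def labelled_body[OF lab'] by (intro exI[of _ ps]) simp
  qed
  fix H M assume H: "H : algebraic_realizations (index_order G)" and M: "projectivity_on M (body (face H f))"
  have "indexed_polytope H" "index_order H = index_order (labelled v L' D')"
   using H by (simp_all add: algebraic_realizations_def realization_indexed G_def)
  then obtain w where w: "labelling w I L' D'" "H = labelled w L' D'" "cfaces (hat w) I = cfaces (hat v) I"
   using labelled_same_order[OF lab'] by blast
  obtain A1 \<kappa>1 where A1: "linear A1" "inj_on A1 (span (hat (%x. x) ` E))"
   "!!e. e : E ==> \<kappa>1 e > 0 & A1 (hat (%x. x) e) = \<kappa>1 e *R hat (%e. w (star e)) e"
   using force[OF trans[OF w(3) v(2)]] by blast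
  have same1: "cfaces (hat (%e. w (star e))) E = cfaces (hat (%x. x)) E" by (rule cfaces_linear_image[OF A1])
  have labs: "labelling (%e. w (star e)) E L D" by (rule labelling_cong(1)[OF lab same1])
  have "face H f = labelled w L' D" unfolding w(2) face_labelled(1)[OF w(1) fD'(1)] fD'(2) D'(3) ..
  also have "\<dots> = labelled (%e. w (star e)) L D" unfolding labelled_comp using D'(2) by (simp add: labelled_def fun_eq_iff)
  finally have fH: "face H f = labelled (%e. w (star e)) L D" .
  obtain w2 A2 \<kappa>2 where A2: "proj_image M (labelled (%e. w (star e)) L D) = labelled w2 L D" "linear A2"
   "inj_on A2 (span (hat (%e. w (star e)) ` E))"
   "!!e. e : E ==> \<kappa>2 e > 0 & A2 (hat (%e. w (star e)) e) = \<kappa>2 e *R hat w2 e"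
   by (rule proj_image_labelled[OF labs M[unfolded fH]]) blast
  have lin: "linear (%x. A2 (A1 x))" using linear_compose[OF A1(1) A2(2)] by (simp add: o_def)
  have "A1 ` span (hat (%x. x) ` E) = span (A1 ` hat (%x. x) ` E)" by (rule linear_span_image[OF A1(1), symmetric])
  also have "\<dots> <= span (hat (%e. w (star e)) ` E)"
   using A1(3) by (intro span_minimal subspace_span) (auto simp: span_base span_scale)
  finally have "inj_on A2 (A1 ` span (hat (%x. x) ` E))" using A2(3) inj_on_subset by blast
  hence inj: "inj_on (%x. A2 (A1 x)) (span (hat (%x. x) ` E))" using comp_inj_on[OF A1(2)] by (simp add: o_def)
  have \<kappa>: "\<kappa>1 e * \<kappa>2 e > 0 & A2 (A1 (hat (%x. x) e)) = (\<kappa>1 e * \<kappa>2 e) *R hat w2 e" if "e : E" for e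
   using A1(3)[OF that] A2(4)[OF that] linear_scale[OF A2(2)] by simp
  have same2: "cfaces (hat w2) E = cfaces (hat (%x. x)) E" by (rule cfaces_linear_image[OF lin inj \<kappa>])
  have lab2: "labelling w2 E L D" by (rule labelling_cong(1)[OF lab same2])
  obtain M' where M': "projectivity_on M' (body (labelled (%x. x) L D))" "proj_image M' (labelled (%x. x) L D) = labelled w2 L D"
   by (rule projectivity_from_linear[OF lab lab2 lin inj \<kappa>]) blast
  have "comb_equivalent F (labelled w2 L D)" unfolding comb_equivalent_def using labelling_cong(2)[OF lab same2] Feq by simp
  thus "proj_equivalent F (proj_image M (face H f))" unfolding proj_equivalent_def fH A2(1) using M' Feq by metis
 qed
qed

lemma algebraic_representative:
 assumes "combinatorial_polytope r"
 obtains G where "algebraic_indexed G" "realization r G" "!!F. realization r F ==> pdim (body F) = pdim (body G)"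
proof -
 obtain F where F: "indexed_polytope F" "index_order F = r" using assms by (auto simp: combinatorial_polytope_def realization_indexed)
 obtain E L where lab: "labelling (%x. x) E L (dom F)" and Feq: "F = labelled (%x. x) L (dom F)"
  using indexed_polytopeE[OF F(1)] by metis
 note l = labellingD[OF lab]
 obtain N where N: "(%x. x) ` E <= Rpow N" using finite_subset_Rpow[of E] l(2) by auto
 obtain w where w: "vconf w E" "cfaces (hat w) E = cfaces (hat (%x. x)) E" "w ` E <= Ralg_pow N"
  using algebraic_vconf[OF l(1) N] by blast
 note lab2 = labelling_cong[OF lab w(2)]
 define G where "G = labelled w L (dom F)"
 have r: "index_order G = r" using lab2(2) F(2) Feq by (simp add: G_def)
 show ?thesis
 proof (rule that)
  show "algebraic_indexed G" unfolding G_def algebraic_labelled[OF lab2(1)] using w(3) by (auto simp: Ralg_pow_def)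
  show "realization r G" unfolding realization_indexed using labelled_indexed_polytope[OF lab2(1)] r by (simp add: G_def)
  fix H assume "realization r H"
  hence "indexed_polytope H" "index_order H = index_order (labelled w L (dom F))" using r by (simp_all add: realization_indexed G_def)
  then obtain u where u: "labelling u E L (dom F)" "H = labelled u L (dom F)" "cfaces (hat u) E = cfaces (hat w) E"
   using labelled_same_order[OF lab2(1)] by blast
  thus "pdim (body H) = pdim (body G)" using cfaces_dim_eq[OF l(2) u(3) cfaces_hat_empty cfaces_top]
   by (simp add: G_def pdim_labelled(1)[OF u(1)] pdim_labelled(1)[OF lab2(1)])
 qed
qed

text \<open>Inheritance passes \<open>\<psi>\<close> to projective images of the ridge, and
  \<open>force\<close> places these images in the class of \<open>F\<close>.\<close>

lemma holds_via_ridge: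
 assumes inh: "ridges_projectively_inherit n g" and F: "algebraic_indexed F" and G: "algebraic_indexed G" "ridge (index_order G) f"
  and force: "!!H M. H : algebraic_realizations (index_order G) ==> projectivity_on M (body (face H f)) ==>
   proj_equivalent F (proj_image M (face H f))" and holds: "holds_for_some n g (algebraic_realizations (index_order G))"
 shows "holds_for_some n g (proj_class F)"
proof -
 have "combinatorial_polytope (index_order G)" using G(1) by (auto simp: combinatorial_polytope_def realization_indexed algebraic_indexed_def)
 hence "projectively_inherits n g (index_order G) f" using inh G(2) by (simp add: ridges_projectively_inherit_def)
 moreover obtain Ps where Ps: "length Ps = n" "set Ps <= algebraic_realizations (index_order G)" "g Ps"
  using holds by (auto simp: holds_for_some_def)
 ultimately obtain Ms where Ms: "length Ms = n"
  "!!i. i < n ==> projectivity_on (Ms ! i) (body (face (Ps ! i) f)) & algebraic_indexed (proj_image (Ms ! i) (face (Ps ! i) f))"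
  "g (map (%i. proj_image (Ms ! i) (face (Ps ! i) f)) [0..<n])" unfolding projectively_inherits_def by blast
 have "proj_image (Ms ! i) (face (Ps ! i) f) : proj_class F" if "i < n" for i
  
 proof -
  have "Ps ! i : algebraic_realizations (index_order G)" using Ps(1,2) nth_mem[of i Ps] that by blast
  thus ?thesis using Ms(2)[OF that] force[of "Ps ! i" "Ms ! i"] by (simp add: proj_class_def)
 qed
 thus ?thesis using Ms(3) unfolding holds_for_some_def by (intro exI[of _ "map (%i. proj_image (Ms ! i) (face (Ps ! i) f)) [0..<n]"]) auto
qed

lemma holds_for_some_mono: "holds_for_some n g C ==> C <= C' ==> holds_for_some n g C'"
 unfolding holds_for_some_def by blast

lemma proj_class_subset: "proj_class F <= comb_class F" by (auto simp: proj_class_def comb_class_def proj_equivalent_def)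

lemma comb_class_eq: "comb_class F = algebraic_realizations (index_order F)"
 by (auto simp: comb_class_def algebraic_realizations_def comb_equivalent_def realization_indexed algebraic_indexed_def)

theorem theorem2p2:
  fixes n :: nat and \<psi> :: "indexed list \<Rightarrow> bool"
  assumes "ridges_projectively_inherit n \<psi>"
  shows "((\<forall>r. combinatorial_polytope r \<longrightarrow> holds_for_some n \<psi> (algebraic_realizations r)) \<longleftrightarrow>
          (\<forall>F. algebraic_indexed F \<longrightarrow> holds_for_some n \<psi> (proj_class F))) \<and>
         (\<forall>a b. lowest (comb_fail_dims n \<psi>) a \<and> lowest (proj_fail_dims n \<psi>) b \<longrightarrow>
            b \<le> a \<and> a \<le> b + 2) \<and>
         (\<forall>d. (all_hulls_comb n \<psi> (d + 2) \<longrightarrow> all_hulls_proj n \<psi> d) \<and>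
              (all_hulls_proj n \<psi> d \<longrightarrow> all_hulls_comb n \<psi> d))"
proof (intro conjI allI impI iffI)
 fix F assume h: "ALL r. combinatorial_polytope r --> holds_for_some n \<psi> (algebraic_realizations r)"
  and F: "algebraic_indexed F"
 obtain G f where G: "algebraic_indexed G" "ridge (index_order G) f"
  "!!H M. H : algebraic_realizations (index_order G) ==> projectivity_on M (body (face H f)) ==>
   proj_equivalent F (proj_image M (face H f))" by (rule stamp_forces[OF F]) blast
 have "combinatorial_polytope (index_order G)" using G(1) by (auto simp: combinatorial_polytope_def realization_indexed algebraic_indexed_def)
 thus "holds_for_some n \<psi> (proj_class F)" using holds_via_ridge[OF assms F G] h by blast
next
 fix r assume h: "ALL F. algebraic_indexed F --> holds_for_some n \<psi> (proj_class F)" and r: "combinatorial_polytope r"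
 obtain G where G: "algebraic_indexed G" "realization r G" by (rule algebraic_representative[OF r]) blast
 hence "proj_class G <= algebraic_realizations r" using proj_class_subset[of G] comb_class_eq[of G] by (simp add: realization_indexed)
 thus "holds_for_some n \<psi> (algebraic_realizations r)" using h G(1) holds_for_some_mono by blast
next
 fix a b assume ab: "lowest (comb_fail_dims n \<psi>) a & lowest (proj_fail_dims n \<psi>) b"
 then obtain r F where r: "combinatorial_polytope r" "realization r F" "pdim (body F) = a"
  "~ holds_for_some n \<psi> (algebraic_realizations r)" by (auto simp: lowest_def comb_fail_dims_def comb_dim_def)
 obtain G where G: "algebraic_indexed G" "realization r G" "!!F. realization r F ==> pdim (body F) = pdim (body G)"
  by (rule algebraic_representative[OF r(1)]) blast
 hence "proj_class G <= algebraic_realizations r" using proj_class_subset[of G] comb_class_eq[of G] by (simp add: realization_indexed)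
 hence "~ holds_for_some n \<psi> (proj_class G)" using r(4) holds_for_some_mono by blast
 hence "a : proj_fail_dims n \<psi>" using G(1) G(3)[OF r(2)] r(3) by (auto simp: proj_fail_dims_def)
 thus "b <= a" using ab by (auto simp: lowest_def)
next
 fix a b assume ab: "lowest (comb_fail_dims n \<psi>) a & lowest (proj_fail_dims n \<psi>) b"
 then obtain F where F: "algebraic_indexed F" "pdim (body F) = b" "~ holds_for_some n \<psi> (proj_class F)"
  by (auto simp: lowest_def proj_fail_dims_def)
 obtain G f where G: "algebraic_indexed G" "ridge (index_order G) f" "pdim (body G) = pdim (body F) + 2"
  "!!H M. H : algebraic_realizations (index_order G) ==> projectivity_on M (body (face H f)) ==>
   proj_equivalent F (proj_image M (face H f))" by (rule stamp_forces[OF F(1)]) blast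
 have r: "realization (index_order G) G" using G(1) by (simp add: realization_indexed algebraic_indexed_def)
 have "~ holds_for_some n \<psi> (algebraic_realizations (index_order G))" using holds_via_ridge[OF assms F(1) G(1,2,4)] F(3) by blast
 \<comment> \<open>A projective type of dimension \<open>b\<close> where \<open>\<psi>\<close> fails
   yields, through its stamp, a combinatorial type of dimension \<open>b + 2\<close> where it
   fails.\<close>
 hence "b + 2 : comb_fail_dims n \<psi>" using r G(3) F(2) unfolding comb_fail_dims_def comb_dim_def combinatorial_polytope_def by blast
 thus "a <= b + 2" using ab by (auto simp: lowest_def)
next
 fix d assume h: "all_hulls_comb n \<psi> (d + 2)"
 show "all_hulls_proj n \<psi> d" unfolding all_hulls_proj_def
 proof (intro allI impI)
  fix ps F assume F: "set ps <= Ralg_pow d & indexed_polytope F & body F = convex hull (set ps)"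
  have alg: "algebraic_indexed F" unfolding algebraic_indexed_def algebraic_polytope_def
  proof (intro conjI allI impI)
   show "polytope (body F)" using F by (auto simp: polytope_def)
   fix x assume "x extreme_point_of body F"
   hence "x : set ps" using F extreme_point_of_convex_hull by metis
   thus "algebraic_pt x" using F by (auto simp: Ralg_pow_def)
  qed (use F in simp)
  obtain G f where G: "algebraic_indexed G" "ridge (index_order G) f"
   "!!d. body F <= Rpow d ==> EX ps. set ps <= Ralg_pow (d + 2) & body G = convex hull (set ps)"
   "!!H M. H : algebraic_realizations (index_order G) ==> projectivity_on M (body (face H f)) ==>
    proj_equivalent F (proj_image M (face H f))" by (rule stamp_forces[OF alg]) blast
  have "body F <= Rpow d" using F convex_hull_Rpow[of "set ps" d] by (auto simp: Ralg_pow_def)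
  then obtain qs where "set qs <= Ralg_pow (d + 2)" "body G = convex hull (set qs)" using G(3) by blast
  hence "holds_for_some n \<psi> (comb_class G)" using h G(1) unfolding all_hulls_comb_def algebraic_indexed_def by blast
  thus "holds_for_some n \<psi> (proj_class F)" unfolding comb_class_eq using holds_via_ridge[OF assms alg G(1,2,4)] by blast
 qed
next
 fix d assume "all_hulls_proj n \<psi> d"
 thus "all_hulls_comb n \<psi> d" unfolding all_hulls_comb_def all_hulls_proj_def using holds_for_some_mono[OF _ proj_class_subset] by blast
qed

end
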